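(* Let $d\ge 3$ be fixed and $c>0$. Let $G^d_n=G^d(n,c/n^{d-1})$ be the random $d$-uniform hypergraph on $\{1,\dots,n\}$ in which each of the $\binom{n}{d}$ possible $d$-element edges is present independently with probability $c/n^{d-1}$. For every first order sentence $\phi$ in the language of $d$-uniform hypergraphs let $p_c(\phi)=\lim_{n\to\infty}\mathbf{P}(G^d_n\models\phi)$ (this limit exists), let $L_c=\{p_c(\phi)\colon\phi\text{ a first order sentence}\}$, and let $\overline{L_c}$ be its closure in $[0,1]$. Let $c_0$ be the unique positive solution of $$\exp\left(\frac{c}{2(d-2)!}\right)\sqrt{1-\frac{c}{(d-2)!}}=\frac12 .$$ Then for every $c>0$ the set $\overline{L_c}$ is a finite union of intervals. Moreover: (1) $\overline{L_c}=[0,1]$ for $c\ge c_0$; (2) $\overline{L_c}$ has at least one gap for $0<c<c_0$, i.e. there exist $a<b$ in $[0,1]$ with $\overline{L_c}\cap[a,b]=\emptyset$.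
   Context: The FO language of $d$-uniform hypergraphs is first order logic with a $d$-ary relation that is anti-reflexive (holds only on $d$ distinct elements) and completely symmetric, interpreted as the edge relation. A sentence is a FO formula without free variables; $H\models\phi$ means $H$ satisfies $\phi$. Equivalently $c_0=r\,(d-2)!$ where $r\approx0.898$ is the positive solution of $e^{r/2}\sqrt{1-r}=1/2$. *)

theory Defs
  imports "HOL-Probability.Probability"
begin

datatype fm =
    Eq nat nat
  | Edge "nat list"
  | Neg fm
  | Conj fm fm
  | Exists nat fm

primrec free_vars :: "fm \<Rightarrow> nat set" where
  "free_vars (Eq x y) = {x, y}"
| "free_vars (Edge xs) = set xs"
| "free_vars (Neg \<phi>) = free_vars \<phi>"
| "free_vars (Conj \<phi> \<psi>) = free_vars \<phi> \<union> free_vars \<psi>"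
| "free_vars (Exists x \<phi>) = free_vars \<phi> - {x}"

primrec wf_fm :: "nat \<Rightarrow> fm \<Rightarrow> bool" where
  "wf_fm d (Eq x y) \<longleftrightarrow> True"
| "wf_fm d (Edge xs) \<longleftrightarrow> length xs = d"
| "wf_fm d (Neg \<phi>) \<longleftrightarrow> wf_fm d \<phi>"
| "wf_fm d (Conj \<phi> \<psi>) \<longleftrightarrow> wf_fm d \<phi> \<and> wf_fm d \<psi>"
| "wf_fm d (Exists x \<phi>) \<longleftrightarrow> wf_fm d \<phi>"

definition sentence :: "nat \<Rightarrow> fm \<Rightarrow> bool" where
  "sentence d \<phi> \<longleftrightarrow> wf_fm d \<phi> \<and> free_vars \<phi> = {}"

text \<open>A hypergraph is given by its vertex set \<open>V\<close> and its set \<open>E\<close> of edges, each edge being a set of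
  vertices. The edge relation on tuples induced by \<open>E\<close> is anti-reflexive and completely symmetric.\<close>

primrec sat :: "'a set \<Rightarrow> 'a set set \<Rightarrow> (nat \<Rightarrow> 'a) \<Rightarrow> fm \<Rightarrow> bool" where
  "sat V E s (Eq x y) \<longleftrightarrow> s x = s y"
| "sat V E s (Edge xs) \<longleftrightarrow> distinct (map s xs) \<and> set (map s xs) \<in> E"
| "sat V E s (Neg \<phi>) \<longleftrightarrow> \<not> sat V E s \<phi>"
| "sat V E s (Conj \<phi> \<psi>) \<longleftrightarrow> sat V E s \<phi> \<and> sat V E s \<psi>"
| "sat V E s (Exists x \<phi>) \<longleftrightarrow> (\<exists>v\<in>V. sat V E (s(x := v)) \<phi>)"

lemma sat_cong:
  "(\<And>x. x \<in> free_vars \<phi> \<Longrightarrow> s x = t x) \<Longrightarrow> sat V E s \<phi> \<longleftrightarrow> sat V E t \<phi>"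
proof (induction \<phi> arbitrary: s t)
  case (Edge xs)
  then have "map s xs = map t xs" by simp
  then show ?case by (simp only: sat.simps)
next
  case (Neg \<phi>)
  from Neg.IH[of s t] Neg.prems show ?case by simp
next
  case (Conj \<phi> \<psi>)
  from Conj.IH(1)[of s t] Conj.IH(2)[of s t] Conj.prems show ?case by simp
next
  case (Exists x \<phi>)
  have "sat V E (s(x := v)) \<phi> \<longleftrightarrow> sat V E (t(x := v)) \<phi>" for v
    by (rule Exists.IH) (use Exists.prems in auto)
  then show ?case by simp
qed simp

definition models :: "'a set \<Rightarrow> 'a set set \<Rightarrow> fm \<Rightarrow> bool" where
  "models V E \<phi> \<longleftrightarrow> (\<forall>s. sat V E s \<phi>)"

lemma models_iff_sat: "sentence d \<phi> \<Longrightarrow> models V E \<phi> \<longleftrightarrow> sat V E s \<phi>"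
  unfolding models_def sentence_def using sat_cong[of \<phi>] by blast

definition possible_edges :: "nat \<Rightarrow> nat \<Rightarrow> nat set set" where
  "possible_edges d n = {e. e \<subseteq> {1..n} \<and> card e = d}"

definition random_hypergraph :: "nat \<Rightarrow> nat \<Rightarrow> real \<Rightarrow> nat set set pmf" where
  "random_hypergraph d n p =
     map_pmf (\<lambda>present. {e \<in> possible_edges d n. present e})
       (Pi_pmf (possible_edges d n) False (\<lambda>_. bernoulli_pmf p))"

text \<open>For the finitely many \<open>n\<close> with \<open>c / n ^ (d - 1) > 1\<close>, \<^const>\<open>bernoulli_pmf\<close> truncates the
  parameter to \<open>1\<close>; this does not affect the limit.\<close>

definition fo_prob :: "nat \<Rightarrow> real \<Rightarrow> fm \<Rightarrow> nat \<Rightarrow> real" where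
  "fo_prob d c \<phi> n =
     measure_pmf.prob (random_hypergraph d n (c / real n ^ (d - 1))) {E. models {1..n} E \<phi>}"

definition limit_prob :: "nat \<Rightarrow> real \<Rightarrow> fm \<Rightarrow> real" where
  "limit_prob d c \<phi> = lim (fo_prob d c \<phi>)"

definition limit_set :: "nat \<Rightarrow> real \<Rightarrow> real set" where
  "limit_set d c = {limit_prob d c \<phi> |\<phi>. sentence d \<phi>}"

text \<open>Since \<^const>\<open>sqrt\<close> is negative on negative arguments, no \<open>c > (d - 2)!\<close> satisfies the
  equation below.\<close>

definition threshold_eq :: "nat \<Rightarrow> real \<Rightarrow> bool" where
  "threshold_eq d c \<longleftrightarrow> exp (c / (2 * fact (d - 2))) * sqrt (1 - c / fact (d - 2)) = 1 / 2"

definition threshold :: "nat \<Rightarrow> real" where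
  "threshold d = (THE c. 0 < c \<and> threshold_eq d c)"

text \<open>Intervals are understood to be non-degenerate: single points do not count.\<close>

definition finite_union_of_intervals :: "real set \<Rightarrow> bool" where
  "finite_union_of_intervals S \<longleftrightarrow>
     (\<exists>\<I>. finite \<I> \<and> (\<forall>I\<in>\<I>. is_interval I \<and> (\<exists>x\<in>I. \<exists>y\<in>I. x < y)) \<and> S = \<Union>\<I>)"

end

theory Submission
  imports Defs
begin

text \<open>
  Write \<open>r = c / (d - 2)!\<close>. Short cycles and their neighbourhoods are the only features of the random
  hypergraph that a first order sentence can see: away from them the hypergraph is locally a tree, and
  with high probability every fixed tree occurs often as an isolated component. An Ehrenfeucht--Fraisse
  argument therefore shows that the truth of a sentence depends only on the isomorphism type of a
  neighbourhood of the short cycles. The law of this type converges, since the probability of each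
  labelled neighbourhood can be computed up to \<open>O(1/n)\<close>.

  The numbers of \<open>k\<close>-cycles, \<open>k \<ge> 2\<close>, are asymptotically independent Poisson variables with means
  \<open>r ^ k / (2 * k)\<close>, so for \<open>r < 1\<close> the probability of having no short cycle decreases to
  \<open>exp (r / 2) * sqrt (1 - r)\<close> as the length bound grows. A sentence has the same truth value on almost all
  hypergraphs without short cycles, so if this number exceeds \<open>1 / 2\<close> there is a gap around \<open>1 / 2\<close>.

  The events prescribing the cycle counts are first order, and the sums of subsets of their
  limiting probabilities lie in the limit set. Kakeya's criterion (every atom is at most the sum of the
  later ones) fills \<open>[0, 1]\<close> above the threshold. Below it, the criterion holds for the events that there
  are exactly two short cycles, of distinct lengths with large sum; resetting a sentence on these events
  places its limit probability in an interval of fixed length inside the closure.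
\<close>

section \<open>Ehrenfeucht--Fraisse games\<close>

text \<open>The balance point is \<open>d - 1\<close> vertices per edge. An edge set with e edges on
  s vertices has about n^(s - (d-1)e) expected copies: trees have a vertex to spare and abound,
  cycles break even and stay bounded in number, anything with fewer vertices disappears at rate 1/n.
  This first moment bound replaces all higher moments. The Poisson law comes from planting: forcing
  a cycle into the hypergraph raises its count by one and, up to probability O(1/n), changes no
  other count, so neighbouring count vectors have probabilities in a fixed ratio; Markov's
  inequality supplies the normalisation. Isolated trees are handled by planting too. The bound
  \<open>L\<close> is fixed before n grows, so convergence and the Poisson law hold for every
  \<open>c\<close>; the condition r < 1 enters only when \<open>L\<close> tends to infinity. At the
  threshold two requirements meet in Kakeya's criterion: the atom without cycles must not exceed
  1/2, which determines r, about 0.898, while the remaining atoms are served by moving one longest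
  cycle to the three next lengths, which already works from r = 4/5 on.\<close>

text \<open>A partial isomorphism, kept as a set of pairs. Edges are compared on every subset
  \<open>Q\<close> of the pairs, so no tuple length has to be fixed.\<close>

definition atomeq :: "'a set set \<Rightarrow> 'b set set \<Rightarrow> ('a \<times> 'b) set \<Rightarrow> bool" where
  "atomeq E E' P \<longleftrightarrow> (\<forall>p\<in>P. \<forall>q\<in>P. fst p = fst q \<longleftrightarrow> snd p = snd q)
     \<and> (\<forall>Q\<subseteq>P. fst ` Q \<in> E \<longleftrightarrow> snd ` Q \<in> E')"

text \<open>The sets \<open>V\<close> and \<open>V'\<close> restrict the moves of the game only, and
  the edge sets stay whole. A game on a ball is therefore played with the edges of the entire
  hypergraph.\<close>

primrec ef :: "nat \<Rightarrow> 'a set \<Rightarrow> 'a set set \<Rightarrow> 'b set \<Rightarrow> 'b set set \<Rightarrow> ('a \<times> 'b) set \<Rightarrow> bool" where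
  "ef 0 V E V' E' P \<longleftrightarrow> atomeq E E' P"
| "ef (Suc k) V E V' E' P \<longleftrightarrow> atomeq E E' P
     \<and> (\<forall>x\<in>V. \<exists>y\<in>V'. ef k V E V' E' (insert (x, y) P))
     \<and> (\<forall>y\<in>V'. \<exists>x\<in>V. ef k V E V' E' (insert (x, y) P))"

lemma ef_atomeq: "ef k V E V' E' P \<Longrightarrow> atomeq E E' P"
  by (cases k) auto

lemma atomeq_subset: "atomeq E E' P \<Longrightarrow> Q \<subseteq> P \<Longrightarrow> atomeq E E' Q"
  unfolding atomeq_def by (meson subset_eq subset_trans)

lemma ef_subset: "ef k V E V' E' P \<Longrightarrow> Q \<subseteq> P \<Longrightarrow> ef k V E V' E' Q"
proof (induction k arbitrary: P Q)
  case 0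
  then show ?case using atomeq_subset by auto
next
  case (Suc k)
  have "ef k V E V' E' (insert p Q)" if "ef k V E V' E' (insert p P)" for p
    using Suc.IH[OF that, of "insert p Q"] Suc.prems(2) by blast
  then show ?case using Suc.prems atomeq_subset[of E E' P Q] by (simp, meson)
qed

lemma ef_Suc_imp: "ef (Suc k) V E V' E' P \<Longrightarrow> ef k V E V' E' P"
proof (induction k arbitrary: P)
  case (Suc k)
  have at: "atomeq E E' P" using ef_atomeq[OF Suc.prems] .
  have "\<exists>y\<in>V'. ef k V E V' E' (insert (x, y) P)" if "x \<in> V" for x
  proof -
    obtain y where "y \<in> V'" "ef (Suc k) V E V' E' (insert (x, y) P)"
      using Suc.prems \<open>x \<in> V\<close> unfolding ef.simps(2)[of "Suc k"] by blast
    then show ?thesis using Suc.IH by blast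
  qed
  moreover have "\<exists>x\<in>V. ef k V E V' E' (insert (x, y) P)" if "y \<in> V'" for y
  proof -
    obtain x where "x \<in> V" "ef (Suc k) V E V' E' (insert (x, y) P)"
      using Suc.prems \<open>y \<in> V'\<close> unfolding ef.simps(2)[of "Suc k"] by blast
    then show ?thesis using Suc.IH by blast
  qed
  ultimately show ?case using at by simp
qed simp

lemma ef_le: "ef k V E V' E' P \<Longrightarrow> j \<le> k \<Longrightarrow> ef j V E V' E' P"
  by (induction k) (auto simp: le_Suc_eq dest: ef_Suc_imp simp del: ef.simps(2))

lemma atomeq_sym: "atomeq E E' P \<Longrightarrow> atomeq E' E (P\<inverse>)"
proof -
  assume a: "atomeq E E' P"
  have c: "snd ` Q = fst ` (Q\<inverse>)" "fst ` Q = snd ` (Q\<inverse>)" for Q :: "('b \<times> 'a) set"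
    by force+
  have "fst ` Q \<in> E' \<longleftrightarrow> snd ` Q \<in> E" if "Q \<subseteq> P\<inverse>" for Q
  proof -
    have "Q\<inverse> \<subseteq> P" using that by auto
    then show ?thesis using a c[of Q] unfolding atomeq_def by (metis (no_types))
  qed
  moreover have "fst p = fst q \<longleftrightarrow> snd p = snd q" if pq: "p \<in> P\<inverse>" "q \<in> P\<inverse>" for p q
    proof -
    obtain x y x' y' where "p = (y, x)" "q = (y', x')" "(x, y) \<in> P" "(x', y') \<in> P"
      using pq by (cases p, cases q) auto
    then show ?thesis using a unfolding atomeq_def by (metis fst_conv snd_conv)
  qed
  ultimately show ?thesis unfolding atomeq_def by blast
qed

lemma ef_sym: "ef k V E V' E' P \<Longrightarrow> ef k V' E' V E (P\<inverse>)"
proof (induction k arbitrary: P)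
  case (Suc k)
  have "insert (y, x) (P\<inverse>) = (insert (x, y) P)\<inverse>" for x y by auto
  then show ?case using Suc atomeq_sym[of E E' P] by (simp, metis)
qed (simp add: atomeq_sym)

lemma atomeq_trans:
  assumes "atomeq E1 E2 P" "atomeq E2 E3 Q" shows "atomeq E1 E3 (P O Q)"
  unfolding atomeq_def
proof (intro conjI ballI allI impI)
  fix p q assume "p \<in> P O Q" "q \<in> P O Q"
  then obtain x y z x' y' z' where "p = (x, z)" "(x, y) \<in> P" "(y, z) \<in> Q"
    "q = (x', z')" "(x', y') \<in> P" "(y', z') \<in> Q" by auto
  then show "fst p = fst q \<longleftrightarrow> snd p = snd q"
    using assms unfolding atomeq_def by (metis fst_conv snd_conv)
next
  fix R assume R: "R \<subseteq> P O Q"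
  \<comment> \<open>A middle vertex is chosen for each pair of \<open>R\<close>, which splits
    \<open>R\<close> into a subset of \<open>P\<close> and a subset of \<open>Q\<close>.\<close>
  then have "\<forall>r\<in>R. \<exists>y. (fst r, y) \<in> P \<and> (y, snd r) \<in> Q"
    by (metis relcompEpair prod.collapse subsetD)
  then obtain m where m: "\<forall>r\<in>R. (fst r, m r) \<in> P \<and> (m r, snd r) \<in> Q" by metis
  have 1: "fst ` ((\<lambda>r. (fst r, m r)) ` R) = fst ` R"
    "snd ` ((\<lambda>r. (fst r, m r)) ` R) = m ` R"
    "fst ` ((\<lambda>r. (m r, snd r)) ` R) = m ` R"
    "snd ` ((\<lambda>r. (m r, snd r)) ` R) = snd ` R"
    by (simp_all add: image_image)
  have "(\<lambda>r. (fst r, m r)) ` R \<subseteq> P" "(\<lambda>r. (m r, snd r)) ` R \<subseteq> Q" using m by auto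
  then show "fst ` R \<in> E1 \<longleftrightarrow> snd ` R \<in> E3"
    using assms 1 unfolding atomeq_def by metis
qed

lemma ef_trans:
  "ef k V1 E1 V2 E2 P \<Longrightarrow> ef k V2 E2 V3 E3 Q \<Longrightarrow> ef k V1 E1 V3 E3 (P O Q)"
proof (induction k arbitrary: P Q)
  case 0 then show ?case by (simp add: atomeq_trans)
next
  case (Suc k)
  have *: "ef k V1 E1 V3 E3 (insert (x, z) (P O Q))"
    if "ef k V1 E1 V2 E2 (insert (x, y) P)" "ef k V2 E2 V3 E3 (insert (y, z) Q)" for x y z
    by (rule ef_subset[OF Suc.IH[OF that]]) auto
  have "\<exists>z\<in>V3. ef k V1 E1 V3 E3 (insert (x, z) (P O Q))" if "x \<in> V1" for x
    using Suc.prems * that by (simp, meson)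
  moreover have "\<exists>x\<in>V1. ef k V1 E1 V3 E3 (insert (x, z) (P O Q))" if "z \<in> V3" for z
    using Suc.prems * that by (simp, meson)
  moreover have "atomeq E1 E3 (P O Q)" using Suc.prems atomeq_trans by auto
  ultimately show ?case by simp
qed

text \<open>Duplicator answers by \<open>h\<close>. The full graph of \<open>h\<close> is taken as
  the position, so every move only repeats a pair that is already there; smaller positions follow by
  \<open>ef_subset\<close>.\<close>

lemma ef_iso:
  assumes "bij_betw h V V'" "\<And>A. A \<subseteq> V \<Longrightarrow> A \<in> E \<longleftrightarrow> h ` A \<in> E'"
  shows "ef k V E V' E' ((\<lambda>x. (x, h x)) ` V)"
proof (induction k)
  case 0
  have "fst ` Q \<in> E \<longleftrightarrow> snd ` Q \<in> E'" if "Q \<subseteq> (\<lambda>x. (x, h x)) ` V" for Q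
  proof -
    have "fst ` Q \<subseteq> V" using that by auto
    moreover have "snd ` Q = h ` (fst ` Q)" using that by (force simp: image_image)
    ultimately show ?thesis using assms(2) by simp
  qed
  then show ?case using assms(1) unfolding bij_betw_def inj_on_def ef.simps(1) atomeq_def
    by auto
next
  case (Suc k)
  have "\<exists>y\<in>V'. ef k V E V' E' (insert (x, y) ((\<lambda>x. (x, h x)) ` V))" if "x \<in> V" for x
    using that Suc assms(1) by (intro bexI[of _ "h x"]) (auto simp: insert_absorb bij_betw_def)
  moreover have "\<exists>x\<in>V. ef k V E V' E' (insert (x, y) ((\<lambda>x. (x, h x)) ` V))" if y: "y \<in> V'" for y
  proof -
    obtain x where "x \<in> V" "y = h x" using y assms(1) by (auto simp: bij_betw_def)
    then show ?thesis using Suc by (intro bexI[of _ x]) (auto simp: insert_absorb)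
  qed
  ultimately show ?case using ef_atomeq[OF Suc] by simp
qed

text \<open>A set that \<open>K\<close> rounds can recognise may bound the moves: as long as
  \<open>K\<close> rounds are in reserve, an answer to a move in \<open>U\<close> falls into
  \<open>U'\<close> and conversely. This is the game version of bounded quantifiers.\<close>

lemma ef_relativize:
  assumes "ef (k + K) W E W' E' P" "U \<subseteq> W" "U' \<subseteq> W'"
    and "\<And>R x y. P \<subseteq> R \<Longrightarrow> ef K W E W' E' R \<Longrightarrow> (x, y) \<in> R \<Longrightarrow> x \<in> U \<longleftrightarrow> y \<in> U'"
  shows "ef k U E U' E' P"
  using assms(1,4)
proof (induction k arbitrary: P)
  case 0 then show ?case using ef_atomeq by auto
next
  case (Suc k)
  have step: "(x \<in> U \<longleftrightarrow> y \<in> U') \<and> ef k U E U' E' (insert (x, y) P)"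
    if "ef (k + K) W E W' E' (insert (x, y) P)" for x y
  proof
    show "x \<in> U \<longleftrightarrow> y \<in> U'"
      by (rule Suc.prems(2)[of "insert (x, y) P"]) (use that in \<open>auto intro: ef_le\<close>)
    show "ef k U E U' E' (insert (x, y) P)"
      by (rule Suc.IH[OF that]) (use Suc.prems(2) in blast)
  qed
  have "\<exists>y\<in>U'. ef k U E U' E' (insert (x, y) P)" if x: "x \<in> U" for x
  proof -
    obtain y where "y \<in> W'" "ef (k + K) W E W' E' (insert (x, y) P)"
      using Suc.prems(1) x assms(2) by (auto dest!: subsetD)
    then show ?thesis using step[of x y] x by blast
  qed
  moreover have "\<exists>x\<in>U. ef k U E U' E' (insert (x, y) P)" if y: "y \<in> U'" for y
  proof -
    obtain x where "x \<in> W" "ef (k + K) W E W' E' (insert (x, y) P)"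
      using Suc.prems(1) y assms(3) by (auto dest!: subsetD)
    then show ?thesis using step[of x y] y by blast
  qed
  ultimately show ?case using ef_atomeq[OF Suc.prems(1)] by simp
qed

lemma atomeq_union:
  assumes "atomeq E E' P1" "atomeq E E' P2"
    and P: "P1 \<subseteq> W1 \<times> W1'" "P2 \<subseteq> W2 \<times> W2'"
    and disj: "W1 \<inter> W2 = {}" "W1' \<inter> W2' = {}"
    and E: "\<And>e. e \<in> E \<Longrightarrow> e \<inter> W1 \<noteq> {} \<Longrightarrow> e \<inter> W2 = {}"
    and E': "\<And>e. e \<in> E' \<Longrightarrow> e \<inter> W1' \<noteq> {} \<Longrightarrow> e \<inter> W2' = {}"
  shows "atomeq E E' (P1 \<union> P2)"
  unfolding atomeq_def
proof (intro conjI ballI allI impI)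
  fix p q assume "p \<in> P1 \<union> P2" "q \<in> P1 \<union> P2"
  then consider "p \<in> P1" "q \<in> P1" | "p \<in> P2" "q \<in> P2"
    | "fst p \<in> W1" "fst q \<in> W2" "snd p \<in> W1'" "snd q \<in> W2'"
    | "fst p \<in> W2" "fst q \<in> W1" "snd p \<in> W2'" "snd q \<in> W1'"
    using P by (metis UnE mem_Times_iff subsetD)
  then show "fst p = fst q \<longleftrightarrow> snd p = snd q"
  proof cases
    case 1 then show ?thesis using assms(1) unfolding atomeq_def by blast
  next
    case 2 then show ?thesis using assms(2) unfolding atomeq_def by blast
  qed (use disj in \<open>metis disjoint_iff\<close>)+
next
  fix Q assume Q: "Q \<subseteq> P1 \<union> P2"
  consider "Q \<subseteq> P1" | "Q \<subseteq> P2" | "Q \<inter> P1 \<noteq> {}" "Q \<inter> P2 \<noteq> {}" using Q by blast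
  then show "fst ` Q \<in> E \<longleftrightarrow> snd ` Q \<in> E'"
  proof cases
    case 3
    then have "fst ` Q \<inter> W1 \<noteq> {}" "fst ` Q \<inter> W2 \<noteq> {}" "snd ` Q \<inter> W1' \<noteq> {}" "snd ` Q \<inter> W2' \<noteq> {}"
      using P by fastforce+
    then show ?thesis using E E' by blast
  qed (use assms(1,2) in \<open>auto simp: atomeq_def\<close>)
qed

text \<open>If no edge meets both sides, two games can be played side by side: Duplicator answers on
  the side on which Spoiler moved, and a set of pairs taken from both positions is never an
  edge.\<close>

lemma ef_union:
  assumes "ef k W1 E W1' E' P1" "ef k W2 E W2' E' P2"
    and "P1 \<subseteq> W1 \<times> W1'" "P2 \<subseteq> W2 \<times> W2'"
    and disj: "W1 \<inter> W2 = {}" "W1' \<inter> W2' = {}"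
    and E: "\<And>e. e \<in> E \<Longrightarrow> e \<inter> W1 \<noteq> {} \<Longrightarrow> e \<inter> W2 = {}"
    and E': "\<And>e. e \<in> E' \<Longrightarrow> e \<inter> W1' \<noteq> {} \<Longrightarrow> e \<inter> W2' = {}"
  shows "ef k (W1 \<union> W2) E (W1' \<union> W2') E' (P1 \<union> P2)"
  using assms(1-4)
proof (induction k arbitrary: P1 P2)
  case 0
  then show ?case using atomeq_union[of E E' P1 P2 W1 W1' W2 W2'] disj E E' by simp
next
  case (Suc k)
  have at: "atomeq E E' (P1 \<union> P2)"
    using atomeq_union[of E E' P1 P2 W1 W1' W2 W2'] Suc.prems disj E E' by simp
  have k: "ef k W1 E W1' E' P1" "ef k W2 E W2' E' P2" using Suc.prems(1,2) ef_Suc_imp by blast+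
  have 1: "ef k (W1 \<union> W2) E (W1' \<union> W2') E' (insert (x, y) (P1 \<union> P2))"
    if "x \<in> W1" "y \<in> W1'" "ef k W1 E W1' E' (insert (x, y) P1)" for x y
    using Suc.IH[OF that(3) k(2)] Suc.prems(3,4) that by simp
  have 2: "ef k (W1 \<union> W2) E (W1' \<union> W2') E' (insert (x, y) (P1 \<union> P2))"
    if "x \<in> W2" "y \<in> W2'" "ef k W2 E W2' E' (insert (x, y) P2)" for x y
    using Suc.IH[OF k(1) that(3)] Suc.prems(3,4) that by simp
  show ?case using at Suc.prems(1,2) 1 2 by (simp, blast)
qed

primrec qrank :: "fm \<Rightarrow> nat" where
  "qrank (Eq x y) = 0"
| "qrank (Edge xs) = 0"
| "qrank (Neg \<phi>) = qrank \<phi>"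
| "qrank (Conj \<phi> \<psi>) = max (qrank \<phi>) (qrank \<psi>)"
| "qrank (Exists x \<phi>) = Suc (qrank \<phi>)"

text \<open>One round pays for one quantifier; atoms are settled by \<open>ef_atomeq\<close> because
  the values of their variables form a subset of the position.\<close>

lemma ef_sat:
  "ef k V E V' E' P \<Longrightarrow> qrank \<phi> \<le> k \<Longrightarrow> (\<And>x. x \<in> free_vars \<phi> \<Longrightarrow> (s x, t x) \<in> P) \<Longrightarrow>
    sat V E s \<phi> \<longleftrightarrow> sat V' E' t \<phi>"
proof (induction \<phi> arbitrary: k P s t)
  case (Eq x y)
  then show ?case using ef_atomeq[OF Eq.prems(1)] unfolding atomeq_def
    by (metis fst_conv snd_conv free_vars.simps(1) insertCI sat.simps(1))
next
  case (Edge xs)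
  have at: "atomeq E E' P" using ef_atomeq[OF Edge.prems(1)] .
  let ?Q = "(\<lambda>x. (s x, t x)) ` set xs"
  have Q: "?Q \<subseteq> P" using Edge.prems(3) by auto
  have "s x = s y \<longleftrightarrow> t x = t y" if "x \<in> set xs" "y \<in> set xs" for x y
  proof -
    have "(s x, t x) \<in> P" "(s y, t y) \<in> P" using Edge.prems(3) that by auto
    then show ?thesis using at unfolding atomeq_def by (metis fst_conv snd_conv)
  qed
  then have "distinct (map s xs) \<longleftrightarrow> distinct (map t xs)"
    by (auto simp: distinct_map inj_on_def)
  moreover have "fst ` ?Q = s ` set xs" "snd ` ?Q = t ` set xs" by (simp_all add: image_image)
  moreover have "fst ` ?Q \<in> E \<longleftrightarrow> snd ` ?Q \<in> E'" using at Q unfolding atomeq_def by blast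
  ultimately show ?case by simp
next
  case (Neg \<phi>)
  have "sat V E s \<phi> \<longleftrightarrow> sat V' E' t \<phi>" by (rule Neg.IH[OF Neg.prems(1)]) (use Neg.prems in auto)
  then show ?case by simp
next
  case (Conj \<phi> \<psi>)
  have "sat V E s \<phi> \<longleftrightarrow> sat V' E' t \<phi>" by (rule Conj.IH(1)[OF Conj.prems(1)]) (use Conj.prems in auto)
  moreover have "sat V E s \<psi> \<longleftrightarrow> sat V' E' t \<psi>"
    by (rule Conj.IH(2)[OF Conj.prems(1)]) (use Conj.prems in auto)
  ultimately show ?case by simp
next
  case (Exists x \<phi>)
  obtain k' where k: "k = Suc k'" "qrank \<phi> \<le> k'" using Exists.prems(2) by (cases k) auto
  have *: "sat V E (s(x := v)) \<phi> \<longleftrightarrow> sat V' E' (t(x := w)) \<phi>"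
    if "ef k' V E V' E' (insert (v, w) P)" for v w
    by (rule Exists.IH[OF that k(2)]) (use Exists.prems(3) in auto)
  show ?case using Exists.prems(1) * unfolding k(1) by (simp, blast)
qed

section \<open>Finitely many game types\<close>

lemma finite_code:
  assumes "finite B" obtains g :: "'b \<Rightarrow> nat" and N where "inj_on g B" "\<And>x. x \<in> B \<Longrightarrow> g x < N"
  using finite_imp_inj_to_nat_seg[OF assms] by (metis imageI mem_Collect_eq)

text \<open>The atomic type of an \<open>m\<close>-tuple is its equality pattern together with the
  index sets that carry an edge, a finite amount of data. Types are coded as numbers below a bound
  so that sets of types can be formed again.\<close>

lemma atomeq_finite_index:
  "\<exists>(f :: 'a set set \<times> 'a list \<Rightarrow> nat) N. (\<forall>\<sigma>. f \<sigma> < N) \<and>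
    (\<forall>E a E' b. length a = m \<longrightarrow> length b = m \<longrightarrow> f (E, a) = f (E', b) \<longrightarrow>
      atomeq E E' (set (zip a b)))"
proof -
  define B where "B = Pow ({..<m} \<times> {..<m}) \<times> Pow (Pow {..<m})"
  define code :: "'a set set \<times> 'a list \<Rightarrow> (nat \<times> nat) set \<times> nat set set" where
    "code = (\<lambda>(E, a). ({(i, j). i < m \<and> j < m \<and> a ! i = a ! j}, {I. I \<subseteq> {..<m} \<and> (!) a ` I \<in> E}))"
  have "finite B" unfolding B_def by simp
  then obtain g N where g: "inj_on g B" "\<And>x. x \<in> B \<Longrightarrow> g x < (N::nat)" by (rule finite_code) blast
  have codeB: "code \<sigma> \<in> B" for \<sigma> unfolding B_def code_def by (auto split: prod.split)
  have "atomeq E E' (set (zip a b))"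
    if len: "length a = m" "length b = m" and eq: "g (code (E, a)) = g (code (E', b))" for E a E' b
  proof -
    have c: "code (E, a) = code (E', b)" using eq g(1) codeB by (meson inj_onD)
    have eqv: "a ! i = a ! j \<longleftrightarrow> b ! i = b ! j" if "i < m" "j < m" for i j
      using c that unfolding code_def by (auto simp: set_eq_iff)
    have edg: "(!) a ` I \<in> E \<longleftrightarrow> (!) b ` I \<in> E'" if "I \<subseteq> {..<m}" for I
      using c that unfolding code_def by (auto simp: set_eq_iff)
    have z: "set (zip a b) = (\<lambda>i. (a ! i, b ! i)) ` {..<m}"
      using len by (auto simp: set_zip)
    have "fst ` Q \<in> E \<longleftrightarrow> snd ` Q \<in> E'" if "Q \<subseteq> set (zip a b)" for Q
    proof -
      define I where "I = {i. i < m \<and> (a ! i, b ! i) \<in> Q}"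
      have "Q = (\<lambda>i. (a ! i, b ! i)) ` I" using that unfolding z I_def by auto
      then have "fst ` Q = (!) a ` I" "snd ` Q = (!) b ` I" by (simp_all add: image_image)
      then show ?thesis using edg[of I] unfolding I_def by auto
    qed
    then show ?thesis unfolding atomeq_def using eqv z by auto
  qed
  then show ?thesis using g(2)[OF codeB]
    by (intro exI[of _ "\<lambda>\<sigma>. g (code \<sigma>)"] exI[of _ N]) auto
qed

text \<open>The type for \<open>Suc k\<close> rounds consists of the atomic type and the set of
  \<open>k\<close>-round types of all one-point extensions (Hintikka's construction). The bound
  \<open>N\<close> is chosen before the structures are.\<close>

lemma ef_finite_index:
  "\<exists>(f :: 'a set \<times> 'a set set \<times> 'a list \<Rightarrow> nat) N. (\<forall>\<sigma>. f \<sigma> < N) \<and>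
    (\<forall>V E a V' E' b. length a = m \<longrightarrow> length b = m \<longrightarrow> f (V, E, a) = f (V', E', b) \<longrightarrow>
      ef k V E V' E' (set (zip a b)))"
proof (induction k arbitrary: m)
  case 0
  obtain f :: "'a set set \<times> 'a list \<Rightarrow> nat" and N where f: "\<forall>\<sigma>. f \<sigma> < N"
    "\<forall>E a E' b. length a = m \<longrightarrow> length b = m \<longrightarrow> f (E, a) = f (E', b) \<longrightarrow>
      atomeq E E' (set (zip a b))"
    using atomeq_finite_index[of m] by blast
  show ?case using f by (intro exI[of _ "\<lambda>\<sigma>. f (snd \<sigma>)"] exI[of _ N]) auto
next
  case (Suc k)
  obtain f0 :: "'a set set \<times> 'a list \<Rightarrow> nat" and N0 where f0: "\<forall>\<sigma>. f0 \<sigma> < N0"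
    "\<And>E a E' b. length a = m \<Longrightarrow> length b = m \<Longrightarrow> f0 (E, a) = f0 (E', b) \<Longrightarrow>
      atomeq E E' (set (zip a b))"
    using atomeq_finite_index[of m] by blast
  obtain f :: "'a set \<times> 'a set set \<times> 'a list \<Rightarrow> nat" and N where f: "\<forall>\<sigma>. f \<sigma> < N"
    "\<And>V E a V' E' b. length a = Suc m \<Longrightarrow> length b = Suc m \<Longrightarrow> f (V, E, a) = f (V', E', b) \<Longrightarrow>
      ef k V E V' E' (set (zip a b))"
    using Suc[of "Suc m"] by blast
  define B where "B = {..<N0} \<times> Pow {..<N}"
  define code :: "'a set \<times> 'a set set \<times> 'a list \<Rightarrow> nat \<times> nat set" where
    "code = (\<lambda>(V, E, a). (f0 (E, a), (\<lambda>x. f (V, E, a @ [x])) ` V))"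
  have "finite B" unfolding B_def by simp
  then obtain g M where g: "inj_on g B" "\<And>x. x \<in> B \<Longrightarrow> g x < (M::nat)" by (rule finite_code) blast
  have codeB: "code \<sigma> \<in> B" for \<sigma> unfolding B_def code_def using f0(1) f(1) by (auto split: prod.split)
  have "ef (Suc k) V E V' E' (set (zip a b))"
    if len: "length a = m" "length b = m" and eq: "g (code (V, E, a)) = g (code (V', E', b))"
    for V E a V' E' b
  proof -
    have c: "code (V, E, a) = code (V', E', b)" using eq g(1) codeB by (meson inj_onD)
    then have c1: "f0 (E, a) = f0 (E', b)"
      and c2: "(\<lambda>x. f (V, E, a @ [x])) ` V = (\<lambda>x. f (V', E', b @ [x])) ` V'"
      unfolding code_def by auto
    have st: "ef k V E V' E' (insert (x, y) (set (zip a b)))"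
      if "f (V, E, a @ [x]) = f (V', E', b @ [y])" for x y
      using f(2)[OF _ _ that] len by simp
    have "\<exists>y\<in>V'. ef k V E V' E' (insert (x, y) (set (zip a b)))" if "x \<in> V" for x
      using c2 st that by (metis (no_types, lifting) imageE imageI)
    moreover have "\<exists>x\<in>V. ef k V E V' E' (insert (x, y) (set (zip a b)))" if "y \<in> V'" for y
      using c2 st that by (metis (no_types, lifting) imageE imageI)
    ultimately show ?thesis using f0(2)[OF len c1] by simp
  qed
  then show ?case using g(2)[OF codeB]
    by (intro exI[of _ "\<lambda>\<sigma>. g (code \<sigma>)"] exI[of _ M]) auto
qed

section \<open>Balls and local back-and-forth\<close>

definition nbr :: "'a set set \<Rightarrow> 'a set \<Rightarrow> 'a set" where
  "nbr E A = A \<union> \<Union>{e \<in> E. e \<inter> A \<noteq> {}}"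

definition ball_of :: "'a set set \<Rightarrow> nat \<Rightarrow> 'a set \<Rightarrow> 'a set" where
  "ball_of E k A = (nbr E ^^ k) A"

lemma ball_of_0 [simp]: "ball_of E 0 A = A" by (simp add: ball_of_def)

lemma ball_of_Suc: "ball_of E (Suc k) A = nbr E (ball_of E k A)" by (simp add: ball_of_def)

lemma ball_of_add: "ball_of E (j + k) A = ball_of E j (ball_of E k A)"
  by (simp add: ball_of_def funpow_add)

lemma nbr_mono: "E \<subseteq> F \<Longrightarrow> A \<subseteq> B \<Longrightarrow> nbr E A \<subseteq> nbr F B" by (auto simp: nbr_def)

lemma ball_of_mono: "E \<subseteq> F \<Longrightarrow> A \<subseteq> B \<Longrightarrow> ball_of E k A \<subseteq> ball_of F k B"
  by (induction k) (simp_all add: ball_of_Suc nbr_mono)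

lemma subset_nbr: "A \<subseteq> nbr E A" by (auto simp: nbr_def)

lemma ball_of_radius_mono: "j \<le> k \<Longrightarrow> ball_of E j A \<subseteq> ball_of E k A"
proof (induction k)
  case (Suc k)
  then show ?case using subset_nbr[of "ball_of E k A" E] by (auto simp: le_Suc_eq ball_of_Suc)
qed simp

lemma subset_ball_of: "A \<subseteq> ball_of E k A" using ball_of_radius_mono[of 0 k E A] by simp

lemma nbr_Un: "nbr E (A \<union> B) = nbr E A \<union> nbr E B" by (auto simp: nbr_def)

lemma ball_of_Un: "ball_of E k (A \<union> B) = ball_of E k A \<union> ball_of E k B"
  by (induction k) (auto simp: ball_of_Suc nbr_Un)

lemma nbr_UN: "nbr E A = (\<Union>a\<in>A. nbr E {a})" by (auto simp: nbr_def)

lemma nbr_sym: "y \<in> nbr E {x} \<longleftrightarrow> x \<in> nbr E {y}" by (auto simp: nbr_def)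

lemma ball_of_sym_imp: "y \<in> ball_of E k {x} \<Longrightarrow> x \<in> ball_of E k {y}"
proof (induction k arbitrary: y)
  case (Suc k)
  then obtain z where z: "z \<in> ball_of E k {x}" "y \<in> nbr E {z}"
    unfolding ball_of_Suc by (subst (asm) nbr_UN) auto
  have "z \<in> ball_of E 1 {y}" using z(2) nbr_sym[of y E z] by (simp add: ball_of_def)
  then have "ball_of E k {z} \<subseteq> ball_of E (k + 1) {y}"
    unfolding ball_of_add by (intro ball_of_mono) auto
  then show ?case using Suc.IH[OF z(1)] by auto
qed simp

lemma ball_of_sym: "y \<in> ball_of E k {x} \<longleftrightarrow> x \<in> ball_of E k {y}"
  using ball_of_sym_imp by metis

lemma ball_of_trans: "y \<in> ball_of E j {x} \<Longrightarrow> x \<in> ball_of E k A \<Longrightarrow> y \<in> ball_of E (j + k) A"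
  unfolding ball_of_add using ball_of_mono[of E E "{x}" "ball_of E k A" j] by auto

lemma ball_of_subset: "A \<subseteq> V \<Longrightarrow> E \<subseteq> Pow V \<Longrightarrow> ball_of E k A \<subseteq> V"
  by (induction k) (auto simp: ball_of_Suc nbr_def)

lemma ball_of_closed: "A \<subseteq> U \<Longrightarrow> (\<And>e. e \<in> E \<Longrightarrow> e \<inter> U \<noteq> {} \<Longrightarrow> e \<subseteq> U) \<Longrightarrow> ball_of E k A \<subseteq> U"
proof (induction k)
  case (Suc k)
  then have "ball_of E k A \<subseteq> U" by blast
  then show ?case using Suc.prems(2) by (fastforce simp: ball_of_Suc nbr_def)
qed simp

text \<open>Spoiler plays the vertices of \<open>D\<close> one after the other, at the price of
  \<open>card D\<close> rounds.\<close>

lemma ef_extend_set: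
  assumes "finite D" "ef (card D + k) W E W' E' P" "D \<subseteq> W"
  shows "\<exists>R. P \<subseteq> R \<and> D \<subseteq> fst ` R \<and> ef k W E W' E' R"
  using assms
proof (induction D arbitrary: k P rule: finite_induct)
  case (insert x D)
  have "ef (card D + Suc k) W E W' E' P" using insert by simp
  then obtain R where R: "P \<subseteq> R" "D \<subseteq> fst ` R" "ef (Suc k) W E W' E' R"
    using insert.IH[of "Suc k" P] insert.prems by auto
  then obtain y where "ef k W E W' E' (insert (x, y) R)" using insert.prems by auto
  then show ?case using R by (intro exI[of _ "insert (x, y) R"]) auto
qed auto

text \<open>Distance is visible to the game: on the way to \<open>x\<close> every edge of a path is
  played out in full, at most \<open>d\<close> rounds per edge, and a fully played edge is carried
  over to an edge.\<close>

lemma ef_ball_pres: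
  assumes "ef (d * k) W E W' E' P" "P0 \<subseteq> P" "(x, y) \<in> P" "x \<in> ball_of E k (fst ` P0)"
    and "ball_of E k (fst ` P0) \<subseteq> W" and E: "\<And>e. e \<in> E \<Longrightarrow> finite e \<and> card e \<le> d"
  shows "y \<in> ball_of E' k (snd ` P0)"
  using assms(1-5)
proof (induction k arbitrary: P x y)
  case 0
  then obtain p where "p \<in> P0" "x = fst p" by auto
  then show ?case using 0 ef_atomeq[OF 0(1)] unfolding atomeq_def by (force)
next
  case (Suc k)
  let ?A = "ball_of E k (fst ` P0)"
  have AW: "?A \<subseteq> W" using ball_of_radius_mono[of k "Suc k" E "fst ` P0"] Suc.prems(5) by auto
  consider "x \<in> ?A" | e z where "e \<in> E" "x \<in> e" "z \<in> e" "z \<in> ?A"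
    using Suc.prems(4) by (auto simp: ball_of_Suc nbr_def)
  then show ?case
  proof cases
    case 1
    have "y \<in> ball_of E' k (snd ` P0)"
      by (rule Suc.IH[OF ef_le[OF Suc.prems(1)] Suc.prems(2,3) 1 AW]) simp
    then show ?thesis using ball_of_radius_mono[of k "Suc k" E' "snd ` P0"] by auto
  next
    case 2
    have eW: "e \<subseteq> W" using 2 Suc.prems(5) by (auto simp: ball_of_Suc nbr_def)
    have "ef (card e + d * k) W E W' E' P"
      by (rule ef_le[OF Suc.prems(1)]) (use E[OF 2(1)] in simp)
    then obtain R where R: "P \<subseteq> R" "e \<subseteq> fst ` R" "ef (d * k) W E W' E' R"
      using ef_extend_set[of e "d * k" W E W' E' P] E[OF 2(1)] eW by auto
    obtain z' where z': "(z, z') \<in> R" using R(2) 2(3) by force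
    have z'b: "z' \<in> ball_of E' k (snd ` P0)"
      by (rule Suc.IH[OF R(3) _ z' 2(4) AW]) (use Suc.prems(2) R(1) in auto)
    define Q where "Q = {p \<in> R. fst p \<in> e}"
    have "fst ` Q = e" using R(2) unfolding Q_def by auto
    then have "snd ` Q \<in> E'"
      using ef_atomeq[OF R(3)] 2(1) unfolding atomeq_def by (metis (no_types, lifting) Q_def mem_Collect_eq subsetI)
    moreover have "y \<in> snd ` Q" "z' \<in> snd ` Q"
      using Suc.prems(3) R(1) z' 2 unfolding Q_def by force+
    ultimately show ?thesis using z'b by (auto simp: ball_of_Suc nbr_def)
  qed
qed

lemma ef_ball_pres_iff:
  assumes "ef (d * k) W E W' E' P" "P0 \<subseteq> P" "(x, y) \<in> P"
    and "ball_of E k (fst ` P0) \<subseteq> W" "ball_of E' k (snd ` P0) \<subseteq> W'"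
    and E: "\<And>e. e \<in> E \<Longrightarrow> finite e \<and> card e \<le> d" "\<And>e. e \<in> E' \<Longrightarrow> finite e \<and> card e \<le> d"
  shows "x \<in> ball_of E k (fst ` P0) \<longleftrightarrow> y \<in> ball_of E' k (snd ` P0)"
proof
  show "y \<in> ball_of E' k (snd ` P0)" if "x \<in> ball_of E k (fst ` P0)"
    using ef_ball_pres[of d k W E W' E' P P0 x y] assms that by blast
  have c: "fst ` (P0\<inverse>) = snd ` P0" "snd ` (P0\<inverse>) = fst ` P0" by force+
  show "x \<in> ball_of E k (fst ` P0)" if "y \<in> ball_of E' k (snd ` P0)"
    using ef_ball_pres[of d k W' E' W E "P\<inverse>" "P0\<inverse>" y x] ef_sym[OF assms(1)] assms that c
    by auto
qed

section \<open>Radii and round budgets of the local game\<close>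

text \<open>Let r be the radius for j remaining rounds. A point within 2r + 1 of the old ones has
  its r-ball inside their (3r + 1)-ball; a point further away has an r-ball that no edge joins to
  the r-balls of the old ones. This explains the recursion.\<close>

primrec lrad :: "nat \<Rightarrow> nat" where
  "lrad 0 = 0"
| "lrad (Suc j) = 3 * lrad j + 1"

text \<open>One round for the move itself and \<open>d * (2 * lrad j + 1)\<close> in reserve, the
  price of recognising a ball of radius 2r + 1 according to \<open>ef_ball_pres\<close>.\<close>

primrec lrank :: "nat \<Rightarrow> nat \<Rightarrow> nat" where
  "lrank d 0 = 0"
| "lrank d (Suc j) = Suc (lrank d j + d * (2 * lrad j + 1))"

text \<open>A far move of Spoiler can be answered: the other side offers an equivalent ball, and
  does so away from any given \<open>N\<close> points. \<open>C\<close> will be the core, whose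
  surroundings are matched by an isomorphism instead.\<close>

definition far_ext :: "nat \<Rightarrow> nat \<Rightarrow> nat \<Rightarrow> 'a set \<Rightarrow> 'a set set \<Rightarrow> 'a set \<Rightarrow> 'b set \<Rightarrow> 'b set set \<Rightarrow> bool"
  where
  "far_ext d q N V E C V' E' \<longleftrightarrow> (\<forall>j<q. \<forall>x\<in>V. x \<notin> ball_of E (2 * lrad j + 1) C \<longrightarrow>
     (\<forall>B. finite B \<and> card B \<le> N \<longrightarrow> (\<exists>y\<in>V'. y \<notin> ball_of E' (2 * lrad j + 1) B \<and>
        ef (lrank d j) (ball_of E (lrad j) {x}) E (ball_of E' (lrad j) {y}) E' {(x, y)})))"

text \<open>An edge meeting both r-balls would bring \<open>x\<close> within (r + 1) + r of
  \<open>A\<close>; the surplus 1 in the radius pays for this edge.\<close>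

lemma ball_of_far:
  assumes "x \<notin> ball_of E (2 * r + 1) A"
  shows "ball_of E r A \<inter> ball_of E r {x} = {}"
    and "e \<in> E \<Longrightarrow> e \<inter> ball_of E r A \<noteq> {} \<Longrightarrow> e \<inter> ball_of E r {x} = {}"
proof -
  have *: False if "w \<in> ball_of E (r + 1) A" "w \<in> ball_of E r {x}" for w
  proof -
    have "x \<in> ball_of E r {w}" using that(2) ball_of_sym by metis
    then have "x \<in> ball_of E (r + (r + 1)) A" using ball_of_trans that(1) by metis
    then show False using assms by (simp add: mult_2)
  qed
  then show "ball_of E r A \<inter> ball_of E r {x} = {}"
    using ball_of_radius_mono[of r "r + 1" E A] by auto
  show "e \<inter> ball_of E r {x} = {}" if "e \<in> E" "e \<inter> ball_of E r A \<noteq> {}"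
  proof -
    have "e \<subseteq> ball_of E (r + 1) A" using that by (auto simp: ball_of_Suc nbr_def)
    then show ?thesis using * by auto
  qed
qed

text \<open>A near move is answered inside the large ball by the invariant, and the ball of the new
  position is then cut out by \<open>ef_relativize\<close>. A far move is answered by
  \<open>far_ext\<close>, and \<open>ef_union\<close> joins two games that no edge connects.\<close>

lemma ef_local_step:
  assumes inv: "ef (lrank d (Suc j)) (ball_of E (lrad (Suc j)) (fst ` P)) E
      (ball_of E' (lrad (Suc j)) (snd ` P)) E' P"
    and far: "far_ext d q N V E C V' E'" and "j < q"
    and C: "C \<subseteq> fst ` P" and P: "finite P" "card P \<le> N" "snd ` P \<subseteq> V'"
    and E: "\<And>e. e \<in> E \<Longrightarrow> finite e \<and> card e \<le> d" 
    and E': "\<And>e. e \<in> E' \<Longrightarrow> finite e \<and> card e \<le> d" "E' \<subseteq> Pow V'"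
    and x: "x \<in> V"
  shows "\<exists>y\<in>V'. ef (lrank d j) (ball_of E (lrad j) (fst ` insert (x, y) P)) E
      (ball_of E' (lrad j) (snd ` insert (x, y) P)) E' (insert (x, y) P)"
proof -
  define r where "r = lrad j"
  let ?A = "fst ` P" and ?B = "snd ` P"
  let ?W = "ball_of E (3 * r + 1) ?A" and ?W' = "ball_of E' (3 * r + 1) ?B"
  let ?K = "d * (2 * r + 1)"
  have inv': "ef (Suc (lrank d j + ?K)) ?W E ?W' E' P" using inv by (simp add: r_def)
  have WW: "ball_of E i ?A \<subseteq> ?W" "ball_of E' i ?B \<subseteq> ?W'" if "i \<le> 3 * r + 1" for i
    by (rule ball_of_radius_mono[OF that])+
  show ?thesis
  proof (cases "x \<in> ball_of E (2 * r + 1) ?A")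
    case True
    then have xW: "x \<in> ?W" using WW(1)[of "2 * r + 1"] by auto
    then obtain y where y: "y \<in> ?W'" "ef (lrank d j + ?K) ?W E ?W' E' (insert (x, y) P)"
      using inv' by auto
    have yB: "y \<in> ball_of E' (2 * r + 1) ?B"
      by (rule ef_ball_pres[of d _ ?W E ?W' E' "insert (x, y) P" P x])
        (use y(2) True WW E in \<open>auto intro: ef_le\<close>)
    have near: "ball_of F r {z} \<subseteq> ball_of F (3 * r + 1) D"
      if "z \<in> ball_of F (2 * r + 1) D" for F and z :: 'c and D
      using ball_of_trans[OF _ that, of _ r] by (auto simp: algebra_simps)
    let ?P = "insert (x, y) P"
    have img: "fst ` ?P = {x} \<union> ?A" "snd ` ?P = {y} \<union> ?B" by auto
    have sub: "ball_of E r (fst ` ?P) \<subseteq> ?W" "ball_of E' r (snd ` ?P) \<subseteq> ?W'"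
      unfolding img ball_of_Un using near[OF True] near[OF yB] WW[of r] by auto
    have "ef (lrank d j) (ball_of E r (fst ` ?P)) E (ball_of E' r (snd ` ?P)) E' ?P"
    proof (rule ef_relativize[OF y(2) sub])
      fix R u v assume R: "?P \<subseteq> R" "ef ?K ?W E ?W' E' R" "(u, v) \<in> R"
      show "u \<in> ball_of E r (fst ` ?P) \<longleftrightarrow> v \<in> ball_of E' r (snd ` ?P)"
        by (rule ef_ball_pres_iff[of d r ?W E ?W' E' R])
          (use R sub E E' in \<open>auto intro: ef_le\<close>)
    qed
    moreover have "y \<in> V'" using y(1) ball_of_subset[OF P(3) E'(2)] by blast
    ultimately show ?thesis unfolding r_def by blast
  next
    case False
    have "x \<notin> ball_of E (2 * r + 1) C" using False ball_of_mono[OF _ C, of E E] by auto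
    moreover have "finite ?B" "card ?B \<le> N" using P by (auto intro: le_trans[OF card_image_le])
    ultimately obtain y where y: "y \<in> V'" "y \<notin> ball_of E' (2 * r + 1) ?B"
      "ef (lrank d j) (ball_of E r {x}) E (ball_of E' r {y}) E' {(x, y)}"
      using far x \<open>j < q\<close> unfolding far_ext_def r_def by blast
    have inv2: "ef (lrank d j + ?K) ?W E ?W' E' P" using ef_Suc_imp[OF inv'] .
    have "ef (lrank d j) (ball_of E r ?A) E (ball_of E' r ?B) E' P"
    proof (rule ef_relativize[OF inv2 WW])
      fix R u v assume R: "P \<subseteq> R" "ef ?K ?W E ?W' E' R" "(u, v) \<in> R"
      show "u \<in> ball_of E r ?A \<longleftrightarrow> v \<in> ball_of E' r ?B"
        by (rule ef_ball_pres_iff[of d r ?W E ?W' E' R])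
          (use R WW E E' in \<open>auto intro: ef_le\<close>)
    qed auto
    then have "ef (lrank d j) (ball_of E r ?A \<union> ball_of E r {x}) E
        (ball_of E' r ?B \<union> ball_of E' r {y}) E' (P \<union> {(x, y)})"
    proof (rule ef_union[OF _ y(3)])
      show "P \<subseteq> ball_of E r ?A \<times> ball_of E' r ?B"
        using subset_ball_of[of ?A E r] subset_ball_of[of ?B E' r] by force
      show "{(x, y)} \<subseteq> ball_of E r {x} \<times> ball_of E' r {y}"
        using subset_ball_of[of "{x}" E r] subset_ball_of[of "{y}" E' r] by auto
    qed (use ball_of_far[OF False] ball_of_far[OF y(2)] in auto)
    then have "ef (lrank d j) (ball_of E r (fst ` insert (x, y) P)) E
        (ball_of E' r (snd ` insert (x, y) P)) E' (insert (x, y) P)"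
      by (simp add: ball_of_Un[symmetric])
    then show ?thesis using y(1) unfolding r_def by blast
  qed
qed

text \<open>Back moves are forth moves for the converse position. The bound
  \<open>card P + j \<le> N\<close> keeps every position within the number of points that
  \<open>far_ext\<close> can avoid.\<close>

lemma ef_from_local:
  assumes "ef (lrank d j) (ball_of E (lrad j) (fst ` P)) E (ball_of E' (lrad j) (snd ` P)) E' P"
    and "far_ext d q N V E C V' E'" "far_ext d q N V' E' C' V E" "j \<le> q"
    and "C \<subseteq> fst ` P" "C' \<subseteq> snd ` P" "finite P" "card P + j \<le> N"
    and "P \<subseteq> V \<times> V'"
    and E: "\<And>e. e \<in> E \<Longrightarrow> finite e \<and> card e \<le> d" "E \<subseteq> Pow V"
    and E': "\<And>e. e \<in> E' \<Longrightarrow> finite e \<and> card e \<le> d" "E' \<subseteq> Pow V'"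
  shows "ef j V E V' E' P"
  using assms(1,4-9)
proof (induction j arbitrary: P)
  case 0
  then show ?case by simp
next
  case (Suc j)
  have cv: "fst ` (R\<inverse>) = snd ` R" "snd ` (R\<inverse>) = fst ` R" "card (R\<inverse>) = card R"
    for R :: "('a \<times> 'b) set"
    by (force, force, simp add: card_inverse)
  have sub: "fst ` P \<subseteq> V" "snd ` P \<subseteq> V'" using Suc.prems(7) by auto
  have rec: "ef j V E V' E' (insert (x, y) P)"
    if "x \<in> V" "y \<in> V'" "ef (lrank d j) (ball_of E (lrad j) (fst ` insert (x, y) P)) E
      (ball_of E' (lrad j) (snd ` insert (x, y) P)) E' (insert (x, y) P)" for x y
    by (rule Suc.IH[OF that(3)])
      (use Suc.prems that in \<open>auto simp: card_insert_if\<close>)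
  have "\<exists>y\<in>V'. ef j V E V' E' (insert (x, y) P)" if "x \<in> V" for x
    using ef_local_step[OF Suc.prems(1) assms(2) _ Suc.prems(3,5) _ sub(2) E(1) E' that] rec that
      Suc.prems(2,6) by (metis Suc_le_lessD add_leD1)
  moreover have "\<exists>x\<in>V. ef j V E V' E' (insert (x, y) P)" if y: "y \<in> V'" for y
  proof -
    have inv: "ef (lrank d (Suc j)) (ball_of E' (lrad (Suc j)) (fst ` P\<inverse>)) E'
      (ball_of E (lrad (Suc j)) (snd ` P\<inverse>)) E (P\<inverse>)"
      using ef_sym[OF Suc.prems(1)] unfolding cv .
    have "\<exists>x\<in>V. ef (lrank d j) (ball_of E' (lrad j) (fst ` insert (y, x) (P\<inverse>))) E'
      (ball_of E (lrad j) (snd ` insert (y, x) (P\<inverse>))) E (insert (y, x) (P\<inverse>))"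
      by (rule ef_local_step[OF inv assms(3) _ _ _ _ _ E'(1) E y])
        (use Suc.prems sub in \<open>simp_all add: cv\<close>)
    then obtain x where x: "x \<in> V" "ef (lrank d j) (ball_of E' (lrad j) (fst ` insert (y, x) (P\<inverse>))) E'
      (ball_of E (lrad j) (snd ` insert (y, x) (P\<inverse>))) E (insert (y, x) (P\<inverse>))" by blast
    have "(insert (y, x) (P\<inverse>))\<inverse> = insert (x, y) P" by auto
    then have "ef (lrank d j) (ball_of E (lrad j) (fst ` insert (x, y) P)) E
      (ball_of E' (lrad j) (snd ` insert (x, y) P)) E' (insert (x, y) P)"
      using ef_sym[OF x(2)] cv[of "insert (x, y) P"] by (metis converse_converse)
    then show ?thesis using rec[OF x(1) y] x(1) by blast
  qed
  ultimately show ?case using ef_atomeq[OF Suc.prems(1)] by simp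
qed

section \<open>Cycles in uniform hypergraphs\<close>

lemma edge_finite: "card e = d \<Longrightarrow> 0 < d \<Longrightarrow> finite e"
  using card_ge_0_finite by blast

text \<open>A loose cycle is encoded by \<open>k\<close> disjoint blocks of \<open>d - 1\<close>
  vertices; edge \<open>i\<close> is block \<open>i\<close> closed up by the first vertex of the
  next block. In particular a 2-cycle consists of two edges that share exactly two vertices.\<close>

definition cyc_blocks :: "nat \<Rightarrow> nat \<Rightarrow> 'a list list \<Rightarrow> bool" where
  "cyc_blocks d k bs \<longleftrightarrow> length bs = k \<and> (\<forall>b\<in>set bs. length b = d - 1) \<and> distinct (concat bs)"

definition cyc_edge :: "'a list list \<Rightarrow> nat \<Rightarrow> 'a set" where
  "cyc_edge bs i = insert (hd (bs ! (Suc i mod length bs))) (set (bs ! i))"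

definition cyc_edges :: "'a list list \<Rightarrow> 'a set set" where
  "cyc_edges bs = cyc_edge bs ` {..<length bs}"

definition is_cycle :: "nat \<Rightarrow> nat \<Rightarrow> 'a set set \<Rightarrow> bool" where
  "is_cycle d k C \<longleftrightarrow> 2 \<le> k \<and> (\<exists>bs. cyc_blocks d k bs \<and> C = cyc_edges bs)"

context
  fixes d k :: nat and bs :: "'a list list"
  assumes d: "3 \<le> d" and k: "2 \<le> k" and bs: "cyc_blocks d k bs"
begin

lemma cyc_len: "length bs = k" and cyc_block_len: "i < k \<Longrightarrow> length (bs ! i) = d - 1"
  using bs unfolding cyc_blocks_def by auto

lemma cyc_block_card: "i < k \<Longrightarrow> card (set (bs ! i)) = d - 1"
  using bs cyc_block_len distinct_card unfolding cyc_blocks_def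
  by (metis distinct_concat_iff nth_mem)

lemma cyc_block_disjoint: 
  assumes "i < k" "j < k" "i \<noteq> j" shows "set (bs ! i) \<inter> set (bs ! j) = {}"
proof -
  have "[] \<notin> set bs" using bs d unfolding cyc_blocks_def by fastforce
  then have "distinct bs" using bs unfolding cyc_blocks_def distinct_concat_iff by simp
  then have "bs ! i \<noteq> bs ! j" using assms cyc_len by (simp add: nth_eq_iff_index_eq)
  then show ?thesis using bs assms cyc_len unfolding cyc_blocks_def distinct_concat_iff
    by (meson nth_mem)
qed

lemma cyc_hd_in: "i < k \<Longrightarrow> hd (bs ! i) \<in> set (bs ! i)"
  using cyc_block_len[of i] d by (intro hd_in_set) auto

lemma cyc_succ: "i < k \<Longrightarrow> Suc i mod k < k \<and> Suc i mod k \<noteq> i"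
  using k by (metis Suc_n_not_le_n bot_nat_0.not_eq_extremum less_antisym mod_Suc mod_less
      mod_less_divisor n_not_Suc_n nat_le_linear not_less_eq_eq numeral_2_eq_2 order_less_le_trans zero_less_Suc)

lemma cyc_edge_eq: "cyc_edge bs i = insert (hd (bs ! (Suc i mod k))) (set (bs ! i))"
  by (simp add: cyc_edge_def cyc_len)

lemma cyc_hd_notin: "i < k \<Longrightarrow> hd (bs ! (Suc i mod k)) \<notin> set (bs ! i)"
  using cyc_block_disjoint[of "Suc i mod k" i] cyc_succ[of i] cyc_hd_in[of "Suc i mod k"] by auto

lemma cyc_edge_card: "i < k \<Longrightarrow> card (cyc_edge bs i) = d"
  using cyc_hd_notin cyc_block_card d unfolding cyc_edge_eq by simp

text \<open>Equal edges at different positions would confine a block to a single vertex, but blocks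
  have \<open>d - 1 \<ge> 2\<close> vertices.\<close>

lemma cyc_edge_inj: "inj_on (cyc_edge bs) {..<k}"
proof (rule inj_onI, rule ccontr)
  fix i j assume ij: "i \<in> {..<k}" "j \<in> {..<k}" "cyc_edge bs i = cyc_edge bs j" "i \<noteq> j"
  then have "set (bs ! i) \<subseteq> {hd (bs ! (Suc j mod k))}"
    using cyc_block_disjoint[of i j] unfolding cyc_edge_eq by auto
  then have "card (set (bs ! i)) \<le> 1" using card_mono[of "{hd (bs ! (Suc j mod k))}"] by simp
  then show False using cyc_block_card[of i] ij d by simp
qed

lemma cyc_edges_card: "card (cyc_edges bs) = k"
  unfolding cyc_edges_def cyc_len using cyc_edge_inj by (simp add: card_image)

lemma cyc_Union_blocks: "(\<Union>i<k. set (bs ! i)) = set (concat bs)"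
  by (auto simp: cyc_len set_conv_nth[of bs])

lemma cyc_Union: "\<Union>(cyc_edges bs) = set (concat bs)"
proof -
  have "(\<Union>i<k. cyc_edge bs i) = (\<Union>i<k. set (bs ! i))"
  proof
    show "(\<Union>i<k. cyc_edge bs i) \<subseteq> (\<Union>i<k. set (bs ! i))"
    proof
      fix x assume "x \<in> (\<Union>i<k. cyc_edge bs i)"
      then obtain i where i: "i < k" "x \<in> cyc_edge bs i" by auto
      then have "x \<in> set (bs ! i) \<or> x \<in> set (bs ! (Suc i mod k))"
        using cyc_hd_in[of "Suc i mod k"] cyc_succ[OF i(1)] unfolding cyc_edge_eq by auto
      then show "x \<in> (\<Union>i<k. set (bs ! i))" using i(1) cyc_succ[OF i(1)] by blast
    qed
  qed (auto simp: cyc_edge_eq)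
  then show ?thesis using cyc_Union_blocks by (simp add: cyc_edges_def cyc_len)
qed

lemma cyc_length_concat: "length (concat bs) = (d - 1) * k"
proof -
  have "map length bs = replicate k (d - 1)"
    using bs unfolding cyc_blocks_def by (intro replicate_eqI) auto
  then show ?thesis by (simp add: length_concat sum_list_replicate)
qed

lemma cyc_Union_card: "card (\<Union>(cyc_edges bs)) = (d - 1) * k"
  using bs cyc_length_concat distinct_card unfolding cyc_Union cyc_blocks_def by metis

lemma cyc_succ_closed:
  assumes I: "I \<subseteq> {..<k}" "I \<noteq> {}" and cl: "\<And>i. i \<in> I \<Longrightarrow> Suc i mod k \<in> I"
  shows "I = {..<k}"
proof -
  obtain i where i: "i \<in> I" using I by auto
  have "(i + j) mod k \<in> I" for j
  proof (induction j)
    case 0 then show ?case using i I by auto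
  next
    case (Suc j) then show ?case using cl[OF Suc] by (simp add: mod_Suc_eq)
  qed
  from this[of "k - i + _"] have *: "j mod k \<in> I" for j
  proof -
    have "(i + (k - i + j)) mod k = j mod k" using i I by (auto simp: add.assoc[symmetric])
    then show ?thesis using \<open>\<And>j. (i + j) mod k \<in> I\<close>[of "k - i + j"] by simp
  qed
  show ?thesis
  proof
    show "{..<k} \<subseteq> I" using * by (metis lessThan_iff mod_less subsetI)
  qed (use I in auto)
qed

text \<open>Some edge of a proper part has its successor missing. The joint between the two lies in
  none of the disjoint blocks of the part and is the extra vertex: cycles are strictly
  balanced.\<close>

lemma cyc_proper_subset:
  assumes S: "S \<subseteq> cyc_edges bs" "S \<noteq> {}" "S \<noteq> cyc_edges bs"
  shows "(d - 1) * card S + 1 \<le> card (\<Union>S)"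
proof -
  define I where "I = {i. i < k \<and> cyc_edge bs i \<in> S}"
  have SI: "S = cyc_edge bs ` I" using S(1) unfolding I_def cyc_edges_def cyc_len by auto
  have Ik: "I \<subseteq> {..<k}" unfolding I_def by auto
  have cI: "card S = card I" unfolding SI
    by (rule card_image) (rule inj_on_subset[OF cyc_edge_inj Ik])
  have "I \<noteq> {..<k}" "I \<noteq> {}" using S(2,3) SI by (auto simp: cyc_edges_def cyc_len)
  then obtain i where i: "i \<in> I" "Suc i mod k \<notin> I" using cyc_succ_closed[OF Ik] by metis
  let ?B = "\<Union>j\<in>I. set (bs ! j)" and ?v = "hd (bs ! (Suc i mod k))"
  have finI: "finite I" using Ik finite_subset by blast
  have ik: "i < k" using i Ik by auto
  have "card ?B = (\<Sum>j\<in>I. card (set (bs ! j)))"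
    using finI cyc_block_disjoint Ik by (intro card_UN_disjoint) auto
  also have "\<dots> = (d - 1) * card I" using cyc_block_card Ik by (simp add: subset_iff)
  finally have cB: "card ?B = (d - 1) * card I" .
  have "?v \<notin> ?B"
  proof
    assume "?v \<in> ?B"
    then obtain j where "j \<in> I" "?v \<in> set (bs ! j)" by auto
    then show False using cyc_block_disjoint[of j "Suc i mod k"] i Ik cyc_succ[OF ik]
        cyc_hd_in[of "Suc i mod k"] by auto
  qed
  then have "card (insert ?v ?B) = (d - 1) * card I + 1" using cB finI by simp
  moreover have "insert ?v ?B \<subseteq> \<Union>S" unfolding SI using i(1) by (auto simp: cyc_edge_eq)
  moreover have "finite (\<Union>S)" unfolding SI using finI by (auto simp: cyc_edge_eq)
  ultimately show ?thesis using card_mono cI by metis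
qed

end

lemma cycle_finite: "is_cycle d k C \<Longrightarrow> finite C \<and> finite (\<Union>C)"
  unfolding is_cycle_def cyc_edges_def cyc_edge_def by auto

lemma cycle_card: "3 \<le> d \<Longrightarrow> is_cycle d k C \<Longrightarrow> card C = k"
  and cycle_Union_card: "3 \<le> d \<Longrightarrow> is_cycle d k C \<Longrightarrow> card (\<Union>C) = (d - 1) * k"
  unfolding is_cycle_def using cyc_edges_card cyc_Union_card by blast+

lemma cycle_edge_card: "3 \<le> d \<Longrightarrow> is_cycle d k C \<Longrightarrow> e \<in> C \<Longrightarrow> card e = d"
  unfolding is_cycle_def by (auto simp: cyc_edges_def cyc_edge_card cyc_len)

lemma cycle_ge2: "is_cycle d k C \<Longrightarrow> 2 \<le> k" by (simp add: is_cycle_def)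

lemma cycle_proper_subset:
  "3 \<le> d \<Longrightarrow> is_cycle d k C \<Longrightarrow> S \<subseteq> C \<Longrightarrow> S \<noteq> {} \<Longrightarrow> S \<noteq> C \<Longrightarrow> (d - 1) * card S < card (\<Union>S)"
  unfolding is_cycle_def using cyc_proper_subset[of d k _ S] by (metis Suc_eq_plus1 Suc_le_lessD)

text \<open>Every edge set in \<open>dense\<close> position over \<open>Z\<close> has expected number of copies \<open>O(1/n)\<close>.\<close>

definition dense_over :: "nat \<Rightarrow> 'a set \<Rightarrow> nat \<Rightarrow> 'a set set \<Rightarrow> bool" where
  "dense_over d Z M g \<longleftrightarrow> (\<exists>S\<subseteq>g. S \<noteq> {} \<and> card S \<le> M \<and> card (\<Union>S - Z) < (d - 1) * card S)"

lemma dense_over_mono: "dense_over d Z M g \<Longrightarrow> g \<subseteq> g' \<Longrightarrow> dense_over d Z M g'"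
  unfolding dense_over_def by blast

text \<open>By strict balance the part of \<open>C\<close> inside \<open>H\<close> has more than
  \<open>d - 1\<close> vertices per edge, while \<open>C\<close> as a whole has exactly that ratio;
  so the remaining edges bring on average fewer than \<open>d - 1\<close> new vertices each.\<close>

lemma cycle_overlap_dense:
  assumes d: "3 \<le> d" and C: "is_cycle d k C" "k \<le> L" and H: "C \<inter> H \<noteq> {}" "\<not> C \<subseteq> H"
  shows "dense_over d (\<Union>H) L (C - H)"
proof -
  have fin: "finite C" "finite (\<Union>C)" using cycle_finite[OF C(1)] by auto
  have fin2: "finite (\<Union>(C \<inter> H))" by (rule finite_subset[OF _ fin(2)]) auto
  have "card (\<Union>(C - H) - \<Union>H) \<le> card (\<Union>C - \<Union>(C \<inter> H))"
    using fin by (intro card_mono) auto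
  also have "\<dots> = card (\<Union>C) - card (\<Union>(C \<inter> H))"
    by (rule card_Diff_subset) (use fin2 in auto)
  also have "\<dots> < (d - 1) * card (C - H)"
  proof -
    have "(d - 1) * card (C \<inter> H) < card (\<Union>(C \<inter> H))"
      by (rule cycle_proper_subset[OF d C(1)]) (use H in auto)
    moreover have "card (\<Union>C) = (d - 1) * card C"
      using cycle_card[OF d C(1)] cycle_Union_card[OF d C(1)] by simp
    moreover have "card C = card (C \<inter> H) + card (C - H)"
      using card_Un_disjoint[of "C \<inter> H" "C - H"] fin(1) by (simp add: Int_Diff_Un Diff_Int_distrib Int_Diff)
    moreover have "card (C - H) > 0" using H fin by (auto simp: card_gt_0_iff)
    moreover have "(d - 1) * card (C - H) > 0" using \<open>card (C - H) > 0\<close> d by simp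
    ultimately have "(d - 1) * card (C \<inter> H) < card (\<Union>(C \<inter> H))" "(d - 1) * card (C - H) > 0"
      "card (\<Union>C) = (d - 1) * card (C \<inter> H) + (d - 1) * card (C - H)"
      by (simp_all only: distrib_left)
    then show ?thesis by linarith
  qed
  finally have "card (\<Union>(C - H) - \<Union>H) < (d - 1) * card (C - H)" .
  moreover have "card (C - H) \<le> L"
    using card_mono[OF fin(1), of "C - H"] cycle_card[OF d C(1)] C(2) by simp
  ultimately show ?thesis using H(2) unfolding dense_over_def by blast
qed

text \<open>A cycle just breaks even, so losing a single vertex to \<open>Z\<close> tips the
  count.\<close>

lemma cycle_meets_dense:
  assumes d: "3 \<le> d" and C: "is_cycle d k C" "k \<le> L" and Z: "\<Union>C \<inter> Z \<noteq> {}"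
  shows "dense_over d Z L C"
proof -
  have "card (\<Union>C - Z) < card (\<Union>C)"
    using cycle_finite[OF C(1)] Z by (intro psubset_card_mono) auto
  moreover have "C \<noteq> {}" using Z by auto
  ultimately show ?thesis unfolding dense_over_def
    using cycle_card[OF d C(1)] cycle_Union_card[OF d C(1)] C(2) by (intro exI[of _ C]) auto
qed

section \<open>Short cycles from paths, and trees away from short cycles\<close>

text \<open>The blocks, each made of \<open>w i\<close> and the vertices of \<open>f i\<close> that
  are not joints, have total length \<open>(d - 1) * k\<close>. If the edges cover that many
  vertices, the blocks cannot repeat any vertex, and the closed walk is a loose cycle.\<close>

lemma berge_cycle:
  assumes d: "3 \<le> d" and k: "2 \<le> k" and inj: "inj_on w {..<k}" "inj_on f {..<k}"
    and f: "\<And>i. i < k \<Longrightarrow> w i \<in> f i \<and> w (Suc i mod k) \<in> f i \<and> card (f i) = d"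
    and dense: "(d - 1) * k \<le> card (\<Union>(f ` {..<k}))"
  shows "is_cycle d k (f ` {..<k})"
proof -
  have finf: "finite (f i)" if "i < k" for i using f[OF that] d edge_finite[of "f i" d] by auto
  have ne: "w i \<noteq> w (Suc i mod k)" if "i < k" for i
  proof -
    have "Suc i mod k \<noteq> i" "Suc i mod k < k" using k that by (auto simp: mod_Suc)
    then show ?thesis using inj(1) that by (metis inj_on_eq_iff lessThan_iff)
  qed
  have "\<exists>l. set l = f i - {w i, w (Suc i mod k)} \<and> distinct l" if "i < k" for i
    by (rule finite_distinct_list) (use finf[OF that] in simp)
  then obtain l where l: "\<And>i. i < k \<Longrightarrow> set (l i) = f i - {w i, w (Suc i mod k)} \<and> distinct (l i)"
    by metis
  have len: "length (l i) = d - 2" if "i < k" for i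
  proof -
    have "length (l i) = card (f i - {w i, w (Suc i mod k)})" using l[OF that] distinct_card by metis
    also have "\<dots> = d - 2" using f[OF that] ne[OF that] finf[OF that] by (subst card_Diff_subset) auto
    finally show ?thesis .
  qed
  define bs where "bs = map (\<lambda>i. w i # l i) [0..<k]"
  have lb: "length bs = k" by (simp add: bs_def)
  have nb: "bs ! i = w i # l i" if "i < k" for i using that by (simp add: bs_def)
  have e: "cyc_edge bs i = f i" if "i < k" for i
  proof -
    have "Suc i mod k < k" using k by simp
    then show ?thesis using that l[OF that] f[OF that] by (auto simp: cyc_edge_def lb nb)
  qed
  have E: "cyc_edges bs = f ` {..<k}" unfolding cyc_edges_def lb using e by (auto intro!: image_cong)
  have blen: "\<forall>b\<in>set bs. length b = d - 1" unfolding bs_def using len d by auto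
  have "map length bs = replicate k (d - 1)" using blen lb by (intro replicate_eqI) auto
  then have lc: "length (concat bs) = (d - 1) * k" by (simp add: length_concat sum_list_replicate)
  have "\<Union>(f ` {..<k}) \<subseteq> set (concat bs)"
  proof
    fix x assume "x \<in> \<Union>(f ` {..<k})"
    then obtain i where i: "i < k" "x \<in> f i" by auto
    have s: "Suc i mod k < k" using k by simp
    have "x \<in> set (bs ! i) \<or> x \<in> set (bs ! (Suc i mod k))"
      using i l[OF i(1)] nb[OF i(1)] nb[OF s] by auto
    then show "x \<in> set (concat bs)" using i(1) s lb by (metis UN_I nth_mem set_concat)
  qed
  then have "length (concat bs) \<le> card (set (concat bs))"
    using dense lc card_mono[of "set (concat bs)"] by (metis finite_set le_trans)
  then have "distinct (concat bs)" using card_length[of "concat bs"] by (intro card_distinct) simp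
  then have "cyc_blocks d k bs" unfolding cyc_blocks_def using lb blen by simp
  then show ?thesis using k E unfolding is_cycle_def by metis
qed

text \<open>The walk keeps \<open>w i\<close> at distance exactly \<open>i\<close> from
  \<open>u\<close>; the distinctness of its vertices and edges is read off from this.\<close>

lemma ball_of_shortest_path:
  assumes "v \<in> ball_of F m {u}" "\<And>j. j < m \<Longrightarrow> v \<notin> ball_of F j {u}"
  shows "\<exists>w f. w 0 = u \<and> w m = v \<and> (\<forall>i<m. f i \<in> F \<and> w i \<in> f i \<and> w (Suc i) \<in> f i) \<and>
    (\<forall>i\<le>m. w i \<in> ball_of F i {u} \<and> (\<forall>j<i. w i \<notin> ball_of F j {u}))"
  using assms
proof (induction m arbitrary: v)
  case 0
  then show ?case by (intro exI[of _ "\<lambda>_. u"]) auto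
next
  case (Suc m)
  have "v \<notin> ball_of F m {u}" using Suc.prems by blast
  then obtain e z where ez: "e \<in> F" "v \<in> e" "z \<in> e" "z \<in> ball_of F m {u}"
    using Suc.prems(1) by (auto simp: ball_of_Suc nbr_def)
  have "z \<notin> ball_of F j {u}" if "j < m" for j
  proof
    assume "z \<in> ball_of F j {u}"
    then have "v \<in> ball_of F (Suc j) {u}" using ez by (auto simp: ball_of_Suc nbr_def)
    then show False using Suc.prems(2) that by simp
  qed
  then obtain w f where wf: "w 0 = u" "w m = z" "\<forall>i<m. f i \<in> F \<and> w i \<in> f i \<and> w (Suc i) \<in> f i"
    "\<forall>i\<le>m. w i \<in> ball_of F i {u} \<and> (\<forall>j<i. w i \<notin> ball_of F j {u})"
    using Suc.IH[OF ez(4)] by blast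
  have st: "(f(m := e)) i \<in> F \<and> (w(Suc m := v)) i \<in> (f(m := e)) i \<and>
      (w(Suc m := v)) (Suc i) \<in> (f(m := e)) i" if "i < Suc m" for i
    using that wf ez by (cases "i = m") auto
  have "(w(Suc m := v)) i \<in> ball_of F i {u} \<and> (\<forall>j<i. (w(Suc m := v)) i \<notin> ball_of F j {u})"
    if "i \<le> Suc m" for i
    using that wf(4) Suc.prems by (cases "i = Suc m") auto
  then show ?case using st wf(1)
    by (intro exI[of _ "w(Suc m := v)"] exI[of _ "f(m := e)"]) auto
qed

text \<open>A shortest path from \<open>u\<close> to \<open>v\<close> in \<open>F\<close> is closed
  by the edge \<open>e\<close>. The result has at most \<open>L\<close> edges, so sparsity provides
  the vertex count that \<open>berge_cycle\<close> asks for.\<close>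

lemma short_cycle_from_path:
  assumes d: "3 \<le> d" and E: "\<And>e. e \<in> E \<Longrightarrow> card e = d" and sparse: "\<not> dense_over d {} L E"
    and F: "F \<subseteq> E" "e \<in> E" "e \<notin> F" and uv: "u \<in> e" "v \<in> e" "u \<noteq> v"
    and path: "v \<in> ball_of F n {u}" "n < L"
  shows "\<exists>C k. C \<subseteq> E \<and> e \<in> C \<and> is_cycle d k C \<and> k \<le> L"
proof -
  define m where "m = (LEAST j. v \<in> ball_of F j {u})"
  have m: "v \<in> ball_of F m {u}" unfolding m_def using path(1) by (rule LeastI)
  have mn: "m \<le> n" unfolding m_def using path(1) by (rule Least_le)
  have min: "v \<notin> ball_of F j {u}" if "j < m" for j using that not_less_Least unfolding m_def by blast
  have m0: "m \<noteq> 0" using m uv(3) by (auto intro!: Nat.gr0I)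
  obtain w f where wf: "w 0 = u" "w m = v" "\<forall>i<m. f i \<in> F \<and> w i \<in> f i \<and> w (Suc i) \<in> f i"
    "\<forall>i\<le>m. w i \<in> ball_of F i {u} \<and> (\<forall>j<i. w i \<notin> ball_of F j {u})"
    using ball_of_shortest_path[OF m min] by blast
  define g where "g = f(m := e)"
  have injw: "inj_on w {..<Suc m}"
  proof (rule linorder_inj_onI)
    fix i j assume "i < j" "i \<in> {..<Suc m}" "j \<in> {..<Suc m}"
    then have "w i \<in> ball_of F i {u}" "w j \<notin> ball_of F i {u}" using wf(4) by auto
    then show "w i \<noteq> w j" by metis
  qed auto
  have injg: "inj_on g {..<Suc m}"
  proof (rule linorder_inj_onI)
    fix i j assume ij: "i < j" "i \<in> {..<Suc m}" "j \<in> {..<Suc m}"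
    show "g i \<noteq> g j"
    proof (cases "j = m")
      case True
      then show ?thesis using ij wf(3) F(3) unfolding g_def by auto
    next
      case False
      then have jm: "j < m" using ij by auto
      show ?thesis
      proof
        assume eq: "g i = g j"
        \<comment> \<open>An edge used at two steps i < j would take the walk from distance i to
          distance j + 1 at once.\<close>
        have "w (Suc j) \<in> f i" using eq jm wf(3) ij unfolding g_def by auto
        moreover have "w i \<in> f i" "f i \<in> F" "w i \<in> ball_of F i {u}" using wf(3,4) ij jm by auto
        ultimately have "w (Suc j) \<in> ball_of F (Suc i) {u}" by (auto simp: ball_of_Suc nbr_def)
        then show False using wf(4) jm ij by auto
      qed
    qed
  qed auto
  have gE: "g i \<in> E" if "i < Suc m" for i
    using that wf(3) F unfolding g_def by (cases "i = m") auto
  have gi: "w i \<in> g i \<and> w (Suc i mod Suc m) \<in> g i \<and> card (g i) = d" if "i < Suc m" for i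
    using that wf(1,2,3) uv E[OF gE[OF that]] unfolding g_def by (cases "i = m") auto
  have cg: "card (g ` {..<Suc m}) = Suc m" using card_image[OF injg] by simp
  have gsub: "g ` {..<Suc m} \<subseteq> E" using gE by auto
  have gne: "g ` {..<Suc m} \<noteq> {}" by auto
  have "(d - 1) * Suc m \<le> card (\<Union>(g ` {..<Suc m}))"
  proof (rule ccontr)
    assume "\<not> ?thesis"
    then have "card (\<Union>(g ` {..<Suc m}) - {}) < (d - 1) * card (g ` {..<Suc m})" using cg by simp
    moreover have "card (g ` {..<Suc m}) \<le> L" using cg mn path(2) by simp
    ultimately have "dense_over d {} L E" unfolding dense_over_def using gsub gne by blast
    then show False using sparse by blast
  qed
  then have "is_cycle d (Suc m) (g ` {..<Suc m})"
    using berge_cycle[OF d _ injw injg gi] m0 by simp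
  moreover have "e \<in> g ` {..<Suc m}" unfolding g_def by auto
  ultimately show ?thesis using gsub mn path(2) by (metis Suc_leI le_less_trans)
qed

definition core :: "nat \<Rightarrow> nat \<Rightarrow> 'a set set \<Rightarrow> 'a set" where
  "core d L g = \<Union>{\<Union>C |C k. C \<subseteq> g \<and> is_cycle d k C \<and> k \<le> L}"

lemma core_subset: "core d L g \<subseteq> \<Union>g" unfolding core_def by auto

lemma core_intro: "C \<subseteq> g \<Longrightarrow> is_cycle d k C \<Longrightarrow> k \<le> L \<Longrightarrow> \<Union>C \<subseteq> core d L g"
  unfolding core_def by blast

lemma core_mono: "g \<subseteq> g' \<Longrightarrow> core d L g \<subseteq> core d L g'" unfolding core_def by blast

text \<open>A tree is grown from \<open>x\<close> inside the ball. A new edge can touch it in one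
  vertex only: two of them would be joined through \<open>x\<close> by a path of at most 2r edges
  and close a short cycle meeting the ball. So every edge adds \<open>d - 1\<close>
  vertices.\<close>

lemma ball_is_tree:
  assumes d: "3 \<le> d" and E: "\<And>e. e \<in> E \<Longrightarrow> card e = d" "finite E" and sparse: "\<not> dense_over d {} L E"
    and L: "2 * r < L" and disj: "ball_of E r {x} \<inter> core d L E = {}"
  shows "(d - 1) * card {e \<in> E. e \<subseteq> ball_of E r {x}} + 1 \<le> card (ball_of E r {x})"
proof -
  let ?W = "ball_of E r {x}"
  define T where "T = {e \<in> E. e \<subseteq> ?W}"
  have finE: "finite e" if "e \<in> E" for e using E(1)[OF that] d edge_finite[of e d] by auto
  have TE: "T \<subseteq> E" and finT: "finite T" using E(2) unfolding T_def by auto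
  \<comment> \<open>Invariant of the growing tree: all its vertices are within r steps of
    \<open>x\<close> along its own edges, and it has the vertex count of a tree. A largest such set
    turns out to be \<open>T\<close>.\<close>
  define good where "good F \<longleftrightarrow> F \<subseteq> T \<and> {x} \<union> \<Union>F \<subseteq> ball_of F r {x} \<and>
    (d - 1) * card F + 1 \<le> card ({x} \<union> \<Union>F)" for F
  have no_cycle: False if F: "F \<subseteq> T" "e \<in> T" "e \<notin> F" "u \<in> e" "v \<in> e" "u \<noteq> v"
    "u \<in> ball_of F r {x}" "v \<in> ball_of F r {x}" for F e u v
  proof -
    have "x \<in> ball_of F r {u}" using F(7) ball_of_sym by metis
    then have "v \<in> ball_of F (r + r) {u}" using ball_of_trans[OF F(8)] by blast
    then obtain C k where C: "C \<subseteq> E" "e \<in> C" "is_cycle d k C" "k \<le> L"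
      using short_cycle_from_path[OF d E(1) sparse _ _ F(3,4,5,6)] F TE L by (metis mult_2 subset_trans subsetD)
    have "u \<in> core d L E" unfolding core_def using C F(4) by blast
    moreover have "u \<in> ?W" using F(2,4) unfolding T_def by auto
    ultimately show False using disj by auto
  qed
  have "good {}" unfolding good_def using subset_ball_of[of "{x}"] by auto
  moreover have "\<forall>F. good F \<longrightarrow> card F \<le> card T" using finT card_mono unfolding good_def by blast
  ultimately have "\<exists>F. good F \<and> (\<forall>F'. good F' \<longrightarrow> card F' \<le> card F)" 
    by (intro ex_has_greatest_nat[where b = "Suc (card T)"]) (auto simp: less_Suc_eq_le)
  then obtain F where F: "good F" and max: "\<And>F'. good F' \<Longrightarrow> card F' \<le> card F" by metis
  have FT: "F \<subseteq> T" and FW: "{x} \<union> \<Union>F \<subseteq> ball_of F r {x}" using F unfolding good_def by auto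
  have finF: "finite F" using FT finT finite_subset by blast
  have finUF: "finite (\<Union>F)" using finF FT TE finE by auto
  have reach: "y \<in> ball_of F j {x}"
    if "\<And>e i. e \<in> T - F \<Longrightarrow> i < j \<Longrightarrow> e \<inter> ball_of E i {x} = {}" "j \<le> r" "y \<in> ball_of E j {x}" for j y
    using that
  proof (induction j arbitrary: y)
    case (Suc j)
    have IH: "ball_of E j {x} \<subseteq> ball_of F j {x}" using Suc by auto
    consider "y \<in> ball_of E j {x}" | e z where "e \<in> E" "y \<in> e" "z \<in> e" "z \<in> ball_of E j {x}"
      using Suc.prems(3) by (auto simp: ball_of_Suc nbr_def)
    then show ?case
    proof cases
      case 1 then show ?thesis using IH ball_of_radius_mono[of j "Suc j" F "{x}"] by auto
    next
      case 2
      have "e \<subseteq> ball_of E (Suc j) {x}" using 2 by (auto simp: ball_of_Suc nbr_def)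
      then have "e \<in> T" unfolding T_def using 2(1) ball_of_radius_mono[OF Suc.prems(2), of E "{x}"] by auto
      then have "e \<in> F" using Suc.prems(1)[of e j] 2 by auto
      then show ?thesis using 2 IH by (auto simp: ball_of_Suc nbr_def)
    qed
  qed simp
  have "F = T"
  proof (rule ccontr)
    assume "F \<noteq> T"
    then obtain e0 where e0: "e0 \<in> T - F" using FT by auto
    have "e0 \<noteq> {}" using e0 E(1)[of e0] d unfolding T_def by auto
    then have "\<exists>i. \<exists>e\<in>T - F. e \<inter> ball_of E i {x} \<noteq> {}" using e0 unfolding T_def by auto
    \<comment> \<open>The missing edge is taken as close to \<open>x\<close> as possible, so that
      all smaller distances are already realised inside \<open>F\<close>.\<close>
    define i where "i = (LEAST i. \<exists>e\<in>T - F. e \<inter> ball_of E i {x} \<noteq> {})"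
    obtain e where e: "e \<in> T - F" "e \<inter> ball_of E i {x} \<noteq> {}"
      using LeastI_ex[OF \<open>\<exists>i. \<exists>e\<in>T - F. e \<inter> ball_of E i {x} \<noteq> {}\<close>] unfolding i_def by blast
    have imin: "e' \<inter> ball_of E j {x} = {}" if "e' \<in> T - F" "j < i" for e' j
      using not_less_Least that unfolding i_def by blast
    have card_e: "card e = d" "finite e" using e(1) TE E(1) finE by auto
    have ir: "i < r"
    proof (rule ccontr)
      assume "\<not> i < r"
      \<comment> \<open>If no missing edge comes closer than r, then \<open>F\<close> already
        reaches the whole ball, and any missing edge closes a cycle.\<close>
      then have sub: "?W \<subseteq> ball_of F r {x}" using reach[of r] imin by auto
      have "\<not> card e \<le> 1" using card_e d by simp
      then obtain u v where "u \<in> e" "v \<in> e" "u \<noteq> v" using card_le_Suc0_iff_eq[OF card_e(2)] by auto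
      then show False using no_cycle[OF FT, of e u v] e(1) sub unfolding T_def by auto
    qed
    obtain z where z: "z \<in> e" "z \<in> ball_of E i {x}" using e(2) by auto
    have zF: "z \<in> ball_of F i {x}" using reach[of i z] imin z ir by auto
    then have zF': "z \<in> ball_of F r {x}" using ball_of_radius_mono[of i r F "{x}"] ir by auto
    have only: "e \<inter> ({x} \<union> \<Union>F) \<subseteq> {z}"
      using no_cycle[OF FT, of e z] e(1) z zF' FW by blast
    have ins: "{x} \<union> \<Union>(insert e F) \<subseteq> ball_of (insert e F) r {x}"
    proof -
      have "ball_of F r {x} \<subseteq> ball_of (insert e F) r {x}" by (rule ball_of_mono) auto
      moreover have "z \<in> ball_of (insert e F) i {x}"
        using zF ball_of_mono[of F "insert e F" "{x}" "{x}" i] by auto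
      then have "e \<subseteq> ball_of (insert e F) (Suc i) {x}" using z(1) by (auto simp: ball_of_Suc nbr_def)
      then have "e \<subseteq> ball_of (insert e F) r {x}"
        using ball_of_radius_mono[of "Suc i" r "insert e F" "{x}"] ir by auto
      ultimately show ?thesis using FW by auto
    qed
    have "card ({x} \<union> \<Union>F) + card (e - {z}) \<le> card ({x} \<union> \<Union>(insert e F))"
    proof -
      have "card ({x} \<union> \<Union>F) + card (e - {z}) = card (({x} \<union> \<Union>F) \<union> (e - {z}))"
        using finUF card_e only by (intro card_Un_disjoint[symmetric]) auto
      also have "\<dots> \<le> card ({x} \<union> \<Union>(insert e F))" using finUF card_e by (intro card_mono) auto
      finally show ?thesis .
    qed
    moreover have "card (e - {z}) = d - 1" using card_e z by simp
    moreover have "card (insert e F) = Suc (card F)" using finF e(1) by simp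
    ultimately have "good (insert e F)" unfolding good_def using ins F FT e(1) unfolding good_def by auto
    then show False using max[of "insert e F"] finF e(1) by simp
  qed
  moreover have "{x} \<union> \<Union>T \<subseteq> ?W" using subset_ball_of[of "{x}" E r] unfolding T_def by auto
  moreover have "finite ?W"
  proof -
    have "ball_of E r {x} \<subseteq> {x} \<union> \<Union>E" by (induction r) (auto simp: ball_of_Suc nbr_def)
    then show ?thesis using E(2) finE by (auto intro: finite_subset)
  qed
  ultimately show ?thesis using F card_mono[of ?W "{x} \<union> \<Union>T"] unfolding good_def T_def by fastforce
qed

section \<open>Neighbourhoods of short cycles\<close>

text \<open>All edges touching the ball are taken, so the neighbourhood reaches one step beyond
  radius \<open>R\<close>. Its occurrence then prescribes the state of a fixed set of possible
  edges.\<close>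

definition near :: "nat \<Rightarrow> nat \<Rightarrow> nat \<Rightarrow> 'a set set \<Rightarrow> 'a set set" where
  "near d L R g = {e \<in> g. e \<inter> ball_of g R (core d L g) \<noteq> {}}"

lemma near_subset: "near d L R g \<subseteq> g" unfolding near_def by auto

lemma ball_of_local_lt:
  assumes "H \<subseteq> g" "\<And>e i. e \<in> g \<Longrightarrow> i < R \<Longrightarrow> e \<inter> ball_of H i A \<noteq> {} \<Longrightarrow> e \<in> H" "j \<le> R"
  shows "ball_of g j A = ball_of H j A"
  using assms(3)
proof (induction j)
  case (Suc j)
  then have "j < R" by simp
  then have "{e \<in> g. e \<inter> ball_of H j A \<noteq> {}} = {e \<in> H. e \<inter> ball_of H j A \<noteq> {}}"
    using assms(1,2) by blast
  then show ?case using Suc by (simp add: ball_of_Suc nbr_def)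
qed simp

lemma ball_of_local:
  assumes "H \<subseteq> g" "\<And>e. e \<in> g \<Longrightarrow> e \<inter> ball_of H R A \<noteq> {} \<Longrightarrow> e \<in> H" "j \<le> R"
  shows "ball_of g j A = ball_of H j A"
proof (rule ball_of_local_lt[OF assms(1) _ assms(3)])
  fix e i assume "e \<in> g" "i < R" "e \<inter> ball_of H i A \<noteq> {}"
  then show "e \<in> H" using assms(2)[of e] ball_of_radius_mono[of i R H A] by auto
qed

lemma cycle_in_near:
  assumes d: "3 \<le> d" and "C \<subseteq> g" "is_cycle d k C" "k \<le> L" shows "C \<subseteq> near d L R g"
proof
  fix e assume e: "e \<in> C"
  have "e \<noteq> {}" using cycle_edge_card[OF d assms(3) e] d by auto
  moreover have "e \<subseteq> core d L g" using assms e unfolding core_def by blast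
  ultimately show "e \<in> near d L R g"
    using assms(2) e subset_ball_of[of "core d L g" g R] unfolding near_def by blast
qed

lemma core_near: assumes d: "3 \<le> d" shows "core d L (near d L R g) = core d L g"
proof
  show "core d L (near d L R g) \<subseteq> core d L g" by (rule core_mono[OF near_subset])
  show "core d L g \<subseteq> core d L (near d L R g)"
  proof
    fix x assume "x \<in> core d L g"
    then obtain C k where C: "C \<subseteq> g" "is_cycle d k C" "k \<le> L" "x \<in> \<Union>C" unfolding core_def by auto
    have "\<Union>C \<subseteq> core d L (near d L R g)"
      by (rule core_intro[OF cycle_in_near[OF d C(1,2,3)] C(2,3)])
    then show "x \<in> core d L (near d L R g)" using C(4) by blast
  qed
qed

lemma ball_near:
  assumes d: "3 \<le> d" and "j \<le> R"
  shows "ball_of (near d L R g) j (core d L g) = ball_of g j (core d L g)"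
proof (rule ball_of_local[OF near_subset _ assms(2), symmetric])
  fix e assume "e \<in> g" "e \<inter> ball_of (near d L R g) R (core d L g) \<noteq> {}"
  then show "e \<in> near d L R g" 
    using ball_of_mono[OF near_subset[of d L R g] order_refl, of R "core d L g"] unfolding near_def by blast
qed

text \<open>The possible neighbourhoods are therefore exactly the fixed points of
  \<open>near\<close>, a condition on \<open>H\<close> alone.\<close>

lemma near_near: "3 \<le> d \<Longrightarrow> near d L R (near d L R g) = near d L R g"
  unfolding near_def[of d L R "near d L R g"] by (simp add: core_near ball_near) (auto simp: near_def)

text \<open>This separates the event into two parts: the edges meeting the ball of \<open>H\<close>
  are prescribed exactly, and the edges elsewhere must not enlarge the core.\<close>

lemma near_eq_iff:
  assumes d: "3 \<le> d" and H: "near d L R H = H" "H \<subseteq> g"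
  shows "near d L R g = H \<longleftrightarrow>
    {e \<in> g. e \<inter> ball_of H R (core d L H) \<noteq> {}} = H \<and> core d L g = core d L H"
proof
  assume eq: "near d L R g = H"
  then have c: "core d L g = core d L H" using core_near[OF d, of L R g] by simp
  have "ball_of H R (core d L H) = ball_of g R (core d L g)"
    using ball_near[OF d, of R R L g] eq c by simp
  then show "{e \<in> g. e \<inter> ball_of H R (core d L H) \<noteq> {}} = H \<and> core d L g = core d L H"
    using eq c unfolding near_def by simp
next
  assume a: "{e \<in> g. e \<inter> ball_of H R (core d L H) \<noteq> {}} = H \<and> core d L g = core d L H"
  have "ball_of g R (core d L H) = ball_of H R (core d L H)"
    by (rule ball_of_local[OF H(2) _ order_refl]) (use a in blast)
  then show "near d L R g = H" using a unfolding near_def by simp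
qed

text \<open>One vertex of \<open>e\<close> is old, so at most \<open>d - 1\<close> are new and the
  ratio persists.\<close>

lemma dense_extend:
  assumes "finite S" "finite (\<Union>S)" "card (\<Union>S) \<le> (d - 1) * card S" "card e = d" "2 \<le> d" "e \<inter> \<Union>S \<noteq> {}"
    "e \<notin> S"
  shows "card (\<Union>(insert e S)) \<le> (d - 1) * card (insert e S)"
proof -
  have fe: "finite e" using assms(4,5) edge_finite[of e d] by auto
  obtain z where z: "z \<in> e" "z \<in> \<Union>S" using assms(6) by auto
  have "\<Union>(insert e S) = \<Union>S \<union> (e - {z})" using z by auto
  then have "card (\<Union>(insert e S)) \<le> card (\<Union>S) + card (e - {z})" by (simp add: card_Un_le)
  also have "\<dots> \<le> (d - 1) * card S + (d - 1)" using assms z fe by simp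
  also have "\<dots> = (d - 1) * card (insert e S)" using assms(1,7) by simp
  finally show ?thesis .
qed

text \<open>The witness is a cycle together with a path to \<open>x\<close>. The expected number of
  edge sets with this vertex ratio is bounded, which later yields tightness.\<close>

lemma near_dense_cover_ball:
  assumes d: "3 \<le> d" and g: "\<And>e. e \<in> g \<Longrightarrow> card e = d" and x: "x \<in> ball_of g i (core d L g)"
  shows "\<exists>S\<subseteq>g. S \<noteq> {} \<and> finite S \<and> finite (\<Union>S) \<and> card S \<le> L + i \<and> card (\<Union>S) \<le> (d - 1) * card S \<and> x \<in> \<Union>S"
  using x
proof (induction i arbitrary: x)
  case 0
  then obtain C k where "C \<subseteq> g" "is_cycle d k C" "k \<le> L" "x \<in> \<Union>C" unfolding core_def by auto
  then show ?case using cycle_card[OF d, of k C] cycle_Union_card[OF d, of k C] cycle_finite[of d k C]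
    by (intro exI[of _ C]) auto
next
  case (Suc i)
  consider "x \<in> ball_of g i (core d L g)" | e z where "e \<in> g" "x \<in> e" "z \<in> e" "z \<in> ball_of g i (core d L g)"
    using Suc.prems by (auto simp: ball_of_Suc nbr_def)
  then show ?case
  proof cases
    case 1 then show ?thesis using Suc.IH by fastforce
  next
    case 2
    then obtain S where S: "S \<subseteq> g" "S \<noteq> {}" "finite S" "finite (\<Union>S)" "card S \<le> L + i"
      "card (\<Union>S) \<le> (d - 1) * card S" "z \<in> \<Union>S" using Suc.IH[of z] by blast
    have fe: "finite e" using g[OF 2(1)] d edge_finite[of e d] by auto
    show ?thesis
    proof (cases "e \<in> S")
      case True then show ?thesis using S 2 by (intro exI[of _ S]) auto
    next
      case False
      have "card (\<Union>(insert e S)) \<le> (d - 1) * card (insert e S)"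
        by (rule dense_extend[OF S(3,4,6) g[OF 2(1)]]) (use d False 2 S in auto)
      then show ?thesis using S 2 False fe by (intro exI[of _ "insert e S"]) auto
    qed
  qed
qed

lemma near_dense_cover:
  assumes d: "3 \<le> d" and g: "\<And>e. e \<in> g \<Longrightarrow> card e = d" and e: "e \<in> near d L R g"
  shows "\<exists>S\<subseteq>g. S \<noteq> {} \<and> card S \<le> L + R + 1 \<and> card (\<Union>S) \<le> (d - 1) * card S \<and> e \<in> S"
proof -
  obtain z where z: "e \<in> g" "z \<in> e" "z \<in> ball_of g R (core d L g)" using e unfolding near_def by auto
  then obtain S where S: "S \<subseteq> g" "S \<noteq> {}" "finite S" "finite (\<Union>S)" "card S \<le> L + R"
    "card (\<Union>S) \<le> (d - 1) * card S" "z \<in> \<Union>S" using near_dense_cover_ball[OF d g z(3)] by blast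
  show ?thesis
  proof (cases "e \<in> S")
    case True then show ?thesis using S by (intro exI[of _ S]) auto
  next
    case False
    have "card (\<Union>(insert e S)) \<le> (d - 1) * card (insert e S)"
      by (rule dense_extend[OF S(3,4,6) g[OF z(1)]]) (use d False z S in auto)
    then show ?thesis using S z False by (intro exI[of _ "insert e S"]) auto
  qed
qed

text \<open>A largest edge set with at most \<open>d - 1\<close> vertices per edge absorbs every
  cycle, by strict balance, and every edge attached to it, by \<open>dense_extend\<close>; so it is
  all of \<open>H\<close>. The bound says that no neighbourhood has a diverging expected number of
  copies.\<close>

lemma near_vertex_bound:
  assumes d: "3 \<le> d" and H: "near d L R H = H" "finite H" "\<And>e. e \<in> H \<Longrightarrow> card e = d"
  shows "card (\<Union>H) \<le> (d - 1) * card H"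
proof -
  have fe: "finite e" if "e \<in> H" for e using H(3)[OF that] d edge_finite[of e d] by auto
  define good where "good S \<longleftrightarrow> S \<subseteq> H \<and> card (\<Union>S) \<le> (d - 1) * card S" for S
  have "good {}" unfolding good_def by auto
  moreover have "\<forall>F. good F \<longrightarrow> card F \<le> card H" using H(2) card_mono unfolding good_def by blast
  ultimately have "\<exists>F. good F \<and> (\<forall>F'. good F' \<longrightarrow> card F' \<le> card F)" 
    by (intro ex_has_greatest_nat[where b = "Suc (card H)"]) (auto simp: less_Suc_eq_le)
  then obtain S where S: "good S" and max: "\<And>S'. good S' \<Longrightarrow> card S' \<le> card S" by metis
  have SH: "S \<subseteq> H" and cS: "card (\<Union>S) \<le> (d - 1) * card S" using S unfolding good_def by auto
  have finS: "finite S" "finite (\<Union>S)" using SH H(2) fe finite_subset by blast+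
  have cyc: "C \<subseteq> S" if C: "C \<subseteq> H" "is_cycle d k C" for C k
  proof (rule ccontr)
    assume nC: "\<not> C \<subseteq> S"
    have "card (\<Union>(C - S) - \<Union>S) \<le> (d - 1) * card (C - S)"
    proof (cases "C \<inter> S = {}")
      case True
      have "card (\<Union>(C - S) - \<Union>S) \<le> card (\<Union>C)"
        using cycle_finite[OF C(2)] by (intro card_mono) auto
      also have "\<dots> = (d - 1) * card (C - S)"
        using True cycle_card[OF d C(2)] cycle_Union_card[OF d C(2)] by (simp add: Diff_triv)
      finally show ?thesis .
    next
      case False
      have "finite (\<Union>(C \<inter> S))" by (rule finite_subset[OF _ finS(2)]) auto
      have "(d - 1) * card (C \<inter> S) < card (\<Union>(C \<inter> S))"
        by (rule cycle_proper_subset[OF d C(2)]) (use nC False in auto)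
      moreover have "card (\<Union>(C - S) - \<Union>S) \<le> card (\<Union>C - \<Union>(C \<inter> S))"
        using cycle_finite[OF C(2)] by (intro card_mono) auto
      moreover have "card (\<Union>C - \<Union>(C \<inter> S)) = card (\<Union>C) - card (\<Union>(C \<inter> S))"
        by (rule card_Diff_subset) (use \<open>finite (\<Union>(C \<inter> S))\<close> in auto)
      moreover have "card (\<Union>C) = (d - 1) * card C"
        using cycle_card[OF d C(2)] cycle_Union_card[OF d C(2)] by simp
      moreover have "card C = card (C \<inter> S) + card (C - S)"
        using card_Un_disjoint[of "C \<inter> S" "C - S"] cycle_finite[OF C(2)] by (simp add: Int_Diff_Un Diff_Int_distrib Int_Diff)
      ultimately have "(d - 1) * card (C \<inter> S) < card (\<Union>(C \<inter> S))"
        "card (\<Union>(C - S) - \<Union>S) \<le> card (\<Union>C) - card (\<Union>(C \<inter> S))"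
        "card (\<Union>C) = (d - 1) * card (C \<inter> S) + (d - 1) * card (C - S)"
        by (simp_all only: distrib_left)
      then show ?thesis by linarith
    qed
    moreover have "card (\<Union>(S \<union> C)) \<le> card (\<Union>S) + card (\<Union>(C - S) - \<Union>S)"
    proof -
      have "\<Union>(S \<union> C) = \<Union>S \<union> (\<Union>(C - S) - \<Union>S)" by auto
      then show ?thesis by (metis card_Un_le)
    qed
    moreover have "card (S \<union> C) = card S + card (C - S)"
      using card_Un_disjoint[of S "C - S"] finS cycle_finite[OF C(2)] by auto
    ultimately have "good (S \<union> C)" unfolding good_def using SH C cS by (simp add: algebra_simps)
    moreover have "card S < card (S \<union> C)"
      using nC finS cycle_finite[OF C(2)] by (intro psubset_card_mono) auto
    ultimately show False using max by fastforce
  qed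
  have closed: "e \<in> S" if "e \<in> H" "e \<inter> \<Union>S \<noteq> {}" for e
  proof (rule ccontr)
    assume n: "e \<notin> S"
    have "card (\<Union>(insert e S)) \<le> (d - 1) * card (insert e S)"
      by (rule dense_extend[OF finS cS H(3)[OF that(1)]]) (use d n that in auto)
    then have "good (insert e S)" using SH that unfolding good_def by auto
    then show False using max[of "insert e S"] finS n by simp
  qed
  have "core d L H \<subseteq> \<Union>S"
  proof
    fix x assume "x \<in> core d L H"
    then obtain C k where "C \<subseteq> H" "is_cycle d k C" "x \<in> \<Union>C" unfolding core_def by auto
    then show "x \<in> \<Union>S" using cyc[of C k] by blast
  qed
  then have sub: "ball_of H R (core d L H) \<subseteq> \<Union>S"
    using closed by (intro ball_of_closed) auto
  have "H \<subseteq> S"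
  proof
    fix e assume e: "e \<in> H"
    then have "e \<in> near d L R H" using H(1) by simp
    then have "e \<inter> \<Union>S \<noteq> {}" using sub unfolding near_def by blast
    then show "e \<in> S" by (rule closed[OF e])
  qed
  then show ?thesis using cS SH by auto
qed

section \<open>Isomorphism invariance\<close>

lemma cyc_edges_map:
  assumes "bs \<noteq> []" "\<And>b. b \<in> set bs \<Longrightarrow> b \<noteq> []"
  shows "cyc_edges (map (map h) bs) = (`) h ` cyc_edges bs"
proof -
  have "cyc_edge (map (map h) bs) i = h ` cyc_edge bs i" if "i < length bs" for i
  proof -
    have "Suc i mod length bs < length bs" using assms(1) by simp
    then show ?thesis using that assms(2) by (simp add: cyc_edge_def hd_map)
  qed
  then show ?thesis unfolding cyc_edges_def by (auto simp: image_image intro!: image_cong)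
qed

lemma cycle_image:
  assumes d: "3 \<le> d" and C: "is_cycle d k C" and h: "inj_on h (\<Union>C)"
  shows "is_cycle d k ((`) h ` C)"
proof -
  obtain bs where bs: "cyc_blocks d k bs" "C = cyc_edges bs" and k: "2 \<le> k" using C unfolding is_cycle_def by blast
  have ne: "bs \<noteq> []" "\<And>b. b \<in> set bs \<Longrightarrow> b \<noteq> []" using bs(1) k d unfolding cyc_blocks_def by fastforce+
  have "distinct (map h (concat bs))"
    using bs h cyc_Union[OF d k bs(1)] unfolding cyc_blocks_def by (simp add: distinct_map)
  then have "cyc_blocks d k (map (map h) bs)" using bs(1) unfolding cyc_blocks_def by (simp add: map_concat)
  then show ?thesis using cyc_edges_map[OF ne] bs(2) k unfolding is_cycle_def by metis
qed

lemma core_image_subset: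
  assumes d: "3 \<le> d" and h: "inj_on h (\<Union>H)"
  shows "h ` core d L H \<subseteq> core d L ((`) h ` H)"
proof
  fix y assume "y \<in> h ` core d L H"
  then obtain C k x where C: "C \<subseteq> H" "is_cycle d k C" "k \<le> L" "x \<in> \<Union>C" "y = h x" unfolding core_def by auto
  have "inj_on h (\<Union>C)" using h C(1) by (meson Union_mono inj_on_subset)
  then have "is_cycle d k ((`) h ` C)" by (rule cycle_image[OF d C(2)])
  moreover have "(`) h ` C \<subseteq> (`) h ` H" using C(1) by auto
  moreover have "y \<in> \<Union>((`) h ` C)" using C(4,5) by auto
  ultimately show "y \<in> core d L ((`) h ` H)" unfolding core_def using C(3) by blast
qed

lemma image_image_inv:
  assumes "inj_on h (\<Union>H)" shows "(`) (the_inv_into (\<Union>H) h) ` ((`) h ` H) = H"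
proof -
  have "the_inv_into (\<Union>H) h ` h ` e = e" if "e \<in> H" for e
    using the_inv_into_f_f[OF assms] that by (force simp: image_image)
  then show ?thesis by (simp add: image_image)
qed

text \<open>One inclusion is \<open>core_image_subset\<close> for \<open>h\<close>, the other is the
  same lemma for the inverse of \<open>h\<close>.\<close>

lemma core_image:
  assumes d: "3 \<le> d" and h: "inj_on h (\<Union>H)"
  shows "core d L ((`) h ` H) = h ` core d L H"
proof
  let ?i = "the_inv_into (\<Union>H) h"
  have U: "\<Union>((`) h ` H) = h ` \<Union>H" by auto
  have inj: "inj_on ?i (\<Union>((`) h ` H))" unfolding U by (rule inj_on_the_inv_into[OF h])
  have "?i ` core d L ((`) h ` H) \<subseteq> core d L H"
    using core_image_subset[OF d inj, of L] image_image_inv[OF h] by simp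
  then have "h ` ?i ` core d L ((`) h ` H) \<subseteq> h ` core d L H" by (rule image_mono)
  moreover have "h (?i y) = y" if "y \<in> core d L ((`) h ` H)" for y
    using core_subset[of d L "(`) h ` H"] that f_the_inv_into_f[OF h, of y] U by blast
  ultimately show "core d L ((`) h ` H) \<subseteq> h ` core d L H" by (force simp: image_image)
qed (rule core_image_subset[OF d h])

lemma ball_of_image:
  assumes h: "inj_on h W" and H: "\<Union>H \<subseteq> W" and A: "A \<subseteq> W"
  shows "ball_of ((`) h ` H) j (h ` A) = h ` ball_of H j A"
proof (induction j)
  case (Suc j)
  have sub: "ball_of H j A \<subseteq> W" by (rule ball_of_subset[OF A]) (use H in auto)
  have "h ` e \<inter> h ` ball_of H j A \<noteq> {} \<longleftrightarrow> e \<inter> ball_of H j A \<noteq> {}" if "e \<in> H" for e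
    using inj_on_image_Int[OF h, of e "ball_of H j A"] sub H that by (metis Sup_upper image_is_empty subset_trans)
  then have "{e \<in> (`) h ` H. e \<inter> h ` ball_of H j A \<noteq> {}} = (`) h ` {e \<in> H. e \<inter> ball_of H j A \<noteq> {}}"
    by auto
  then show ?case unfolding ball_of_Suc Suc nbr_def by (simp only: image_Un image_Union)
qed simp

lemma near_image:
  assumes d: "3 \<le> d" and h: "inj_on h (\<Union>H)"
  shows "near d L R ((`) h ` H) = (`) h ` near d L R H"
proof -
  have sub: "ball_of H R (core d L H) \<subseteq> \<Union>H" by (rule ball_of_subset[OF core_subset]) auto
  have "h ` e \<inter> h ` ball_of H R (core d L H) \<noteq> {} \<longleftrightarrow> e \<inter> ball_of H R (core d L H) \<noteq> {}" if "e \<in> H" for e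
    using inj_on_image_Int[OF h, of e "ball_of H R (core d L H)"] sub that by (metis Sup_upper image_is_empty)
  then show ?thesis unfolding near_def core_image[OF d h] ball_of_image[OF h order_refl core_subset] by auto
qed

section \<open>Counting cycles\<close>

definition cyc_hd :: "'a list list \<Rightarrow> nat \<Rightarrow> 'a" where "cyc_hd bs i = hd (bs ! i)"

context
  fixes d k :: nat and bs :: "'a list list"
  assumes d: "3 \<le> d" and k: "2 \<le> k" and bs: "cyc_blocks d k bs"
begin

lemma cyc_hd_inj: "i < k \<Longrightarrow> j < k \<Longrightarrow> cyc_hd bs i = cyc_hd bs j \<Longrightarrow> i = j"
  using cyc_block_disjoint[OF d k bs, of i j] cyc_hd_in[OF d k bs] unfolding cyc_hd_def
  by (metis disjoint_iff)

lemma cyc_edge_hd: "cyc_edge bs i = insert (cyc_hd bs (Suc i mod k)) (set (bs ! i))"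
  by (simp add: cyc_edge_eq[OF d k bs] cyc_hd_def)

text \<open>Blocks are disjoint, so a vertex common to two edges must be a head by which one of them
  was closed up.\<close>

lemma cyc_joint:
  assumes ij: "i < k" "j < k" "i \<noteq> j" and v: "v \<in> cyc_edge bs i" "v \<in> cyc_edge bs j"
  shows "v = cyc_hd bs i \<or> v = cyc_hd bs (Suc i mod k)"
proof (cases "v = cyc_hd bs (Suc i mod k)")
  case False
  then have vi: "v \<in> set (bs ! i)" using v(1) unfolding cyc_edge_hd by auto
  then have vj: "v = cyc_hd bs (Suc j mod k)"
    using v(2) cyc_block_disjoint[OF d k bs ij] unfolding cyc_edge_hd by auto
  then have "v \<in> set (bs ! (Suc j mod k))"
    using cyc_hd_in[OF d k bs, of "Suc j mod k"] cyc_succ[OF d k bs ij(2)] unfolding cyc_hd_def by auto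
  then have "Suc j mod k = i"
    using vi cyc_block_disjoint[OF d k bs, of "Suc j mod k" i] cyc_succ[OF d k bs ij(2)] ij(1) by blast
  then show ?thesis using vj by simp
qed simp

lemma cyc_hd_in_edge:
  assumes ij: "i < k" "j < k" and v: "cyc_hd bs j \<in> cyc_edge bs i"
  shows "i = j \<or> Suc i mod k = j"
proof (cases "cyc_hd bs j \<in> set (bs ! i)")
  case True
  then show ?thesis using cyc_block_disjoint[OF d k bs, of i j] cyc_hd_in[OF d k bs, of j] ij
    unfolding cyc_hd_def by blast
next
  case False
  then have "cyc_hd bs j = cyc_hd bs (Suc i mod k)" using v unfolding cyc_edge_hd by simp
  then show ?thesis using cyc_hd_inj[of j "Suc i mod k"] cyc_succ[OF d k bs ij(1)] ij by simp
qed

lemma cyc_hd_mem: "i < k \<Longrightarrow> cyc_hd bs i \<in> cyc_edge bs i"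
  "cyc_hd bs (Suc i mod k) \<in> cyc_edge bs i"
  using cyc_hd_in[OF d k bs, of i] unfolding cyc_edge_hd by (auto simp: cyc_hd_def)

lemma cyc_tl: "i < k \<Longrightarrow> set (tl (bs ! i)) = cyc_edge bs i - {cyc_hd bs i, cyc_hd bs (Suc i mod k)}"
proof -
  assume i: "i < k"
  have "bs ! i \<noteq> []" using cyc_block_len[OF d k bs i] d by auto
  then have c: "bs ! i = cyc_hd bs i # tl (bs ! i)" by (simp add: cyc_hd_def)
  have "distinct (bs ! i)"
    using bs i cyc_len[OF d k bs] unfolding cyc_blocks_def distinct_concat_iff by auto
  then have "cyc_hd bs i \<notin> set (tl (bs ! i))" using c by (metis distinct.simps(2))
  moreover have "set (bs ! i) = insert (cyc_hd bs i) (set (tl (bs ! i)))" using c by (metis list.simps(15))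
  moreover have "cyc_hd bs (Suc i mod k) \<notin> set (bs ! i)"
    using cyc_hd_notin[OF d k bs i] by (simp add: cyc_hd_def)
  ultimately show ?thesis unfolding cyc_edge_hd by auto
qed

end

text \<open>A cycle can be traversed from its first joint and first edge: the next joint is the
  vertex that the current edge shares with a different edge and that was not the previous joint, and
  it fixes the next edge.\<close>

lemma cyc_determined:
  assumes d: "3 \<le> d" and k: "2 \<le> k" and bs: "cyc_blocks d k bs" and bs': "cyc_blocks d k bs'"
    and same: "cyc_edges bs = cyc_edges bs'"
    and flag: "cyc_hd bs 0 = cyc_hd bs' 0" "cyc_edge bs 0 = cyc_edge bs' 0"
  shows "i < k \<Longrightarrow> cyc_hd bs i = cyc_hd bs' i \<and> cyc_edge bs i = cyc_edge bs' i"
proof (induction i)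
  case 0 then show ?case using flag by simp
next
  case (Suc i)
  then have IH: "cyc_hd bs i = cyc_hd bs' i" "cyc_edge bs i = cyc_edge bs' i" and ik: "i < k" by auto
  have s: "Suc i mod k = Suc i" using Suc.prems by simp
  have "cyc_edge bs' (Suc i) \<in> cyc_edges bs"
    unfolding same using Suc.prems by (auto simp: cyc_edges_def cyc_len[OF d k bs'])
  then obtain j where j: "j < k" "cyc_edge bs' (Suc i) = cyc_edge bs j"
    by (auto simp: cyc_edges_def cyc_len[OF d k bs])
  have ji: "j \<noteq> i" using j(2) IH(2) inj_onD[OF cyc_edge_inj[OF d k bs'], of "Suc i" i] Suc.prems by auto
  have "cyc_hd bs' (Suc i) \<in> cyc_edge bs i" "cyc_hd bs' (Suc i) \<in> cyc_edge bs j"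
    using cyc_hd_mem(2)[OF d k bs', of i] cyc_hd_mem(1)[OF d k bs' Suc.prems] s IH(2) j(2) by auto
  then have "cyc_hd bs' (Suc i) = cyc_hd bs i \<or> cyc_hd bs' (Suc i) = cyc_hd bs (Suc i)"
    using cyc_joint[OF d k bs ik j(1) ji[symmetric]] s by simp
  moreover have "cyc_hd bs' (Suc i) \<noteq> cyc_hd bs i"
    using cyc_hd_inj[OF d k bs', of "Suc i" i] IH(1) Suc.prems by auto
  ultimately have hd: "cyc_hd bs' (Suc i) = cyc_hd bs (Suc i)" by simp
  then have "cyc_hd bs (Suc i) \<in> cyc_edge bs j"
    using \<open>cyc_hd bs' (Suc i) \<in> cyc_edge bs j\<close> by simp
  then have "j = Suc i \<or> Suc j mod k = Suc i" using cyc_hd_in_edge[OF d k bs j(1) Suc.prems] by simp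
  moreover have "Suc j mod k \<noteq> Suc i" using ji j(1) by (auto simp: mod_Suc)
  ultimately show ?case using hd j(2) by simp
qed

lemma card_lists_nth: "(\<And>i. i < k \<Longrightarrow> finite (X i)) \<Longrightarrow>
  finite {bs. length bs = k \<and> (\<forall>i<k. bs ! i \<in> X i)} \<and>
  card {bs. length bs = k \<and> (\<forall>i<k. bs ! i \<in> X i)} = (\<Prod>i<k. card (X i))"
proof (induction k)
  case 0
  have "{bs :: 'a list. length bs = 0 \<and> (\<forall>i<0. bs ! i \<in> X i)} = {[]}" by auto
  then show ?case by simp
next
  case (Suc k)
  let ?A = "{bs. length bs = k \<and> (\<forall>i<k. bs ! i \<in> X i)}"
  have eq: "{bs. length bs = Suc k \<and> (\<forall>i<Suc k. bs ! i \<in> X i)} = (\<lambda>(bs, x). bs @ [x]) ` (?A \<times> X k)"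
  proof (intro equalityI subsetI)
    fix bs assume b: "bs \<in> {bs. length bs = Suc k \<and> (\<forall>i<Suc k. bs ! i \<in> X i)}"
    then have "bs = butlast bs @ [bs ! k]"
      by (metis (mono_tags, lifting) append_butlast_last_id diff_Suc_1 last_conv_nth length_0_conv mem_Collect_eq nat.distinct(1))
    moreover have "butlast bs \<in> ?A" "bs ! k \<in> X k" using b by (auto simp: nth_butlast)
    ultimately show "bs \<in> (\<lambda>(bs, x). bs @ [x]) ` (?A \<times> X k)" by (metis (mono_tags, lifting) SigmaI case_prod_conv image_eqI)
  qed (auto simp: nth_append less_Suc_eq)
  have inj: "inj_on (\<lambda>(bs, x). bs @ [x]) (?A \<times> X k)" by (auto simp: inj_on_def)
  show ?case unfolding eq using Suc by (auto simp: card_image[OF inj] card_cartesian_product)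
qed

text \<open>Once the joints and edges are fixed, only the order of the \<open>d - 2\<close> inner
  vertices within each block is free.\<close>

lemma card_cyc_flag_fiber:
  assumes d: "3 \<le> d" and k: "2 \<le> k" and bs: "cyc_blocks d k bs"
  shows "finite {bs'. cyc_blocks d k bs' \<and> cyc_edges bs' = cyc_edges bs \<and>
     (cyc_hd bs' 0, cyc_edge bs' 0) = (cyc_hd bs 0, cyc_edge bs 0)} \<and>
    card {bs'. cyc_blocks d k bs' \<and> cyc_edges bs' = cyc_edges bs \<and>
     (cyc_hd bs' 0, cyc_edge bs' 0) = (cyc_hd bs 0, cyc_edge bs 0)} = fact (d - 2) ^ k"
proof -
  define X where "X i = (#) (cyc_hd bs i) ` permutations_of_set (set (tl (bs ! i)))" for i
  let ?W = "{bs'. cyc_blocks d k bs' \<and> cyc_edges bs' = cyc_edges bs \<and>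
     (cyc_hd bs' 0, cyc_edge bs' 0) = (cyc_hd bs 0, cyc_edge bs 0)}"
  have split: "bs' ! i = cyc_hd bs' i # tl (bs' ! i)" "distinct (tl (bs' ! i))"
    if "cyc_blocks d k bs'" "i < k" for bs' i
  proof -
    have "bs' ! i \<noteq> []" using cyc_block_len[OF d k that] d by auto
    then show "bs' ! i = cyc_hd bs' i # tl (bs' ! i)" by (simp add: cyc_hd_def)
    have "distinct (bs' ! i)"
      using that cyc_len[OF d k that(1)] unfolding cyc_blocks_def distinct_concat_iff by auto
    then show "distinct (tl (bs' ! i))" by (rule distinct_tl)
  qed
  have "?W = {bs'. length bs' = k \<and> (\<forall>i<k. bs' ! i \<in> X i)}"
  proof (intro equalityI subsetI)
    fix bs' assume "bs' \<in> ?W"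
    then have b: "cyc_blocks d k bs'" "cyc_edges bs' = cyc_edges bs"
      "cyc_hd bs' 0 = cyc_hd bs 0" "cyc_edge bs' 0 = cyc_edge bs 0" by auto
    note det = cyc_determined[OF d k b(1) bs b(2) b(3) b(4)]
    have "bs' ! i \<in> X i" if "i < k" for i
    proof -
      have "Suc i mod k < k" using k by simp
      then have "set (tl (bs' ! i)) = set (tl (bs ! i))"
        using cyc_tl[OF d k b(1) that] cyc_tl[OF d k bs that] det[OF that] det[of "Suc i mod k"] by simp
      then show ?thesis using split[OF b(1) that] det[OF that]
        unfolding X_def permutations_of_set_def by (metis (mono_tags, lifting) image_eqI mem_Collect_eq)
    qed
    then show "bs' \<in> {bs'. length bs' = k \<and> (\<forall>i<k. bs' ! i \<in> X i)}" using cyc_len[OF d k b(1)] by simp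
  next
    fix bs' assume "bs' \<in> {bs'. length bs' = k \<and> (\<forall>i<k. bs' ! i \<in> X i)}"
    then have len: "length bs' = k" and b: "\<And>i. i < k \<Longrightarrow> bs' ! i \<in> X i" by auto
    have i: "cyc_hd bs' i = cyc_hd bs i \<and> set (bs' ! i) = set (bs ! i) \<and> length (bs' ! i) = length (bs ! i)"
      if i: "i < k" for i
    proof -
      obtain l where l: "bs' ! i = cyc_hd bs i # l" "set l = set (tl (bs ! i))" "distinct l"
        using b[OF i] unfolding X_def permutations_of_set_def by auto
      have "length l = length (tl (bs ! i))" using l split(2)[OF bs i] by (metis distinct_card)
      then show ?thesis using l split(1)[OF bs i] by (metis cyc_hd_def length_Cons list.sel(1) list.simps(15))
    qed
    have lens: "\<forall>b\<in>set bs'. length b = d - 1"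
      using i cyc_block_len[OF d k bs] len by (metis in_set_conv_nth)
    have "map length bs' = replicate k (d - 1)" using lens len by (intro replicate_eqI) auto
    then have lc: "length (concat bs') = (d - 1) * k" by (simp add: length_concat sum_list_replicate)
    have "set (concat bs') = (\<Union>i<k. set (bs' ! i))" using len by (auto simp: set_conv_nth[of bs'])
    also have "\<dots> = (\<Union>i<k. set (bs ! i))" using i by simp
    also have "\<dots> = set (concat bs)" by (rule cyc_Union_blocks[OF d k bs])
    finally have "card (set (concat bs')) = length (concat bs')"
      using lc cyc_Union_card[OF d k bs] cyc_Union[OF d k bs] by simp
    then have "distinct (concat bs')" by (rule card_distinct)
    then have cb: "cyc_blocks d k bs'" unfolding cyc_blocks_def using len lens by simp
    have ce: "cyc_edge bs' i = cyc_edge bs i" if "i < k" for i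
      unfolding cyc_edge_hd[OF d k cb] cyc_edge_hd[OF d k bs] using i[OF that] i[of "Suc i mod k"] k by simp
    have "cyc_edges bs' = cyc_edges bs"
      unfolding cyc_edges_def len cyc_len[OF d k bs] using ce by (intro image_cong) auto
    then show "bs' \<in> ?W" using cb i[of 0] ce[of 0] k by simp
  qed
  moreover have "finite (X i)" "card (X i) = fact (d - 2)" if "i < k" for i
  proof -
    have "card (set (tl (bs ! i))) = d - 2"
      using distinct_card[OF split(2)[OF bs that]] cyc_block_len[OF d k bs that] by simp
    then show "finite (X i)" "card (X i) = fact (d - 2)" unfolding X_def
      by (auto simp: card_image inj_on_def)
  qed
  ultimately show ?thesis using card_lists_nth[of k X] by (simp add: prod_constant)
qed

lemma cyc_rotate:
  assumes d: "3 \<le> d" and k: "2 \<le> k" and bs: "cyc_blocks d k bs"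
  shows "cyc_blocks d k (rotate i bs)" "cyc_edges (rotate i bs) = cyc_edges bs"
    and "cyc_hd (rotate i bs) 0 = cyc_hd bs (i mod k)" "cyc_edge (rotate i bs) 0 = cyc_edge bs (i mod k)"
proof -
  have len: "length bs = k" by (rule cyc_len[OF d k bs])
  have lc: "length (concat (rotate i bs)) = length (concat bs)"
  proof -
    have "map length (rotate i bs) = replicate k (d - 1)"
      using bs unfolding cyc_blocks_def by (intro replicate_eqI) auto
    then show ?thesis using cyc_length_concat[OF d k bs] by (simp add: length_concat sum_list_replicate)
  qed
  have "distinct (concat (rotate i bs))"
  proof (rule card_distinct)
    have "set (concat (rotate i bs)) = set (concat bs)" by simp
    then show "card (set (concat (rotate i bs))) = length (concat (rotate i bs))"
      using bs distinct_card unfolding lc cyc_blocks_def by metis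
  qed
  then show "cyc_blocks d k (rotate i bs)" using bs unfolding cyc_blocks_def by simp
  have nth: "rotate i bs ! j = bs ! ((i + j) mod k)" if "j < k" for j using nth_rotate[of j bs i] that len by simp
  have e: "cyc_edge (rotate i bs) j = cyc_edge bs ((i + j) mod k)" if "j < k" for j
  proof -
    have "Suc j mod k < k" using k by simp
    moreover have "(i + Suc j mod k) mod k = Suc ((i + j) mod k) mod k" by (simp add: mod_simps)
    ultimately show ?thesis unfolding cyc_edge_def using nth[OF that] nth[of "Suc j mod k"] len by simp
  qed
  show "cyc_hd (rotate i bs) 0 = cyc_hd bs (i mod k)" unfolding cyc_hd_def using nth[of 0] k by simp
  show "cyc_edge (rotate i bs) 0 = cyc_edge bs (i mod k)" using e[of 0] k by simp
  have "(\<lambda>j. (i + j) mod k) ` {..<k} = {..<k}"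
  proof (intro equalityI subsetI)
    fix m assume m: "m \<in> {..<k}"
    have ik: "i mod k < k" using k by simp
    have "(i + (m + (k - i mod k)) mod k) mod k = (i mod k + (m + (k - i mod k))) mod k"
      by (simp add: mod_simps)
    also have "i mod k + (m + (k - i mod k)) = m + k" using ik by simp
    finally have "(i + (m + (k - i mod k)) mod k) mod k = m" using m by simp
    moreover have "(m + (k - i mod k)) mod k \<in> {..<k}" using k by simp
    ultimately show "m \<in> (\<lambda>j. (i + j) mod k) ` {..<k}" by (metis image_eqI)
  qed (use k in auto)
  then have "cyc_edge bs ` {..<k} = cyc_edge bs ` ((\<lambda>j. (i + j) mod k) ` {..<k})" by simp
  also have "\<dots> = cyc_edge (rotate i bs) ` {..<k}" unfolding image_image using e by (intro image_cong) auto
  finally show "cyc_edges (rotate i bs) = cyc_edges bs" unfolding cyc_edges_def len by (simp add: len)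
qed

text \<open>The cycle traversed backwards. Block \<open>j\<close> opens with the far joint of edge
  \<open>k - 1 - j\<close>, where k is the length, followed by the inner vertices of that edge; the
  \<open>mod\<close> turns joint k into joint 0.\<close>

definition cyc_refl :: "'a list list \<Rightarrow> 'a list list" where
  "cyc_refl bs = map (\<lambda>j. cyc_hd bs ((length bs - j) mod length bs) # tl (bs ! (length bs - 1 - j))) [0..<length bs]"

lemma cyc_refl:
  assumes d: "3 \<le> d" and k: "2 \<le> k" and bs: "cyc_blocks d k bs"
  shows "cyc_blocks d k (cyc_refl bs)" "cyc_edges (cyc_refl bs) = cyc_edges bs"
    and "j < k \<Longrightarrow> cyc_hd (cyc_refl bs) j = cyc_hd bs ((k - j) mod k)"
    and "j < k \<Longrightarrow> cyc_edge (cyc_refl bs) j = cyc_edge bs (k - 1 - j)"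
proof -
  have len: "length bs = k" by (rule cyc_len[OF d k bs])
  have rlen: "length (cyc_refl bs) = k" by (simp add: cyc_refl_def len)
  have nth: "cyc_refl bs ! j = cyc_hd bs ((k - j) mod k) # tl (bs ! (k - 1 - j))" if "j < k" for j
    using that by (simp add: cyc_refl_def len)
  show hd: "cyc_hd (cyc_refl bs) j = cyc_hd bs ((k - j) mod k)" if "j < k" for j
    using nth[OF that] by (simp add: cyc_hd_def)
  show e: "cyc_edge (cyc_refl bs) j = cyc_edge bs (k - 1 - j)" if j: "j < k" for j
  proof -
    have s: "Suc j mod k < k" using k by simp
    have h1: "(k - Suc j mod k) mod k = k - 1 - j" using j by (auto simp: mod_Suc)
    have h2: "Suc (k - 1 - j) mod k = (k - j) mod k" using j by (simp add: Suc_diff_Suc)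
    have i: "k - 1 - j < k" using j by simp
    have "cyc_edge (cyc_refl bs) j = insert (cyc_hd (cyc_refl bs) (Suc j mod k)) (set (cyc_refl bs ! j))"
      by (simp add: cyc_edge_def rlen cyc_hd_def)
    also have "\<dots> = insert (cyc_hd bs (k - 1 - j)) (insert (cyc_hd bs ((k - j) mod k)) (set (tl (bs ! (k - 1 - j)))))"
      using hd[OF s] h1 nth[OF j] by simp
    also have "\<dots> = cyc_edge bs (k - 1 - j)"
      using cyc_tl[OF d k bs i] cyc_hd_mem[OF d k bs, of "k - 1 - j"] i h2 by auto
    finally show ?thesis .
  qed
  have "(\<lambda>j. k - 1 - j) ` {..<k} = {..<k}"
    by (rule endo_inj_surj) (use k in \<open>auto simp: inj_on_def\<close>)
  then have "cyc_edge bs ` {..<k} = cyc_edge bs ` ((\<lambda>j. k - 1 - j) ` {..<k})" by simp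
  also have "\<dots> = cyc_edge (cyc_refl bs) ` {..<k}" unfolding image_image using e by (intro image_cong) auto
  finally show E: "cyc_edges (cyc_refl bs) = cyc_edges bs" unfolding cyc_edges_def len rlen by simp
  have lens: "\<forall>b\<in>set (cyc_refl bs). length b = d - 1"
  proof
    fix b assume "b \<in> set (cyc_refl bs)"
    then obtain j where "j < k" "b = cyc_refl bs ! j" using rlen by (metis in_set_conv_nth)
    then show "length b = d - 1" using nth[of j] cyc_block_len[OF d k bs, of "k - 1 - j"] d by simp
  qed
  have "map length (cyc_refl bs) = replicate k (d - 1)" using lens rlen by (intro replicate_eqI) auto
  then have lc: "length (concat (cyc_refl bs)) = (d - 1) * k" by (simp add: length_concat sum_list_replicate)
  have "\<Union>(cyc_edges (cyc_refl bs)) \<subseteq> set (concat (cyc_refl bs))"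
  proof
    fix x assume "x \<in> \<Union>(cyc_edges (cyc_refl bs))"
    then obtain j where j: "j < k" "x \<in> cyc_edge (cyc_refl bs) j" by (auto simp: cyc_edges_def rlen)
    have s: "Suc j mod k < k" using k by simp
    have "x \<in> set (cyc_refl bs ! j) \<or> x \<in> set (cyc_refl bs ! (Suc j mod k))"
      using j(2) nth[OF s] by (auto simp: cyc_edge_def rlen)
    then show "x \<in> set (concat (cyc_refl bs))" using j(1) s rlen by (metis UN_I nth_mem set_concat)
  qed
  then have "(d - 1) * k \<le> card (set (concat (cyc_refl bs)))"
    using E cyc_Union_card[OF d k bs] card_mono by (metis List.finite_set)
  then have "distinct (concat (cyc_refl bs))"
    using lc card_length[of "concat (cyc_refl bs)"] by (intro card_distinct) simp
  then show "cyc_blocks d k (cyc_refl bs)" unfolding cyc_blocks_def using rlen lens by simp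
qed

text \<open>A flag is an edge with one of its two joints, so there are \<open>2 * k\<close> of them.
  Rotations and the reflection reach every flag, and each flag leaves
  \<open>fact (d - 2) ^ k\<close> orderings. This symmetry factor becomes the denominator of
  \<open>cyc_rate\<close>.\<close>

lemma card_cyc_fiber:
  assumes d: "3 \<le> d" and k: "2 \<le> k" and bs: "cyc_blocks d k bs"
  shows "finite {bs'. cyc_blocks d k bs' \<and> cyc_edges bs' = cyc_edges bs} \<and>
    card {bs'. cyc_blocks d k bs' \<and> cyc_edges bs' = cyc_edges bs} = 2 * k * fact (d - 2) ^ k"
proof -
  let ?W = "{bs'. cyc_blocks d k bs' \<and> cyc_edges bs' = cyc_edges bs}"
  let ?flag = "\<lambda>bs'. (cyc_hd bs' 0, cyc_edge bs' 0)"
  define \<Phi> where "\<Phi> = (\<lambda>(i, b). (cyc_hd bs (if b then i else Suc i mod k), cyc_edge bs i)) ` ({..<k} \<times> (UNIV :: bool set))"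
  have sk: "Suc i mod k < k" for i using k by simp
  have sne: "Suc i mod k \<noteq> i" if "i < k" for i using cyc_succ[OF d k bs that] by simp
  have "inj_on (\<lambda>(i, b). (cyc_hd bs (if b then i else Suc i mod k), cyc_edge bs i)) ({..<k} \<times> (UNIV :: bool set))"
  proof (rule inj_onI)
    fix p q assume pq: "p \<in> {..<k} \<times> (UNIV :: bool set)" "q \<in> {..<k} \<times> (UNIV :: bool set)"
      "(\<lambda>(i, b). (cyc_hd bs (if b then i else Suc i mod k), cyc_edge bs i)) p =
       (\<lambda>(i, b). (cyc_hd bs (if b then i else Suc i mod k), cyc_edge bs i)) q"
    obtain i b j c where p: "p = (i, b)" "q = (j, c)" by (cases p, cases q)
    have a: "i \<in> {..<k}" "j \<in> {..<k}" "cyc_edge bs i = cyc_edge bs j"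
      "cyc_hd bs (if b then i else Suc i mod k) = cyc_hd bs (if c then j else Suc j mod k)"
      using pq unfolding p by auto
    have ij: "i = j" using a inj_onD[OF cyc_edge_inj[OF d k bs]] by blast
    have "(if b then i else Suc i mod k) = (if c then i else Suc i mod k)"
      by (rule cyc_hd_inj[OF d k bs]) (use a ij sk in auto)
    then have "b = c" using sne[of i] a(1) by (metis lessThan_iff)
    then show "p = q" using ij p by simp
  qed
  then have card\<Phi>: "card \<Phi> = 2 * k" and fin\<Phi>: "finite \<Phi>"
    unfolding \<Phi>_def by (simp_all add: card_image card_cartesian_product)
  have flag_in: "?flag bs' \<in> \<Phi>" if W: "bs' \<in> ?W" for bs'
  proof -
    have b: "cyc_blocks d k bs'" "cyc_edges bs' = cyc_edges bs" using W by auto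
    have ex: "\<exists>i<k. cyc_edge bs' j = cyc_edge bs i" if "j < k" for j
    proof -
      have "cyc_edge bs' j \<in> cyc_edges bs'" using that by (auto simp: cyc_edges_def cyc_len[OF d k b(1)])
      then show ?thesis unfolding b(2) by (auto simp: cyc_edges_def cyc_len[OF d k bs])
    qed
    obtain i where i: "i < k" "cyc_edge bs' 0 = cyc_edge bs i" using ex[of 0] k by auto
    have k1: "k - 1 < k" "Suc (k - 1) mod k = 0" using k by auto
    obtain j where j: "j < k" "cyc_edge bs' (k - 1) = cyc_edge bs j" using ex[OF k1(1)] by auto
    have "cyc_edge bs' 0 \<noteq> cyc_edge bs' (k - 1)"
      using inj_onD[OF cyc_edge_inj[OF d k b(1)], of 0 "k - 1"] k by auto
    then have "i \<noteq> j" using i j by auto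
    \<comment> \<open>The first joint of \<open>bs'\<close> lies on its first and its last edge,
      hence on two different edges of \<open>bs\<close>, and so it is a joint of
      \<open>bs\<close>.\<close>
    moreover have "cyc_hd bs' 0 \<in> cyc_edge bs i" "cyc_hd bs' 0 \<in> cyc_edge bs j"
      using cyc_hd_mem(1)[OF d k b(1), of 0] cyc_hd_mem(2)[OF d k b(1), of "k - 1"] k1 k i j by auto
    ultimately have "cyc_hd bs' 0 = cyc_hd bs i \<or> cyc_hd bs' 0 = cyc_hd bs (Suc i mod k)"
      using cyc_joint[OF d k bs i(1) j(1)] by blast
    then show ?thesis unfolding \<Phi>_def using i by (auto simp: image_iff intro!: bexI[of _ i]) 
  qed
  have flag_ex: "\<exists>bs'\<in>?W. ?flag bs' = \<phi>" if "\<phi> \<in> \<Phi>" for \<phi>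
  proof -
    obtain i b where ib: "i < k" "\<phi> = (cyc_hd bs (if b then i else Suc i mod k), cyc_edge bs i)"
      using \<open>\<phi> \<in> \<Phi>\<close> unfolding \<Phi>_def by auto
    show ?thesis
    proof (cases b)
      case True
      then show ?thesis using cyc_rotate[OF d k bs, of i] ib by (intro bexI[of _ "rotate i bs"]) auto
    next
      case False
      define j where "j = k - 1 - i"
      have j: "j < k" "k - 1 - j = i" "(k - j) mod k = Suc i mod k"
        using ib(1) unfolding j_def by (auto simp: Suc_diff_Suc)
      note r = cyc_refl[OF d k bs]
      show ?thesis using cyc_rotate[OF d k r(1), of j] r(2) r(3)[OF j(1)] r(4)[OF j(1)] j False ib
        by (intro bexI[of _ "rotate j (cyc_refl bs)"]) auto
    qed
  qed
  have fib: "finite {bs' \<in> ?W. ?flag bs' = \<phi>} \<and> card {bs' \<in> ?W. ?flag bs' = \<phi>} = fact (d - 2) ^ k" if \<phi>: "\<phi> \<in> \<Phi>" for \<phi>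
  proof -
    obtain bs1 where b1: "bs1 \<in> ?W" "?flag bs1 = \<phi>" using flag_ex[OF \<phi>] by blast
    have "{bs' \<in> ?W. ?flag bs' = \<phi>} = {bs'. cyc_blocks d k bs' \<and> cyc_edges bs' = cyc_edges bs1 \<and>
       (cyc_hd bs' 0, cyc_edge bs' 0) = (cyc_hd bs1 0, cyc_edge bs1 0)}" using b1 by auto
    then show ?thesis using card_cyc_flag_fiber[OF d k, of bs1] b1 by simp
  qed
  have W: "?W = (\<Union>\<phi>\<in>\<Phi>. {bs' \<in> ?W. ?flag bs' = \<phi>})" using flag_in by auto
  have finW: "finite ?W" by (subst W) (use fin\<Phi> fib in blast)
  have "card ?W = (\<Sum>\<phi>\<in>\<Phi>. card {bs' \<in> ?W. ?flag bs' = \<phi>})"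
    by (subst W, rule card_UN_disjoint) (use fin\<Phi> fib in auto)
  also have "\<dots> = (\<Sum>\<phi>\<in>\<Phi>. fact (d - 2) ^ k)" using fib by (intro sum.cong) auto
  finally show ?thesis using card\<Phi> finW by simp
qed

lemma card_cyc_blocks:
  assumes d: "3 \<le> d" and k: "2 \<le> k" and "finite G"
  shows "card {bs. cyc_blocks d k bs \<and> cyc_edges bs \<subseteq> G} = 2 * k * fact (d - 2) ^ k * card {C. is_cycle d k C \<and> C \<subseteq> G}"
    and "finite {bs. cyc_blocks d k bs \<and> cyc_edges bs \<subseteq> G}"
proof -
  let ?B = "{bs. cyc_blocks d k bs \<and> cyc_edges bs \<subseteq> G}" and ?C = "{C. is_cycle d k C \<and> C \<subseteq> G}"
  have fib: "finite {bs. cyc_blocks d k bs \<and> cyc_edges bs = C} \<and>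
      card {bs. cyc_blocks d k bs \<and> cyc_edges bs = C} = 2 * k * fact (d - 2) ^ k" if "C \<in> ?C" for C
  proof -
    obtain bs where bs: "cyc_blocks d k bs" "C = cyc_edges bs" using \<open>C \<in> ?C\<close> unfolding is_cycle_def by auto
    then show ?thesis using card_cyc_fiber[OF d k bs(1)] by simp
  qed
  have finC: "finite ?C" by (rule finite_subset[of _ "Pow G"]) (use assms(3) in auto)
  have B: "?B = (\<Union>C\<in>?C. {bs. cyc_blocks d k bs \<and> cyc_edges bs = C})" using k by (auto simp: is_cycle_def)
  show "finite ?B" by (subst B) (use finC fib in blast)
  have "card ?B = (\<Sum>C\<in>?C. card {bs. cyc_blocks d k bs \<and> cyc_edges bs = C})"
    by (subst B, rule card_UN_disjoint) (use finC fib in auto)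
  also have "\<dots> = (\<Sum>C\<in>?C. 2 * k * fact (d - 2) ^ k)" using fib by (intro sum.cong) auto
  finally show "card ?B = 2 * k * fact (d - 2) ^ k * card ?C" by simp
qed

definition all_edges :: "nat \<Rightarrow> 'a set \<Rightarrow> 'a set set" where
  "all_edges d V = {e. e \<subseteq> V \<and> card e = d}"

lemma ex_concat: "length xs = D * k \<Longrightarrow> \<exists>bs. length bs = k \<and> (\<forall>b\<in>set bs. length b = D) \<and> concat bs = xs"
proof (induction k arbitrary: xs)
  case (Suc k)
  then have "length (drop D xs) = D * k" "length (take D xs) = D" by auto
  then obtain bs where "length bs = k" "\<forall>b\<in>set bs. length b = D" "concat bs = drop D xs" using Suc.IH by blast
  then show ?case using \<open>length (take D xs) = D\<close> by (intro exI[of _ "take D xs # bs"]) auto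
qed auto

text \<open>Concatenating the blocks turns encodings into lists of \<open>(d - 1) * k\<close>
  distinct vertices, and these are counted by a falling factorial.\<close>

lemma card_cycles:
  assumes d: "3 \<le> d" and k: "2 \<le> k" and V: "finite V"
  shows "2 * k * fact (d - 2) ^ k * card {C. is_cycle d k C \<and> C \<subseteq> all_edges d V} =
    fact ((d - 1) * k) * (card V choose ((d - 1) * k))"
proof -
  let ?l = "(d - 1) * k"
  let ?B = "{bs. cyc_blocks d k bs \<and> cyc_edges bs \<subseteq> all_edges d V}"
  let ?X = "{xs. length xs = ?l \<and> distinct xs \<and> set xs \<subseteq> V}"
  have edges: "cyc_edges bs \<subseteq> all_edges d V \<longleftrightarrow> set (concat bs) \<subseteq> V" if "cyc_blocks d k bs" for bs
    unfolding cyc_Union[OF d k that, symmetric]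
    using cyc_edge_card[OF d k that] by (auto simp: all_edges_def cyc_edges_def cyc_len[OF d k that])
  have "bij_betw concat ?B ?X"
  proof (rule bij_betwI')
    fix bs bs' assume b: "bs \<in> ?B" "bs' \<in> ?B"
    show "concat bs = concat bs' \<longleftrightarrow> bs = bs'"
    proof
      assume eq: "concat bs = concat bs'"
      show "bs = bs'"
      proof (rule concat_injective[OF eq])
        show "length bs = length bs'" using b by (simp add: cyc_blocks_def)
        show "\<forall>(x, y)\<in>set (zip bs bs'). length x = length y"
        proof clarify
          fix x y assume "(x, y) \<in> set (zip bs bs')"
          then have "x \<in> set bs" "y \<in> set bs'" by (auto dest: set_zip_leftD set_zip_rightD)
          then show "length x = length y" using b by (simp add: cyc_blocks_def)
        qed
      qed
    qed simp
  next
    fix bs assume "bs \<in> ?B"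
    then show "concat bs \<in> ?X" using edges[of bs] cyc_length_concat[OF d k, of bs] by (simp add: cyc_blocks_def)
  next
    fix xs assume x: "xs \<in> ?X"
    then obtain bs where bs: "length bs = k" "\<forall>b\<in>set bs. length b = d - 1" "concat bs = xs"
      using ex_concat[of xs "d - 1" k] by auto
    then have "cyc_blocks d k bs" using x unfolding cyc_blocks_def by simp
    then show "\<exists>bs\<in>?B. xs = concat bs" using edges[of bs] bs x by blast
  qed
  then have "card ?B = card ?X" by (rule bij_betw_same_card)
  also have "\<dots> = fact ?l * (card V choose ?l)"
  proof (cases "?l \<le> card V")
    case True
    have "fact (card V) = fact (card V - ?l) * \<Prod>{card V - ?l + 1..card V}"
      using True by (metis Suc_eq_plus1 diff_le_self fact_eq_fact_times prod.cong)
    moreover have "fact ?l * (card V choose ?l) * fact (card V - ?l) = (fact (card V) :: nat)"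
      using binomial_fact_lemma[OF True] by (simp add: mult.commute mult.left_commute)
    ultimately have "\<Prod>{card V - ?l + 1..card V} = fact ?l * (card V choose ?l)"
      by (metis fact_nonzero mult.commute mult_cancel_left)
    then show ?thesis using card_lists_distinct_length_eq[OF V True] by simp
  next
    case False
    have "length xs \<le> card V" if "distinct xs" "set xs \<subseteq> V" for xs
      using card_mono[OF V that(2)] distinct_card[OF that(1)] by simp
    then have "xs \<notin> ?X" for xs using False by force
    then have "?X = {}" by blast
    then have "card ?X = 0" by (simp only: card.empty)
    moreover have "card V choose ?l = 0" using False by (intro binomial_eq_0) linarith
    ultimately show ?thesis by (simp only: mult_0_right)
  qed
  finally have "card ?B = fact ?l * (card V choose ?l)" .
  moreover have "finite (all_edges d V)" unfolding all_edges_def using V by (auto intro: finite_subset[of _ "Pow V"])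
  ultimately show ?thesis using card_cyc_blocks(1)[OF d k, of "all_edges d V"] by simp
qed

section \<open>Random subsets\<close>

text \<open>Expectation over a random subset containing each element independently with probability
  \<open>p\<close>, written as a finite sum to keep all estimates elementary;
  \<open>random_hypergraph_prob\<close> makes the connection to the given distribution.\<close>

definition bexp :: "'e set \<Rightarrow> real \<Rightarrow> ('e set \<Rightarrow> real) \<Rightarrow> real" where
  "bexp A p f = (\<Sum>g\<in>Pow A. p ^ card g * (1 - p) ^ card (A - g) * f g)"

definition prb :: "'e set \<Rightarrow> real \<Rightarrow> ('e set \<Rightarrow> bool) \<Rightarrow> real" where
  "prb A p Q = bexp A p (\<lambda>g. of_bool (Q g))"

text \<open>Independence of disjoint parts of the ground set: the weight is a product, and subsets
  of a disjoint union are pairs of subsets.\<close>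

lemma bexp_split:
  assumes "finite A" "finite B" "A \<inter> B = {}"
  shows "bexp (A \<union> B) p f = bexp A p (\<lambda>a. bexp B p (\<lambda>b. f (a \<union> b)))"
proof -
  let ?w = "\<lambda>A a. p ^ card a * (1 - p) ^ card (A - a)"
  have "bexp A p (\<lambda>a. bexp B p (\<lambda>b. f (a \<union> b))) =
      (\<Sum>(a, b)\<in>Pow A \<times> Pow B. ?w A a * (?w B b * f (a \<union> b)))"
    unfolding bexp_def by (simp add: sum_distrib_left sum.cartesian_product)
  also have "\<dots> = (\<Sum>g\<in>Pow (A \<union> B). ?w (A \<union> B) g * f g)"
  proof (rule sum.reindex_bij_witness[of _ "\<lambda>g. (g \<inter> A, g \<inter> B)" "\<lambda>(a, b). a \<union> b"])
    fix ab assume "ab \<in> Pow A \<times> Pow B"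
    then obtain a b where ab: "ab = (a, b)" "a \<subseteq> A" "b \<subseteq> B" by auto
    have fin: "finite a" "finite b" using ab assms finite_subset by blast+
    have "card (a \<union> b) = card a + card b" using ab assms fin by (intro card_Un_disjoint) auto
    have "(A \<union> B) - (a \<union> b) = (A - a) \<union> (B - b)" using ab assms by auto
    have "card ((A - a) \<union> (B - b)) = card (A - a) + card (B - b)"
      using assms by (intro card_Un_disjoint) auto
    show "?w (A \<union> B) (case ab of (a, b) \<Rightarrow> a \<union> b) * f (case ab of (a, b) \<Rightarrow> a \<union> b) =
       (case ab of (a, b) \<Rightarrow> ?w A a * (?w B b * f (a \<union> b)))"
      using ab \<open>card (a \<union> b) = _\<close> \<open>(A \<union> B) - (a \<union> b) = _\<close> \<open>card ((A - a) \<union> (B - b)) = _\<close>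
      by (simp add: power_add mult_ac)
  qed (use assms in auto)
  finally show ?thesis unfolding bexp_def by simp
qed

lemma bexp_cong: "(\<And>g. g \<subseteq> A \<Longrightarrow> f g = h g) \<Longrightarrow> bexp A p f = bexp A p h"
  unfolding bexp_def by (intro sum.cong) auto

lemma prb_cong: "(\<And>g. g \<subseteq> A \<Longrightarrow> Q g \<longleftrightarrow> R g) \<Longrightarrow> prb A p Q = prb A p R"
  unfolding prb_def by (intro bexp_cong) auto

lemma bexp_add: "bexp A p (\<lambda>g. f g + h g) = bexp A p f + bexp A p h"
  unfolding bexp_def by (simp add: distrib_left sum.distrib)

lemma bexp_diff: "bexp A p (\<lambda>g. f g - h g) = bexp A p f - bexp A p h"
  unfolding bexp_def by (simp add: right_diff_distrib sum_subtractf)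

lemma bexp_cmult: "bexp A p (\<lambda>g. c * f g) = c * bexp A p f"
  unfolding bexp_def by (simp add: sum_distrib_left mult_ac)

lemma bexp_sum: "bexp A p (\<lambda>g. \<Sum>i\<in>I. f i g) = (\<Sum>i\<in>I. bexp A p (f i))"
  unfolding bexp_def by (subst sum.swap) (simp add: sum_distrib_left)

lemma bexp_single: "bexp {e} p f = (1 - p) * f {} + p * f {e}"
proof -
  have "Pow {e} = {{}, {e}}" by auto
  then show ?thesis unfolding bexp_def by simp
qed

lemma bexp_const: "finite A \<Longrightarrow> bexp A p (\<lambda>_. c) = c"
proof (induction A rule: finite_induct)
  case empty then show ?case by (simp add: bexp_def)
next
  case (insert e A)
  have "bexp ({e} \<union> A) p (\<lambda>_. c) = bexp {e} p (\<lambda>a. bexp A p (\<lambda>b. c))"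
    using insert by (intro bexp_split) auto
  then show ?case using insert by (simp add: bexp_single algebra_simps)
qed

lemma bexp_mono: "0 \<le> p \<Longrightarrow> p \<le> 1 \<Longrightarrow> (\<And>g. g \<subseteq> A \<Longrightarrow> f g \<le> h g) \<Longrightarrow> bexp A p f \<le> bexp A p h"
  unfolding bexp_def by (intro sum_mono mult_left_mono) auto

lemma bexp_nonneg: "0 \<le> p \<Longrightarrow> p \<le> 1 \<Longrightarrow> (\<And>g. g \<subseteq> A \<Longrightarrow> 0 \<le> f g) \<Longrightarrow> 0 \<le> bexp A p f"
  unfolding bexp_def by (intro sum_nonneg mult_nonneg_nonneg) auto

lemma prb_mono: "0 \<le> p \<Longrightarrow> p \<le> 1 \<Longrightarrow> (\<And>g. g \<subseteq> A \<Longrightarrow> Q g \<Longrightarrow> R g) \<Longrightarrow> prb A p Q \<le> prb A p R"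
  unfolding prb_def by (intro bexp_mono) auto

lemma prb_nonneg: "0 \<le> p \<Longrightarrow> p \<le> 1 \<Longrightarrow> 0 \<le> prb A p Q"
  unfolding prb_def by (intro bexp_nonneg) auto

lemma prb_True: "finite A \<Longrightarrow> prb A p (\<lambda>_. True) = 1"
  unfolding prb_def by (simp add: bexp_const)

lemma prb_le_1: "0 \<le> p \<Longrightarrow> p \<le> 1 \<Longrightarrow> finite A \<Longrightarrow> prb A p Q \<le> 1"
  using prb_mono[of p A Q "\<lambda>_. True"] prb_True[of A p] by simp

lemma prb_not: "finite A \<Longrightarrow> prb A p (\<lambda>g. \<not> Q g) = 1 - prb A p Q"
  using bexp_diff[of A p "\<lambda>_. 1" "\<lambda>g. of_bool (Q g)"] bexp_const[of A p 1] unfolding prb_def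
  by (simp add: of_bool_not_iff)

lemma prb_disj: "(\<And>g. g \<subseteq> A \<Longrightarrow> \<not> (Q g \<and> R g)) \<Longrightarrow> prb A p (\<lambda>g. Q g \<or> R g) = prb A p Q + prb A p R"
  unfolding prb_def bexp_add[symmetric] by (intro bexp_cong) (auto simp: of_bool_def)

lemma prb_le_add: "0 \<le> p \<Longrightarrow> p \<le> 1 \<Longrightarrow> prb A p (\<lambda>g. Q g \<or> R g) \<le> prb A p Q + prb A p R"
  unfolding prb_def bexp_add[symmetric] by (intro bexp_mono) auto

lemma prb_Ex_le: "0 \<le> p \<Longrightarrow> p \<le> 1 \<Longrightarrow> finite I \<Longrightarrow>
  prb A p (\<lambda>g. \<exists>i\<in>I. Q i g) \<le> (\<Sum>i\<in>I. prb A p (Q i))"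
  unfolding prb_def bexp_sum[symmetric]
proof (rule bexp_mono)
  fix g assume fin: "finite I"
  show "of_bool (\<exists>i\<in>I. Q i g) \<le> (\<Sum>i\<in>I. of_bool (Q i g) :: real)"
  proof (cases "\<exists>i\<in>I. Q i g")
    case True
    then obtain i where "i \<in> I" "Q i g" by blast
    then have "(of_bool (Q i g) :: real) \<le> (\<Sum>i\<in>I. of_bool (Q i g))"
      using fin by (intro member_le_sum) auto
    then show ?thesis using True \<open>Q i g\<close> by simp
  qed (simp add: sum_nonneg)
qed

lemma prb_Ex_disjoint:
  assumes "finite I" "\<And>g i j. g \<subseteq> A \<Longrightarrow> i \<in> I \<Longrightarrow> j \<in> I \<Longrightarrow> Q i g \<Longrightarrow> Q j g \<Longrightarrow> i = j"
  shows "prb A p (\<lambda>g. \<exists>i\<in>I. Q i g) = (\<Sum>i\<in>I. prb A p (Q i))"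
  unfolding prb_def bexp_sum[symmetric]
proof (rule bexp_cong)
  fix g assume g: "g \<subseteq> A"
  show "of_bool (\<exists>i\<in>I. Q i g) = (\<Sum>i\<in>I. of_bool (Q i g) :: real)"
  proof (cases "\<exists>i\<in>I. Q i g")
    case True
    then obtain i where i: "i \<in> I" "Q i g" by blast
    have "Q j g \<longleftrightarrow> j = i" if "j \<in> I" for j using assms(2)[OF g that i(1) _ i(2)] i(2) by blast
    then have "(\<Sum>j\<in>I. of_bool (Q j g) :: real) = (\<Sum>j\<in>I. if j = i then 1 else 0)"
      by (intro sum.cong) (simp_all add: of_bool_def)
    then show ?thesis using True i assms(1) by simp
  qed auto
qed

lemma prb_diff_le:
  assumes "0 \<le> p" "p \<le> 1" "\<And>g. g \<subseteq> A \<Longrightarrow> \<not> B g \<Longrightarrow> Q g \<longleftrightarrow> R g"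
  shows "\<bar>prb A p Q - prb A p R\<bar> \<le> prb A p B"
proof -
  have "prb A p Q \<le> prb A p (\<lambda>g. R g \<or> B g)" "prb A p R \<le> prb A p (\<lambda>g. Q g \<or> B g)"
    using assms by (auto intro!: prb_mono)
  then show ?thesis using prb_le_add[OF assms(1,2), of A R B] prb_le_add[OF assms(1,2), of A Q B] by linarith
qed

lemma prb_markov:
  assumes "0 \<le> p" "p \<le> 1" "\<And>g. g \<subseteq> A \<Longrightarrow> 0 \<le> X g" "0 < m"
  shows "prb A p (\<lambda>g. m \<le> X g) \<le> bexp A p X / m"
proof -
  have "m * prb A p (\<lambda>g. m \<le> X g) \<le> bexp A p X"
    unfolding prb_def bexp_cmult[symmetric] using assms by (intro bexp_mono) auto
  then show ?thesis using assms(4) by (simp add: field_simps)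
qed

text \<open>Fixing the trace of \<open>g\<close> on \<open>F\<close> costs its weight and leaves an
  independent random subset of the rest.\<close>

lemma bexp_exact:
  assumes "finite A" "F \<subseteq> A" "S \<subseteq> F"
  shows "bexp A p (\<lambda>g. of_bool (g \<inter> F = S) * f g) =
    p ^ card S * (1 - p) ^ card (F - S) * bexp (A - F) p (\<lambda>b. f (S \<union> b))"
proof -
  have finF: "finite F" using assms finite_subset by blast
  have A: "A = F \<union> (A - F)" using assms by auto
  have "bexp A p (\<lambda>g. of_bool (g \<inter> F = S) * f g) =
    bexp F p (\<lambda>a. bexp (A - F) p (\<lambda>b. of_bool ((a \<union> b) \<inter> F = S) * f (a \<union> b)))"
    by (subst A, rule bexp_split) (use assms finF in auto)
  also have "\<dots> = bexp F p (\<lambda>a. of_bool (a = S) * bexp (A - F) p (\<lambda>b. f (a \<union> b)))"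
  proof (rule bexp_cong)
    fix a assume a: "a \<subseteq> F"
    have "bexp (A - F) p (\<lambda>b. of_bool ((a \<union> b) \<inter> F = S) * f (a \<union> b)) =
      bexp (A - F) p (\<lambda>b. of_bool (a = S) * f (a \<union> b))"
    proof (rule bexp_cong)
      fix b assume "b \<subseteq> A - F"
      then have "(a \<union> b) \<inter> F = a" using a by auto
      then show "of_bool ((a \<union> b) \<inter> F = S) * f (a \<union> b) = of_bool (a = S) * f (a \<union> b)" by simp
    qed
    then show "bexp (A - F) p (\<lambda>b. of_bool ((a \<union> b) \<inter> F = S) * f (a \<union> b)) =
      of_bool (a = S) * bexp (A - F) p (\<lambda>b. f (a \<union> b))" by (simp only: bexp_cmult)
  qed
  also have "\<dots> = (\<Sum>a\<in>Pow F. if a = S then p ^ card S * (1 - p) ^ card (F - S) * bexp (A - F) p (\<lambda>b. f (S \<union> b)) else 0)"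
    unfolding bexp_def[of F] by (intro sum.cong) auto
  also have "\<dots> = p ^ card S * (1 - p) ^ card (F - S) * bexp (A - F) p (\<lambda>b. f (S \<union> b))"
    using finF assms(3) by simp
  finally show ?thesis .
qed

lemma bexp_restrict:
  assumes "finite A" "F \<subseteq> A"
  shows "bexp (A - F) p f = bexp A p (\<lambda>g. f (g - F))"
proof -
  have finF: "finite F" using assms finite_subset by blast
  have A: "A = F \<union> (A - F)" using assms by auto
  have "bexp A p (\<lambda>g. f (g - F)) = bexp F p (\<lambda>a. bexp (A - F) p (\<lambda>b. f ((a \<union> b) - F)))"
    by (subst A, rule bexp_split) (use assms finF in auto)
  also have "\<dots> = bexp F p (\<lambda>a. bexp (A - F) p f)"
  proof (intro bexp_cong)
    fix a b assume "a \<subseteq> F" "b \<subseteq> A - F"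
    then have "a \<union> b - F = b" by auto
    then show "f (a \<union> b - F) = f b" by simp
  qed
  finally show ?thesis using bexp_const[OF finF] by simp
qed

text \<open>Conditioning on the presence of \<open>S\<close> amounts to planting \<open>S\<close>
  into an independent sample. This identity underlies the Poisson recursion.\<close>

lemma bexp_contains:
  assumes "finite A" "S \<subseteq> A"
  shows "bexp A p (\<lambda>g. of_bool (S \<subseteq> g) * f g) = p ^ card S * bexp A p (\<lambda>g. f (g \<union> S))"
proof -
  have "bexp A p (\<lambda>g. of_bool (S \<subseteq> g) * f g) = bexp A p (\<lambda>g. of_bool (g \<inter> S = S) * f g)"
    by (intro bexp_cong) (auto simp: of_bool_def)
  also have "\<dots> = p ^ card S * bexp (A - S) p (\<lambda>b. f (S \<union> b))"
    using bexp_exact[OF assms(1,2) order_refl] by simp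
  also have "bexp (A - S) p (\<lambda>b. f (S \<union> b)) = bexp A p (\<lambda>g. f (S \<union> (g - S)))"
    by (rule bexp_restrict[OF assms])
  also have "\<dots> = bexp A p (\<lambda>g. f (g \<union> S))" by (simp add: Un_commute)
  finally show ?thesis .
qed

lemma prb_contains: "finite A \<Longrightarrow> S \<subseteq> A \<Longrightarrow> prb A p (\<lambda>g. S \<subseteq> g) = p ^ card S"
  using bexp_contains[of A S p "\<lambda>_. 1"] bexp_const[of A p 1] unfolding prb_def by simp

lemma bexp_relabel:
  assumes "bij_betw \<pi> A B" shows "bexp B p f = bexp A p (\<lambda>g. f (\<pi> ` g))"
proof -
  have inj: "inj_on \<pi> A" and B: "B = \<pi> ` A" using assms by (auto simp: bij_betw_def)
  have bij: "bij_betw ((`) \<pi>) (Pow A) (Pow B)" using assms by (rule bij_betw_Pow)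
  show ?thesis unfolding bexp_def
  proof (subst sum.reindex_bij_betw[OF bij, symmetric], rule sum.cong[OF refl])
    fix g assume "g \<in> Pow A"
    then have g: "g \<subseteq> A" by auto
    have "B - \<pi> ` g = \<pi> ` (A - g)" unfolding B using inj g by (metis inj_on_image_set_diff subset_refl Diff_subset)
    moreover have "card (\<pi> ` g) = card g" "card (\<pi> ` (A - g)) = card (A - g)"
      using inj g by (auto intro!: card_image elim!: inj_on_subset)
    ultimately show "p ^ card (\<pi> ` g) * (1 - p) ^ card (B - \<pi> ` g) * f (\<pi> ` g) =
       p ^ card g * (1 - p) ^ card (A - g) * f (\<pi> ` g)" by simp
  qed
qed

lemma possible_edges_eq: "possible_edges d n = all_edges d {1..n}"
  unfolding possible_edges_def all_edges_def by simp

lemma finite_all_edges [simp]: "finite V \<Longrightarrow> finite (all_edges d V)"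
  unfolding all_edges_def by (auto intro: finite_subset[of _ "Pow V"])

lemma card_all_edges: "finite V \<Longrightarrow> card (all_edges d V) = card V choose d"
  unfolding all_edges_def by (rule n_subsets)

text \<open>The strict bounds on \<open>p\<close> give every choice of present edges positive mass,
  and passing to edge sets is injective on this support, so point masses can be read off.\<close>

lemma random_hypergraph_prob:
  assumes p: "0 < p" "p < 1"
  shows "measure_pmf.prob (random_hypergraph d n p) {E. Q E} = prb (possible_edges d n) p Q"
proof -
  let ?A = "possible_edges d n"
  have finA: "finite ?A" by (simp add: possible_edges_eq)
  let ?M = "Pi_pmf ?A False (\<lambda>_. bernoulli_pmf p)"
  let ?h = "\<lambda>present. {e \<in> ?A. present e}"
  have setM: "set_pmf ?M = PiE_dflt ?A False (\<lambda>_. UNIV)"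
    using p by (simp add: set_Pi_pmf[OF finA] comp_def)
  have inj: "inj_on ?h (set_pmf ?M)"
    unfolding setM PiE_dflt_def by (rule inj_onI, rule ext) (smt (verit, best) mem_Collect_eq)
  have pmf: "pmf (random_hypergraph d n p) g = p ^ card g * (1 - p) ^ card (?A - g)" if g: "g \<subseteq> ?A" for g
  proof -
    have s: "(\<lambda>e. e \<in> g) \<in> set_pmf ?M" unfolding setM PiE_dflt_def using g by auto
    have "?h (\<lambda>e. e \<in> g) = g" using g by auto
    then have "pmf (random_hypergraph d n p) g = pmf ?M (\<lambda>e. e \<in> g)"
      unfolding random_hypergraph_def using pmf_map_inj[OF inj s] by simp
    also have "\<dots> = (\<Prod>e\<in>?A. pmf (bernoulli_pmf p) (e \<in> g))"
      using g by (subst pmf_Pi'[OF finA]) auto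
    also have "\<dots> = (\<Prod>e\<in>g. p) * (\<Prod>e\<in>?A - g. 1 - p)"
    proof -
      have "(\<Prod>e\<in>?A. pmf (bernoulli_pmf p) (e \<in> g)) =
         (\<Prod>e\<in>?A - g. pmf (bernoulli_pmf p) (e \<in> g)) * (\<Prod>e\<in>g. pmf (bernoulli_pmf p) (e \<in> g))"
        by (rule prod.subset_diff[OF g finA])
      then show ?thesis using p by (simp add: mult.commute)
    qed
    finally show ?thesis by simp
  qed
  have supp: "set_pmf (random_hypergraph d n p) \<subseteq> Pow ?A" unfolding random_hypergraph_def by auto
  have "measure_pmf.prob (random_hypergraph d n p) {E. Q E} =
      measure_pmf.prob (random_hypergraph d n p) {E \<in> Pow ?A. Q E}"
  proof -
    have "{E. Q E} \<inter> set_pmf (random_hypergraph d n p) = {E \<in> Pow ?A. Q E} \<inter> set_pmf (random_hypergraph d n p)"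
      using supp by auto
    then show ?thesis by (metis measure_Int_set_pmf)
  qed
  also have "\<dots> = (\<Sum>g\<in>{E \<in> Pow ?A. Q E}. pmf (random_hypergraph d n p) g)"
    using finA by (intro measure_measure_pmf_finite) auto
  also have "\<dots> = (\<Sum>g\<in>Pow ?A. pmf (random_hypergraph d n p) g * of_bool (Q g))"
    using finA by (intro sum.mono_neutral_cong_left) auto
  also have "\<dots> = prb ?A p Q" unfolding prb_def bexp_def using pmf by (intro sum.cong) auto
  finally show ?thesis .
qed

section \<open>First moment bounds\<close>

lemma card_subsets_le:
  assumes "finite V" "V \<noteq> {}"
  shows "card {U. U \<subseteq> V \<and> card U \<le> t} \<le> (t + 1) * card V ^ t"
proof -
  have n1: "1 \<le> card V" using assms by (simp add: Suc_le_eq card_gt_0_iff)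
  have "{U. U \<subseteq> V \<and> card U \<le> t} = (\<Union>i\<in>{..t}. {U. U \<subseteq> V \<and> card U = i})" by auto
  then have "card {U. U \<subseteq> V \<and> card U \<le> t} \<le> (\<Sum>i\<le>t. card {U. U \<subseteq> V \<and> card U = i})"
    by (simp add: card_UN_le)
  also have "\<dots> = (\<Sum>i\<le>t. card V choose i)" using assms by (simp add: n_subsets)
  also have "\<dots> \<le> (\<Sum>i\<le>t. card V ^ t)"
  proof (rule sum_mono)
    fix i assume "i \<in> {..t}"
    have "card V choose i \<le> card V ^ i"
      by (cases "i \<le> card V") (auto simp: binomial_le_pow binomial_eq_0)
    also have "\<dots> \<le> card V ^ t" using n1 \<open>i \<in> {..t}\<close> by (intro power_increasing) auto
    finally show "card V choose i \<le> card V ^ t" .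
  qed
  finally show ?thesis by simp
qed

text \<open>The new vertices can be chosen in at most order n^t ways; everything else happens on at
  most \<open>z + t\<close> vertices and is bounded crudely by the number of all set systems
  there.\<close>

lemma card_edge_sets_le:
  assumes "finite V" "V \<noteq> {}" "Z \<subseteq> V" "card Z \<le> z"
  shows "card {S. S \<subseteq> all_edges d V \<and> card (\<Union>S - Z) \<le> t} \<le> 2 ^ 2 ^ (z + t) * ((t + 1) * card V ^ t)"
proof -
  let ?U = "{U. U \<subseteq> V \<and> card U \<le> t}"
  have finU: "finite ?U" using assms by simp
  have finVU: "finite (Z \<union> U)" if "U \<in> ?U" for U using that assms finite_subset by blast
  have "{S. S \<subseteq> all_edges d V \<and> card (\<Union>S - Z) \<le> t} \<subseteq> (\<Union>U\<in>?U. Pow (Pow (Z \<union> U)))"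
  proof
    fix S assume "S \<in> {S. S \<subseteq> all_edges d V \<and> card (\<Union>S - Z) \<le> t}"
    then have S: "S \<subseteq> all_edges d V" "card (\<Union>S - Z) \<le> t" by auto
    then have "\<Union>S - Z \<in> ?U" unfolding all_edges_def by auto
    moreover have "S \<in> Pow (Pow (Z \<union> (\<Union>S - Z)))" by auto
    ultimately show "S \<in> (\<Union>U\<in>?U. Pow (Pow (Z \<union> U)))" by blast
  qed
  then have "card {S. S \<subseteq> all_edges d V \<and> card (\<Union>S - Z) \<le> t} \<le> card (\<Union>U\<in>?U. Pow (Pow (Z \<union> U)))"
    using finU finVU by (intro card_mono) auto
  also have "\<dots> \<le> (\<Sum>U\<in>?U. card (Pow (Pow (Z \<union> U))))" by (rule card_UN_le[OF finU])
  also have "\<dots> \<le> (\<Sum>U\<in>?U. 2 ^ 2 ^ (z + t))"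
  proof (rule sum_mono)
    fix U assume U: "U \<in> ?U"
    have "card (Z \<union> U) \<le> z + t" using card_Un_le[of Z U] assms(4) U by auto
    then show "card (Pow (Pow (Z \<union> U))) \<le> 2 ^ 2 ^ (z + t)"
      using finVU[OF U] by (simp add: card_Pow power_increasing)
  qed
  also have "\<dots> = card ?U * 2 ^ 2 ^ (z + t)" by simp
  also have "\<dots> \<le> ((t + 1) * card V ^ t) * 2 ^ 2 ^ (z + t)"
    using card_subsets_le[OF assms(1,2)] by (intro mult_right_mono) auto
  finally show ?thesis by (simp add: mult.commute)
qed

text \<open>The number \<open>j\<close> measures how far a set falls short of \<open>d - 1\<close>
  new vertices per edge: 1 describes the dense sets over \<open>Z\<close>, and 0 also admits the
  sets that break even.\<close>

definition dense_sets :: "nat \<Rightarrow> 'a set set \<Rightarrow> nat \<Rightarrow> nat \<Rightarrow> 'a set \<Rightarrow> 'a set set set" where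
  "dense_sets d A j M Z = {S. S \<subseteq> A \<and> S \<noteq> {} \<and> card S \<le> M \<and> card (\<Union>S - Z) + j \<le> (d - 1) * card S}"

text \<open>A set of k edges with slack \<open>j\<close> has at most (d-1)k - j new vertices, while
  its probability carries the factor n^(-(d-1)k); what remains is n^(-j). The constant
  \<open>K\<close> is chosen before \<open>V\<close> and \<open>Z\<close>.\<close>

lemma first_moment:
  assumes c: "0 < (c::real)"
  obtains K :: real where "0 \<le> K" "\<And>(V :: 'a set) Z. finite V \<Longrightarrow> V \<noteq> {} \<Longrightarrow> Z \<subseteq> V \<Longrightarrow> card Z \<le> z \<Longrightarrow>
    (\<Sum>S\<in>dense_sets d (all_edges d V) j M Z. (c / real (card V) ^ (d - 1)) ^ card S) \<le> K / real (card V) ^ j"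
proof
  define B where "B k = (2 ^ 2 ^ (z + ((d - 1) * k - j)) * (((d - 1) * k - j) + 1) :: real)" for k
  define K where "K = (\<Sum>k\<le>M. B k * c ^ k)"
  show "0 \<le> K" unfolding K_def B_def using c by (intro sum_nonneg mult_nonneg_nonneg) auto
  fix V Z :: "'a set" assume V: "finite V" "V \<noteq> {}" "Z \<subseteq> V" "card Z \<le> z"
  define n where "n = real (card V)"
  have n: "n > 0" unfolding n_def using V by (simp add: card_gt_0_iff)
  let ?D = "dense_sets d (all_edges d V) j M Z"
  have finD: "finite ?D" by (rule finite_subset[of _ "Pow (all_edges d V)"]) (use V in \<open>auto simp: dense_sets_def\<close>)
  have "(\<Sum>S\<in>?D. (c / n ^ (d - 1)) ^ card S) = (\<Sum>k\<le>M. \<Sum>S\<in>{S\<in>?D. card S = k}. (c / n ^ (d - 1)) ^ card S)"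
    by (rule sum.group[symmetric, where g = card]) (use finD in \<open>auto simp: dense_sets_def\<close>)
  also have "\<dots> \<le> (\<Sum>k\<le>M. B k * c ^ k / n ^ j)"
  proof (rule sum_mono)
    fix k assume "k \<in> {..M}"
    let ?Dk = "{S\<in>?D. card S = k}"
    show "(\<Sum>S\<in>?Dk. (c / n ^ (d - 1)) ^ card S) \<le> B k * c ^ k / n ^ j"
    proof (cases "j \<le> (d - 1) * k")
      case False
      then have E: "?Dk = {}" unfolding dense_sets_def by auto
      show ?thesis unfolding E B_def using c n by simp
    next
      case True
      define t where "t = (d - 1) * k - j"
      have "?Dk \<subseteq> {S. S \<subseteq> all_edges d V \<and> card (\<Union>S - Z) \<le> t}" unfolding dense_sets_def t_def by auto
      then have "card ?Dk \<le> card {S. S \<subseteq> all_edges d V \<and> card (\<Union>S - Z) \<le> t}"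
        using V by (intro card_mono) (auto intro: finite_subset[of _ "Pow (all_edges d V)"])
      also have "\<dots> \<le> 2 ^ 2 ^ (z + t) * ((t + 1) * card V ^ t)" by (rule card_edge_sets_le[OF V])
      finally have "real (card ?Dk) \<le> real (2 ^ 2 ^ (z + t) * ((t + 1) * card V ^ t))" by (simp only: of_nat_le_iff)
      also have "\<dots> = B k * n ^ t" unfolding B_def n_def t_def[symmetric] by (simp add: algebra_simps)
      finally have cD: "real (card ?Dk) \<le> B k * n ^ t" .
      have "(\<Sum>S\<in>?Dk. (c / n ^ (d - 1)) ^ card S) = real (card ?Dk) * (c / n ^ (d - 1)) ^ k" by simp
      also have "\<dots> \<le> B k * n ^ t * (c / n ^ (d - 1)) ^ k"
        using cD c n by (intro mult_right_mono) auto
      also have "\<dots> = B k * c ^ k * (n ^ t / n ^ ((d - 1) * k))"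
        unfolding power_divide power_mult[symmetric] by simp
      also have "n ^ t / n ^ ((d - 1) * k) = 1 / n ^ j"
        using n True unfolding t_def by (simp add: field_simps flip: power_add)
      finally show ?thesis by simp
    qed
  qed
  also have "\<dots> = K / n ^ j" unfolding K_def by (simp add: sum_divide_distrib)
  finally show "(\<Sum>S\<in>?D. (c / real (card V) ^ (d - 1)) ^ card S) \<le> K / real (card V) ^ j" unfolding n_def .
qed

lemma prb_dense_over:
  assumes c: "0 < (c::real)"
  obtains K :: real where "0 \<le> K" "\<And>n Z. 0 < n \<Longrightarrow> c / real n ^ (d - 1) \<le> 1 \<Longrightarrow> Z \<subseteq> {1..n} \<Longrightarrow> card Z \<le> z \<Longrightarrow>
    prb (possible_edges d n) (c / real n ^ (d - 1)) (dense_over d Z M) \<le> K / real n"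
proof -
  obtain K :: real where K: "0 \<le> K" "\<And>(V :: nat set) Z. finite V \<Longrightarrow> V \<noteq> {} \<Longrightarrow> Z \<subseteq> V \<Longrightarrow> card Z \<le> z \<Longrightarrow>
    (\<Sum>S\<in>dense_sets d (all_edges d V) 1 M Z. (c / real (card V) ^ (d - 1)) ^ card S) \<le> K / real (card V) ^ 1"
    by (rule first_moment[OF c, where z = z and d = d and j = 1 and M = M]) (rule that)
  show ?thesis
  proof (rule that[OF K(1)])
    fix n :: nat and Z assume n: "0 < n" "c / real n ^ (d - 1) \<le> 1" "Z \<subseteq> {1..n}" "card Z \<le> z"
    let ?A = "possible_edges d n" and ?p = "c / real n ^ (d - 1)"
    let ?D = "dense_sets d ?A 1 M Z"
    have p0: "0 \<le> ?p" using c by simp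
    have finA: "finite ?A" by (simp add: possible_edges_eq)
    have finD: "finite ?D" by (rule finite_subset[of _ "Pow ?A"]) (use finA in \<open>auto simp: dense_sets_def\<close>)
    have "prb ?A ?p (dense_over d Z M) \<le> prb ?A ?p (\<lambda>g. \<exists>S\<in>?D. S \<subseteq> g)"
    proof (rule prb_mono[OF p0 n(2)])
      fix g assume g: "g \<subseteq> ?A" "dense_over d Z M g"
      then obtain S where "S \<subseteq> g" "S \<noteq> {}" "card S \<le> M" "card (\<Union>S - Z) < (d - 1) * card S"
        unfolding dense_over_def by blast
      then show "\<exists>S\<in>?D. S \<subseteq> g" using g(1) unfolding dense_sets_def by (intro bexI[of _ S]) auto
    qed
    also have "\<dots> \<le> (\<Sum>S\<in>?D. prb ?A ?p (\<lambda>g. S \<subseteq> g))" by (rule prb_Ex_le[OF p0 n(2) finD])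
    also have "\<dots> = (\<Sum>S\<in>?D. ?p ^ card S)"
      by (intro sum.cong refl prb_contains[OF finA]) (auto simp: dense_sets_def)
    also have "\<dots> \<le> K / real n" using K(2)[of "{1..n}" Z] n by (simp add: possible_edges_eq)
    finally show "prb ?A ?p (dense_over d Z M) \<le> K / real n" .
  qed
qed

lemma edge_prob_tendsto_0: "3 \<le> d \<Longrightarrow> (\<lambda>n. c / real n ^ (d - 1)) \<longlonglongrightarrow> 0"
proof -
  assume d: "3 \<le> d"
  have "(\<lambda>n. c * inverse (real n) ^ (d - 1)) \<longlonglongrightarrow> c * 0 ^ (d - 1)"
    by (intro tendsto_intros lim_inverse_n)
  then show ?thesis using d by (simp add: divide_inverse power_inverse power_0_left)
qed

lemma edge_prob_eventually:
  assumes "3 \<le> d" "0 < c"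
  shows "\<forall>\<^sub>F n in sequentially. 0 < n \<and> 0 < c / real n ^ (d - 1) \<and> c / real n ^ (d - 1) < 1"
proof -
  have "\<forall>\<^sub>F n in sequentially. c / real n ^ (d - 1) < 1"
    using order_tendstoD(2)[OF edge_prob_tendsto_0[OF assms(1)], of 1 c] by simp
  moreover have "\<forall>\<^sub>F n :: nat in sequentially. 0 < n" by (rule eventually_gt_at_top)
  ultimately show ?thesis by eventually_elim (use assms in auto)
qed

text \<open>The shifts \<open>a\<close> and \<open>b\<close> allow for vertices that are planted in
  addition to the \<open>n\<close> to which the edge probability refers.\<close>

lemma binomial_asymp: "(\<lambda>n. real ((n + a) choose k) / real (n + b) ^ k) \<longlonglongrightarrow> 1 / fact k"
proof -
  have "(\<lambda>n. (real (n + a) - real i) / real (n + b)) \<longlonglongrightarrow> 1" for i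
  proof -
    have "(\<lambda>n. 1 + (real a - real i - real b) / real (n + b)) \<longlonglongrightarrow> 1 + 0"
      by (intro tendsto_add tendsto_const LIMSEQ_ignore_initial_segment lim_const_over_n)
    moreover have "\<forall>\<^sub>F n in sequentially. 1 + (real a - real i - real b) / real (n + b) = (real (n + a) - real i) / real (n + b)"
      using eventually_gt_at_top[of 0] by eventually_elim (simp add: field_simps)
    ultimately have "(\<lambda>n. (real (n + a) - real i) / real (n + b)) \<longlonglongrightarrow> 1 + 0"
      by (rule Lim_transform_eventually)
    then show ?thesis by simp
  qed
  then have "(\<lambda>n. (\<Prod>i<k. (real (n + a) - real i) / real (n + b)) / fact k) \<longlonglongrightarrow> (\<Prod>i<k. 1) / fact k"
    by (intro tendsto_intros) auto
  moreover have "(\<Prod>i<k. (real (n + a) - real i) / real (n + b)) / fact k = real ((n + a) choose k) / real (n + b) ^ k" for n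
    by (simp add: binomial_gbinomial gbinomial_prod_rev atLeast0LessThan prod_dividef)
  ultimately show ?thesis by simp
qed

section \<open>Poisson limit of the cycle counts\<close>

definition ncyc :: "nat \<Rightarrow> nat \<Rightarrow> 'a set set \<Rightarrow> nat" where
  "ncyc d k g = card {C. is_cycle d k C \<and> C \<subseteq> g}"

text \<open>The limit of the expected number of \<open>k\<close>-cycles: about n^((d-1)k) lists of
  distinct vertices, each cycle occurring \<open>2 * k * fact (d - 2) ^ k\<close> times among them,
  times the probability (c / n^(d-1))^k.\<close>

definition cyc_rate :: "nat \<Rightarrow> real \<Rightarrow> nat \<Rightarrow> real" where
  "cyc_rate d c k = (c / fact (d - 2)) ^ k / (2 * real k)"

definition cyc_prob :: "nat \<Rightarrow> real \<Rightarrow> nat \<Rightarrow> nat \<Rightarrow> (nat \<Rightarrow> nat) \<Rightarrow> real" where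
  "cyc_prob d c L n x = prb (possible_edges d n) (c / real n ^ (d - 1)) (\<lambda>g. \<forall>k\<in>{2..L}. ncyc d k g = x k)"

text \<open>A further new cycle would have to overlap \<open>C0\<close> and would make
  \<open>g\<close> dense over the vertices of \<open>C0\<close>. The same would happen if
  \<open>C0\<close> were already contained in \<open>g\<close>.\<close>

lemma ncyc_add_cycle:
  assumes d: "3 \<le> d" and C0: "is_cycle d k0 C0" "k0 \<le> L" and g: "finite g" "\<not> dense_over d (\<Union>C0) L g"
    and k: "k \<le> L"
  shows "ncyc d k (g \<union> C0) = ncyc d k g + of_bool (k = k0)"
proof -
  have ne0: "\<Union>C0 \<noteq> {}" 
  proof -
    have "card (\<Union>C0) \<noteq> 0" using cycle_Union_card[OF d C0(1)] cycle_ge2[OF C0(1)] d by simp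
    then show ?thesis by (metis card.empty)
  qed
  have sub: "C \<subseteq> g \<or> C = C0" if C: "is_cycle d k C" "C \<subseteq> g \<union> C0" for C
  proof (cases "C \<inter> C0 = {}")
    case True then show ?thesis using C by auto
  next
    case False
    show ?thesis
    proof (cases "C \<subseteq> C0")
      case True
      have "C = C0"
      proof (rule ccontr)
        assume "C \<noteq> C0"
        then have "(d - 1) * card C < card (\<Union>C)"
          using cycle_proper_subset[OF d C0(1) True] False by auto
        then show False using cycle_card[OF d C(1)] cycle_Union_card[OF d C(1)] by simp
      qed
      then show ?thesis by simp
    next
      case F: False
      have "dense_over d (\<Union>C0) L (C - C0)" by (rule cycle_overlap_dense[OF d C(1) k False F])
      then have "dense_over d (\<Union>C0) L g" using dense_over_mono C(2) by blast
      then show ?thesis using g(2) by simp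
    qed
  qed
  have C0g: "\<not> C0 \<subseteq> g"
    using cycle_meets_dense[OF d C0, of "\<Union>C0"] ne0 dense_over_mono g(2) by (metis inf.idem)
  have fin: "finite {C. is_cycle d k C \<and> C \<subseteq> g}" using g(1) by (auto intro: finite_subset[of _ "Pow g"])
  show ?thesis
  proof (cases "k = k0")
    case True
    then have "{C. is_cycle d k C \<and> C \<subseteq> g \<union> C0} = insert C0 {C. is_cycle d k C \<and> C \<subseteq> g}"
      using sub C0(1) by auto
    then show ?thesis unfolding ncyc_def using fin C0g True by simp
  next
    case False
    have "\<not> is_cycle d k C0" using cycle_card[OF d] C0(1) False by metis
    then have "{C. is_cycle d k C \<and> C \<subseteq> g \<union> C0} = {C. is_cycle d k C \<and> C \<subseteq> g}" using sub by auto
    then show ?thesis unfolding ncyc_def using False by simp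
  qed
qed

text \<open>Adding a cycle \<open>C\<close> to the random hypergraph changes the cycle counts only by one cycle, up to
  probability \<open>O(1/n)\<close>; this is the characteristic identity of the Poisson law.\<close>

lemma cyc_prob_step:
  assumes d: "3 \<le> d" and c: "0 < c" and k: "k \<in> {2..L}"
    and K: "\<And>Z. Z \<subseteq> {1..n} \<Longrightarrow> card Z = (d - 1) * k \<Longrightarrow>
      prb (possible_edges d n) (c / real n ^ (d - 1)) (dense_over d Z L) \<le> e"
    and p: "c / real n ^ (d - 1) \<le> 1"
  defines "m \<equiv> real (card {C. is_cycle d k C \<and> C \<subseteq> possible_edges d n}) * (c / real n ^ (d - 1)) ^ k"
  shows "\<bar>real (x k + 1) * cyc_prob d c L n (x(k := x k + 1)) - m * cyc_prob d c L n x\<bar> \<le> m * e"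
proof -
  let ?A = "possible_edges d n" and ?p = "c / real n ^ (d - 1)" and ?y = "x(k := x k + 1)"
  let ?X = "\<lambda>y g. \<forall>k\<in>{2..L}. ncyc d k g = y k"
  let ?C = "{C. is_cycle d k C \<and> C \<subseteq> ?A}"
  have p0: "0 \<le> ?p" using c by simp
  have finA: "finite ?A" by (simp add: possible_edges_eq)
  have finC: "finite ?C" by (rule finite_subset[of _ "Pow ?A"]) (use finA in auto)
  \<comment> \<open>The factor \<open>x k + 1\<close> is the number of \<open>k\<close>-cycles on
    this event. Written as a sum over all possible cycles, it allows each of them to be planted by
    \<open>bexp_contains\<close>.\<close>
  have "real (x k + 1) * cyc_prob d c L n ?y = bexp ?A ?p (\<lambda>g. real (ncyc d k g) * of_bool (?X ?y g))"
    unfolding cyc_prob_def prb_def bexp_cmult[symmetric] using k by (intro bexp_cong) auto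
  also have "\<dots> = bexp ?A ?p (\<lambda>g. \<Sum>C\<in>?C. of_bool (C \<subseteq> g) * of_bool (?X ?y g))"
  proof (rule bexp_cong)
    fix g assume g: "g \<subseteq> ?A"
    have "{C. is_cycle d k C \<and> C \<subseteq> g} = {C \<in> ?C. C \<subseteq> g}" using g by auto
    then have "real (ncyc d k g) = (\<Sum>C\<in>?C. of_bool (C \<subseteq> g))"
      unfolding ncyc_def using finC by (simp add: of_bool_def sum.If_cases Int_def conj_commute)
    then show "real (ncyc d k g) * of_bool (?X ?y g) = (\<Sum>C\<in>?C. of_bool (C \<subseteq> g) * of_bool (?X ?y g))"
      by (simp only: sum_distrib_right)
  qed
  also have "\<dots> = (\<Sum>C\<in>?C. bexp ?A ?p (\<lambda>g. of_bool (C \<subseteq> g) * of_bool (?X ?y g)))" by (rule bexp_sum)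
  also have "\<dots> = (\<Sum>C\<in>?C. ?p ^ k * prb ?A ?p (\<lambda>g. ?X ?y (g \<union> C)))"
  proof (rule sum.cong[OF refl])
    fix C assume C: "C \<in> ?C"
    then have "card C = k" using cycle_card[OF d] by blast
    then show "bexp ?A ?p (\<lambda>g. of_bool (C \<subseteq> g) * of_bool (?X ?y g)) = ?p ^ k * prb ?A ?p (\<lambda>g. ?X ?y (g \<union> C))"
      unfolding prb_def using bexp_contains[OF finA, of C ?p "\<lambda>g. of_bool (?X ?y g)"] C by simp
  qed
  finally have eq: "real (x k + 1) * cyc_prob d c L n ?y = (\<Sum>C\<in>?C. ?p ^ k * prb ?A ?p (\<lambda>g. ?X ?y (g \<union> C)))" .
  have eq2: "m * cyc_prob d c L n x = (\<Sum>C\<in>?C. ?p ^ k * cyc_prob d c L n x)" unfolding m_def by simp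
  have "\<bar>real (x k + 1) * cyc_prob d c L n ?y - m * cyc_prob d c L n x\<bar> =
      \<bar>\<Sum>C\<in>?C. ?p ^ k * (prb ?A ?p (\<lambda>g. ?X ?y (g \<union> C)) - cyc_prob d c L n x)\<bar>"
    unfolding eq eq2 by (simp add: sum_subtractf right_diff_distrib)
  also have "\<dots> \<le> (\<Sum>C\<in>?C. \<bar>?p ^ k * (prb ?A ?p (\<lambda>g. ?X ?y (g \<union> C)) - cyc_prob d c L n x)\<bar>)" by (rule sum_abs)
  also have "\<dots> \<le> (\<Sum>C\<in>?C. ?p ^ k * e)"
  proof (rule sum_mono)
    fix C assume C: "C \<in> ?C"
    have "\<bar>prb ?A ?p (\<lambda>g. ?X ?y (g \<union> C)) - cyc_prob d c L n x\<bar> \<le> prb ?A ?p (dense_over d (\<Union>C) L)"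
      unfolding cyc_prob_def
    proof (rule prb_diff_le[OF p0 p])
      fix g assume g: "g \<subseteq> ?A" "\<not> dense_over d (\<Union>C) L g"
      have "ncyc d j (g \<union> C) = ncyc d j g + of_bool (j = k)" if "j \<in> {2..L}" for j
        by (rule ncyc_add_cycle[OF d _ _ _ g(2)]) (use C k that g finA finite_subset in auto)
      then show "?X ?y (g \<union> C) \<longleftrightarrow> ?X x g" by auto
    qed
    also have "\<dots> \<le> e"
    proof (rule K)
      show "\<Union>C \<subseteq> {1..n}" using C unfolding possible_edges_def by auto
      show "card (\<Union>C) = (d - 1) * k" using cycle_Union_card[OF d] C by blast
    qed
    finally have "\<bar>prb ?A ?p (\<lambda>g. ?X ?y (g \<union> C)) - cyc_prob d c L n x\<bar> \<le> e" .
    then show "\<bar>?p ^ k * (prb ?A ?p (\<lambda>g. ?X ?y (g \<union> C)) - cyc_prob d c L n x)\<bar> \<le> ?p ^ k * e"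
      using p0 by (simp add: abs_mult mult_left_mono)
  qed
  also have "\<dots> = m * e" unfolding m_def by simp
  finally show ?thesis .
qed

lemma cyc_mean_tendsto:
  assumes d: "3 \<le> d" and k: "2 \<le> k"
  shows "(\<lambda>n. real (card {C. is_cycle d k C \<and> C \<subseteq> possible_edges d n}) * (c / real n ^ (d - 1)) ^ k)
    \<longlonglongrightarrow> cyc_rate d c k"
proof -
  let ?l = "(d - 1) * k" and ?m = "2 * real k * fact (d - 2) ^ k"
  have m0: "?m > 0" using k by simp
  have N: "real (card {C. is_cycle d k C \<and> C \<subseteq> possible_edges d n}) = fact ?l * real (n choose ?l) / ?m" for n
  proof -
    have "real (2 * k * fact (d - 2) ^ k * card {C. is_cycle d k C \<and> C \<subseteq> all_edges d {1..n}}) =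
      real (fact ?l * (card {1..n} choose ?l))" using card_cycles[OF d k, of "{1..n}"] by simp
    then have "real (card {C. is_cycle d k C \<and> C \<subseteq> all_edges d {1..n}}) * ?m = fact ?l * real (n choose ?l)"
      by (simp add: mult_ac)
    then show ?thesis using m0 unfolding possible_edges_eq 

      by (subst nonzero_eq_divide_eq) (use k in simp_all)
  qed
  have "(\<lambda>n. fact ?l * c ^ k / ?m * (real ((n + 0) choose ?l) / real (n + 0) ^ ?l)) \<longlonglongrightarrow>
      fact ?l * c ^ k / ?m * (1 / fact ?l)" by (intro tendsto_intros binomial_asymp)
  moreover have "fact ?l * c ^ k / ?m * (1 / fact ?l) = cyc_rate d c k"
    unfolding cyc_rate_def using m0 by (simp add: power_divide)
  ultimately show ?thesis unfolding N by (simp add: power_divide power_mult[symmetric] mult_ac)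
qed

lemma cyc_prob_recursion:
  assumes d: "3 \<le> d" and c: "0 < c" and k: "k \<in> {2..L}"
  shows "(\<lambda>n. real (x k + 1) * cyc_prob d c L n (x(k := x k + 1)) - cyc_rate d c k * cyc_prob d c L n x) \<longlonglongrightarrow> 0"
proof -
  define m where "m n = real (card {C. is_cycle d k C \<and> C \<subseteq> possible_edges d n}) * (c / real n ^ (d - 1)) ^ k" for n
  have m: "m \<longlonglongrightarrow> cyc_rate d c k" unfolding m_def using cyc_mean_tendsto[OF d] k by auto
  obtain K :: real where K: "0 \<le> K" "\<And>n Z. 0 < n \<Longrightarrow> c / real n ^ (d - 1) \<le> 1 \<Longrightarrow> Z \<subseteq> {1..n} \<Longrightarrow> card Z \<le> (d - 1) * k \<Longrightarrow>
    prb (possible_edges d n) (c / real n ^ (d - 1)) (dense_over d Z L) \<le> K / real n" 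
    by (rule prb_dense_over[OF c, where z = "(d - 1) * k" and d = d and M = L]) (rule that)
  have "(\<lambda>n. real (x k + 1) * cyc_prob d c L n (x(k := x k + 1)) - m n * cyc_prob d c L n x) \<longlonglongrightarrow> 0"
  proof (rule Lim_null_comparison)
    show "\<forall>\<^sub>F n in sequentially. norm (real (x k + 1) * cyc_prob d c L n (x(k := x k + 1)) - m n * cyc_prob d c L n x) \<le> m n * (K / real n)"
      using edge_prob_eventually[OF d c]
    proof eventually_elim
      case (elim n)
      show ?case unfolding m_def real_norm_def by (rule cyc_prob_step[OF d c k]) (use elim K(2)[of n] in auto)
    qed
    have "(\<lambda>n. m n * (K / real n)) \<longlonglongrightarrow> cyc_rate d c k * 0"
      by (intro tendsto_mult m lim_const_over_n)
    then show "(\<lambda>n. m n * (K / real n)) \<longlonglongrightarrow> 0" by simp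
  qed
  moreover have "(\<lambda>n. (m n - cyc_rate d c k) * cyc_prob d c L n x) \<longlonglongrightarrow> 0"
  proof (rule Lim_null_comparison)
    show "\<forall>\<^sub>F n in sequentially. norm ((m n - cyc_rate d c k) * cyc_prob d c L n x) \<le> \<bar>m n - cyc_rate d c k\<bar>"
      using edge_prob_eventually[OF d c]
    proof eventually_elim
      case (elim n)
      have "0 \<le> cyc_prob d c L n x" "cyc_prob d c L n x \<le> 1"
        unfolding cyc_prob_def using elim by (auto intro!: prb_nonneg prb_le_1 simp: possible_edges_eq)
      then show ?case by (simp add: abs_mult mult_left_le)
    qed
    show "(\<lambda>n. \<bar>m n - cyc_rate d c k\<bar>) \<longlonglongrightarrow> 0" using m by (simp add: LIM_zero tendsto_rabs_zero)
  qed
  ultimately have "(\<lambda>n. (real (x k + 1) * cyc_prob d c L n (x(k := x k + 1)) - m n * cyc_prob d c L n x) +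
    (m n - cyc_rate d c k) * cyc_prob d c L n x) \<longlonglongrightarrow> 0 + 0" by (rule tendsto_add)
  then show ?thesis by (simp add: algebra_simps)
qed

definition pois_weight :: "nat \<Rightarrow> real \<Rightarrow> nat \<Rightarrow> (nat \<Rightarrow> nat) \<Rightarrow> real" where
  "pois_weight d c L x = (\<Prod>k=2..L. cyc_rate d c k ^ x k / fact (x k))"

text \<open>Induction on the total number of cycles, removing one at a time: the recursion fixes
  every probability up to a common factor, the probability of the zero vector.\<close>

lemma cyc_prob_relative:
  assumes d: "3 \<le> d" and c: "0 < c"
  shows "(\<lambda>n. cyc_prob d c L n x - pois_weight d c L x * cyc_prob d c L n (\<lambda>_. 0)) \<longlonglongrightarrow> 0"
proof (induction "\<Sum>k=2..L. x k" arbitrary: x)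
  case 0
  then have x: "\<forall>k\<in>{2..L}. x k = 0" by (simp add: sum_eq_0_iff)
  then have "cyc_prob d c L n x = cyc_prob d c L n (\<lambda>_. 0)" for n
    unfolding cyc_prob_def by (intro prb_cong) auto
  moreover have "pois_weight d c L x = 1" unfolding pois_weight_def using x by simp
  ultimately show ?case by simp
next
  case (Suc s)
  then have "(\<Sum>k=2..L. x k) \<noteq> 0" by linarith
  then have "\<exists>k\<in>{2..L}. x k > 0" by (metis gr0I sum.neutral)
  then obtain k where k: "k \<in> {2..L}" "x k > 0" by blast
  define y where "y = x(k := x k - 1)"
  have xy: "x = y(k := y k + 1)" "y k + 1 = x k" using k unfolding y_def by auto
  have "(\<Sum>k=2..L. x k) = x k + (\<Sum>j\<in>{2..L} - {k}. x j)" "(\<Sum>k=2..L. y k) = y k + (\<Sum>j\<in>{2..L} - {k}. y j)"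
    by (rule sum.remove[OF _ k(1)], simp)+
  moreover have "(\<Sum>j\<in>{2..L} - {k}. y j) = (\<Sum>j\<in>{2..L} - {k}. x j)" unfolding y_def by (intro sum.cong) auto
  ultimately have "s = (\<Sum>k=2..L. y k)" using Suc.hyps(2) xy(2) by linarith
  then have IH: "(\<lambda>n. cyc_prob d c L n y - pois_weight d c L y * cyc_prob d c L n (\<lambda>_. 0)) \<longlonglongrightarrow> 0" by (rule Suc.hyps(1))
  have w: "pois_weight d c L x = cyc_rate d c k / real (x k) * pois_weight d c L y"
  proof -
    let ?f = "\<lambda>x j. cyc_rate d c j ^ x j / fact (x j)"
    have "(\<Prod>j=2..L. ?f x j) = ?f x k * (\<Prod>j\<in>{2..L} - {k}. ?f x j)" "(\<Prod>j=2..L. ?f y j) = ?f y k * (\<Prod>j\<in>{2..L} - {k}. ?f y j)"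
      by (rule prod.remove[OF _ k(1)], simp)+
    moreover have "(\<Prod>j\<in>{2..L} - {k}. ?f y j) = (\<Prod>j\<in>{2..L} - {k}. ?f x j)" unfolding y_def by (intro prod.cong) auto
    moreover have "?f x k = cyc_rate d c k / real (x k) * ?f y k" 
      using xy(2) by (simp flip: xy(2))
    ultimately show ?thesis unfolding pois_weight_def by (simp add: mult_ac)
  qed
  have x0: "real (x k) \<noteq> 0" using k by simp
  have yx: "y(k := x k) = x" unfolding y_def by auto
  have "(\<lambda>n. (real (y k + 1) * cyc_prob d c L n (y(k := y k + 1)) - cyc_rate d c k * cyc_prob d c L n y) / real (x k) +
      cyc_rate d c k / real (x k) * (cyc_prob d c L n y - pois_weight d c L y * cyc_prob d c L n (\<lambda>_. 0)))
    \<longlonglongrightarrow> 0 / real (x k) + cyc_rate d c k / real (x k) * 0"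
    by (intro tendsto_intros cyc_prob_recursion[OF d c k(1)] IH x0)
  moreover have "(real (y k + 1) * cyc_prob d c L n (y(k := y k + 1)) - cyc_rate d c k * cyc_prob d c L n y) / real (x k) +
      cyc_rate d c k / real (x k) * (cyc_prob d c L n y - pois_weight d c L y * cyc_prob d c L n (\<lambda>_. 0)) =
      cyc_prob d c L n x - pois_weight d c L x * cyc_prob d c L n (\<lambda>_. 0)" for n
    unfolding w xy(2) yx using x0 by (simp add: field_simps)
  ultimately show ?case by simp
qed

section \<open>Normalisation of the Poisson law\<close>

definition pois_total :: "nat \<Rightarrow> real \<Rightarrow> nat \<Rightarrow> real" where
  "pois_total d c L = (\<Sum>k=2..L. cyc_rate d c k)"

definition box_weight :: "nat \<Rightarrow> real \<Rightarrow> nat \<Rightarrow> nat \<Rightarrow> real" where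
  "box_weight d c L M = (\<Prod>k=2..L. \<Sum>m\<le>M. cyc_rate d c k ^ m / fact m)"

lemma box_weight_sum:
  "box_weight d c L M = (\<Sum>x\<in>PiE {2..L} (\<lambda>_. {..M}). pois_weight d c L x)"
  unfolding box_weight_def pois_weight_def by (rule prod_sum_PiE) auto

lemma box_weight_tendsto: "(\<lambda>M. box_weight d c L M) \<longlonglongrightarrow> exp (pois_total d c L)"
proof -
  have "(\<lambda>M. \<Sum>m\<le>M. x ^ m / fact m) \<longlonglongrightarrow> exp x" for x :: real
    using exp_converges[of x] unfolding sums_def_le by (simp add: divide_inverse mult.commute)
  then have "(\<lambda>M. box_weight d c L M) \<longlonglongrightarrow> (\<Prod>k=2..L. exp (cyc_rate d c k))"
    unfolding box_weight_def by (intro tendsto_prod) auto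
  then show ?thesis by (simp add: pois_total_def exp_sum)
qed

lemma cyc_rate_nonneg: "0 < c \<Longrightarrow> 0 \<le> cyc_rate d c k" unfolding cyc_rate_def by simp

lemma box_weight_ge_1: "0 < c \<Longrightarrow> 1 \<le> box_weight d c L M"
proof -
  assume c: "0 < c"
  have "1 \<le> (\<Sum>m\<le>M. cyc_rate d c k ^ m / fact m)" for k
    using member_le_sum[of 0 "{..M}" "\<lambda>m. cyc_rate d c k ^ m / fact m"] cyc_rate_nonneg[OF c, of d k] by simp
  then show ?thesis unfolding box_weight_def by (intro prod_ge_1) auto
qed

text \<open>The common factor is found by summation. The vectors in a large box have probabilities
  that add up to almost 1, by Markov's inequality, and to almost \<open>box_weight\<close> times the
  factor, by \<open>cyc_prob_relative\<close>; the box weight tends to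
  \<open>exp (pois_total d c L)\<close>.\<close>

lemma no_short_cycle_prob:
  assumes d: "3 \<le> d" and c: "0 < c"
  shows "(\<lambda>n. cyc_prob d c L n (\<lambda>_. 0)) \<longlonglongrightarrow> exp (- pois_total d c L)"
proof (rule LIMSEQ_I)
  fix r :: real assume r: "0 < r"
  let ?q = "\<lambda>n. cyc_prob d c L n (\<lambda>_. 0)"
  \<comment> \<open>\<open>B\<close> dominates the sum of the expected cycle counts once each is
    within 1 of its limit. Markov's inequality then costs B / (M + 1), and the 1 in
    \<open>B + 1\<close> below absorbs the error of the summation.\<close>
  define B where "B = (\<Sum>k=2..L. cyc_rate d c k + 1)"
  have B0: "0 \<le> B" unfolding B_def using cyc_rate_nonneg[OF c] by (intro sum_nonneg) (simp add: add_nonneg_pos less_imp_le)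
  have "(\<lambda>M. (B + 1) / (real M + 1)) \<longlonglongrightarrow> 0"
    using LIMSEQ_Suc[OF lim_const_over_n[of "B + 1"]] by (simp add: add.commute)
  moreover have "(\<lambda>M. inverse (box_weight d c L M)) \<longlonglongrightarrow> inverse (exp (pois_total d c L))"
    by (intro tendsto_inverse box_weight_tendsto) simp
  ultimately have "\<forall>\<^sub>F M in sequentially. (B + 1) / (real M + 1) < r / 2 \<and>
      dist (inverse (box_weight d c L M)) (inverse (exp (pois_total d c L))) < r / 2"
    using r by (intro eventually_conj order_tendstoD(2) tendstoD) auto
  then obtain M where M: "(B + 1) / (real M + 1) < r / 2"
     "dist (inverse (box_weight d c L M)) (inverse (exp (pois_total d c L))) < r / 2"
    by (metis (mono_tags, lifting) eventually_sequentially order_refl)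
  let ?P = "PiE {2..L} (\<lambda>_. {..M})" and ?W = "box_weight d c L M"
  have finP: "finite ?P" by (intro finite_PiE) auto
  have "(\<lambda>n. \<Sum>x\<in>?P. (cyc_prob d c L n x - pois_weight d c L x * ?q n)) \<longlonglongrightarrow> (\<Sum>x\<in>?P. 0)"
    by (intro tendsto_sum cyc_prob_relative[OF d c])
  then have "(\<lambda>n. (\<Sum>x\<in>?P. cyc_prob d c L n x) - ?W * ?q n) \<longlonglongrightarrow> 0"
    by (simp add: sum_subtractf box_weight_sum sum_distrib_right)
  from tendstoD[OF this, of "1 / (real M + 1)"]
  have ev1: "\<forall>\<^sub>F n in sequentially. \<bar>(\<Sum>x\<in>?P. cyc_prob d c L n x) - ?W * ?q n\<bar> < 1 / (real M + 1)"
    by (simp add: dist_real_def)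
  let ?m = "\<lambda>k n. real (card {C. is_cycle d k C \<and> C \<subseteq> possible_edges d n}) * (c / real n ^ (d - 1)) ^ k"
  have ev2: "\<forall>\<^sub>F n in sequentially. \<forall>k\<in>{2..L}. ?m k n < cyc_rate d c k + 1"
    using order_tendstoD(2)[OF cyc_mean_tendsto[OF d]] by (intro eventually_ball_finite) auto
  have "\<forall>\<^sub>F n in sequentially. \<bar>?q n - exp (- pois_total d c L)\<bar> < r"
    using ev1 ev2 edge_prob_eventually[OF d c]
  proof eventually_elim
    case (elim n)
    let ?A = "possible_edges d n" and ?p = "c / real n ^ (d - 1)"
    have p: "0 \<le> ?p" "?p \<le> 1" using elim by auto
    have finA: "finite ?A" by (simp add: possible_edges_eq)
    have "(\<Sum>x\<in>?P. cyc_prob d c L n x) = prb ?A ?p (\<lambda>g. \<exists>x\<in>?P. \<forall>k\<in>{2..L}. ncyc d k g = x k)"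
      unfolding cyc_prob_def by (rule prb_Ex_disjoint[OF finP, symmetric]) (metis PiE_ext)
    also have "\<dots> = prb ?A ?p (\<lambda>g. \<forall>k\<in>{2..L}. ncyc d k g \<le> M)"
    proof (rule prb_cong, rule iffI)
      fix g :: "nat set set" assume "\<forall>k\<in>{2..L}. ncyc d k g \<le> M"
      then show "\<exists>x\<in>?P. \<forall>k\<in>{2..L}. ncyc d k g = x k"
        by (intro bexI[of _ "restrict (\<lambda>k. ncyc d k g) {2..L}"]) auto
    qed (fastforce simp: PiE_iff)
    finally have S: "(\<Sum>x\<in>?P. cyc_prob d c L n x) = prb ?A ?p (\<lambda>g. \<forall>k\<in>{2..L}. ncyc d k g \<le> M)" .
    have S1: "(\<Sum>x\<in>?P. cyc_prob d c L n x) \<le> 1" unfolding S by (rule prb_le_1[OF p finA])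
    have mean: "bexp ?A ?p (\<lambda>g. real (ncyc d k g)) = ?m k n" for k
    proof -
      let ?C = "{C. is_cycle d k C \<and> C \<subseteq> ?A}"
      have finC: "finite ?C" by (rule finite_subset[of _ "Pow ?A"]) (use finA in auto)
      have "bexp ?A ?p (\<lambda>g. real (ncyc d k g)) = bexp ?A ?p (\<lambda>g. \<Sum>C\<in>?C. of_bool (C \<subseteq> g))"
      proof (rule bexp_cong)
        fix g assume g: "g \<subseteq> ?A"
        have "{C. is_cycle d k C \<and> C \<subseteq> g} = {C \<in> ?C. C \<subseteq> g}" using g by auto
        then show "real (ncyc d k g) = (\<Sum>C\<in>?C. of_bool (C \<subseteq> g))"
          unfolding ncyc_def using finC by (simp add: of_bool_def sum.If_cases Int_def conj_commute)
      qed
      also have "\<dots> = (\<Sum>C\<in>?C. prb ?A ?p (\<lambda>g. C \<subseteq> g))" unfolding prb_def by (rule bexp_sum)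
      also have "\<dots> = (\<Sum>C\<in>?C. ?p ^ k)"
      proof (rule sum.cong[OF refl])
        fix C assume C: "C \<in> ?C"
        then have "card C = k" using cycle_card[OF d] by blast
        then show "prb ?A ?p (\<lambda>g. C \<subseteq> g) = ?p ^ k" using prb_contains[OF finA, of C ?p] C by simp
      qed
      finally show ?thesis by simp
    qed
    have "1 - (\<Sum>x\<in>?P. cyc_prob d c L n x) = prb ?A ?p (\<lambda>g. \<not> (\<forall>k\<in>{2..L}. ncyc d k g \<le> M))"
      unfolding S by (rule prb_not[OF finA, symmetric])
    also have "\<dots> \<le> prb ?A ?p (\<lambda>g. \<exists>k\<in>{2..L}. real M + 1 \<le> real (ncyc d k g))"
      by (rule prb_mono[OF p]) force
    also have "\<dots> \<le> (\<Sum>k=2..L. prb ?A ?p (\<lambda>g. real M + 1 \<le> real (ncyc d k g)))"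
      by (rule prb_Ex_le[OF p]) simp
    also have "\<dots> \<le> (\<Sum>k=2..L. (cyc_rate d c k + 1) / (real M + 1))"
    proof (rule sum_mono)
      fix k assume k: "k \<in> {2..L}"
      have "prb ?A ?p (\<lambda>g. real M + 1 \<le> real (ncyc d k g)) \<le> bexp ?A ?p (\<lambda>g. real (ncyc d k g)) / (real M + 1)"
        by (rule prb_markov[OF p]) auto
      also have "\<dots> \<le> (cyc_rate d c k + 1) / (real M + 1)"
        unfolding mean using elim(2) k by (intro divide_right_mono) (auto simp: less_imp_le)
      finally show "prb ?A ?p (\<lambda>g. real M + 1 \<le> real (ncyc d k g)) \<le> (cyc_rate d c k + 1) / (real M + 1)" .
    qed
    also have "\<dots> = B / (real M + 1)" unfolding B_def by (simp add: sum_divide_distrib)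
    finally have S2: "1 - (\<Sum>x\<in>?P. cyc_prob d c L n x) \<le> B / (real M + 1)" .
    have "\<bar>1 - ?W * ?q n\<bar> \<le> B / (real M + 1) + 1 / (real M + 1)" using S1 S2 elim(1) by linarith
    then have b1: "\<bar>1 - ?W * ?q n\<bar> \<le> (B + 1) / (real M + 1)" by (simp add: add_divide_distrib)
    have W1: "1 \<le> ?W" by (rule box_weight_ge_1[OF c])
    have "\<bar>inverse ?W - ?q n\<bar> = \<bar>1 - ?W * ?q n\<bar> / ?W" using W1 by (simp add: field_simps abs_if)
    also have "\<dots> \<le> \<bar>1 - ?W * ?q n\<bar> / 1" using W1 by (intro divide_left_mono) auto
    finally have "\<bar>inverse ?W - ?q n\<bar> \<le> \<bar>1 - ?W * ?q n\<bar>" by simp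
    then have "\<bar>inverse ?W - ?q n\<bar> < r / 2" using b1 M(1) by (meson le_less_trans order_trans)
    moreover have "\<bar>inverse ?W - exp (- pois_total d c L)\<bar> < r / 2"
      using M(2) by (simp add: dist_real_def exp_minus)
    ultimately show ?case by linarith
  qed
  then show "\<exists>no. \<forall>n\<ge>no. norm (?q n - exp (- pois_total d c L)) < r" by (simp add: eventually_sequentially)
qed

theorem cyc_prob_tendsto:
  assumes d: "3 \<le> d" and c: "0 < c"
  shows "(\<lambda>n. cyc_prob d c L n x) \<longlonglongrightarrow> exp (- pois_total d c L) * pois_weight d c L x"
proof -
  have "(\<lambda>n. (cyc_prob d c L n x - pois_weight d c L x * cyc_prob d c L n (\<lambda>_. 0)) +
      pois_weight d c L x * cyc_prob d c L n (\<lambda>_. 0)) \<longlonglongrightarrow> 0 + pois_weight d c L x * exp (- pois_total d c L)"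
    by (intro tendsto_intros cyc_prob_relative[OF d c] no_short_cycle_prob[OF d c])
  then show ?thesis by (simp add: mult.commute)
qed

section \<open>Isolated tree components\<close>

text \<open>For p \<le> 1/2 the bounds -p - 2p^2 \<le> ln (1 - p) \<le> -p squeeze the logarithm,
  since p tends to 0 while p m has a limit.\<close>

lemma one_minus_power_tendsto:
  fixes p :: "nat \<Rightarrow> real" and m :: "nat \<Rightarrow> nat"
  assumes p0: "p \<longlonglongrightarrow> 0" and pos: "\<And>n. 0 \<le> p n" and mp: "(\<lambda>n. p n * real (m n)) \<longlonglongrightarrow> x"
  shows "(\<lambda>n. (1 - p n) ^ m n) \<longlonglongrightarrow> exp (- x)"
proof -
  have ev: "\<forall>\<^sub>F n in sequentially. p n < 1 / 2" using order_tendstoD(2)[OF p0, of "1/2"] by simp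
  have "(\<lambda>n. real (m n) * ln (1 - p n)) \<longlonglongrightarrow> - x"
  proof (rule tendsto_sandwich)
    show "\<forall>\<^sub>F n in sequentially. - (p n * real (m n)) - 2 * p n * (p n * real (m n)) \<le> real (m n) * ln (1 - p n)"
      using ev
    proof eventually_elim
      case (elim n)
      have "real (m n) * (- p n - 2 * (p n)\<^sup>2) \<le> real (m n) * ln (1 - p n)"
        using ln_one_minus_pos_lower_bound[of "p n"] pos[of n] elim by (intro mult_left_mono) auto
      then show ?case by (simp add: algebra_simps power2_eq_square)
    qed
    show "\<forall>\<^sub>F n in sequentially. real (m n) * ln (1 - p n) \<le> - (p n * real (m n))"
      using ev
    proof eventually_elim
      case (elim n)
      have "real (m n) * ln (1 - p n) \<le> real (m n) * (- p n)"
        using ln_one_minus_pos_upper_bound[of "p n"] pos[of n] elim by (intro mult_left_mono) auto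
      then show ?case by (simp add: mult.commute)
    qed
    have "(\<lambda>n. - (p n * real (m n)) - 2 * p n * (p n * real (m n))) \<longlonglongrightarrow> - x - 2 * 0 * x"
      by (intro tendsto_intros mp p0)
    then show "(\<lambda>n. - (p n * real (m n)) - 2 * p n * (p n * real (m n))) \<longlonglongrightarrow> - x" by simp
    show "(\<lambda>n. - (p n * real (m n))) \<longlonglongrightarrow> - x" by (intro tendsto_intros mp)
  qed
  then have "(\<lambda>n. exp (real (m n) * ln (1 - p n))) \<longlonglongrightarrow> exp (- x)" by (rule tendsto_exp)
  moreover have "\<forall>\<^sub>F n in sequentially. exp (real (m n) * ln (1 - p n)) = (1 - p n) ^ m n"
    using ev by eventually_elim (simp add: exp_of_nat_mult)
  ultimately show ?thesis by (rule Lim_transform_eventually)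
qed

lemma choose_diff_sum: "1 \<le> d \<Longrightarrow> ((n + i) choose d) = (n choose d) + (\<Sum>j<i. (n + j) choose (d - 1))"
proof (induction i)
  case (Suc i)
  then obtain d' where "d = Suc d'" by (cases d) auto
  then show ?case using Suc by simp
qed simp

lemma edge_prob_shift_tendsto_0: "3 \<le> d \<Longrightarrow> (\<lambda>n. c / real (n + b) ^ (d - 1)) \<longlonglongrightarrow> 0"
  using LIMSEQ_ignore_initial_segment[OF edge_prob_tendsto_0, of d c b] .

text \<open>About i n^(d-1) / (d-1)! possible edges meet \<open>i\<close> given vertices, so the
  chance that all of them but \<open>e\<close> are absent has a limit. The shift \<open>b\<close>
  serves two uses: planting on top of n vertices (b = 0) and a neighbourhood inside the vertex set
  (b = i).\<close>

lemma nonedge_tendsto: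
  assumes d: "3 \<le> d" and c: "0 < c"
  shows "(\<lambda>n. (1 - c / real (n + b) ^ (d - 1)) ^ (((n + i) choose d) - (n choose d) - e)) \<longlonglongrightarrow>
    exp (- (c * real i / fact (d - 1)))"
proof (rule one_minus_power_tendsto)
  let ?p = "\<lambda>n. c / real (n + b) ^ (d - 1)" and ?s = "\<lambda>n. \<Sum>j<i. (n + j) choose (d - 1)"
  show p0: "?p \<longlonglongrightarrow> 0" by (rule edge_prob_shift_tendsto_0[OF d])
  show "0 \<le> ?p n" for n using c by simp
  have s: "((n + i) choose d) - (n choose d) = ?s n" for n using choose_diff_sum[of d n i] d by simp
  have "(\<lambda>n. c * (\<Sum>j<i. real ((n + j) choose (d - 1)) / real (n + b) ^ (d - 1))) \<longlonglongrightarrow> c * (\<Sum>j<i. 1 / fact (d - 1))"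
    by (intro tendsto_intros binomial_asymp)
  then have lim: "(\<lambda>n. ?p n * real (?s n)) \<longlonglongrightarrow> c * real i / fact (d - 1)"
    by (simp add: sum_distrib_left sum_divide_distrib)
  show "(\<lambda>n. ?p n * real (((n + i) choose d) - (n choose d) - e)) \<longlonglongrightarrow> c * real i / fact (d - 1)"
    unfolding s
  proof (rule tendsto_sandwich[OF _ _ _ lim])
    show "\<forall>\<^sub>F n in sequentially. ?p n * real (?s n) - ?p n * real e \<le> ?p n * real (?s n - e)"
    proof (intro always_eventually allI)
      fix n
      have "?p n * (real (?s n) - real e) \<le> ?p n * real (?s n - e)" using c by (intro mult_left_mono) (linarith, simp)
      then show "?p n * real (?s n) - ?p n * real e \<le> ?p n * real (?s n - e)" by (simp only: right_diff_distrib)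
    qed
    show "\<forall>\<^sub>F n in sequentially. ?p n * real (?s n - e) \<le> ?p n * real (?s n)"
      using c by (intro always_eventually allI mult_left_mono of_nat_mono) simp_all
    have "(\<lambda>n. ?p n * real (?s n) - ?p n * real e) \<longlonglongrightarrow> c * real i / fact (d - 1) - 0 * real e"
      by (intro tendsto_diff tendsto_mult lim p0 tendsto_const)
    then show "(\<lambda>n. ?p n * real (?s n) - ?p n * real e) \<longlonglongrightarrow> c * real i / fact (d - 1)" by simp
  qed
qed

lemma card_edges_meeting:
  assumes "finite V" "I \<subseteq> V"
  shows "card {e \<in> all_edges d V. e \<inter> I \<noteq> {}} = (card V choose d) - ((card V - card I) choose d)"
proof -
  have finI: "finite I" using assms finite_subset by blast
  have "{e \<in> all_edges d V. e \<inter> I \<noteq> {}} = all_edges d V - all_edges d (V - I)"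
    unfolding all_edges_def by auto
  moreover have "all_edges d (V - I) \<subseteq> all_edges d V" unfolding all_edges_def by auto
  ultimately show ?thesis
    using assms finI by (simp add: card_Diff_subset card_all_edges)
qed

section \<open>Isolated copies of a rooted tree\<close>

text \<open>Connectedness comes from the ball condition. The vertex count of a tree enters as a
  strict inequality, the form that makes the expected number of copies grow at least like n.\<close>

definition is_tree :: "nat \<Rightarrow> nat \<Rightarrow> 'a set \<Rightarrow> 'a set set \<Rightarrow> 'a \<Rightarrow> bool" where
  "is_tree d r W T x \<longleftrightarrow> finite W \<and> T \<subseteq> all_edges d W \<and> x \<in> W \<and> ball_of T r {x} = W \<and> (d - 1) * card T < card W"

text \<open>All edges that touch \<open>U\<close> must belong to the copy, so copies are isolated.
  They are recorded by their vertex sets, which makes different copies of a tree disjoint.\<close>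

definition copies :: "'b set \<Rightarrow> 'b set set \<Rightarrow> 'a set \<Rightarrow> 'a set set \<Rightarrow> 'a set set" where
  "copies W T V g = {U. U \<subseteq> V \<and> (\<exists>h. inj_on h W \<and> h ` W = U \<and> {e \<in> g. e \<inter> U \<noteq> {}} = (`) h ` T)}"

lemma copy_ball:
  assumes T: "is_tree d r W T x" and h: "inj_on h W" "h ` W = U" "{e \<in> g. e \<inter> U \<noteq> {}} = (`) h ` T"
  shows "ball_of g r {h x} = U" and "e \<in> g \<Longrightarrow> e \<inter> U \<noteq> {} \<Longrightarrow> e \<subseteq> U"
proof -
  have TW: "\<Union>T \<subseteq> W" "x \<in> W" "ball_of T r {x} = W" using T unfolding is_tree_def all_edges_def by auto
  have b: "ball_of ((`) h ` T) j (h ` {x}) = h ` ball_of T j {x}" for j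
    by (rule ball_of_image[OF h(1) TW(1)]) (use TW in auto)
  have "ball_of g r {h x} = ball_of ((`) h ` T) r {h x}"
  proof (rule ball_of_local[OF _ _ order_refl])
    show "(`) h ` T \<subseteq> g" using h(3) by blast
    fix e assume "e \<in> g" "e \<inter> ball_of ((`) h ` T) r {h x} \<noteq> {}"
    then show "e \<in> (`) h ` T" using b[of r] TW(3) h(2,3) by auto
  qed
  then show "ball_of g r {h x} = U" using b[of r] TW(3) h(2) by simp
  show "e \<subseteq> U" if "e \<in> g" "e \<inter> U \<noteq> {}"
  proof -
    have "e \<in> (`) h ` T" using that h(3) by auto
    then show ?thesis using TW(1) h(2) by auto
  qed
qed

text \<open>An isolated copy is left by no edge, and it is the ball around its own root; hence it
  contains every isolated copy that it meets.\<close>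

lemma copies_disjoint:
  assumes T: "is_tree d r W T x" and U: "U \<in> copies W T V g" "U' \<in> copies W T V' g" "U \<inter> U' \<noteq> {}"
  shows "U = U'"
proof -
  have sub: "U1 \<subseteq> U2" if U1: "U1 \<in> copies W T V1 g" and U2: "U2 \<in> copies W T V2 g" and z: "z \<in> U1" "z \<in> U2" for U1 U2 V1 V2 z
  proof -
    obtain h1 where h1: "inj_on h1 W" "h1 ` W = U1" "{e \<in> g. e \<inter> U1 \<noteq> {}} = (`) h1 ` T" using U1 unfolding copies_def by auto
    obtain h2 where h2: "inj_on h2 W" "h2 ` W = U2" "{e \<in> g. e \<inter> U2 \<noteq> {}} = (`) h2 ` T" using U2 unfolding copies_def by auto
    have "h1 x \<in> ball_of g r {z}" using z(1) copy_ball(1)[OF T h1] ball_of_sym by metis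
    moreover have "ball_of g k {y} \<subseteq> U2" if "y \<in> U2" for k y
      by (rule ball_of_closed) (use that copy_ball(2)[OF T h2] in auto)
    ultimately have "h1 x \<in> U2" using z(2) by blast
    then show ?thesis using \<open>\<And>k y. y \<in> U2 \<Longrightarrow> ball_of g k {y} \<subseteq> U2\<close> copy_ball(1)[OF T h1] by metis
  qed
  obtain z where z: "z \<in> U" "z \<in> U'" using U(3) by auto
  show ?thesis using sub[OF U(1,2) z] sub[OF U(2,1) z(2,1)] by simp
qed

lemma copies_relabel:
  assumes \<pi>: "bij_betw \<pi> V V'" and g: "g \<subseteq> all_edges d V"
  shows "copies W T V' ((`) \<pi> ` g) \<subseteq> (`) \<pi> ` copies W T V g"
proof
  fix U' assume "U' \<in> copies W T V' ((`) \<pi> ` g)"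
  then obtain h where h: "U' \<subseteq> V'" "inj_on h W" "h ` W = U'" "{e \<in> (`) \<pi> ` g. e \<inter> U' \<noteq> {}} = (`) h ` T"
    unfolding copies_def by auto
  have inj: "inj_on \<pi> V" and V': "V' = \<pi> ` V" using \<pi> by (auto simp: bij_betw_def)
  define i where "i = the_inv_into V \<pi>"
  have i1: "i (\<pi> x) = x" if "x \<in> V" for x unfolding i_def by (rule the_inv_into_f_f[OF inj that])
  have i2: "\<pi> (i y) = y" "i y \<in> V" if "y \<in> V'" for y
    using that i1 unfolding V' by auto
  define U where "U = i ` U'"
  have UV: "U \<subseteq> V" using i2 h(1) unfolding U_def by auto
  have pU: "\<pi> ` U = U'" using i2 h(1) unfolding U_def by (force simp: image_image)
  have ie: "i ` \<pi> ` e = e" if "e \<subseteq> V" for e using i1 that by (force simp: image_image)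
  have meet: "\<pi> ` e \<inter> U' \<noteq> {} \<longleftrightarrow> e \<inter> U \<noteq> {}" if "e \<subseteq> V" for e
    using inj_on_image_Int[OF inj that UV] unfolding pU[symmetric] by (metis image_is_empty)
  have gV: "e \<subseteq> V" if "e \<in> g" for e using g that unfolding all_edges_def by auto
  have "inj_on (i \<circ> h) W"
  proof (rule comp_inj_on[OF h(2)])
    show "inj_on i (h ` W)" using i2(1) h(1,3) by (metis inj_onI subsetD)
  qed
  moreover have "(i \<circ> h) ` W = U" unfolding U_def h(3)[symmetric] by (simp add: image_image)
  moreover have "{e \<in> g. e \<inter> U \<noteq> {}} = (`) (i \<circ> h) ` T"
  proof -
    have "{e \<in> g. e \<inter> U \<noteq> {}} = (`) i ` (`) \<pi> ` {e \<in> g. e \<inter> U \<noteq> {}}"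
      using ie gV by (force simp: image_image)
    also have "(`) \<pi> ` {e \<in> g. e \<inter> U \<noteq> {}} = {e \<in> (`) \<pi> ` g. e \<inter> U' \<noteq> {}}"
    proof (intro equalityI subsetI)
      fix e' assume "e' \<in> {e \<in> (`) \<pi> ` g. e \<inter> U' \<noteq> {}}"
      then obtain e where "e \<in> g" "e' = \<pi> ` e" "\<pi> ` e \<inter> U' \<noteq> {}" by auto
      then show "e' \<in> (`) \<pi> ` {e \<in> g. e \<inter> U \<noteq> {}}" using meet[OF gV] by simp
    next
      fix e' assume "e' \<in> (`) \<pi> ` {e \<in> g. e \<inter> U \<noteq> {}}"
      then obtain e where "e \<in> g" "e' = \<pi> ` e" "e \<inter> U \<noteq> {}" by auto
      then show "e' \<in> {e \<in> (`) \<pi> ` g. e \<inter> U' \<noteq> {}}" using meet[OF gV] by simp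
    qed
    also have "(`) i ` \<dots> = (`) (i \<circ> h) ` T" unfolding h(4) by (simp add: image_image image_comp)
    finally show ?thesis .
  qed
  ultimately have "U \<in> copies W T V g" unfolding copies_def using UV by blast
  then show "U' \<in> (`) \<pi> ` copies W T V g" using pU by blast
qed

lemma copies_finite: "finite V \<Longrightarrow> finite (copies W T V g)"
  unfolding copies_def by (auto intro: finite_subset[of _ "Pow V"])

lemma card_copies_relabel:
  assumes "bij_betw \<pi> V V'" "g \<subseteq> all_edges d V" "finite V"
  shows "card (copies W T V' ((`) \<pi> ` g)) \<le> card (copies W T V g)"
  using card_mono[OF _ copies_relabel[OF assms(1,2)], of W T] card_image_le[of "copies W T V g" "(`) \<pi>"]
    copies_finite[OF assms(3), of W T g] by (meson finite_imageI le_trans)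

lemma bij_betw_all_edges: "bij_betw \<pi> V V' \<Longrightarrow> bij_betw ((`) \<pi>) (all_edges d V) (all_edges d V')"
proof -
  assume \<pi>: "bij_betw \<pi> V V'"
  have inj: "inj_on \<pi> V" using \<pi> by (simp add: bij_betw_def)
  have "(`) \<pi> ` all_edges d V = all_edges d V'"
  proof (intro equalityI subsetI)
    fix e assume "e \<in> (`) \<pi> ` all_edges d V"
    then obtain f where f: "f \<subseteq> V" "card f = d" "e = \<pi> ` f" unfolding all_edges_def by auto
    then show "e \<in> all_edges d V'" using \<pi> card_image[OF inj_on_subset[OF inj f(1)]] unfolding all_edges_def bij_betw_def by auto
  next
    fix e assume "e \<in> all_edges d V'"
    then have e: "e \<subseteq> \<pi> ` V" "card e = d" using \<pi> unfolding all_edges_def bij_betw_def by auto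
    then obtain f where f: "f \<subseteq> V" "e = \<pi> ` f" by (meson subset_imageE)
    then show "e \<in> (`) \<pi> ` all_edges d V" using e card_image[OF inj_on_subset[OF inj f(1)]] unfolding all_edges_def by auto
  qed
  moreover have "inj_on ((`) \<pi>) (all_edges d V)"
    using inj unfolding all_edges_def by (intro inj_onI) (simp add: inj_on_image_eq_iff)
  ultimately show ?thesis by (simp add: bij_betw_def)
qed

text \<open>Size biasing: planting an isolated copy of the tree on \<open>v\<close> additional vertices bounds the probability
  of few copies by the reciprocal of the expected number of copies.\<close>

lemma few_copies_bound:
  assumes d: "3 \<le> d" and T: "is_tree d r W T x" and p: "0 \<le> p" "p \<le> 1"
  shows "real ((n + card W) choose card W) * (p ^ card T * (1 - p) ^ (((n + card W) choose d) - (n choose d) - card T)) *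
    prb (all_edges d {1..n}) p (\<lambda>g. card (copies W T {1..n} g) \<le> m) \<le> real (m + 1)"
proof -
  define v where "v = card W"
  let ?V = "{1..n + v}" and ?A = "all_edges d {1..n + v}"
  let ?P = "prb (all_edges d {1..n}) p (\<lambda>g. card (copies W T {1..n} g) \<le> m)"
  let ?w = "p ^ card T * (1 - p) ^ (((n + v) choose d) - (n choose d) - card T)"
  have finW: "finite W" and TW: "T \<subseteq> all_edges d W" and xW: "x \<in> W" using T unfolding is_tree_def by auto
  have finT: "finite T" using TW finW finite_subset finite_all_edges by metis
  have finA: "finite ?A" by simp
  let ?U = "{U. U \<subseteq> ?V \<and> card U = v}"
  have finU: "finite ?U" by simp
  have "\<exists>h. bij_betw h W U" if "U \<in> ?U" for U
  proof -
    have "finite U" "card W = card U" using that finite_subset[of U ?V] by (simp_all add: v_def)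
    then show ?thesis by (rule finite_same_card_bij[OF finW])
  qed
  then obtain h where h: "\<And>U. U \<in> ?U \<Longrightarrow> bij_betw (h U) W U" by metis
  define F where "F U = {e \<in> ?A. e \<inter> U \<noteq> {}}" for U
  define H where "H U = (`) (h U) ` T" for U
  have HU: "H U \<subseteq> all_edges d U" if "U \<in> ?U" for U
  proof -
    have "(`) (h U) ` all_edges d W = all_edges d U"
      using bij_betw_all_edges[OF h[OF that], of d] by (simp add: bij_betw_def)
    then show ?thesis using image_mono[OF TW, of "(`) (h U)"] unfolding H_def by simp
  qed
  have cH: "card (H U) = card T" if "U \<in> ?U" for U
    using bij_betw_all_edges[OF h[OF that], of d] TW unfolding H_def bij_betw_def
    by (meson card_image inj_on_subset)
  have HF: "H U \<subseteq> F U" if U: "U \<in> ?U" for U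
  proof
    fix e assume "e \<in> H U"
    then have e: "e \<subseteq> U" "card e = d" using HU[OF U] unfolding all_edges_def by auto
    then have "e \<noteq> {}" using d by auto
    then show "e \<in> F U" unfolding F_def all_edges_def using e U by auto
  qed
  have cF: "card (F U - H U) = ((n + v) choose d) - (n choose d) - card T" if U: "U \<in> ?U" for U
  proof -
    have "card (F U) = ((n + v) choose d) - (n choose d)"
      unfolding F_def using card_edges_meeting[of ?V U d] U by simp
    moreover have "finite (H U)" unfolding H_def using finT by simp
    ultimately show ?thesis using cH[OF U] HF[OF U] by (simp add: card_Diff_subset)
  qed
  have isc: "U \<in> copies W T ?V g" if U: "U \<in> ?U" and g: "g \<subseteq> ?A" "g \<inter> F U = H U" for U g
  proof -
    have "{e \<in> g. e \<inter> U \<noteq> {}} = g \<inter> F U" using g(1) unfolding F_def by auto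
    then show ?thesis unfolding copies_def using h[OF U] U g(2) unfolding H_def bij_betw_def by auto
  qed
  \<comment> \<open>Each set \<open>U\<close> whose prescribed pattern occurs is an isolated copy,
    so no more of these events can hold at once than there are copies.\<close>
  have "(\<Sum>U\<in>?U. prb ?A p (\<lambda>g. g \<inter> F U = H U \<and> card (copies W T ?V g) \<le> m + 1)) \<le> real (m + 1)"
  proof -
    have "(\<Sum>U\<in>?U. prb ?A p (\<lambda>g. g \<inter> F U = H U \<and> card (copies W T ?V g) \<le> m + 1)) =
      bexp ?A p (\<lambda>g. \<Sum>U\<in>?U. of_bool (g \<inter> F U = H U \<and> card (copies W T ?V g) \<le> m + 1))"
      unfolding prb_def by (rule bexp_sum[symmetric])
    also have "\<dots> \<le> bexp ?A p (\<lambda>g. real (m + 1))"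
    proof (rule bexp_mono[OF p])
      fix g assume g: "g \<subseteq> ?A"
      show "(\<Sum>U\<in>?U. of_bool (g \<inter> F U = H U \<and> card (copies W T ?V g) \<le> m + 1)) \<le> real (m + 1)"
      proof (cases "card (copies W T ?V g) \<le> m + 1")
        case True
        have "(\<Sum>U\<in>?U. of_bool (g \<inter> F U = H U \<and> card (copies W T ?V g) \<le> m + 1)) = real (card {U \<in> ?U. g \<inter> F U = H U})"
          using True finU by (simp add: of_bool_def sum.If_cases Int_def conj_commute)
        also have "\<dots> \<le> real (card (copies W T ?V g))"
          using isc g by (intro of_nat_mono card_mono copies_finite) auto
        finally show ?thesis using True by linarith
      qed (simp del: of_nat_Suc)
    qed
    finally show ?thesis by (simp add: bexp_const)
  qed
  \<comment> \<open>Once \<open>U\<close> carries the planted copy, the rest is a random hypergraph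
    on n remaining vertices, and the copy on \<open>U\<close> adds just one to its count.\<close>
  moreover have "?w * ?P \<le> prb ?A p (\<lambda>g. g \<inter> F U = H U \<and> card (copies W T ?V g) \<le> m + 1)" if U: "U \<in> ?U" for U
  proof -
    have AF: "?A - F U = all_edges d (?V - U)" unfolding F_def all_edges_def by auto
    have FA: "F U \<subseteq> ?A" unfolding F_def by auto
    have "prb ?A p (\<lambda>g. g \<inter> F U = H U \<and> card (copies W T ?V g) \<le> m + 1) =
       bexp ?A p (\<lambda>g. of_bool (g \<inter> F U = H U) * of_bool (card (copies W T ?V g) \<le> m + 1))"
      unfolding prb_def by (simp add: of_bool_conj)
    also have "\<dots> = ?w * prb (all_edges d (?V - U)) p (\<lambda>b. card (copies W T ?V (H U \<union> b)) \<le> m + 1)"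
      unfolding bexp_exact[OF finA FA HF[OF U]] cF[OF U] cH[OF U] AF prb_def ..
    finally have eq: "prb ?A p (\<lambda>g. g \<inter> F U = H U \<and> card (copies W T ?V g) \<le> m + 1) =
      ?w * prb (all_edges d (?V - U)) p (\<lambda>b. card (copies W T ?V (H U \<union> b)) \<le> m + 1)" .
    have cVU: "card (?V - U) = card {1..n}" using U by (simp add: card_Diff_subset finite_subset[of U ?V])
    then obtain \<pi> where \<pi>: "bij_betw \<pi> {1..n} (?V - U)"
      using finite_same_card_bij[of "{1..n}" "?V - U"] by auto
    have "?P \<le> prb (all_edges d {1..n}) p (\<lambda>g. card (copies W T (?V - U) ((`) \<pi> ` g)) \<le> m)"
      by (rule prb_mono[OF p]) (use card_copies_relabel[OF \<pi>] in \<open>meson finite_atLeastAtMost le_trans\<close>)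
    also have "\<dots> = prb (all_edges d (?V - U)) p (\<lambda>b. card (copies W T (?V - U) b) \<le> m)"
      unfolding prb_def by (rule bexp_relabel[OF bij_betw_all_edges[OF \<pi>], symmetric])
    also have "\<dots> \<le> prb (all_edges d (?V - U)) p (\<lambda>b. card (copies W T ?V (H U \<union> b)) \<le> m + 1)"
    proof (rule prb_mono[OF p])
      fix b assume b: "b \<subseteq> all_edges d (?V - U)" "card (copies W T (?V - U) b) \<le> m"
      let ?g = "H U \<union> b"
      have "F U \<inter> b = {}" using b(1) unfolding F_def all_edges_def by auto
      then have gF: "?g \<inter> F U = H U" using HF[OF U] by auto
      have "?g \<subseteq> ?A" using HF[OF U] b(1) unfolding F_def all_edges_def by auto
      then have Uc: "U \<in> copies W T ?V ?g" using isc[OF U _ gF] by auto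
      have "copies W T ?V ?g \<subseteq> insert U (copies W T (?V - U) b)"
      proof
        fix U' assume U': "U' \<in> copies W T ?V ?g"
        show "U' \<in> insert U (copies W T (?V - U) b)"
        proof (cases "U' = U")
          case False
          then have disj: "U \<inter> U' = {}" using copies_disjoint[OF T Uc U'] by auto
          have eqb: "{e \<in> ?g. e \<inter> U' \<noteq> {}} = {e \<in> b. e \<inter> U' \<noteq> {}}"
          proof -
            have "e \<inter> U' = {}" if "e \<in> H U" for e
            proof -
              have "e \<subseteq> U" using HU[OF U] that unfolding all_edges_def by auto
              then show ?thesis using disj by auto
            qed
            then show ?thesis by auto
          qed
          obtain h' where h': "U' \<subseteq> ?V" "inj_on h' W" "h' ` W = U'" "{e \<in> ?g. e \<inter> U' \<noteq> {}} = (`) h' ` T"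
            using U' unfolding copies_def mem_Collect_eq by (elim conjE exE)
          have "U' \<subseteq> ?V - U" using h'(1) disj by auto
          then have "U' \<in> copies W T (?V - U) b" unfolding copies_def using h'(2,3,4) eqb by (intro CollectI conjI exI[of _ h']) simp_all
          then show ?thesis by (rule insertI2)
        qed simp
      qed
      then have "card (copies W T ?V ?g) \<le> card (insert U (copies W T (?V - U) b))"
        by (intro card_mono) (auto intro: copies_finite)
      also have "\<dots> \<le> m + 1" using b(2) by (simp add: card_insert_if copies_finite)
      finally show "card (copies W T ?V ?g) \<le> m + 1" .
    qed
    finally show ?thesis unfolding eq using p by (intro mult_left_mono) auto
  qed
  then have "(\<Sum>U\<in>?U. ?w * ?P) \<le> (\<Sum>U\<in>?U. prb ?A p (\<lambda>g. g \<inter> F U = H U \<and> card (copies W T ?V g) \<le> m + 1))"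
    by (rule sum_mono)
  ultimately have "real (card ?U) * (?w * ?P) \<le> real (m + 1)" by simp
  moreover have "card ?U = (n + v) choose v" by (subst n_subsets) auto
  ultimately show ?thesis unfolding v_def by (simp add: mult_ac)
qed

lemma few_copies_tendsto:
  assumes d: "3 \<le> d" and c: "0 < c" and T: "is_tree d r W T x"
  shows "(\<lambda>n. prb (possible_edges d n) (c / real n ^ (d - 1)) (\<lambda>g. card (copies W T {1..n} g) \<le> m)) \<longlonglongrightarrow> 0"
proof -
  define v where "v = card W"
  define e where "e = card T"
  \<comment> \<open>A tree has at least one vertex more than \<open>(d - 1) * e\<close>, so n^v p^e
    is at least of order n.\<close>
  have ve: "(d - 1) * e + 1 \<le> v" using T unfolding is_tree_def v_def e_def by simp
  let ?p = "\<lambda>n. c / real n ^ (d - 1)"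
  let ?P = "\<lambda>n. prb (possible_edges d n) (?p n) (\<lambda>g. card (copies W T {1..n} g) \<le> m)"
  let ?q = "\<lambda>n. (1 - ?p n) ^ (((n + v) choose d) - (n choose d) - e)"
  let ?b = "\<lambda>n. real ((n + v) choose v) / real n ^ v * ?q n"
  have "(\<lambda>n. real ((n + v) choose v) / real (n + 0) ^ v * (1 - c / real (n + 0) ^ (d - 1)) ^ (((n + v) choose d) - (n choose d) - e))
     \<longlonglongrightarrow> 1 / fact v * exp (- (c * real v / fact (d - 1)))"
    by (intro tendsto_mult binomial_asymp nonedge_tendsto[OF d c])
  then have b: "?b \<longlonglongrightarrow> 1 / fact v * exp (- (c * real v / fact (d - 1)))" by simp
  \<comment> \<open>Half the limit of \<open>?b\<close>, hence a positive lower bound from some n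
    on.\<close>
  define B where "B = 1 / fact v * exp (- (c * real v / fact (d - 1))) / 2"
  have B0: "0 < B" unfolding B_def by simp
  have b2: "?b \<longlonglongrightarrow> 2 * B" using b unfolding B_def by (simp only: mult_2 field_sum_of_halves)
  have evb: "\<forall>\<^sub>F n in sequentially. B < ?b n" by (rule order_tendstoD(1)[OF b2]) (use B0 in simp)
  have "\<forall>\<^sub>F n in sequentially. norm (?P n) \<le> (real (m + 1) / (B * c ^ e)) / real n"
    using evb edge_prob_eventually[OF d c]
  proof eventually_elim
    case (elim n)
    have n: "1 \<le> real n" using elim by simp
    have P0: "0 \<le> ?P n" using elim by (intro prb_nonneg) auto
    have "real n ^ ((d - 1) * e) * real n = real n ^ ((d - 1) * e + 1)" by simp
    also have "\<dots> \<le> real n ^ v" using n ve by (intro power_increasing) auto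
    finally have pw: "real n ^ ((d - 1) * e) * real n \<le> real n ^ v" .
    have "c ^ e * real n \<le> real n ^ v * ?p n ^ e"
      using pw n c by (simp add: power_divide power_mult[symmetric] field_simps)
    then have "B * (c ^ e * real n) \<le> ?b n * (real n ^ v * ?p n ^ e)"
      by (rule mult_mono[rotated]) (use elim B0 c in auto)
    also have "\<dots> = real ((n + v) choose v) * (?p n ^ e * ?q n)" using n by simp
    finally have "B * (c ^ e * real n) * ?P n \<le> real ((n + v) choose v) * (?p n ^ e * ?q n) * ?P n"
      using P0 by (intro mult_right_mono)
    also have "\<dots> \<le> real (m + 1)"
    proof -
      have "0 \<le> ?p n" "?p n \<le> 1" using elim by auto
      from few_copies_bound[OF d T this, of n m] show ?thesis unfolding v_def e_def possible_edges_eq .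
    qed
    finally have "?P n \<le> real (m + 1) / (B * (c ^ e * real n))"
      using B0 c n by (simp add: field_simps)
    then show ?case using P0 by (simp add: mult_ac)
  qed
  then show ?thesis by (rule Lim_null_comparison) (rule lim_const_over_n)
qed

section \<open>The law of the neighbourhood of the short cycles\<close>

lemma ncyc_zero_iff: "finite g \<Longrightarrow> ncyc d k g = 0 \<longleftrightarrow> (\<forall>C\<subseteq>g. \<not> is_cycle d k C)"
proof -
  assume "finite g"
  then have "finite {C. is_cycle d k C \<and> C \<subseteq> g}" by (auto intro: finite_subset[of _ "Pow g"])
  then show ?thesis unfolding ncyc_def by auto
qed

text \<open>If \<open>g\<close> is not dense over the vertices of \<open>H\<close>, a short cycle of
  \<open>g\<close> avoids \<open>H\<close> entirely and survives the removal of \<open>F\<close>,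
  while a cycle using edges of both would give a dense set. So only short cycles of \<open>g\<close>
  itself can change the core.\<close>

lemma core_event_iff:
  assumes d: "3 \<le> d" and g: "finite g" "\<not> dense_over d (\<Union>H) L g" and F: "\<And>e. e \<in> F \<Longrightarrow> e \<inter> \<Union>H \<noteq> {}"
  shows "core d L (H \<union> (g - F)) = core d L H \<longleftrightarrow> (\<forall>k\<in>{2..L}. ncyc d k g = 0)"
proof
  assume eq: "core d L (H \<union> (g - F)) = core d L H"
  have False if C: "C \<subseteq> g" "is_cycle d k C" "k \<le> L" for C k
  proof (cases "\<Union>C \<inter> \<Union>H = {}")
    case False
    then show False using cycle_meets_dense[OF d C(2,3) False] dense_over_mono C(1) g(2) by blast
  next
    case True
    have "C \<inter> F = {}" using True F by blast
    then have "C \<subseteq> H \<union> (g - F)" using C(1) by auto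
    then have "\<Union>C \<subseteq> core d L H" using core_intro[OF _ C(2,3)] eq by metis
    then have "\<Union>C \<subseteq> \<Union>H" using core_subset by (metis subset_trans)
    then have "\<Union>C = {}" using True by auto
    then have "card (\<Union>C) = 0" by (simp only: card.empty)
    then show False using cycle_Union_card[OF d C(2)] cycle_ge2[OF C(2)] d by simp
  qed
  then show "\<forall>k\<in>{2..L}. ncyc d k g = 0" using ncyc_zero_iff[OF g(1)] by auto
next
  assume z: "\<forall>k\<in>{2..L}. ncyc d k g = 0"
  have no: "\<not> is_cycle d k C" if "C \<subseteq> g" "k \<le> L" for C k
    using z that ncyc_zero_iff[OF g(1), of d k] cycle_ge2[of d k C] by auto
  have "C \<subseteq> H" if C: "C \<subseteq> H \<union> (g - F)" "is_cycle d k C" "k \<le> L" for C k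
  proof (rule ccontr)
    assume nH: "\<not> C \<subseteq> H"
    have "C \<inter> H \<noteq> {}"
    proof
      assume "C \<inter> H = {}"
      then have "C \<subseteq> g" using C(1) by auto
      then show False using no C by blast
    qed
    then have "dense_over d (\<Union>H) L (C - H)" using cycle_overlap_dense[OF d C(2,3)] nH by blast
    moreover have "C - H \<subseteq> g" using C(1) by auto
    ultimately show False using dense_over_mono g(2) by blast
  qed
  note sub = this
  show "core d L (H \<union> (g - F)) = core d L H"
  proof
    show "core d L (H \<union> (g - F)) \<subseteq> core d L H"
    proof
      fix x assume "x \<in> core d L (H \<union> (g - F))"
      then obtain C k where C: "C \<subseteq> H \<union> (g - F)" "is_cycle d k C" "k \<le> L" "x \<in> \<Union>C" unfolding core_def by auto
      then show "x \<in> core d L H" using core_intro[OF sub[OF C(1-3)] C(2,3)] by auto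
    qed
  qed (rule core_mono, simp)
qed

text \<open>The possible edges meeting the ball of \<open>H\<close> are prescribed, at the price of
  exactly \<open>w\<close>. Up to dense configurations, the condition left on the core says that a
  fresh random hypergraph has no short cycle, and this is the same for all \<open>H\<close>.\<close>

lemma near_law:
  assumes d: "3 \<le> d" and p: "0 \<le> p" "p \<le> 1" and V: "finite V"
    and H: "H \<subseteq> all_edges d V" "near d L R H = H"
  defines "i \<equiv> card (ball_of H R (core d L H))"
  defines "w \<equiv> p ^ card H * (1 - p) ^ ((card V choose d) - ((card V - i) choose d) - card H)"
  shows "\<bar>prb (all_edges d V) p (\<lambda>g. near d L R g = H) - w * prb (all_edges d V) p (\<lambda>g. \<forall>k\<in>{2..L}. ncyc d k g = 0)\<bar>
    \<le> w * prb (all_edges d V) p (dense_over d (\<Union>H) L)"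
proof -
  let ?A = "all_edges d V" and ?I = "ball_of H R (core d L H)"
  define F where "F = {e \<in> ?A. e \<inter> ?I \<noteq> {}}"
  have finA: "finite ?A" using V by simp
  have FA: "F \<subseteq> ?A" unfolding F_def by auto
  have HF: "H \<subseteq> F"
  proof
    fix e assume e: "e \<in> H"
    then have "e \<in> near d L R H" using H(2) by simp
    then show "e \<in> F" using e H(1) unfolding F_def near_def by auto
  qed
  have IH: "?I \<subseteq> \<Union>H" by (rule ball_of_subset[OF core_subset]) auto
  have HV: "\<Union>H \<subseteq> V" using H(1) unfolding all_edges_def by auto
  have finH: "finite H" using H(1) finA finite_subset by blast
  have "card F = (card V choose d) - ((card V - i) choose d)"
    unfolding F_def i_def using card_edges_meeting[OF V, of ?I d] IH HV by auto
  then have cF: "card (F - H) = (card V choose d) - ((card V - i) choose d) - card H"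
    using HF finH by (simp add: card_Diff_subset)
  have "near d L R g = H \<longleftrightarrow> g \<inter> F = H \<and> core d L g = core d L H" if g: "g \<subseteq> ?A" for g
  proof -
    have gF: "{e \<in> g. e \<inter> ?I \<noteq> {}} = g \<inter> F" using g unfolding F_def by auto
    show ?thesis
    proof (cases "H \<subseteq> g")
      case True then show ?thesis using near_eq_iff[OF d H(2) True] gF by simp
    next
      case False
      then have "near d L R g \<noteq> H" using near_subset by metis
      then show ?thesis using False by blast
    qed
  qed
  then have "prb ?A p (\<lambda>g. near d L R g = H) = bexp ?A p (\<lambda>g. of_bool (g \<inter> F = H) * of_bool (core d L g = core d L H))"
    unfolding prb_def by (intro bexp_cong) (simp add: of_bool_conj)
  also have "\<dots> = w * bexp (?A - F) p (\<lambda>b. of_bool (core d L (H \<union> b) = core d L H))"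
    unfolding w_def cF[symmetric] by (rule bexp_exact[OF finA FA HF])
  also have "bexp (?A - F) p (\<lambda>b. of_bool (core d L (H \<union> b) = core d L H)) =
      prb ?A p (\<lambda>g. core d L (H \<union> (g - F)) = core d L H)"
    unfolding prb_def by (rule bexp_restrict[OF finA FA])
  finally have eq: "prb ?A p (\<lambda>g. near d L R g = H) = w * prb ?A p (\<lambda>g. core d L (H \<union> (g - F)) = core d L H)" .
  have w0: "0 \<le> w" unfolding w_def using p by simp
  have "\<bar>prb ?A p (\<lambda>g. core d L (H \<union> (g - F)) = core d L H) - prb ?A p (\<lambda>g. \<forall>k\<in>{2..L}. ncyc d k g = 0)\<bar>
      \<le> prb ?A p (dense_over d (\<Union>H) L)"
  proof (rule prb_diff_le[OF p])
    fix g assume g: "g \<subseteq> ?A" "\<not> dense_over d (\<Union>H) L g"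
    show "core d L (H \<union> (g - F)) = core d L H \<longleftrightarrow> (\<forall>k\<in>{2..L}. ncyc d k g = 0)"
      by (rule core_event_iff[OF d _ g(2)]) (use g(1) finA finite_subset IH in \<open>auto simp: F_def\<close>)
  qed
  then have "w * \<bar>prb ?A p (\<lambda>g. core d L (H \<union> (g - F)) = core d L H) - prb ?A p (\<lambda>g. \<forall>k\<in>{2..L}. ncyc d k g = 0)\<bar>
      \<le> w * prb ?A p (dense_over d (\<Union>H) L)" using w0 by (rule mult_left_mono)
  then show ?thesis unfolding eq using w0 by (simp add: right_diff_distrib[symmetric] abs_mult)
qed

section \<open>Isomorphism classes of neighbourhoods\<close>

definition iso_closed :: "nat set set set \<Rightarrow> bool" where
  "iso_closed \<F> \<longleftrightarrow> (\<forall>H h. H \<in> \<F> \<longrightarrow> inj_on h (\<Union>H) \<longrightarrow> (`) h ` H \<in> \<F>)"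

text \<open>The numbers of vertices, of edges and of ball vertices are all that the weight in
  \<open>near_law\<close> and the number of placements depend on, so neighbourhoods are sorted by
  them.\<close>

definition profiles :: "nat \<Rightarrow> nat \<Rightarrow> nat \<Rightarrow> nat set set set \<Rightarrow> nat \<Rightarrow> nat \<Rightarrow> nat set \<Rightarrow> nat set set set" where
  "profiles d L R \<F> e i U = {H. H \<subseteq> all_edges d U \<and> \<Union>H = U \<and> near d L R H = H \<and> H \<in> \<F> \<and> card H = e \<and>
     card (ball_of H R (core d L H)) = i}"

lemma finite_profiles: "finite U \<Longrightarrow> finite (profiles d L R \<F> e i U)"
  unfolding profiles_def by (auto intro: finite_subset[of _ "Pow (all_edges d U)"])

lemma card_profiles_le:
  assumes d: "3 \<le> d" and F: "iso_closed \<F>" and U: "finite U'" and bij: "bij_betw h U U'"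
  shows "card (profiles d L R \<F> e i U) \<le> card (profiles d L R \<F> e i U')"
proof (rule card_inj_on_le)
  have inj: "inj_on h U" using bij by (simp add: bij_betw_def)
  show "finite (profiles d L R \<F> e i U')" by (rule finite_profiles[OF U])
  show "inj_on ((`) ((`) h)) (profiles d L R \<F> e i U)"
  proof (rule inj_onI)
    fix H H' assume H: "H \<in> profiles d L R \<F> e i U" "H' \<in> profiles d L R \<F> e i U" "(`) h ` H = (`) h ` H'"
    have "H \<subseteq> all_edges d U" "H' \<subseteq> all_edges d U" using H unfolding profiles_def by auto
    moreover have "inj_on ((`) h) (all_edges d U)" using bij_betw_all_edges[OF bij] by (simp add: bij_betw_def)
    ultimately show "H = H'" using H(3) by (simp add: inj_on_image_eq_iff)
  qed
  show "(`) ((`) h) ` profiles d L R \<F> e i U \<subseteq> profiles d L R \<F> e i U'"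
  proof
    fix H' assume "H' \<in> (`) ((`) h) ` profiles d L R \<F> e i U"
    then obtain H where H: "H \<in> profiles d L R \<F> e i U" "H' = (`) h ` H" by auto
    have h: "inj_on h (\<Union>H)" using inj H(1) unfolding profiles_def by auto
    have sub: "H \<subseteq> all_edges d U" and un: "\<Union>H = U" and nr: "near d L R H = H" and HF: "H \<in> \<F>" and ce: "card H = e"
      and ci: "card (ball_of H R (core d L H)) = i" using H(1) unfolding profiles_def by auto
    have "H' \<subseteq> all_edges d U'"
      using image_mono[OF sub, of "(`) h"] bij_betw_all_edges[OF bij, of d] H(2) by (simp add: bij_betw_def)
    moreover have "\<Union>H' = U'" unfolding H(2) using un bij by (simp add: bij_betw_def image_Union[symmetric])
    moreover have "near d L R H' = H'" unfolding H(2) near_image[OF d h] nr ..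
    moreover have "H' \<in> \<F>" unfolding H(2) using F HF h unfolding iso_closed_def by blast
    moreover have "card H' = e"
    proof -
      have "inj_on ((`) h) H" using bij_betw_all_edges[OF bij, of d] sub unfolding bij_betw_def by (meson inj_on_subset)
      then show ?thesis unfolding H(2) using ce by (simp add: card_image)
    qed
    moreover have "card (ball_of H' R (core d L H')) = i"
    proof -
      have "ball_of H R (core d L H) \<subseteq> \<Union>H" by (rule ball_of_subset[OF core_subset]) auto
      then have "card (h ` ball_of H R (core d L H)) = card (ball_of H R (core d L H))"
        using h by (meson card_image inj_on_subset)
      then show ?thesis unfolding H(2) core_image[OF d h] ball_of_image[OF h order_refl core_subset] using ci by simp
    qed
    ultimately show "H' \<in> profiles d L R \<F> e i U'" unfolding profiles_def by blast
  qed
qed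

lemma card_profiles:
  assumes d: "3 \<le> d" and F: "iso_closed \<F>" and U: "finite U" "card U = s"
  shows "card (profiles d L R \<F> e i U) = card (profiles d L R \<F> e i {1..s})"
proof -
  obtain h where h: "bij_betw h {1..s} U" using finite_same_card_bij[of "{1..s}" U] U by auto
  have h': "bij_betw (the_inv_into {1..s} h) U {1..s}" by (rule bij_betw_the_inv_into[OF h])
  show ?thesis using card_profiles_le[OF d F _ h, of L R e i] card_profiles_le[OF d F _ h', of L R e i] U by simp
qed

definition profile_prob :: "nat \<Rightarrow> real \<Rightarrow> nat \<Rightarrow> nat \<Rightarrow> nat set set set \<Rightarrow> nat \<Rightarrow> nat \<Rightarrow> nat \<Rightarrow> nat \<Rightarrow> real" where
  "profile_prob d c L R \<F> s e i n = prb (possible_edges d n) (c / real n ^ (d - 1))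
     (\<lambda>g. near d L R g \<in> \<F> \<and> card (\<Union>(near d L R g)) = s \<and> card (near d L R g) = e \<and>
        card (ball_of (near d L R g) R (core d L (near d L R g))) = i)"

text \<open>All \<open>N * (n choose s)\<close> neighbourhoods of one profile have the same weight
  up to O(1/n) times that weight, so it suffices that the product of number and weight
  converges.\<close>

lemma profile_prob_convergent:
  assumes d: "3 \<le> d" and c: "0 < c" and F: "iso_closed \<F>"
  shows "convergent (profile_prob d c L R \<F> s e i)"
proof -
  define N where "N = card (profiles d L R \<F> e i {1..s})"
  let ?p = "\<lambda>n. c / real n ^ (d - 1)"
  let ?w = "\<lambda>n. ?p n ^ e * (1 - ?p n) ^ ((n choose d) - ((n - i) choose d) - e)"
  let ?\<pi> = "\<lambda>n. cyc_prob d c L n (\<lambda>_. 0)"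
  let ?a = "\<lambda>n. real N * real (n choose s) * ?w n"
  obtain K :: real where K: "0 \<le> K" "\<And>n Z. 0 < n \<Longrightarrow> c / real n ^ (d - 1) \<le> 1 \<Longrightarrow> Z \<subseteq> {1..n} \<Longrightarrow> card Z \<le> s \<Longrightarrow>
    prb (possible_edges d n) (c / real n ^ (d - 1)) (dense_over d Z L) \<le> K / real n"
    by (rule prb_dense_over[OF c, where z = s and d = d and M = L]) (rule that)
  have main: "\<bar>profile_prob d c L R \<F> s e i n - ?a n * ?\<pi> n\<bar> \<le> ?a n * (K / real n)"
    if n: "0 < n" "?p n \<le> 1" for n
  proof -
    let ?A = "all_edges d {1..n}"
    have finA: "finite ?A" by simp
    have p: "0 \<le> ?p n" "?p n \<le> 1" using c n by auto
    define X where "X = (\<Union>U\<in>{U. U \<subseteq> {1..n} \<and> card U = s}. profiles d L R \<F> e i U)"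
    have finX: "finite X" unfolding X_def
    proof (rule finite_UN_I)
      show "finite (profiles d L R \<F> e i U)" if "U \<in> {U. U \<subseteq> {1..n} \<and> card U = s}" for U
        using that finite_subset[of U "{1..n}"] by (intro finite_profiles) auto
    qed auto
    have "card X = (\<Sum>U\<in>{U. U \<subseteq> {1..n} \<and> card U = s}. card (profiles d L R \<F> e i U))"
      unfolding X_def
    proof (rule card_UN_disjoint)
      show "\<forall>U\<in>{U. U \<subseteq> {1..n} \<and> card U = s}. finite (profiles d L R \<F> e i U)"
        using finite_profiles finite_subset by blast
    qed (auto simp: profiles_def)
    also have "\<dots> = (\<Sum>U\<in>{U. U \<subseteq> {1..n} \<and> card U = s}. N)"
      unfolding N_def by (intro sum.cong card_profiles[OF d F] refl) (auto intro: finite_subset)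
    finally have cX: "card X = N * (n choose s)" by (simp add: n_subsets)
    have XH: "H \<subseteq> ?A \<and> near d L R H = H \<and> H \<in> \<F> \<and> card (\<Union>H) = s \<and> card H = e \<and> card (ball_of H R (core d L H)) = i"
      if HX: "H \<in> X" for H
    proof -
      obtain U where U: "U \<subseteq> {1..n}" "card U = s" "H \<in> profiles d L R \<F> e i U" using HX unfolding X_def by auto
      have "all_edges d U \<subseteq> ?A" using U(1) unfolding all_edges_def by auto
      then show ?thesis using U unfolding profiles_def by auto
    qed
    have "profile_prob d c L R \<F> s e i n = prb ?A (?p n) (\<lambda>g. \<exists>H\<in>X. near d L R g = H)"
      unfolding profile_prob_def possible_edges_eq
    proof (rule prb_cong)
      fix g assume g: "g \<subseteq> ?A"
      let ?H = "near d L R g"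
      show "(?H \<in> \<F> \<and> card (\<Union>?H) = s \<and> card ?H = e \<and> card (ball_of ?H R (core d L ?H)) = i) \<longleftrightarrow> (\<exists>H\<in>X. ?H = H)"
      proof
        assume a: "?H \<in> \<F> \<and> card (\<Union>?H) = s \<and> card ?H = e \<and> card (ball_of ?H R (core d L ?H)) = i"
        have HA: "?H \<subseteq> ?A" using near_subset[of d L R g] g by blast
        have "\<Union>?H \<subseteq> {1..n}" using HA unfolding all_edges_def by blast
        moreover have "?H \<subseteq> all_edges d (\<Union>?H)" using HA unfolding all_edges_def by blast
        ultimately have "?H \<in> X" unfolding X_def profiles_def
          using a near_near[OF d, of L R g] by blast
        then show "\<exists>H\<in>X. ?H = H" by blast
      next
        assume "\<exists>H\<in>X. ?H = H"
        then have "?H \<in> X" by blast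
        then show "?H \<in> \<F> \<and> card (\<Union>?H) = s \<and> card ?H = e \<and> card (ball_of ?H R (core d L ?H)) = i" using XH by blast
      qed
    qed
    also have "\<dots> = (\<Sum>H\<in>X. prb ?A (?p n) (\<lambda>g. near d L R g = H))" by (rule prb_Ex_disjoint[OF finX]) auto
    finally have Q: "profile_prob d c L R \<F> s e i n = (\<Sum>H\<in>X. prb ?A (?p n) (\<lambda>g. near d L R g = H))" .
    have a: "?a n * ?\<pi> n = (\<Sum>H\<in>X. ?w n * ?\<pi> n)" using cX by simp
    have "\<bar>profile_prob d c L R \<F> s e i n - ?a n * ?\<pi> n\<bar> =
        \<bar>\<Sum>H\<in>X. (prb ?A (?p n) (\<lambda>g. near d L R g = H) - ?w n * ?\<pi> n)\<bar>"
      unfolding Q a by (simp only: sum_subtractf)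
    also have "\<dots> \<le> (\<Sum>H\<in>X. \<bar>prb ?A (?p n) (\<lambda>g. near d L R g = H) - ?w n * ?\<pi> n\<bar>)" by (rule sum_abs)
    also have "\<dots> \<le> (\<Sum>H\<in>X. ?w n * (K / real n))"
    proof (rule sum_mono)
      fix H assume "H \<in> X"
      note H = XH[OF this]
      have "\<bar>prb ?A (?p n) (\<lambda>g. near d L R g = H) - ?w n * ?\<pi> n\<bar> \<le> ?w n * prb ?A (?p n) (dense_over d (\<Union>H) L)"
        using near_law[OF d p, of "{1..n}" H L R] H unfolding cyc_prob_def possible_edges_eq by simp
      also have "\<dots> \<le> ?w n * (K / real n)"
      proof (rule mult_left_mono)
        have "\<Union>H \<subseteq> {1..n}" using H unfolding all_edges_def by blast
        then show "prb ?A (?p n) (dense_over d (\<Union>H) L) \<le> K / real n"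
          using K(2)[OF n, of "\<Union>H"] H by (simp add: possible_edges_eq)
        show "0 \<le> ?w n" using p by simp
      qed
      finally show "\<bar>prb ?A (?p n) (\<lambda>g. near d L R g = H) - ?w n * ?\<pi> n\<bar> \<le> ?w n * (K / real n)" .
    qed
    also have "\<dots> = ?a n * (K / real n)" using cX by simp
    finally show ?thesis .
  qed
  have lim_a: "\<exists>a. ?a \<longlonglongrightarrow> a"
  proof (cases "N = 0")
    case False
    then have "profiles d L R \<F> e i {1..s} \<noteq> {}" unfolding N_def by auto
    then obtain H where H: "H \<in> profiles d L R \<F> e i {1..s}" by auto
    have Hs: "H \<subseteq> all_edges d {1..s}" "\<Union>H = {1..s}" "near d L R H = H" "card H = e" using H unfolding profiles_def by auto
    have "finite H" using Hs(1) finite_subset[OF Hs(1)] by simp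
    \<comment> \<open>By \<open>near_vertex_bound\<close> the power of 1/n that is left over is not
      negative, so the product has a limit; it vanishes unless the neighbourhood breaks
      even.\<close>
    then have se: "s \<le> (d - 1) * e"
      using near_vertex_bound[OF d Hs(3)] Hs by (force simp: all_edges_def)
    define t where "t = (d - 1) * e - s"
    have "(\<lambda>n. inverse (real n) ^ t) \<longlonglongrightarrow> 0 ^ t" by (intro tendsto_intros lim_inverse_n)
    moreover have "(\<lambda>n. (1 - c / real n ^ (d - 1)) ^ ((n choose d) - ((n - i) choose d) - e)) \<longlonglongrightarrow> exp (- (c * real i / fact (d - 1)))"
      by (rule LIMSEQ_offset[where k = i]) (use nonedge_tendsto[OF d c, of i i e] in simp)
    moreover have "(\<lambda>n. real ((n + 0) choose s) / real (n + 0) ^ s) \<longlonglongrightarrow> 1 / fact s" by (rule binomial_asymp)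
    ultimately have "(\<lambda>n. real N * (real ((n + 0) choose s) / real (n + 0) ^ s) * (c ^ e * inverse (real n) ^ t *
        (1 - c / real n ^ (d - 1)) ^ ((n choose d) - ((n - i) choose d) - e))) \<longlonglongrightarrow>
        real N * (1 / fact s) * (c ^ e * 0 ^ t * exp (- (c * real i / fact (d - 1))))"
      by (intro tendsto_mult tendsto_const)
    moreover have "\<forall>\<^sub>F n in sequentially. real N * (real ((n + 0) choose s) / real (n + 0) ^ s) * (c ^ e * inverse (real n) ^ t *
        (1 - c / real n ^ (d - 1)) ^ ((n choose d) - ((n - i) choose d) - e)) = ?a n"
      using eventually_gt_at_top[of 0]
    proof eventually_elim
      case (elim n)
      have "real n ^ ((d - 1) * e) = real n ^ s * real n ^ t" unfolding t_def using se by (simp add: power_add[symmetric])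
      then have pe: "?p n ^ e = c ^ e / (real n ^ s * real n ^ t)" by (simp add: power_divide power_mult)
      show ?case unfolding pe by (simp add: divide_inverse power_inverse mult_ac)
    qed
    ultimately show ?thesis by (blast intro: Lim_transform_eventually)
  qed (auto intro: exI[of _ 0])
  then obtain a where a: "?a \<longlonglongrightarrow> a" by blast
  have "(\<lambda>n. profile_prob d c L R \<F> s e i n - ?a n * ?\<pi> n) \<longlonglongrightarrow> 0"
  proof (rule Lim_null_comparison)
    show "\<forall>\<^sub>F n in sequentially. norm (profile_prob d c L R \<F> s e i n - ?a n * ?\<pi> n) \<le> ?a n * (K / real n)"
      using edge_prob_eventually[OF d c] unfolding real_norm_def
      by eventually_elim (rule main, auto)
    have "(\<lambda>n. ?a n * (K / real n)) \<longlonglongrightarrow> a * 0" by (intro tendsto_mult a lim_const_over_n)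
    then show "(\<lambda>n. ?a n * (K / real n)) \<longlonglongrightarrow> 0" by simp
  qed
  moreover have "(\<lambda>n. ?a n * ?\<pi> n) \<longlonglongrightarrow> a * exp (- pois_total d c L)"
    by (intro tendsto_mult a no_short_cycle_prob[OF d c])
  ultimately have "(\<lambda>n. (profile_prob d c L R \<F> s e i n - ?a n * ?\<pi> n) + ?a n * ?\<pi> n) \<longlonglongrightarrow> 0 + a * exp (- pois_total d c L)"
    by (rule tendsto_add)
  then show ?thesis by (auto simp: convergent_def)
qed

text \<open>Every edge of the neighbourhood lies in one of the small edge sets of
  \<open>near_dense_cover\<close>. Their number has bounded expectation, by the first moment with
  slack 0, so Markov's inequality applies to the number of vertices.\<close>

lemma near_tight:
  assumes d: "3 \<le> d" and c: "0 < c"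
  obtains K :: real where "0 \<le> K" "\<And>n s. 0 < n \<Longrightarrow> c / real n ^ (d - 1) \<le> 1 \<Longrightarrow>
    prb (possible_edges d n) (c / real n ^ (d - 1)) (\<lambda>g. s < card (\<Union>(near d L R g))) \<le> K / (real s + 1)"
proof -
  define M where "M = L + R + 1"
  obtain K :: real where K: "0 \<le> K" "\<And>(V :: nat set) Z. finite V \<Longrightarrow> V \<noteq> {} \<Longrightarrow> Z \<subseteq> V \<Longrightarrow> card Z \<le> 0 \<Longrightarrow>
    (\<Sum>S\<in>dense_sets d (all_edges d V) 0 M Z. (c / real (card V) ^ (d - 1)) ^ card S) \<le> K / real (card V) ^ 0"
    by (rule first_moment[OF c, where z = 0 and d = d and j = 0 and M = M]) (rule that)
  show ?thesis
  proof (rule that[of "real (d * M) * K"])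
    show "0 \<le> real (d * M) * K" using K(1) by simp
    fix n s :: nat assume n: "0 < n" "c / real n ^ (d - 1) \<le> 1"
    let ?A = "possible_edges d n" and ?p = "c / real n ^ (d - 1)"
    have p: "0 \<le> ?p" "?p \<le> 1" using c n by auto
    have finA: "finite ?A" by (simp add: possible_edges_eq)
    let ?D = "dense_sets d ?A 0 M {}"
    have finD: "finite ?D" by (rule finite_subset[of _ "Pow ?A"]) (use finA in \<open>auto simp: dense_sets_def\<close>)
    define Y where "Y g = card {S \<in> ?D. S \<subseteq> g}" for g
    have bound: "card (\<Union>(near d L R g)) \<le> d * M * Y g" if g: "g \<subseteq> ?A" for g
    proof -
      have gd: "card e = d" if "e \<in> g" for e using g that unfolding possible_edges_def by auto
      have fin: "finite {S \<in> ?D. S \<subseteq> g}" using finD by simp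
      have cS: "finite S \<and> card S \<le> M" if "S \<in> ?D" for S
      proof -
        have "S \<subseteq> ?A" "card S \<le> M" using that unfolding dense_sets_def by simp_all
        then show ?thesis using finite_subset[OF _ finA] by simp
      qed
      have nearsub: "near d L R g \<subseteq> \<Union>{S \<in> ?D. S \<subseteq> g}"
      proof
        fix e assume e: "e \<in> near d L R g"
        from near_dense_cover[OF d gd e]
        obtain S where S: "S \<subseteq> g" "S \<noteq> {}" "card S \<le> M" "card (\<Union>S) \<le> (d - 1) * card S" "e \<in> S"
          unfolding M_def by auto
        then have "S \<in> {S \<in> ?D. S \<subseteq> g}" using g unfolding dense_sets_def by auto
        then show "e \<in> \<Union>{S \<in> ?D. S \<subseteq> g}" using S(5) by blast
      qed
      have "finite (\<Union>{S \<in> ?D. S \<subseteq> g})" using fin cS by blast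
      then have "card (near d L R g) \<le> card (\<Union>{S \<in> ?D. S \<subseteq> g})" using nearsub by (rule card_mono)
      also have "\<dots> \<le> (\<Sum>S\<in>{S \<in> ?D. S \<subseteq> g}. card S)" by (rule card_Union_le_sum_card)
      also have "\<dots> \<le> (\<Sum>S\<in>{S \<in> ?D. S \<subseteq> g}. M)" by (rule sum_mono) (use cS in auto)
      also have "\<dots> = M * Y g" unfolding Y_def by simp
      finally have cn: "card (near d L R g) \<le> M * Y g" .
      have "card (\<Union>(near d L R g)) \<le> (\<Sum>e\<in>near d L R g. card e)" by (rule card_Union_le_sum_card)
      also have "\<dots> = (\<Sum>e\<in>near d L R g. d)" using gd near_subset by (intro sum.cong) blast+
      also have "\<dots> = d * card (near d L R g)" by simp
      also have "\<dots> \<le> d * (M * Y g)" using cn by (rule mult_le_mono2)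
      finally show ?thesis by simp
    qed
    have EY: "bexp ?A ?p (\<lambda>g. real (Y g)) \<le> K"
    proof -
      have "bexp ?A ?p (\<lambda>g. real (Y g)) = bexp ?A ?p (\<lambda>g. \<Sum>S\<in>?D. of_bool (S \<subseteq> g))"
        unfolding Y_def using finD by (simp add: of_bool_def sum.If_cases Int_def conj_commute)
      also have "\<dots> = (\<Sum>S\<in>?D. prb ?A ?p (\<lambda>g. S \<subseteq> g))" unfolding prb_def by (rule bexp_sum)
      also have "\<dots> = (\<Sum>S\<in>?D. ?p ^ card S)"
        by (intro sum.cong refl prb_contains[OF finA]) (auto simp: dense_sets_def)
      also have "\<dots> \<le> K" using K(2)[of "{1..n}" "{}"] n by (simp add: possible_edges_eq)
      finally show ?thesis .
    qed
    have "prb ?A ?p (\<lambda>g. s < card (\<Union>(near d L R g))) \<le> prb ?A ?p (\<lambda>g. real s + 1 \<le> real (d * M) * real (Y g))"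
    proof (rule prb_mono[OF p])
      fix g assume g: "g \<subseteq> ?A" "s < card (\<Union>(near d L R g))"
      then have "s + 1 \<le> d * M * Y g" using bound[OF g(1)] by linarith
      then have "real (s + 1) \<le> real (d * M * Y g)" by (simp only: of_nat_le_iff)
      then show "real s + 1 \<le> real (d * M) * real (Y g)" by simp
    qed
    also have "\<dots> \<le> bexp ?A ?p (\<lambda>g. real (d * M) * real (Y g)) / (real s + 1)"
      by (rule prb_markov[OF p]) auto
    also have "\<dots> \<le> real (d * M) * K / (real s + 1)"
      unfolding bexp_cmult using EY by (intro divide_right_mono mult_left_mono) auto
    finally show "prb ?A ?p (\<lambda>g. s < card (\<Union>(near d L R g))) \<le> real (d * M) * K / (real s + 1)" .
  qed
qed

lemma convergent_approx:
  fixes P :: "nat \<Rightarrow> real"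
  assumes "\<And>r. 0 < r \<Longrightarrow> \<exists>T. convergent T \<and> (\<forall>\<^sub>F n in sequentially. \<bar>P n - T n\<bar> \<le> r)"
  shows "convergent P"
proof (rule Cauchy_convergent, rule metric_CauchyI)
  fix r :: real assume r: "0 < r"
  obtain T where T: "convergent T" "\<forall>\<^sub>F n in sequentially. \<bar>P n - T n\<bar> \<le> r / 4" using assms[of "r / 4"] r by auto
  obtain N1 where N1: "\<forall>m\<ge>N1. \<forall>n\<ge>N1. dist (T m) (T n) < r / 4"
    using metric_CauchyD[OF convergent_Cauchy[OF T(1)], of "r / 4"] r by auto
  obtain N2 where N2: "\<forall>n\<ge>N2. \<bar>P n - T n\<bar> \<le> r / 4" using T(2) unfolding eventually_sequentially by auto
  have "dist (P m) (P n) < r" if "max N1 N2 \<le> m" "max N1 N2 \<le> n" for m n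
  proof -
    have "\<bar>T m - T n\<bar> < r / 4" "\<bar>P m - T m\<bar> \<le> r / 4" "\<bar>P n - T n\<bar> \<le> r / 4"
      using N1 N2 that by (auto simp: dist_real_def)
    then show ?thesis using r unfolding dist_real_def by linarith
  qed
  then show "\<exists>M. \<forall>m\<ge>M. \<forall>n\<ge>M. dist (P m) (P n) < r" by blast
qed

text \<open>By tightness, neighbourhoods with more than \<open>s0\<close> vertices contribute at
  most \<open>r\<close>, and the others have finitely many profiles.\<close>

theorem near_law_convergent:
  assumes d: "3 \<le> d" and c: "0 < c" and F: "iso_closed \<F>"
  shows "convergent (\<lambda>n. prb (possible_edges d n) (c / real n ^ (d - 1)) (\<lambda>g. near d L R g \<in> \<F>))"
proof (rule convergent_approx)
  fix r :: real assume r: "0 < r"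
  obtain K :: real where K: "0 \<le> K" "\<And>n s. 0 < n \<Longrightarrow> c / real n ^ (d - 1) \<le> 1 \<Longrightarrow>
    prb (possible_edges d n) (c / real n ^ (d - 1)) (\<lambda>g. s < card (\<Union>(near d L R g))) \<le> K / (real s + 1)"
    by (rule near_tight[OF d c, where L = L and R = R]) (rule that)
  obtain s0 :: nat where s0: "K / r < real s0" using reals_Archimedean2 by blast
  have sK: "K / (real s0 + 1) \<le> r" using s0 r K(1) by (simp add: field_simps)
  \<comment> \<open>On at most \<open>s0\<close> vertices there are at most \<open>2 ^ s0\<close>
    edges, and the ball has at most \<open>s0\<close> vertices.\<close>
  define I where "I = {..s0} \<times> {..2 ^ s0 :: nat} \<times> {..s0}"
  have finI: "finite I" unfolding I_def by simp
  let ?T = "\<lambda>n. \<Sum>(s, e, i)\<in>I. profile_prob d c L R \<F> s e i n"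
  have "convergent ?T"
    using profile_prob_convergent[OF d c F] by (intro convergent_sum) (auto split: prod.split)
  moreover have "\<forall>\<^sub>F n in sequentially.
      \<bar>prb (possible_edges d n) (c / real n ^ (d - 1)) (\<lambda>g. near d L R g \<in> \<F>) - ?T n\<bar> \<le> r"
    using edge_prob_eventually[OF d c]
  proof eventually_elim
    case (elim n)
    let ?A = "possible_edges d n" and ?p = "c / real n ^ (d - 1)"
    have p: "0 \<le> ?p" "?p \<le> 1" using elim by auto
    have finA: "finite ?A" by (simp add: possible_edges_eq)
    define Q where "Q = (\<lambda>(s, e, i) g. near d L R g \<in> \<F> \<and> card (\<Union>(near d L R g)) = s \<and> card (near d L R g) = e \<and>
        card (ball_of (near d L R g) R (core d L (near d L R g))) = i)"
    have "?T n = (\<Sum>x\<in>I. prb ?A ?p (Q x))" unfolding profile_prob_def Q_def by (intro sum.cong) auto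
    also have "\<dots> = prb ?A ?p (\<lambda>g. \<exists>x\<in>I. Q x g)"
      by (rule prb_Ex_disjoint[OF finI, symmetric]) (auto simp: Q_def)
    finally have T: "?T n = prb ?A ?p (\<lambda>g. \<exists>x\<in>I. Q x g)" .
    have "\<bar>prb ?A ?p (\<lambda>g. near d L R g \<in> \<F>) - prb ?A ?p (\<lambda>g. \<exists>x\<in>I. Q x g)\<bar> \<le> prb ?A ?p (\<lambda>g. s0 < card (\<Union>(near d L R g)))"
    proof (rule prb_diff_le[OF p])
      fix g assume g: "g \<subseteq> ?A" "\<not> s0 < card (\<Union>(near d L R g))"
      let ?H = "near d L R g"
      have HA: "?H \<subseteq> ?A" using near_subset[of d L R g] g(1) by blast
      have "\<Union>?H \<subseteq> {1..n}" using HA unfolding possible_edges_def by blast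
      then have finU: "finite (\<Union>?H)" using finite_subset by blast
      have "card ?H \<le> card (Pow (\<Union>?H))" using finU by (intro card_mono) auto
      also have "\<dots> = 2 ^ card (\<Union>?H)" using finU by (simp add: card_Pow)
      also have "\<dots> \<le> 2 ^ s0" using g(2) by (intro power_increasing) auto
      finally have "card ?H \<le> 2 ^ s0" .
      moreover have "card (ball_of ?H R (core d L ?H)) \<le> card (\<Union>?H)"
        by (rule card_mono[OF finU]) (rule ball_of_subset[OF core_subset], auto)
      ultimately show "?H \<in> \<F> \<longleftrightarrow> (\<exists>x\<in>I. Q x g)" using g(2) unfolding I_def Q_def by auto
    qed
    also have "\<dots> \<le> K / (real s0 + 1)" using K(2)[OF _ p(2), of s0] elim by blast
    finally show ?case using T sK by linarith
  qed
  ultimately show "\<exists>T. convergent T \<and> (\<forall>\<^sub>F n in sequentially.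
      \<bar>prb (possible_edges d n) (c / real n ^ (d - 1)) (\<lambda>g. near d L R g \<in> \<F>) - T n\<bar> \<le> r)" by blast
qed

section \<open>First order sentences see only the neighbourhood of the short cycles\<close>

text \<open>There are finitely many game types of rooted trees by \<open>ef_finite_index\<close>;
  one tree is selected for each type that occurs.\<close>

lemma tree_representatives:
  "\<exists>\<T>. finite \<T> \<and> (\<forall>(W, T, x)\<in>\<T>. is_tree d r W T (x :: nat)) \<and>
    (\<forall>W' T' x'. is_tree d r W' T' (x' :: nat) \<longrightarrow> (\<exists>(W, T, x)\<in>\<T>. ef m W' T' W T {(x', x)}))"
proof -
  obtain f :: "nat set \<times> nat set set \<times> nat list \<Rightarrow> nat" and N where f: "\<And>\<sigma>. f \<sigma> < N"
    "\<And>V E a V' E' b. length a = 1 \<Longrightarrow> length b = 1 \<Longrightarrow> f (V, E, a) = f (V', E', b) \<Longrightarrow> ef m V E V' E' (set (zip a b))"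
    using ef_finite_index[of 1 m] by blast
  define Q where "Q t = (\<lambda>(W, T, x). is_tree d r W T x \<and> f (W, T, [x]) = t)" for t
  define \<T> where "\<T> = (\<lambda>t. SOME \<tau>. Q t \<tau>) ` {t. t < N \<and> (\<exists>\<tau>. Q t \<tau>)}"
  have "finite \<T>" unfolding \<T>_def by simp
  moreover have "is_tree d r W T x" if mem: "(W, T, x) \<in> \<T>" for W T x
  proof -
    obtain t where t: "\<exists>\<tau>. Q t \<tau>" "(W, T, x) = (SOME \<tau>. Q t \<tau>)" using mem unfolding \<T>_def by auto
    have "Q t (W, T, x)" unfolding t(2) using t(1) by (rule someI_ex)
    then show ?thesis unfolding Q_def by simp
  qed
  moreover have "\<exists>(W, T, x)\<in>\<T>. ef m W' T' W T {(x', x)}" if "is_tree d r W' T' x'" for W' T' and x' :: nat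
  proof -
    let ?t = "f (W', T', [x'])"
    have ex: "\<exists>\<tau>. Q ?t \<tau>" using that unfolding Q_def by auto
    obtain W T x where \<tau>: "(SOME \<tau>. Q ?t \<tau>) = (W, T, x)" by (metis prod_cases3)
    have "Q ?t (W, T, x)" using someI_ex[OF ex] \<tau> by simp
    then have "f (W', T', [x']) = f (W, T, [x])" unfolding Q_def by simp
    then have "ef m W' T' W T {(x', x)}" using f(2)[of "[x']" "[x]"] by simp
    moreover have "(W, T, x) \<in> \<T>" unfolding \<T>_def using ex f(1) \<tau> by (intro image_eqI[of _ _ ?t]) auto
    ultimately show ?thesis by blast
  qed
  ultimately show ?thesis by (intro exI[of _ \<T>]) auto
qed

definition reps_ok :: "nat \<Rightarrow> nat \<Rightarrow> (nat \<Rightarrow> (nat set \<times> nat set set \<times> nat) set) \<Rightarrow> bool" where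
  "reps_ok d q \<T> \<longleftrightarrow> (\<forall>j<q. finite (\<T> j) \<and> (\<forall>(W, T, x)\<in>\<T> j. is_tree d (lrad j) W T x) \<and>
    (\<forall>W' T' x'. is_tree d (lrad j) W' T' (x' :: nat) \<longrightarrow> (\<exists>(W, T, x)\<in>\<T> j. ef (lrank d j) W' T' W T {(x', x)})))"

lemma reps_ok_exists: "\<exists>\<T>. reps_ok d q \<T>"
proof -
  have "\<forall>j. \<exists>\<T>. finite \<T> \<and> (\<forall>(W, T, x)\<in>\<T>. is_tree d (lrad j) W T (x :: nat)) \<and>
    (\<forall>W' T' x'. is_tree d (lrad j) W' T' (x' :: nat) \<longrightarrow> (\<exists>(W, T, x)\<in>\<T>. ef (lrank d j) W' T' W T {(x', x)}))"
    using tree_representatives by blast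
  then have "\<exists>\<T>. \<forall>j. finite (\<T> j) \<and> (\<forall>(W, T, x)\<in>\<T> j. is_tree d (lrad j) W T (x :: nat)) \<and>
    (\<forall>W' T' x'. is_tree d (lrad j) W' T' (x' :: nat) \<longrightarrow> (\<exists>(W, T, x)\<in>\<T> j. ef (lrank d j) W' T' W T {(x', x)}))"
    by (rule choice)
  then obtain \<T> where "\<forall>j. finite (\<T> j) \<and> (\<forall>(W, T, x)\<in>\<T> j. is_tree d (lrad j) W T (x :: nat)) \<and>
    (\<forall>W' T' x'. is_tree d (lrad j) W' T' (x' :: nat) \<longrightarrow> (\<exists>(W, T, x)\<in>\<T> j. ef (lrank d j) W' T' W T {(x', x)}))" ..
  then have "reps_ok d q \<T>" unfolding reps_ok_def by simp
  then show ?thesis by (rule exI[of "reps_ok d q"])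
qed

text \<open>The copies of each representative outnumber the vertices that the core and
  \<open>q\<close> moves can occupy. As copies are disjoint, one of them is always free.\<close>

definition good_graph :: "nat \<Rightarrow> nat \<Rightarrow> nat \<Rightarrow> (nat \<Rightarrow> (nat set \<times> nat set set \<times> nat) set) \<Rightarrow> nat \<Rightarrow> nat set set \<Rightarrow> bool" where
  "good_graph d L q \<T> n g \<longleftrightarrow> \<not> dense_over d {} L g \<and>
    (\<forall>j<q. \<forall>(W, T, x)\<in>\<T> j. card (core d L g) + q < card (copies W T {1..n} g))"

lemma lrad_mono: "i \<le> j \<Longrightarrow> lrad i \<le> lrad j"
  by (induction j) (auto simp: le_Suc_eq)

text \<open>A ball far from the core is a tree, so it has the game type of a representative, and
  some isolated copy of the representative is disjoint from \<open>B\<close>. Isolation puts that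
  copy out of reach of \<open>B\<close> at every radius.\<close>

lemma good_far_ext:
  assumes d: "3 \<le> d" and \<T>: "reps_ok d q \<T>" and L: "2 * lrad q < L"
    and g: "g \<subseteq> possible_edges d n" "good_graph d L q \<T> n g"
    and g': "g' \<subseteq> possible_edges d n'" "good_graph d L q \<T> n' g'"
  shows "far_ext d q (card (core d L g') + q) {1..n} g (core d L g) {1..n'} g'"
  unfolding far_ext_def
proof (intro allI impI ballI)
  fix j x and B :: "nat set"
  assume j: "j < q" and x: "x \<in> {1..n}" and far: "x \<notin> ball_of g (2 * lrad j + 1) (core d L g)"
    and B: "finite B \<and> card B \<le> card (core d L g') + q"
  let ?r = "lrad j" and ?W = "ball_of g (lrad j) {x}"
  let ?T = "{e \<in> g. e \<subseteq> ?W}"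
  have gd: "card e = d" "e \<subseteq> {1..n}" if "e \<in> g" for e using g(1) that unfolding possible_edges_def by auto
  have fing: "finite g" by (rule finite_subset[OF g(1)]) (simp add: possible_edges_eq)
  have gd': "card e = d" "e \<subseteq> {1..n'}" if "e \<in> g'" for e using g'(1) that unfolding possible_edges_def by auto
  have disj: "?W \<inter> core d L g = {}"
  proof (rule ccontr)
    assume "?W \<inter> core d L g \<noteq> {}"
    then obtain z where z: "z \<in> ?W" "z \<in> core d L g" by auto
    have "x \<in> ball_of g ?r {z}" using z(1) ball_of_sym by metis
    then have "x \<in> ball_of g ?r (core d L g)" using ball_of_mono[of g g "{z}" "core d L g" ?r] z(2) by auto
    then show False using far ball_of_radius_mono[of ?r "2 * ?r + 1" g "core d L g"] by auto
  qed
  have "2 * ?r < L" using L lrad_mono[of j q] j by simp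
  then have cnt: "(d - 1) * card ?T + 1 \<le> card ?W"
    using ball_is_tree[OF d gd(1) fing _ _ disj] g(2) unfolding good_graph_def by blast
  have Wsub: "?W \<subseteq> {1..n}" by (rule ball_of_subset) (use x gd(2) in auto)
  have ballT: "ball_of g ?r {x} = ball_of ?T ?r {x}"
  proof (rule ball_of_local_lt[OF _ _ order_refl])
    fix e i assume e: "e \<in> g" "i < ?r" "e \<inter> ball_of ?T i {x} \<noteq> {}"
    then have "e \<inter> ball_of g i {x} \<noteq> {}" using ball_of_mono[of ?T g "{x}" "{x}" i] by auto
    then have "e \<subseteq> ball_of g (Suc i) {x}" using e(1) by (auto simp: ball_of_Suc nbr_def)
    then show "e \<in> ?T" using e(1,2) ball_of_radius_mono[of "Suc i" ?r g "{x}"] by auto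
  qed auto
  have "is_tree d ?r ?W ?T x"
    unfolding is_tree_def
  proof (intro conjI)
    show "finite ?W" using Wsub finite_subset by blast
    show "?T \<subseteq> all_edges d ?W" using gd(1) unfolding all_edges_def by auto
    show "x \<in> ?W" using subset_ball_of[of "{x}" g ?r] by auto
    show "ball_of ?T ?r {x} = ?W" using ballT by simp
    show "(d - 1) * card ?T < card ?W" using cnt by simp
  qed
  then obtain W T x0 where rep: "(W, T, x0) \<in> \<T> j" "ef (lrank d j) ?W ?T W T {(x, x0)}"
    using \<T> j unfolding reps_ok_def by blast
  have tree: "is_tree d ?r W T x0" using rep(1) \<T> j unfolding reps_ok_def by blast
  have many: "card B < card (copies W T {1..n'} g')" using B g'(2) rep(1) j unfolding good_graph_def by fastforce
  have "\<exists>U\<in>copies W T {1..n'} g'. U \<inter> B = {}"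
  proof (rule ccontr)
    assume "\<not> ?thesis"
    then have "\<forall>U\<in>copies W T {1..n'} g'. \<exists>b. b \<in> U \<inter> B" by blast
    then obtain b where b: "\<forall>U\<in>copies W T {1..n'} g'. b U \<in> U \<inter> B" by metis
    have "inj_on b (copies W T {1..n'} g')"
    proof (rule inj_onI)
      fix U U' assume U: "U \<in> copies W T {1..n'} g'" "U' \<in> copies W T {1..n'} g'" "b U = b U'"
      have "b U \<in> U" "b U \<in> U'" using b U by auto
      then have "U \<inter> U' \<noteq> {}" by blast
      then show "U = U'" by (rule copies_disjoint[OF tree U(1,2)])
    qed
    then have "card (copies W T {1..n'} g') \<le> card B" by (rule card_inj_on_le) (use b B in auto)
    then show False using many by simp
  qed
  then obtain U where U: "U \<in> copies W T {1..n'} g'" "U \<inter> B = {}" by blast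
  then obtain h where h: "U \<subseteq> {1..n'}" "inj_on h W" "h ` W = U" "{e \<in> g'. e \<inter> U \<noteq> {}} = (`) h ` T"
    unfolding copies_def by auto
  have TW: "\<And>t. t \<in> T \<Longrightarrow> t \<subseteq> W \<and> card t = d" "x0 \<in> W" using tree unfolding is_tree_def all_edges_def by auto
  define y where "y = h x0"
  have yU: "y \<in> U" unfolding y_def using h(3) TW(2) by auto
  have ballU: "ball_of g' ?r {y} = U" unfolding y_def by (rule copy_ball(1)[OF tree h(2-4)])
  have closed: "e \<subseteq> U" if "e \<in> g'" "e \<inter> U \<noteq> {}" for e by (rule copy_ball(2)[OF tree h(2-4) that])
  have "ball_of g' k B \<subseteq> - U" for k by (rule ball_of_closed) (use U(2) closed in auto)
  then have yfar: "y \<notin> ball_of g' (2 * ?r + 1) B" using yU by blast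
  have ef1: "ef (lrank d j) ?W g ?W ?T ((\<lambda>x. (x, id x)) ` ?W)" by (rule ef_iso) (auto simp: bij_betw_def inj_on_def)
  have ef2: "ef (lrank d j) W T U g' ((\<lambda>x. (x, h x)) ` W)"
  proof (rule ef_iso)
    show "bij_betw h W U" using h by (simp add: bij_betw_def)
    fix A assume A: "A \<subseteq> W"
    show "A \<in> T \<longleftrightarrow> h ` A \<in> g'"
    proof
      assume "A \<in> T" then show "h ` A \<in> g'" using h(4) by blast
    next
      assume hA: "h ` A \<in> g'"
      have "A \<noteq> {}" using gd'(1)[OF hA] d by auto
      then have "h ` A \<inter> U \<noteq> {}" using A h(3) by blast
      then have "h ` A \<in> (`) h ` T" using hA h(4) by blast
      then obtain t where t: "t \<in> T" "h ` A = h ` t" by auto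
      then have "A = t" using inj_on_image_eq_iff[OF h(2) A] TW(1) by blast
      then show "A \<in> T" using t by simp
    qed
  qed
  \<comment> \<open>Three games are composed: the ball with its induced tree, that tree with its
    representative, and the representative with the isolated copy. Only the pair of roots is
    kept.\<close>
  have "ef (lrank d j) ?W g U g' (((\<lambda>x. (x, id x)) ` ?W O {(x, x0)}) O (\<lambda>x. (x, h x)) ` W)"
    by (rule ef_trans[OF ef_trans[OF ef1 rep(2)] ef2])
  then have "ef (lrank d j) ?W g U g' {(x, y)}"
    by (rule ef_subset) (use subset_ball_of[of "{x}" g ?r] TW(2) in \<open>auto simp: y_def relcomp_unfold image_iff\<close>)
  then show "\<exists>y\<in>{1..n'}. y \<notin> ball_of g' (2 * ?r + 1) B \<and> ef (lrank d j) ?W g (ball_of g' ?r {y}) g' {(x, y)}"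
    using yfar yU h(1) ballU by (intro bexI[of _ y]) auto
qed

text \<open>The game starts with the two cores already matched by \<open>h\<close>, at no cost in
  rounds; the isomorphism of neighbourhoods of radius \<open>lrad q\<close> is the local invariant
  for \<open>q\<close> rounds.\<close>

lemma good_models_iff:
  assumes d: "3 \<le> d" and \<T>: "reps_ok d q \<T>" and L: "2 * lrad q < L"
    and g: "g \<subseteq> possible_edges d n" "good_graph d L q \<T> n g"
    and g': "g' \<subseteq> possible_edges d n'" "good_graph d L q \<T> n' g'"
    and iso: "inj_on h (\<Union>(near d L (lrad q) g))" "near d L (lrad q) g' = (`) h ` near d L (lrad q) g"
    and \<phi>: "sentence d \<phi>" "qrank \<phi> \<le> q"
  shows "models {1..n} g \<phi> \<longleftrightarrow> models {1..n'} g' \<phi>"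
proof -
  let ?R = "lrad q" and ?H = "near d L (lrad q) g" and ?H' = "near d L (lrad q) g'"
  let ?C = "core d L g" and ?C' = "core d L g'"
  have gd: "card e = d" "e \<subseteq> {1..n}" if "e \<in> g" for e using g(1) that unfolding possible_edges_def by auto
  have gd': "card e = d" "e \<subseteq> {1..n'}" if "e \<in> g'" for e using g'(1) that unfolding possible_edges_def by auto
  have C': "?C' = h ` ?C"
    using core_near[OF d, of L ?R g'] core_near[OF d, of L ?R g] core_image[OF d iso(1), of L] iso(2) by simp
  have CH: "?C \<subseteq> \<Union>?H" using core_near[OF d, of L ?R g] core_subset[of d L ?H] by simp
  have ball: "ball_of g' ?R ?C' = h ` ball_of g ?R ?C"
    using ball_near[OF d order_refl, of L ?R g'] ball_near[OF d order_refl, of L ?R g]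
      ball_of_image[OF iso(1) order_refl CH, of ?R] C' iso(2) by simp
  have ballH: "ball_of g ?R ?C \<subseteq> \<Union>?H"
    using ball_near[OF d order_refl, of L ?R g] ball_of_subset[OF CH, of ?H ?R] by blast
  have ef0: "ef (lrank d q) (ball_of g ?R ?C) g (ball_of g' ?R ?C') g' ((\<lambda>x. (x, h x)) ` ball_of g ?R ?C)"
  proof (rule ef_iso)
    show "bij_betw h (ball_of g ?R ?C) (ball_of g' ?R ?C')"
      unfolding ball bij_betw_def using inj_on_subset[OF iso(1) ballH] by simp
    fix A assume A: "A \<subseteq> ball_of g ?R ?C"
    show "A \<in> g \<longleftrightarrow> h ` A \<in> g'"
    proof
      assume Ag: "A \<in> g"
      then have "A \<noteq> {}" using gd(1)[OF Ag] d by auto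
      then have "A \<in> ?H" using Ag A unfolding near_def by auto
      then show "h ` A \<in> g'" using iso(2) near_subset[of d L ?R g'] by blast
    next
      assume Ag: "h ` A \<in> g'"
      then have "h ` A \<noteq> {}" using gd'(1)[OF Ag] d by auto
      moreover have "h ` A \<subseteq> ball_of g' ?R ?C'" unfolding ball using A by blast
      ultimately have "h ` A \<in> ?H'" using Ag unfolding near_def by auto
      then obtain t where t: "t \<in> ?H" "h ` A = h ` t" using iso(2) by auto
      have "A = t" using inj_on_image_eq_iff[OF iso(1), of A t] A ballH t by blast
      then show "A \<in> g" using t near_subset[of d L ?R g] by blast
    qed
  qed
  define P where "P = (\<lambda>x. (x, h x)) ` ?C"
  have Psub: "P \<subseteq> (\<lambda>x. (x, h x)) ` ball_of g ?R ?C" unfolding P_def using subset_ball_of by (intro image_mono)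
  have PC: "fst ` P = ?C" "snd ` P = ?C'" unfolding P_def C' by (simp_all add: image_image)
  have inv: "ef (lrank d q) (ball_of g (lrad q) (fst ` P)) g (ball_of g' (lrad q) (snd ` P)) g' P"
    unfolding PC by (rule ef_subset[OF ef0 Psub])
  have CV: "?C \<subseteq> {1..n}" using core_subset[of d L g] gd(2) by blast
  have CV': "?C' \<subseteq> {1..n'}" using core_subset[of d L g'] gd'(2) by blast
  have finC: "finite ?C" using CV finite_subset by blast
  have cC: "card ?C' = card ?C" unfolding C' by (rule card_image) (rule inj_on_subset[OF iso(1) CH])
  have cP: "card P = card ?C" unfolding P_def by (rule card_image) (auto simp: inj_on_def)
  have PV: "P \<subseteq> {1..n} \<times> {1..n'}" using PC CV CV' by force
  have E: "finite e \<and> card e \<le> d" if "e \<in> g" for e using gd(1)[OF that] d edge_finite[of e d] by auto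
  have E': "finite e \<and> card e \<le> d" if "e \<in> g'" for e using gd'(1)[OF that] d edge_finite[of e d] by auto
  have "ef q {1..n} g {1..n'} g' P"
  proof (rule ef_from_local[OF inv, where q = q and N = "card ?C + q" and C = ?C and C' = ?C'])
    show "far_ext d q (card ?C + q) {1..n} g ?C {1..n'} g'"
      using good_far_ext[OF d \<T> L g g'] cC by simp
    show "far_ext d q (card ?C + q) {1..n'} g' ?C' {1..n} g"
      by (rule good_far_ext[OF d \<T> L g' g])
    show "finite P" unfolding P_def using finC by simp
    show "g \<subseteq> Pow {1..n}" "g' \<subseteq> Pow {1..n'}" using gd(2) gd'(2) by blast+
  qed (use PC cP PV E E' in auto)
  then have "ef q {1..n} g {1..n'} g' {}" by (rule ef_subset) auto
  then have "sat {1..n} g (\<lambda>_. 0) \<phi> \<longleftrightarrow> sat {1..n'} g' (\<lambda>_. 0) \<phi>"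
    by (rule ef_sat[OF _ \<phi>(2)]) (use \<phi>(1) in \<open>auto simp: sentence_def\<close>)
  then show ?thesis using models_iff_sat[OF \<phi>(1)] by metis
qed

text \<open>A hypergraph is bad only if its core is large, it contains a small dense edge set, or a
  representative has few copies. Tightness with R = 0 controls the core and thereby the number of
  copies to be exceeded.\<close>

lemma good_graph_whp:
  assumes d: "3 \<le> d" and c: "0 < c" and \<T>: "reps_ok d q \<T>"
  shows "(\<lambda>n. prb (possible_edges d n) (c / real n ^ (d - 1)) (\<lambda>g. \<not> good_graph d L q \<T> n g)) \<longlonglongrightarrow> 0"
proof (rule LIMSEQ_I)
  fix r :: real assume r: "0 < r"
  let ?A = "\<lambda>n. possible_edges d n" and ?p = "\<lambda>n. c / real n ^ (d - 1)"
  obtain K :: real where K: "0 \<le> K" "\<And>n s. 0 < n \<Longrightarrow> c / real n ^ (d - 1) \<le> 1 \<Longrightarrow>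
    prb (possible_edges d n) (c / real n ^ (d - 1)) (\<lambda>g. s < card (\<Union>(near d L 0 g))) \<le> K / (real s + 1)"
    by (rule near_tight[OF d c, where L = L and R = 0]) (rule that)
  obtain K' :: real where K': "0 \<le> K'" "\<And>n Z. 0 < n \<Longrightarrow> c / real n ^ (d - 1) \<le> 1 \<Longrightarrow> Z \<subseteq> {1..n} \<Longrightarrow> card Z \<le> 0 \<Longrightarrow>
    prb (possible_edges d n) (c / real n ^ (d - 1)) (dense_over d Z L) \<le> K' / real n"
    by (rule prb_dense_over[OF c, where z = 0 and d = d and M = L]) (rule that)
  obtain s0 :: nat where s0: "2 * K / r < real s0" using reals_Archimedean2 by blast
  have sK: "K / (real s0 + 1) < r / 2"
  proof -
    have "2 * K < real s0 * r" using s0 r by (simp add: field_simps)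
    then have "2 * K < (real s0 + 1) * r" using r by (simp add: algebra_simps)
    then show ?thesis by (simp add: field_simps)
  qed
  define I where "I = (SIGMA j:{..<q}. \<T> j)"
  have finI: "finite I" unfolding I_def using \<T> unfolding reps_ok_def by auto
  define Q where "Q = (\<lambda>(j :: nat, W :: nat set, T :: nat set set, x :: nat) (n :: nat) g. card (copies W T {1..n} g) \<le> s0 + q)"
  have lim: "(\<lambda>n. K' / real n + (\<Sum>i\<in>I. prb (?A n) (?p n) (Q i n))) \<longlonglongrightarrow> 0 + (\<Sum>i\<in>I. 0)"
  proof (intro tendsto_add tendsto_sum lim_const_over_n)
    fix i assume "i \<in> I"
    then obtain j W T x where i: "i = (j, W, T, x)" "j < q" "(W, T, x) \<in> \<T> j" unfolding I_def by auto
    then have "is_tree d (lrad j) W T x" using \<T> unfolding reps_ok_def by blast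
    then show "(\<lambda>n. prb (?A n) (?p n) (Q i n)) \<longlonglongrightarrow> 0"
      unfolding i(1) Q_def using few_copies_tendsto[OF d c, of "lrad j" W T x "s0 + q"] by simp
  qed
  have "\<forall>\<^sub>F n in sequentially. K' / real n + (\<Sum>i\<in>I. prb (?A n) (?p n) (Q i n)) < r / 2"
    by (rule order_tendstoD(2)[OF lim]) (use r in simp)
  then have "\<forall>\<^sub>F n in sequentially. norm (prb (?A n) (?p n) (\<lambda>g. \<not> good_graph d L q \<T> n g) - 0) < r"
    using edge_prob_eventually[OF d c]
  proof eventually_elim
    case (elim n)
    have p: "0 \<le> ?p n" "?p n \<le> 1" using elim by auto
    have "prb (?A n) (?p n) (\<lambda>g. \<not> good_graph d L q \<T> n g) \<le>
      prb (?A n) (?p n) (\<lambda>g. s0 < card (\<Union>(near d L 0 g)) \<or> (dense_over d {} L g \<or> (\<exists>i\<in>I. Q i n g)))"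
    proof (rule prb_mono[OF p])
      fix g assume g: "g \<subseteq> ?A n" "\<not> good_graph d L q \<T> n g"
      show "s0 < card (\<Union>(near d L 0 g)) \<or> (dense_over d {} L g \<or> (\<exists>i\<in>I. Q i n g))"
      proof (rule ccontr)
        assume not: "\<not> ?thesis"
        then obtain j W T x where i: "j < q" "(W, T, x) \<in> \<T> j" "card (copies W T {1..n} g) \<le> card (core d L g) + q"
          using g(2) unfolding good_graph_def by (force simp: not_less)
        have "\<Union>(near d L 0 g) \<subseteq> {1..n}" using near_subset[of d L 0 g] g(1) unfolding possible_edges_def by blast
        then have "finite (\<Union>(near d L 0 g))" using finite_subset by blast
        moreover have "core d L g \<subseteq> \<Union>(near d L 0 g)"
          using core_near[OF d, of L 0 g] core_subset[of d L "near d L 0 g"] by simp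
        ultimately have "card (core d L g) \<le> s0" using card_mono not by (metis le_trans not_less)
        then have "Q (j, W, T, x) n g" unfolding Q_def using i(3) by simp
        moreover have "(j, W, T, x) \<in> I" unfolding I_def using i by simp
        ultimately show False using not by blast
      qed
    qed
    also have "\<dots> \<le> prb (?A n) (?p n) (\<lambda>g. s0 < card (\<Union>(near d L 0 g))) +
       (prb (?A n) (?p n) (dense_over d {} L) + prb (?A n) (?p n) (\<lambda>g. \<exists>i\<in>I. Q i n g))"
      by (intro order_trans[OF prb_le_add[OF p]] add_left_mono prb_le_add[OF p])
    also have "\<dots> \<le> K / (real s0 + 1) + (K' / real n + (\<Sum>i\<in>I. prb (?A n) (?p n) (Q i n)))"
    proof (intro add_mono)
      show "prb (?A n) (?p n) (\<lambda>g. s0 < card (\<Union>(near d L 0 g))) \<le> K / (real s0 + 1)"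
        using K(2)[OF _ p(2)] elim by blast
      show "prb (?A n) (?p n) (dense_over d {} L) \<le> K' / real n" using K'(2)[OF _ p(2), of "{}"] elim by simp
      show "prb (?A n) (?p n) (\<lambda>g. \<exists>i\<in>I. Q i n g) \<le> (\<Sum>i\<in>I. prb (?A n) (?p n) (Q i n))"
        by (rule prb_Ex_le[OF p finI])
    qed
    also have "\<dots> < r" using sK elim by linarith
    finally show ?case using prb_nonneg[OF p, of "?A n" "\<lambda>g. \<not> good_graph d L q \<T> n g"] by simp
  qed
  then show "\<exists>no. \<forall>n\<ge>no. norm (prb (?A n) (?p n) (\<lambda>g. \<not> good_graph d L q \<T> n g) - 0) < r"
    by (simp add: eventually_sequentially)
qed

text \<open>The family \<F> collects all relabelled neighbourhoods of good models of \<phi>, of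
  every size n. On good hypergraphs \<open>good_models_iff\<close> shows that membership in \<F>
  decides \<phi>.\<close>

theorem sentence_determined_by_near:
  assumes d: "3 \<le> d" and c: "0 < c" and \<phi>: "sentence d \<phi>"
  shows "\<exists>L R \<F>. iso_closed \<F> \<and>
    (\<lambda>n. prb (possible_edges d n) (c / real n ^ (d - 1)) (\<lambda>g. models {1..n} g \<phi> \<noteq> (near d L R g \<in> \<F>))) \<longlonglongrightarrow> 0"
proof -
  define q where "q = qrank \<phi>"
  \<comment> \<open>Just long enough for \<open>ball_is_tree\<close> at radius
    \<open>lrad q\<close>.\<close>
  define L where "L = 2 * lrad q + 1"
  define R where "R = lrad q"
  obtain \<T> where \<T>: "reps_ok d q \<T>" using reps_ok_exists by blast
  define \<F> where "\<F> = {H. \<exists>n g h. g \<subseteq> possible_edges d n \<and> good_graph d L q \<T> n g \<and> models {1..n} g \<phi> \<and>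
    inj_on h (\<Union>(near d L R g)) \<and> H = (`) (h :: nat \<Rightarrow> nat) ` near d L R g}"
  have "iso_closed \<F>"
    unfolding iso_closed_def
  proof (intro allI impI)
    fix H and k :: "nat \<Rightarrow> nat" assume H: "H \<in> \<F>" "inj_on k (\<Union>H)"
    then obtain n g h where g: "g \<subseteq> possible_edges d n" "good_graph d L q \<T> n g" "models {1..n} g \<phi>"
      "inj_on h (\<Union>(near d L R g))" "H = (`) (h :: nat \<Rightarrow> nat) ` near d L R g"
      unfolding \<F>_def mem_Collect_eq by (elim exE conjE)
    have "\<Union>H = h ` \<Union>(near d L R g)" unfolding g(5) by auto
    then have "inj_on (k \<circ> h) (\<Union>(near d L R g))" using comp_inj_on[OF g(4)] H(2) by simp
    moreover have "(`) k ` H = (`) (k \<circ> h) ` near d L R g" unfolding g(5) by (auto simp: image_image image_comp)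
    ultimately show "(`) k ` H \<in> \<F>" unfolding \<F>_def mem_Collect_eq using g(1-3)
      by (intro exI[of _ n] exI[of _ g] exI[of _ "k \<circ> h"] conjI)
  qed
  moreover have "models {1..n} g \<phi> \<longleftrightarrow> near d L R g \<in> \<F>"
    if g: "g \<subseteq> possible_edges d n" "good_graph d L q \<T> n g" for n g
  proof
    assume m: "models {1..n} g \<phi>"
    have "near d L R g = (`) id ` near d L R g" by simp
    then show "near d L R g \<in> \<F>" unfolding \<F>_def mem_Collect_eq using g m
      by (intro exI[of _ n] exI[of _ g] exI[of _ id] conjI) auto
  next
    assume "near d L R g \<in> \<F>"
    then obtain n0 g0 h where g0: "g0 \<subseteq> possible_edges d n0" "good_graph d L q \<T> n0 g0" "models {1..n0} g0 \<phi>"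
      "inj_on h (\<Union>(near d L R g0))" "near d L R g = (`) (h :: nat \<Rightarrow> nat) ` near d L R g0"
      unfolding \<F>_def mem_Collect_eq by (elim exE conjE)
    have L': "2 * lrad q < L" unfolding L_def by simp
    show "models {1..n} g \<phi>"
      using good_models_iff[OF d \<T> L' g0(1,2) g(1,2) g0(4)[unfolded R_def] g0(5)[unfolded R_def] \<phi>] g0(3)
      unfolding q_def by simp
  qed
  note iff = this
  have "(\<lambda>n. prb (possible_edges d n) (c / real n ^ (d - 1)) (\<lambda>g. models {1..n} g \<phi> \<noteq> (near d L R g \<in> \<F>))) \<longlonglongrightarrow> 0"
  proof (rule Lim_null_comparison[OF _ good_graph_whp[OF d c \<T>, of L]])
    show "\<forall>\<^sub>F n in sequentially. norm (prb (possible_edges d n) (c / real n ^ (d - 1)) (\<lambda>g. models {1..n} g \<phi> \<noteq> (near d L R g \<in> \<F>)))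
       \<le> prb (possible_edges d n) (c / real n ^ (d - 1)) (\<lambda>g. \<not> good_graph d L q \<T> n g)"
      using edge_prob_eventually[OF d c]
    proof eventually_elim
      case (elim n)
      have p: "0 \<le> c / real n ^ (d - 1)" "c / real n ^ (d - 1) \<le> 1" using elim by auto
      have "prb (possible_edges d n) (c / real n ^ (d - 1)) (\<lambda>g. models {1..n} g \<phi> \<noteq> (near d L R g \<in> \<F>))
       \<le> prb (possible_edges d n) (c / real n ^ (d - 1)) (\<lambda>g. \<not> good_graph d L q \<T> n g)"
        by (rule prb_mono[OF p]) (use iff in blast)
      then show ?case using prb_nonneg[OF p, of "possible_edges d n"] by (simp only: real_norm_def abs_of_nonneg)
    qed
  qed
  ultimately show ?thesis by blast
qed

lemma fo_prob_eventually:
  assumes "3 \<le> d" "0 < c"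
  shows "\<forall>\<^sub>F n in sequentially. fo_prob d c \<phi> n = prb (possible_edges d n) (c / real n ^ (d - 1)) (\<lambda>g. models {1..n} g \<phi>)"
  using edge_prob_eventually[OF assms] unfolding fo_prob_def
  by eventually_elim (rule random_hypergraph_prob, auto)

theorem fo_prob_convergent:
  assumes d: "3 \<le> d" and c: "0 < c" and \<phi>: "sentence d \<phi>"
  shows "convergent (fo_prob d c \<phi>)"
proof -
  obtain L R \<F> where F: "iso_closed \<F>" and
    lim: "(\<lambda>n. prb (possible_edges d n) (c / real n ^ (d - 1)) (\<lambda>g. models {1..n} g \<phi> \<noteq> (near d L R g \<in> \<F>))) \<longlonglongrightarrow> 0"
    using sentence_determined_by_near[OF d c \<phi>] by blast
  let ?Q = "\<lambda>n. prb (possible_edges d n) (c / real n ^ (d - 1)) (\<lambda>g. near d L R g \<in> \<F>)"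
  obtain a where a: "?Q \<longlonglongrightarrow> a" using near_law_convergent[OF d c F] unfolding convergent_def by blast
  have "(\<lambda>n. fo_prob d c \<phi> n - ?Q n) \<longlonglongrightarrow> 0"
  proof (rule Lim_null_comparison[OF _ lim])
    show "\<forall>\<^sub>F n in sequentially. norm (fo_prob d c \<phi> n - ?Q n) \<le>
       prb (possible_edges d n) (c / real n ^ (d - 1)) (\<lambda>g. models {1..n} g \<phi> \<noteq> (near d L R g \<in> \<F>))"
      using fo_prob_eventually[OF d c, of \<phi>] edge_prob_eventually[OF d c]
    proof eventually_elim
      case (elim n)
      have p: "0 \<le> c / real n ^ (d - 1)" "c / real n ^ (d - 1) \<le> 1" using elim by auto
      show ?case unfolding elim(1) real_norm_def by (rule prb_diff_le[OF p]) simp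
    qed
  qed
  from tendsto_add[OF this a] show ?thesis by (auto simp: convergent_def)
qed

lemma limit_prob_tendsto:
  assumes "3 \<le> d" "0 < c" "sentence d \<phi>"
  shows "(\<lambda>n. prb (possible_edges d n) (c / real n ^ (d - 1)) (\<lambda>g. models {1..n} g \<phi>)) \<longlonglongrightarrow> limit_prob d c \<phi>"
proof -
  have "fo_prob d c \<phi> \<longlonglongrightarrow> limit_prob d c \<phi>"
    using fo_prob_convergent[OF assms] unfolding limit_prob_def by (simp add: convergent_LIMSEQ_iff)
  then show ?thesis using fo_prob_eventually[OF assms(1,2)] by (rule Lim_transform_eventually)
qed

text \<open>A hypergraph without short cycles has the empty neighbourhood, so whether
  \<open>{}\<close> belongs to \<F> decides the sentence on almost all of them.\<close>

theorem limit_prob_dichotomy: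
  assumes d: "3 \<le> d" and c: "0 < c" and \<phi>: "sentence d \<phi>"
  shows "\<exists>L. exp (- pois_total d c L) \<le> limit_prob d c \<phi> \<or> limit_prob d c \<phi> \<le> 1 - exp (- pois_total d c L)"
proof -
  obtain L R \<F> where F: "iso_closed \<F>" and
    lim: "(\<lambda>n. prb (possible_edges d n) (c / real n ^ (d - 1)) (\<lambda>g. models {1..n} g \<phi> \<noteq> (near d L R g \<in> \<F>))) \<longlonglongrightarrow> 0"
    using sentence_determined_by_near[OF d c \<phi>] by blast
  let ?A = "\<lambda>n. possible_edges d n" and ?p = "\<lambda>n. c / real n ^ (d - 1)"
  let ?q = "\<lambda>n. cyc_prob d c L n (\<lambda>_. 0)"
  let ?D = "\<lambda>n. prb (?A n) (?p n) (\<lambda>g. models {1..n} g \<phi> \<noteq> (near d L R g \<in> \<F>))"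
  let ?M = "\<lambda>n. prb (?A n) (?p n) (\<lambda>g. models {1..n} g \<phi>)"
  note M = limit_prob_tendsto[OF d c \<phi>] and q = no_short_cycle_prob[OF d c, of L]
  have empty: "near d L R g = {}" if "g \<subseteq> ?A n" "\<forall>k\<in>{2..L}. ncyc d k g = 0" for g n
  proof -
    have fin: "finite g" by (rule finite_subset[OF that(1)]) (simp add: possible_edges_eq)
    have "\<not> is_cycle d k C" if C: "C \<subseteq> g" "k \<le> L" for C k
      using \<open>\<forall>k\<in>{2..L}. ncyc d k g = 0\<close> ncyc_zero_iff[OF fin, of d k] cycle_ge2[of d k C] C by auto
    then have "core d L g = {}" unfolding core_def by auto
    moreover have "ball_of g R {} = {}" by (induction R) (auto simp: ball_of_Suc nbr_def)
    ultimately show ?thesis unfolding near_def by simp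
  qed
  show ?thesis
  proof (cases "{} \<in> \<F>")
    case True
    have "exp (- pois_total d c L) \<le> limit_prob d c \<phi> + 0"
    proof (rule tendsto_le[OF _ tendsto_add[OF M lim] q])
      show "\<forall>\<^sub>F n in sequentially. ?q n \<le> ?M n + ?D n"
        using edge_prob_eventually[OF d c]
      proof eventually_elim
        case (elim n)
        have p: "0 \<le> ?p n" "?p n \<le> 1" using elim by auto
        have "?q n \<le> prb (?A n) (?p n) (\<lambda>g. models {1..n} g \<phi> \<or> models {1..n} g \<phi> \<noteq> (near d L R g \<in> \<F>))"
          unfolding cyc_prob_def by (rule prb_mono[OF p]) (use empty True in auto)
        also have "\<dots> \<le> ?M n + ?D n" by (rule prb_le_add[OF p])
        finally show ?case .
      qed
    qed simp
    then show ?thesis by auto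
  next
    case False
    have "exp (- pois_total d c L) \<le> (1 - limit_prob d c \<phi>) + 0"
    proof (rule tendsto_le[OF _ tendsto_add[OF tendsto_diff[OF tendsto_const M] lim] q])
      show "\<forall>\<^sub>F n in sequentially. ?q n \<le> (1 - ?M n) + ?D n"
        using edge_prob_eventually[OF d c]
      proof eventually_elim
        case (elim n)
        have p: "0 \<le> ?p n" "?p n \<le> 1" using elim by auto
        have "?q n \<le> prb (?A n) (?p n) (\<lambda>g. \<not> models {1..n} g \<phi> \<or> models {1..n} g \<phi> \<noteq> (near d L R g \<in> \<F>))"
          unfolding cyc_prob_def by (rule prb_mono[OF p]) (use empty False in auto)
        also have "\<dots> \<le> prb (?A n) (?p n) (\<lambda>g. \<not> models {1..n} g \<phi>) + ?D n" by (rule prb_le_add[OF p])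
        finally show ?case by (simp add: prb_not possible_edges_eq)
      qed
    qed simp
    then show ?thesis by (intro exI[of _ L] disjI2) simp
  qed
qed

section \<open>Definable events\<close>

definition verum :: fm where "verum = Neg (Exists 0 (Neg (Eq 0 0)))"

primrec conjs :: "fm list \<Rightarrow> fm" where
  "conjs [] = verum"
| "conjs (\<phi> # \<phi>s) = Conj \<phi> (conjs \<phi>s)"

primrec exs :: "nat list \<Rightarrow> fm \<Rightarrow> fm" where
  "exs [] \<phi> = \<phi>"
| "exs (x # xs) \<phi> = Exists x (exs xs \<phi>)"

lemma sat_conjs [simp]: "sat V E s (conjs \<phi>s) \<longleftrightarrow> (\<forall>\<phi>\<in>set \<phi>s. sat V E s \<phi>)"
  by (induction \<phi>s) (auto simp: verum_def)

lemma free_vars_conjs [simp]: "free_vars (conjs \<phi>s) = \<Union>(free_vars ` set \<phi>s)"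
  by (induction \<phi>s) (auto simp: verum_def)

lemma wf_conjs [simp]: "wf_fm d (conjs \<phi>s) \<longleftrightarrow> (\<forall>\<phi>\<in>set \<phi>s. wf_fm d \<phi>)"
  by (induction \<phi>s) (auto simp: verum_def)

lemma free_vars_exs [simp]: "free_vars (exs xs \<phi>) = free_vars \<phi> - set xs"
  by (induction xs) auto

lemma wf_exs [simp]: "wf_fm d (exs xs \<phi>) \<longleftrightarrow> wf_fm d \<phi>"
  by (induction xs) auto

lemma sat_exs: "sat V E s (exs xs \<phi>) \<longleftrightarrow>
  (\<exists>t. (\<forall>x\<in>set xs. t x \<in> V) \<and> (\<forall>x. x \<notin> set xs \<longrightarrow> t x = s x) \<and> sat V E t \<phi>)"
proof (induction xs arbitrary: s)
  case Nil
  have "(\<forall>x. t x = s x) \<longleftrightarrow> t = s" for t by auto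
  then show ?case by simp
next
  case (Cons x xs)
  show ?case
  proof
    assume "sat V E s (exs (x # xs) \<phi>)"
    then obtain v t where vt: "v \<in> V" "\<forall>y\<in>set xs. t y \<in> V" "\<forall>y. y \<notin> set xs \<longrightarrow> t y = (s(x := v)) y" "sat V E t \<phi>"
      using Cons[of "s(x := _)"] by auto
    then show "\<exists>t. (\<forall>y\<in>set (x # xs). t y \<in> V) \<and> (\<forall>y. y \<notin> set (x # xs) \<longrightarrow> t y = s y) \<and> sat V E t \<phi>"
      by (intro exI[of _ t]) (cases "x \<in> set xs"; auto)
  next
    assume "\<exists>t. (\<forall>y\<in>set (x # xs). t y \<in> V) \<and> (\<forall>y. y \<notin> set (x # xs) \<longrightarrow> t y = s y) \<and> sat V E t \<phi>"
    then obtain t where t: "\<forall>y\<in>set (x # xs). t y \<in> V" "\<forall>y. y \<notin> set (x # xs) \<longrightarrow> t y = s y" "sat V E t \<phi>" by blast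
    then have "sat V E (s(x := t x)) (exs xs \<phi>)" unfolding Cons by (intro exI[of _ t]) auto
    then show "sat V E s (exs (x # xs) \<phi>)" using t(1) by auto
  qed
qed

text \<open>A single sentence must describe the event for all n. Working with events makes Boolean
  combinations available without writing out formulas.\<close>

definition definable :: "nat \<Rightarrow> (nat \<Rightarrow> nat set set \<Rightarrow> bool) \<Rightarrow> bool" where
  "definable d Q \<longleftrightarrow> (\<exists>\<phi>. sentence d \<phi> \<and> (\<forall>n g. g \<subseteq> possible_edges d n \<longrightarrow> models {1..n} g \<phi> \<longleftrightarrow> Q n g))"

lemma definable_not: "definable d Q \<Longrightarrow> definable d (\<lambda>n g. \<not> Q n g)"
proof -
  assume "definable d Q"
  then obtain \<phi> where \<phi>: "sentence d \<phi>" "\<And>n g. g \<subseteq> possible_edges d n \<Longrightarrow> models {1..n} g \<phi> \<longleftrightarrow> Q n g"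
    unfolding definable_def by blast
  have s: "sentence d (Neg \<phi>)" using \<phi>(1) by (simp add: sentence_def)
  have "models {1..n} g (Neg \<phi>) \<longleftrightarrow> \<not> Q n g" if "g \<subseteq> possible_edges d n" for n g
    using models_iff_sat[OF s, of "{1..n}" g undefined] models_iff_sat[OF \<phi>(1), of "{1..n}" g undefined] \<phi>(2)[OF that] by simp
  then show ?thesis using s unfolding definable_def by blast
qed

lemma definable_conj: "definable d Q \<Longrightarrow> definable d R \<Longrightarrow> definable d (\<lambda>n g. Q n g \<and> R n g)"
proof -
  assume "definable d Q" "definable d R"
  then obtain \<phi> \<psi> where \<phi>: "sentence d \<phi>" "\<And>n g. g \<subseteq> possible_edges d n \<Longrightarrow> models {1..n} g \<phi> \<longleftrightarrow> Q n g"
    and \<psi>: "sentence d \<psi>" "\<And>n g. g \<subseteq> possible_edges d n \<Longrightarrow> models {1..n} g \<psi> \<longleftrightarrow> R n g"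
    unfolding definable_def by blast
  have s: "sentence d (Conj \<phi> \<psi>)" using \<phi>(1) \<psi>(1) by (simp add: sentence_def)
  have "models {1..n} g (Conj \<phi> \<psi>) \<longleftrightarrow> Q n g \<and> R n g" if "g \<subseteq> possible_edges d n" for n g
    using models_iff_sat[OF s, of "{1..n}" g undefined] models_iff_sat[OF \<phi>(1), of "{1..n}" g undefined]
      models_iff_sat[OF \<psi>(1), of "{1..n}" g undefined] \<phi>(2)[OF that] \<psi>(2)[OF that] by simp
  then show ?thesis using s unfolding definable_def by blast
qed

lemma definable_disj: "definable d Q \<Longrightarrow> definable d R \<Longrightarrow> definable d (\<lambda>n g. Q n g \<or> R n g)"
  using definable_not[OF definable_conj[OF definable_not definable_not], of d Q R] by simp

lemma definable_True: "definable d (\<lambda>n g. True)"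
  unfolding definable_def sentence_def models_def by (intro exI[of _ verum]) (auto simp: verum_def)

lemma definable_Ball: "finite I \<Longrightarrow> (\<And>i. i \<in> I \<Longrightarrow> definable d (Q i)) \<Longrightarrow> definable d (\<lambda>n g. \<forall>i\<in>I. Q i n g)"
proof (induction I rule: finite_induct)
  case empty then show ?case using definable_True by simp
next
  case (insert i I)
  then show ?case using definable_conj[of d "Q i" "\<lambda>n g. \<forall>i\<in>I. Q i n g"] by simp
qed

lemma definable_Bex: "finite I \<Longrightarrow> (\<And>i. i \<in> I \<Longrightarrow> definable d (Q i)) \<Longrightarrow> definable d (\<lambda>n g. \<exists>i\<in>I. Q i n g)"
  using definable_not[OF definable_Ball[of I d "\<lambda>i n g. \<not> Q i n g"]] definable_not by simp

section \<open>Formulas that count cycles\<close>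

text \<open>Mixed radix numbering of the variables: copy \<open>a\<close>, block \<open>i\<close>,
  place \<open>j\<close>. Decoding by \<open>div\<close> and \<open>mod\<close> rebuilds an
  assignment from a family of cycles.\<close>

definition cyc_var :: "nat \<Rightarrow> nat \<Rightarrow> nat \<Rightarrow> nat \<Rightarrow> nat \<Rightarrow> nat" where
  "cyc_var d k a i j = (a * k + i) * (d - 1) + j"

definition cyc_vars :: "nat \<Rightarrow> nat \<Rightarrow> nat \<Rightarrow> nat list list" where
  "cyc_vars d k a = map (\<lambda>i. map (cyc_var d k a i) [0..<d - 1]) [0..<k]"

definition cyc_fm :: "nat \<Rightarrow> nat \<Rightarrow> nat \<Rightarrow> fm" where
  "cyc_fm d k a = Conj
     (conjs (map (\<lambda>(x, y). Neg (Eq x y)) (filter (\<lambda>(x, y). x \<noteq> y)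
        (List.product (concat (cyc_vars d k a)) (concat (cyc_vars d k a))))))
     (conjs (map (\<lambda>i. Edge (cyc_vars d k a ! i @ [hd (cyc_vars d k a ! (Suc i mod k))])) [0..<k]))"

definition diff_fm :: "nat \<Rightarrow> nat \<Rightarrow> nat \<Rightarrow> nat \<Rightarrow> fm" where
  "diff_fm d k a b = Neg (conjs (map (\<lambda>(i, j). Eq (cyc_var d k a i j) (cyc_var d k b i j)) (List.product [0..<k] [0..<d - 1])))"

text \<open>Encodings of cycles are counted instead of cycles, so that distinctness is a plain
  inequality of variable tuples; every cycle has the same number of encodings.\<close>

definition many_fm :: "nat \<Rightarrow> nat \<Rightarrow> nat \<Rightarrow> fm" where
  "many_fm d k m = exs [0..<m * k * (d - 1)] (Conj (conjs (map (cyc_fm d k) [0..<m]))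
     (conjs (map (\<lambda>(a, b). diff_fm d k a b) (filter (\<lambda>(a, b). a \<noteq> b) (List.product [0..<m] [0..<m])))))"

lemma cyc_var_decode:
  assumes "i < k" "j < d - 1"
  shows "cyc_var d k a i j mod (d - 1) = j" "cyc_var d k a i j div (d - 1) mod k = i" "cyc_var d k a i j div (d - 1) div k = a"
proof -
  show "cyc_var d k a i j mod (d - 1) = j" unfolding cyc_var_def using assms by simp
  have "cyc_var d k a i j div (d - 1) = a * k + i" unfolding cyc_var_def using assms by simp
  then show "cyc_var d k a i j div (d - 1) mod k = i" "cyc_var d k a i j div (d - 1) div k = a" using assms by simp_all
qed

lemma cyc_var_inj:
  assumes "i < k" "j < d - 1" "i' < k" "j' < d - 1" "cyc_var d k a i j = cyc_var d k a' i' j'"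
  shows "a = a' \<and> i = i' \<and> j = j'"
  using cyc_var_decode[OF assms(1,2), of a] cyc_var_decode[OF assms(3,4), of a'] assms(5) by metis

lemma cyc_var_less:
  assumes "a < m" "i < k" "j < d - 1" shows "cyc_var d k a i j < m * k * (d - 1)"
proof -
  have "a * k + i < m * k"
  proof -
    have "a * k + i < a * k + k" using assms by simp
    also have "\<dots> = (a + 1) * k" by simp
    also have "\<dots> \<le> m * k" using assms by (intro mult_le_mono1) simp
    finally show ?thesis .
  qed
  have "cyc_var d k a i j < (a * k + i) * (d - 1) + (d - 1)" unfolding cyc_var_def using assms by simp
  also have "\<dots> = (a * k + i + 1) * (d - 1)" by simp
  also have "\<dots> \<le> m * k * (d - 1)" using \<open>a * k + i < m * k\<close> by (intro mult_le_mono1) simp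
  finally show ?thesis .
qed

lemma set_concat_cyc_vars: "set (concat (cyc_vars d k a)) = {cyc_var d k a i j |i j. i < k \<and> j < d - 1}"
proof (intro equalityI subsetI)
  fix x assume "x \<in> set (concat (cyc_vars d k a))"
  then obtain i j where "i < k" "j < d - 1" "x = cyc_var d k a i j" unfolding cyc_vars_def by auto
  then show "x \<in> {cyc_var d k a i j |i j. i < k \<and> j < d - 1}" by blast
next
  fix x assume "x \<in> {cyc_var d k a i j |i j. i < k \<and> j < d - 1}"
  then obtain i j where "i < k" "j < d - 1" "x = cyc_var d k a i j" by blast
  then show "x \<in> set (concat (cyc_vars d k a))" unfolding cyc_vars_def by (auto intro!: bexI[of _ i])
qed

lemma distinct_concat_cyc_vars: "distinct (concat (cyc_vars d k a))"
proof -
  have "concat (cyc_vars d k a) = map (\<lambda>(i, j). cyc_var d k a i j) (List.product [0..<k] [0..<d - 1])"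
    unfolding cyc_vars_def by (simp add: product_concat_map map_concat comp_def)
  moreover have "inj_on (\<lambda>(i, j). cyc_var d k a i j) (set (List.product [0..<k] [0..<d - 1]))"
  proof (rule inj_onI)
    fix p q assume pq: "p \<in> set (List.product [0..<k] [0..<d - 1])" "q \<in> set (List.product [0..<k] [0..<d - 1])"
      "(\<lambda>(i, j). cyc_var d k a i j) p = (\<lambda>(i, j). cyc_var d k a i j) q"
    obtain i j i' j' where p: "p = (i, j)" "q = (i', j')" by (cases p, cases q)
    then show "p = q" using pq cyc_var_inj[of i k j d i' j' a a] by simp
  qed
  ultimately show ?thesis by (simp add: distinct_map distinct_product)
qed

lemma sat_cyc_fm:
  assumes d: "3 \<le> d" and k: "2 \<le> k"
  shows "sat V E t (cyc_fm d k a) \<longleftrightarrow>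
    cyc_blocks d k (map (map t) (cyc_vars d k a)) \<and> cyc_edges (map (map t) (cyc_vars d k a)) \<subseteq> E"
proof -
  let ?vs = "cyc_vars d k a" and ?bs = "map (map t) (cyc_vars d k a)"
  have len: "length ?vs = k" by (simp add: cyc_vars_def)
  have blk: "length b = d - 1" if "b \<in> set ?vs" for b using that by (auto simp: cyc_vars_def)
  have blki: "length (?vs ! i) = d - 1" if "i < k" for i using blk that len by (metis nth_mem)
  have dist: "sat V E t (conjs (map (\<lambda>(x, y). Neg (Eq x y)) (filter (\<lambda>(x, y). x \<noteq> y)
        (List.product (concat ?vs) (concat ?vs))))) \<longleftrightarrow> distinct (concat ?bs)"
  proof -
    have "concat ?bs = map t (concat ?vs)" by (simp add: map_concat)
    then have "distinct (concat ?bs) \<longleftrightarrow> inj_on t (set (concat ?vs))"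
      using distinct_concat_cyc_vars by (simp add: distinct_map)
    also have "\<dots> \<longleftrightarrow> (\<forall>x\<in>set (concat ?vs). \<forall>y\<in>set (concat ?vs). x \<noteq> y \<longrightarrow> t x \<noteq> t y)"
      unfolding inj_on_def by metis
    finally show ?thesis by (auto simp del: set_concat)
  qed
  have cb: "cyc_blocks d k ?bs \<longleftrightarrow> distinct (concat ?bs)"
    unfolding cyc_blocks_def using len blk by auto
  have edge: "sat V E t (Edge (?vs ! i @ [hd (?vs ! (Suc i mod k))])) \<longleftrightarrow> cyc_edge ?bs i \<in> E"
    if cbs: "cyc_blocks d k ?bs" and i: "i < k" for i
  proof -
    have s: "Suc i mod k < k" using k by simp
    have ne: "?vs ! (Suc i mod k) \<noteq> []" using blki[OF s] d by auto
    have e: "set (map t (?vs ! i @ [hd (?vs ! (Suc i mod k))])) = cyc_edge ?bs i"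
      unfolding cyc_edge_eq[OF d k cbs] using i s len ne by (simp add: hd_map)
    have "card (set (map t (?vs ! i @ [hd (?vs ! (Suc i mod k))]))) = length (map t (?vs ! i @ [hd (?vs ! (Suc i mod k))]))"
      unfolding e using cyc_edge_card[OF d k cbs i] blki[OF i] d by simp
    then have "distinct (map t (?vs ! i @ [hd (?vs ! (Suc i mod k))]))" by (rule card_distinct)
    then show ?thesis unfolding sat.simps e by simp
  qed
  have "sat V E t (conjs (map (\<lambda>i. Edge (?vs ! i @ [hd (?vs ! (Suc i mod k))])) [0..<k])) \<longleftrightarrow> cyc_edges ?bs \<subseteq> E"
    if "cyc_blocks d k ?bs"
  proof -
    have "sat V E t (conjs (map (\<lambda>i. Edge (?vs ! i @ [hd (?vs ! (Suc i mod k))])) [0..<k])) \<longleftrightarrow>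
      (\<forall>i<k. sat V E t (Edge (?vs ! i @ [hd (?vs ! (Suc i mod k))])))" by auto
    also have "\<dots> \<longleftrightarrow> (\<forall>i<k. cyc_edge ?bs i \<in> E)" using edge[OF that] by blast
    also have "\<dots> \<longleftrightarrow> cyc_edges ?bs \<subseteq> E" unfolding cyc_edges_def by (auto simp: len)
    finally show ?thesis .
  qed
  then show ?thesis unfolding cyc_fm_def sat.simps(4) dist cb[symmetric] by blast
qed

lemma map_cyc_vars_eq_iff:
  "map (map t) (cyc_vars d k a) = map (map t) (cyc_vars d k b) \<longleftrightarrow>
    (\<forall>i<k. \<forall>j<d - 1. t (cyc_var d k a i j) = t (cyc_var d k b i j))"
  unfolding cyc_vars_def by (auto simp: list_eq_iff_nth_eq)

lemma sat_diff_fm: "sat V E t (diff_fm d k a b) \<longleftrightarrow> map (map t) (cyc_vars d k a) \<noteq> map (map t) (cyc_vars d k b)"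
proof -
  have "sat V E t (diff_fm d k a b) \<longleftrightarrow> \<not> (\<forall>p\<in>{0..<k} \<times> {0..<d - 1}. t (cyc_var d k a (fst p) (snd p)) = t (cyc_var d k b (fst p) (snd p)))"
    unfolding diff_fm_def by (simp add: case_prod_beta)
  also have "\<dots> \<longleftrightarrow> \<not> (\<forall>i<k. \<forall>j<d - 1. t (cyc_var d k a i j) = t (cyc_var d k b i j))" by fastforce
  finally show ?thesis unfolding map_cyc_vars_eq_iff .
qed

lemma sat_many_fm:
  assumes d: "3 \<le> d" and k: "2 \<le> k" and E: "finite E" "E \<subseteq> Pow V"
  shows "sat V E s (many_fm d k m) \<longleftrightarrow> m \<le> card {bs. cyc_blocks d k bs \<and> cyc_edges bs \<subseteq> E}"
proof -
  let ?B = "{bs. cyc_blocks d k bs \<and> cyc_edges bs \<subseteq> E}"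
  have finB: "finite ?B" by (rule card_cyc_blocks(2)[OF d k E(1)])
  let ?f = "\<lambda>t a. map (map t) (cyc_vars d k a)"
  let ?body = "Conj (conjs (map (cyc_fm d k) [0..<m]))
     (conjs (map (\<lambda>(a, b). diff_fm d k a b) (filter (\<lambda>(a, b). a \<noteq> b) (List.product [0..<m] [0..<m]))))"
  have body: "sat V E t ?body \<longleftrightarrow> (\<forall>a<m. ?f t a \<in> ?B) \<and> inj_on (?f t) {..<m}" for t
  proof -
    have 1: "sat V E t (conjs (map (cyc_fm d k) [0..<m])) \<longleftrightarrow> (\<forall>a<m. ?f t a \<in> ?B)"
      using sat_cyc_fm[OF d k, of V E t] by auto
    have 2: "sat V E t (conjs (map (\<lambda>(a, b). diff_fm d k a b) (filter (\<lambda>(a, b). a \<noteq> b) (List.product [0..<m] [0..<m])))) \<longleftrightarrow>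
      (\<forall>a<m. \<forall>b<m. a \<noteq> b \<longrightarrow> ?f t a \<noteq> ?f t b)"
      using sat_diff_fm[of V E t d k] by auto
    have "(\<forall>a<m. \<forall>b<m. a \<noteq> b \<longrightarrow> ?f t a \<noteq> ?f t b) \<longleftrightarrow> inj_on (?f t) {..<m}"
      unfolding inj_on_def Ball_def lessThan_iff by blast
    then show ?thesis unfolding sat.simps(4) 1 2 by simp
  qed
  show ?thesis
  proof
    assume "sat V E s (many_fm d k m)"
    then obtain t where "sat V E t ?body" unfolding many_fm_def sat_exs by blast
    then have "(\<forall>a<m. ?f t a \<in> ?B) \<and> inj_on (?f t) {..<m}" unfolding body .
    then have "card {..<m} \<le> card ?B" using finB by (intro card_inj_on_le[of "?f t"]) auto
    then show "m \<le> card ?B" by simp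
  next
    assume "m \<le> card ?B"
    then have "card {..<m} \<le> card ?B" by simp
    then obtain f where f: "inj_on f {..<m}" "f ` {..<m} \<subseteq> ?B"
      using inj_on_iff_card_le[of "{..<m}" ?B] finB by blast
    have fB: "cyc_blocks d k (f a) \<and> cyc_edges (f a) \<subseteq> E" if "a < m" for a using f(2) that by blast
    let ?n = "m * k * (d - 1)"
    \<comment> \<open>Copy, block and place are read off the variable number; all other variables
      keep their old value, as \<open>sat_exs\<close> demands.\<close>
    define t where "t x = (if x < ?n then f (x div (d - 1) div k) ! (x div (d - 1) mod k) ! (x mod (d - 1)) else s x)" for x
    have tv: "t (cyc_var d k a i j) = f a ! i ! j" if "a < m" "i < k" "j < d - 1" for a i j
      unfolding t_def using cyc_var_less[OF that] cyc_var_decode[OF that(2,3), of a] by simp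
    have ft: "?f t a = f a" if a: "a < m" for a
    proof (rule nth_equalityI)
      show "length (?f t a) = length (f a)" using fB[OF a] by (simp add: cyc_vars_def cyc_blocks_def)
      fix i assume "i < length (?f t a)"
      then have i: "i < k" by (simp add: cyc_vars_def)
      have li: "length (f a ! i) = d - 1" using cyc_block_len[OF d k _ i] fB[OF a] by blast
      show "?f t a ! i = f a ! i"
        by (rule nth_equalityI) (use i li tv[OF a i] in \<open>auto simp: cyc_vars_def\<close>)
    qed
    have "t x \<in> V" if x: "x < ?n" for x
    proof -
      have d1: "0 < d - 1" and k0: "0 < k" using d k by auto
      let ?a = "x div (d - 1) div k" and ?i = "x div (d - 1) mod k" and ?j = "x mod (d - 1)"
      have "x div (d - 1) < m * k" using x d1 by (simp add: div_less_iff_less_mult)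
      then have a: "?a < m" using k0 by (simp add: div_less_iff_less_mult)
      have i: "?i < k" and j: "?j < d - 1" using k0 d1 by simp_all
      have cb: "cyc_blocks d k (f ?a)" "cyc_edges (f ?a) \<subseteq> E" using fB[OF a] by auto
      have "f ?a ! ?i ! ?j \<in> set (f ?a ! ?i)" using cyc_block_len[OF d k cb(1) i] j by simp
      then have "f ?a ! ?i ! ?j \<in> cyc_edge (f ?a) ?i" unfolding cyc_edge_def by simp
      moreover have "cyc_edge (f ?a) ?i \<in> cyc_edges (f ?a)"
        unfolding cyc_edges_def by (rule imageI) (use i cyc_len[OF d k cb(1)] in simp)
      then have "cyc_edge (f ?a) ?i \<in> E" by (rule subsetD[OF cb(2)])
      ultimately show ?thesis unfolding t_def using x E(2) by auto
    qed
    moreover have "sat V E t ?body" unfolding body using ft fB f(1) by (auto simp: inj_on_def)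
    ultimately show "sat V E s (many_fm d k m)"
      unfolding many_fm_def sat_exs by (intro exI[of _ t]) (auto simp: t_def)
  qed
qed

lemma free_vars_cyc_fm: "2 \<le> k \<Longrightarrow> 3 \<le> d \<Longrightarrow> a < m \<Longrightarrow> free_vars (cyc_fm d k a) \<subseteq> {..<m * k * (d - 1)}"
proof -
  assume k: "2 \<le> k" and d: "3 \<le> d" and a: "a < m"
  have v: "x < m * k * (d - 1)" if "x \<in> set (concat (cyc_vars d k a))" for x
    using that cyc_var_less[OF a] unfolding set_concat_cyc_vars by blast
  have e: "set (cyc_vars d k a ! i @ [hd (cyc_vars d k a ! (Suc i mod k))]) \<subseteq> set (concat (cyc_vars d k a))" if "i < k" for i
  proof -
    have s: "Suc i mod k < k" using k by simp
    have l: "length (cyc_vars d k a) = k" by (simp add: cyc_vars_def)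
    have "cyc_vars d k a ! (Suc i mod k) \<noteq> []" using s d by (simp add: cyc_vars_def)
    then have "hd (cyc_vars d k a ! (Suc i mod k)) \<in> set (cyc_vars d k a ! (Suc i mod k))" by (rule hd_in_set)
    moreover have "cyc_vars d k a ! i \<in> set (cyc_vars d k a)" "cyc_vars d k a ! (Suc i mod k) \<in> set (cyc_vars d k a)"
      using that s l by auto
    ultimately show ?thesis by auto
  qed
  show ?thesis unfolding cyc_fm_def using v e by (fastforce simp del: set_concat set_append)
qed

lemma sentence_many_fm:
  assumes d: "3 \<le> d" and k: "2 \<le> k" shows "sentence d (many_fm d k m)"
proof -
  have "length (cyc_vars d k a ! i @ [hd (cyc_vars d k a ! (Suc i mod k))]) = d" if "i < k" for a i
    using that d by (simp add: cyc_vars_def)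
  then have "wf_fm d (many_fm d k m)" unfolding many_fm_def cyc_fm_def diff_fm_def by auto
  moreover have "free_vars (diff_fm d k a b) \<subseteq> {..<m * k * (d - 1)}" if "a < m" "b < m" for a b
    unfolding diff_fm_def using cyc_var_less[OF that(1)] cyc_var_less[OF that(2)] by auto
  then have "free_vars (many_fm d k m) = {}"
    unfolding many_fm_def using free_vars_cyc_fm[OF k d] by (fastforce simp: subset_iff)
  ultimately show ?thesis unfolding sentence_def by blast
qed

text \<open>Each cycle contributes exactly \<open>2 * k * fact (d - 2) ^ k\<close> encodings, so a
  bound on the number of cycles is that multiple of it as a bound on encodings.\<close>

lemma definable_ncyc_ge:
  assumes d: "3 \<le> d" and k: "2 \<le> k" shows "definable d (\<lambda>n g. N \<le> ncyc d k g)"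
  unfolding definable_def
proof (intro exI conjI allI impI)
  let ?\<phi> = "many_fm d k (2 * k * fact (d - 2) ^ k * N)"
  show s: "sentence d ?\<phi>" by (rule sentence_many_fm[OF d k])
  fix n g assume g: "g \<subseteq> possible_edges d n"
  have fin: "finite g" by (rule finite_subset[OF g]) (simp add: possible_edges_eq)
  have sub: "g \<subseteq> Pow {1..n}" using g unfolding possible_edges_def by auto
  have "models {1..n} g ?\<phi> \<longleftrightarrow> 2 * k * fact (d - 2) ^ k * N \<le> 2 * k * fact (d - 2) ^ k * ncyc d k g"
    unfolding models_iff_sat[OF s, of "{1..n}" g undefined] sat_many_fm[OF d k fin sub] card_cyc_blocks(1)[OF d k fin]
      ncyc_def ..
  also have "\<dots> \<longleftrightarrow> N \<le> ncyc d k g" using k by (subst mult_le_cancel1) simp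
  finally show "models {1..n} g ?\<phi> \<longleftrightarrow> N \<le> ncyc d k g" .
qed

lemma definable_cyc_vector:
  assumes d: "3 \<le> d" shows "definable d (\<lambda>n g. \<forall>k\<in>{2..L}. ncyc d k g = x k)"
proof (rule definable_Ball)
  fix k assume "k \<in> {2..L}"
  then have k: "2 \<le> k" by simp
  have "definable d (\<lambda>n g. x k \<le> ncyc d k g \<and> \<not> Suc (x k) \<le> ncyc d k g)"
    by (intro definable_conj definable_not definable_ncyc_ge[OF d k])
  moreover have "(\<lambda>(n :: nat) g. x k \<le> ncyc d k g \<and> \<not> Suc (x k) \<le> ncyc d k g) = (\<lambda>n (g :: nat set set). ncyc d k g = x k)"
    by (intro ext) auto
  ultimately show "definable d (\<lambda>n g. ncyc d k g = x k)" by simp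
qed simp

lemma limit_set_iff:
  assumes d: "3 \<le> d" and c: "0 < c"
  shows "q \<in> limit_set d c \<longleftrightarrow>
    (\<exists>Q. definable d Q \<and> (\<lambda>n. prb (possible_edges d n) (c / real n ^ (d - 1)) (Q n)) \<longlonglongrightarrow> q)"
proof
  assume "q \<in> limit_set d c"
  then obtain \<phi> where \<phi>: "sentence d \<phi>" "q = limit_prob d c \<phi>" unfolding limit_set_def by blast
  have "definable d (\<lambda>n g. models {1..n} g \<phi>)" unfolding definable_def using \<phi>(1) by blast
  then show "\<exists>Q. definable d Q \<and> (\<lambda>n. prb (possible_edges d n) (c / real n ^ (d - 1)) (Q n)) \<longlonglongrightarrow> q"
    using limit_prob_tendsto[OF d c \<phi>(1)] \<phi>(2) by blast
next
  assume "\<exists>Q. definable d Q \<and> (\<lambda>n. prb (possible_edges d n) (c / real n ^ (d - 1)) (Q n)) \<longlonglongrightarrow> q"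
  then obtain Q \<phi> where Q: "(\<lambda>n. prb (possible_edges d n) (c / real n ^ (d - 1)) (Q n)) \<longlonglongrightarrow> q"
    and \<phi>: "sentence d \<phi>" "\<And>n g. g \<subseteq> possible_edges d n \<Longrightarrow> models {1..n} g \<phi> \<longleftrightarrow> Q n g"
    unfolding definable_def by blast
  have "prb (possible_edges d n) p (Q n) = prb (possible_edges d n) p (\<lambda>g. models {1..n} g \<phi>)" for n p
    using \<phi>(2) by (intro prb_cong) blast
  then have "(\<lambda>n. prb (possible_edges d n) (c / real n ^ (d - 1)) (\<lambda>g. models {1..n} g \<phi>)) \<longlonglongrightarrow> q" using Q by simp
  then have "q = limit_prob d c \<phi>" using limit_prob_tendsto[OF d c \<phi>(1)] LIMSEQ_unique by blast
  then show "q \<in> limit_set d c" unfolding limit_set_def using \<phi>(1) by blast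
qed

lemma definable_convergent:
  assumes d: "3 \<le> d" and c: "0 < c" and Q: "definable d Q"
  shows "\<exists>q. (\<lambda>n. prb (possible_edges d n) (c / real n ^ (d - 1)) (Q n)) \<longlonglongrightarrow> q"
proof -
  obtain \<phi> where \<phi>: "sentence d \<phi>" "\<And>n g. g \<subseteq> possible_edges d n \<Longrightarrow> models {1..n} g \<phi> \<longleftrightarrow> Q n g"
    using Q unfolding definable_def by blast
  have "prb (possible_edges d n) p (Q n) = prb (possible_edges d n) p (\<lambda>g. models {1..n} g \<phi>)" for n p
    using \<phi>(2) by (intro prb_cong) blast
  then show ?thesis using limit_prob_tendsto[OF d c \<phi>(1)] by auto
qed

text \<open>The event is removed on all cycle vectors in \<open>X\<close> and put back on those in
  \<open>Y\<close>. The part outside \<open>X\<close> has a limit \<open>a\<close> that does not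
  change, so all subset sums of the atoms occur shifted by \<open>a\<close>, and \<open>q\<close>
  lies within their range.\<close>

lemma limit_set_swap:
  assumes d: "3 \<le> d" and c: "0 < c" and q: "q \<in> limit_set d c"
    and X: "finite X" "X \<subseteq> PiE {2..L} (\<lambda>_. UNIV)"
  defines "w \<equiv> \<lambda>x. exp (- pois_total d c L) * pois_weight d c L x"
  shows "\<exists>a. 0 \<le> a \<and> a \<le> q \<and> q \<le> a + (\<Sum>x\<in>X. w x) \<and> (\<forall>Y\<subseteq>X. a + (\<Sum>x\<in>Y. w x) \<in> limit_set d c)"
proof -
  let ?P = "\<lambda>n. prb (possible_edges d n) (c / real n ^ (d - 1))"
  define C where "C x = (\<lambda>(n :: nat) (g :: nat set set). \<forall>k\<in>{2..L}. ncyc d k g = x k)" for x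
  obtain Q where Q: "definable d Q" "(\<lambda>n. ?P n (Q n)) \<longlonglongrightarrow> q" using q limit_set_iff[OF d c] by blast
  have defC: "definable d (C x)" for x unfolding C_def by (rule definable_cyc_vector[OF d])
  have inj: "x = y" if "x \<in> X" "y \<in> X" "C x n g" "C y n g" for x y n g
  proof (rule PiE_ext)
    show "x \<in> PiE {2..L} (\<lambda>_. UNIV)" "y \<in> PiE {2..L} (\<lambda>_. UNIV)" using that X(2) by auto
    fix k assume k: "k \<in> {2..L}"
    have "ncyc d k g = x k" "ncyc d k g = y k" using that(3,4) k unfolding C_def by blast+
    then show "x k = y k" by simp
  qed
  have limC: "(\<lambda>n. ?P n (\<lambda>g. \<exists>x\<in>Y. C x n g)) \<longlonglongrightarrow> (\<Sum>x\<in>Y. w x)" if Y: "Y \<subseteq> X" for Y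
  proof -
    have finY: "finite Y" using Y X(1) finite_subset by blast
    have "?P n (\<lambda>g. \<exists>x\<in>Y. C x n g) = (\<Sum>x\<in>Y. cyc_prob d c L n x)" for n
    proof -
      have "?P n (\<lambda>g. \<exists>x\<in>Y. C x n g) = (\<Sum>x\<in>Y. ?P n (\<lambda>g. C x n g))"
      proof (rule prb_Ex_disjoint[OF finY])
        fix g x y assume "x \<in> Y" "y \<in> Y" "C x n g" "C y n g"
        then show "x = y" using inj[of x y n g] Y by auto
      qed
      then show ?thesis unfolding cyc_prob_def C_def .
    qed
    then show ?thesis unfolding w_def using cyc_prob_tendsto[OF d c] by (auto intro!: tendsto_sum)
  qed
  let ?R = "\<lambda>n g. Q n g \<and> \<not> (\<exists>x\<in>X. C x n g)"
  have defR: "definable d ?R"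
    by (intro definable_conj Q(1) definable_not definable_Bex X(1) defC)
  obtain a where a: "(\<lambda>n. ?P n (?R n)) \<longlonglongrightarrow> a" using definable_convergent[OF d c defR] by blast
  have pn: "\<forall>\<^sub>F n in sequentially. 0 \<le> c / real n ^ (d - 1) \<and> c / real n ^ (d - 1) \<le> 1"
    using edge_prob_eventually[OF d c] by eventually_elim auto
  have "0 \<le> a"
  proof (rule tendsto_lowerbound[OF a])
    show "\<forall>\<^sub>F n in sequentially. 0 \<le> ?P n (?R n)" using pn by eventually_elim (auto intro: prb_nonneg)
  qed simp
  moreover have "a \<le> q"
  proof (rule tendsto_le[OF _ Q(2) a])
    show "\<forall>\<^sub>F n in sequentially. ?P n (?R n) \<le> ?P n (Q n)" using pn by eventually_elim (auto intro!: prb_mono)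
  qed simp
  moreover have "q \<le> a + (\<Sum>x\<in>X. w x)"
  proof (rule tendsto_le[OF _ tendsto_add[OF a limC[OF order_refl]] Q(2)])
    show "\<forall>\<^sub>F n in sequentially. ?P n (Q n) \<le> ?P n (?R n) + ?P n (\<lambda>g. \<exists>x\<in>X. C x n g)"
      using pn
    proof eventually_elim
      case (elim n)
      have p: "0 \<le> c / real n ^ (d - 1)" "c / real n ^ (d - 1) \<le> 1" using elim by auto
      have "?P n (Q n) \<le> ?P n (\<lambda>g. ?R n g \<or> (\<exists>x\<in>X. C x n g))" by (rule prb_mono[OF p]) blast
      also have "\<dots> \<le> ?P n (?R n) + ?P n (\<lambda>g. \<exists>x\<in>X. C x n g)" by (rule prb_le_add[OF p])
      finally show ?case .
    qed
  qed simp
  moreover have "a + (\<Sum>x\<in>Y. w x) \<in> limit_set d c" if Y: "Y \<subseteq> X" for Y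
  proof -
    have finY: "finite Y" using Y X(1) finite_subset by blast
    have "definable d (\<lambda>n g. ?R n g \<or> (\<exists>x\<in>Y. C x n g))" by (intro definable_disj defR definable_Bex finY defC)
    moreover have "?P n (\<lambda>g. ?R n g \<or> (\<exists>x\<in>Y. C x n g)) = ?P n (?R n) + ?P n (\<lambda>g. \<exists>x\<in>Y. C x n g)" for n
      by (rule prb_disj) (use Y in blast)
    then have "(\<lambda>n. ?P n (\<lambda>g. ?R n g \<or> (\<exists>x\<in>Y. C x n g))) \<longlonglongrightarrow> a + (\<Sum>x\<in>Y. w x)"
      using tendsto_add[OF a limC[OF Y]] by simp
    ultimately show ?thesis unfolding limit_set_iff[OF d c]
      by (intro exI[of _ "\<lambda>n g. ?R n g \<or> (\<exists>x\<in>Y. C x n g)"] conjI)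
  qed
  ultimately show ?thesis by blast
qed

lemma limit_set_bounds:
  assumes d: "3 \<le> d" and c: "0 < c" and q: "q \<in> limit_set d c"
  shows "0 \<le> q" "q \<le> 1"
proof -
  let ?P = "\<lambda>n. prb (possible_edges d n) (c / real n ^ (d - 1))"
  obtain Q where Q: "(\<lambda>n. ?P n (Q n)) \<longlonglongrightarrow> q" using q limit_set_iff[OF d c] by blast
  have pn: "\<forall>\<^sub>F n in sequentially. 0 \<le> ?P n (Q n) \<and> ?P n (Q n) \<le> 1"
    using edge_prob_eventually[OF d c] by eventually_elim (auto intro!: prb_nonneg prb_le_1 simp: possible_edges_eq)
  show "0 \<le> q" by (rule tendsto_lowerbound[OF Q]) (use pn in \<open>auto elim: eventually_mono\<close>)
  show "q \<le> 1" by (rule tendsto_upperbound[OF Q]) (use pn in \<open>auto elim: eventually_mono\<close>)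
qed

lemma limit_set_0: 
  assumes d: "3 \<le> d" and c: "0 < c" shows "0 \<in> limit_set d c"
proof -
  have "definable d (\<lambda>n g. False)" using definable_not[OF definable_True] by simp
  moreover have "(\<lambda>n. prb (possible_edges d n) (c / real n ^ (d - 1)) (\<lambda>_. False)) \<longlonglongrightarrow> 0" by (simp add: prb_def bexp_def)
  ultimately show ?thesis unfolding limit_set_iff[OF d c] by (intro exI[of _ "\<lambda>n g. False"] conjI)
qed

section \<open>Subset sums\<close>

text \<open>Kakeya's greedy argument: the items are decided in the order of increasing \<open>f\<close>.\<close>

lemma subset_sum_dense:
  fixes p :: "'a \<Rightarrow> real" and f :: "'a \<Rightarrow> nat"
  assumes "finite A" "\<And>x. x \<in> A \<Longrightarrow> 0 \<le> p x" "0 \<le> r"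
    and "\<And>x. x \<in> A \<Longrightarrow> p x \<le> (\<Sum>y\<in>{y\<in>A. f x < f y}. p y) + r"
    and "0 \<le> t" "t \<le> (\<Sum>x\<in>A. p x)"
  shows "\<exists>B\<subseteq>A. \<bar>(\<Sum>x\<in>B. p x) - t\<bar> \<le> r"
  using assms
proof (induction "card A" arbitrary: A t)
  case 0
  then have "A = {}" by simp
  then show ?case using 0 by auto
next
  case (Suc n)
  then have "A \<noteq> {}" by auto
  \<comment> \<open>The item with the least \<open>f\<close> is decided first. The sums over larger
    \<open>f\<close> that belong to the other items do not involve it, so the hypothesis is
    inherited.\<close>
  then obtain x where x: "x \<in> A" "\<And>y. y \<in> A \<Longrightarrow> f x \<le> f y"
    using arg_min_if_finite[OF Suc.prems(1), of f] by (metis arg_min_least Suc.prems(1))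
  define A' where "A' = A - {x}"
  have fin: "finite A'" and c: "n = card A'" using Suc.hyps(2) Suc.prems(1) x(1) unfolding A'_def by auto
  have sum: "(\<Sum>y\<in>A. p y) = p x + (\<Sum>y\<in>A'. p y)" unfolding A'_def using Suc.prems(1) x(1) by (rule sum.remove)
  have cond: "p y \<le> (\<Sum>z\<in>{z\<in>A'. f y < f z}. p z) + r" if "y \<in> A'" for y
  proof -
    have yA: "y \<in> A" using that unfolding A'_def by simp
    have "{z\<in>A. f y < f z} = {z\<in>A'. f y < f z}" unfolding A'_def using x(2)[OF yA] by auto
    then show ?thesis using Suc.prems(4)[OF yA] by simp
  qed
  have px: "p x \<le> (\<Sum>y\<in>A'. p y) + r"
  proof -
    have "(\<Sum>y\<in>{y\<in>A. f x < f y}. p y) \<le> (\<Sum>y\<in>A'. p y)"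
      unfolding A'_def using Suc.prems(1,2) by (intro sum_mono2) auto
    then show ?thesis using Suc.prems(4)[OF x(1)] by linarith
  qed
  note IH = Suc.hyps(1)[OF c fin _ Suc.prems(3) cond]
  have pos: "\<And>y. y \<in> A' \<Longrightarrow> 0 \<le> p y" using Suc.prems(2) unfolding A'_def by auto
  consider "p x \<le> t" | "t < p x" "t \<le> (\<Sum>y\<in>A'. p y)" | "t < p x" "(\<Sum>y\<in>A'. p y) < t" by linarith
  then show ?case
  proof cases
    case 1
    then obtain B where B: "B \<subseteq> A'" "\<bar>(\<Sum>y\<in>B. p y) - (t - p x)\<bar> \<le> r"
      using IH[of "t - p x"] pos Suc.prems(6) sum by auto
    have "x \<notin> B" "finite B" using B(1) fin finite_subset unfolding A'_def by auto
    then have "(\<Sum>y\<in>insert x B. p y) = p x + (\<Sum>y\<in>B. p y)" by simp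
    then show ?thesis using B x(1) unfolding A'_def by (intro exI[of _ "insert x B"]) auto
  next
    case 2
    then obtain B where B: "B \<subseteq> A'" "\<bar>(\<Sum>y\<in>B. p y) - t\<bar> \<le> r" using IH[of t] pos Suc.prems(5) by auto
    then show ?thesis unfolding A'_def by blast
  next
    \<comment> \<open>The target lies between the sum of all other items and \<open>p x\<close>, and
      \<open>px\<close> bounds the distance of the two by \<open>r\<close>; taking all other items
      is close enough.\<close>
    case 3
    then show ?thesis using px by (intro exI[of _ A']) (auto simp: A'_def)
  qed
qed

definition cyc_atom :: "nat \<Rightarrow> real \<Rightarrow> nat \<Rightarrow> (nat \<Rightarrow> nat) \<Rightarrow> real" where
  "cyc_atom d c L x = exp (- pois_total d c L) * pois_weight d c L x"

lemma pois_weight_nonneg: "0 < c \<Longrightarrow> 0 \<le> pois_weight d c L x"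
  unfolding pois_weight_def by (intro prod_nonneg) (simp add: cyc_rate_nonneg)

lemma cyc_atom_nonneg: "0 < c \<Longrightarrow> 0 \<le> cyc_atom d c L x"
  unfolding cyc_atom_def by (simp add: pois_weight_nonneg)

lemma cyc_atom_prod: "cyc_atom d c L x = (\<Prod>k=2..L. exp (- cyc_rate d c k) * cyc_rate d c k ^ x k / fact (x k))"
proof -
  have "exp (- pois_total d c L) = (\<Prod>k=2..L. exp (- cyc_rate d c k))"
    unfolding pois_total_def by (simp add: exp_sum sum_negf[symmetric])
  then show ?thesis unfolding cyc_atom_def pois_weight_def by (simp add: prod.distrib[symmetric])
qed

text \<open>Under the criterion the shifted subset sums of \<open>limit_set_swap\<close> come within
  \<open>r\<close> of every point of their range. The order \<open>f\<close> is left open because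
  different families need different orders.\<close>

lemma limit_set_fill:
  assumes d: "3 \<le> d" and c: "0 < c" and q: "q \<in> limit_set d c"
    and X: "finite X" "X \<subseteq> PiE {2..L} (\<lambda>_. UNIV)" and r: "0 \<le> r"
    and cond: "\<And>x. x \<in> X \<Longrightarrow> cyc_atom d c L x \<le> (\<Sum>y\<in>{y\<in>X. f x < (f y :: nat)}. cyc_atom d c L y) + r"
  shows "\<exists>a. 0 \<le> a \<and> a \<le> q \<and> q \<le> a + (\<Sum>x\<in>X. cyc_atom d c L x) \<and>
    (\<forall>t. a \<le> t \<longrightarrow> t \<le> a + (\<Sum>x\<in>X. cyc_atom d c L x) \<longrightarrow> (\<exists>z\<in>limit_set d c. \<bar>z - t\<bar> \<le> r))"
proof -
  obtain a where a: "0 \<le> a" "a \<le> q" "q \<le> a + (\<Sum>x\<in>X. cyc_atom d c L x)"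
    "\<forall>Y\<subseteq>X. a + (\<Sum>x\<in>Y. cyc_atom d c L x) \<in> limit_set d c"
    using limit_set_swap[OF d c q X] unfolding cyc_atom_def by blast
  have "\<exists>z\<in>limit_set d c. \<bar>z - t\<bar> \<le> r" if t: "a \<le> t" "t \<le> a + (\<Sum>x\<in>X. cyc_atom d c L x)" for t
  proof -
    obtain B where "B \<subseteq> X" "\<bar>(\<Sum>x\<in>B. cyc_atom d c L x) - (t - a)\<bar> \<le> r"
      using subset_sum_dense[OF X(1) cyc_atom_nonneg[OF c] r cond, of "t - a"] t by auto
    then show ?thesis using a(4) by (intro bexI[of _ "a + (\<Sum>x\<in>B. cyc_atom d c L x)"]) (auto simp: algebra_simps)
  qed
  then show ?thesis using a by blast
qed

section \<open>The threshold\<close>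

text \<open>The derivative of e^x (1 - x) is -x e^x.\<close>

lemma thr_fun_decreasing:
  fixes a b :: real assumes "0 \<le> a" "a < b" shows "exp b * (1 - b) < exp a * (1 - a)"
proof (rule DERIV_neg_imp_decreasing_open[OF assms(2)])
  fix x assume "a < x" "x < b"
  have "((\<lambda>x. exp x * (1 - x)) has_real_derivative - (x * exp x)) (at x)"
    by (auto intro!: derivative_eq_intros simp: algebra_simps)
  moreover have "- (x * exp x) < 0" using assms(1) \<open>a < x\<close> by simp
  ultimately show "\<exists>y. ((\<lambda>x. exp x * (1 - x)) has_real_derivative y) (at x) \<and> y < 0" by blast
qed (intro continuous_intros)

lemma thr_fun_root: "\<exists>r::real. 0 < r \<and> r < 1 \<and> exp r * (1 - r) = 1 / 4"
proof -
  have "\<exists>r\<ge>0. r \<le> 1 \<and> exp r * (1 - r) = (1 / 4 :: real)"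
    by (rule IVT2) (auto intro!: continuous_intros)
  then obtain r :: real where r: "0 \<le> r" "r \<le> 1" "exp r * (1 - r) = 1 / 4" by blast
  then have "r \<noteq> 0" "r \<noteq> 1" by auto
  then show ?thesis using r by (intro exI[of _ r]) auto
qed

lemma half_power: "exp (r / 2) * sqrt (1 - r) = sqrt (exp r * (1 - r))"
proof -
  have "(exp (r / 2))\<^sup>2 = exp r" by (simp add: exp_double[symmetric] power2_eq_square flip: exp_add)
  then have "exp (r / 2) = sqrt (exp r)" by (metis exp_ge_zero real_sqrt_abs abs_of_nonneg)
  then show ?thesis by (simp add: real_sqrt_mult)
qed

text \<open>The real \<open>sqrt\<close> is odd and injective on all reals, so the equation can be
  squared without losing or gaining solutions, even where 1 - r is negative.\<close>

lemma threshold_eq_iff: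
  fixes c :: real and d :: nat assumes "0 < c"
  defines "r \<equiv> c / fact (d - 2)"
  shows "threshold_eq d c \<longleftrightarrow> exp r * (1 - r) = 1 / 4"
proof -
  have "threshold_eq d c \<longleftrightarrow> sqrt (exp r * (1 - r)) = 1 / 2"
    unfolding threshold_eq_def r_def half_power[symmetric] by (simp add: mult.commute)
  also have "(1 / 2 :: real) = sqrt (1 / 4)" by (simp add: real_sqrt_divide)
  also have "sqrt (exp r * (1 - r)) = sqrt (1 / 4) \<longleftrightarrow> exp r * (1 - r) = 1 / 4" by (rule real_sqrt_eq_iff)
  finally show ?thesis .
qed

lemma threshold_char:
  "\<exists>r. 0 < r \<and> r < 1 \<and> exp r * (1 - r) = 1 / 4 \<and> threshold d = r * fact (d - 2) \<and>
     (\<exists>!c. 0 < c \<and> threshold_eq d c)"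
proof -
  obtain r :: real where r: "0 < r" "r < 1" "exp r * (1 - r) = 1 / 4" using thr_fun_root by blast
  have ex: "0 < r * fact (d - 2) \<and> threshold_eq d (r * fact (d - 2))"
    using r threshold_eq_iff[of "r * fact (d - 2)" d] by simp
  have un: "c = r * fact (d - 2)" if "0 < c \<and> threshold_eq d c" for c
  proof -
    let ?s = "c / fact (d - 2)"
    have s: "0 < ?s" "exp ?s * (1 - ?s) = 1 / 4" using that threshold_eq_iff[of c d] by auto
    have "?s = r"
    proof (rule ccontr)
      assume "?s \<noteq> r"
      then consider "?s < r" | "r < ?s" by linarith
      then show False
      proof cases
        case 1 then show False using thr_fun_decreasing[of ?s r] s r by simp
      next
        case 2 then show False using thr_fun_decreasing[of r ?s] s r by simp
      qed
    qed
    then show ?thesis by (simp add: field_simps)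
  qed
  have "threshold d = r * fact (d - 2)" unfolding threshold_def using ex un by (rule the_equality)
  moreover have "\<exists>!c. 0 < c \<and> threshold_eq d c" using ex un by (rule ex1I)
  ultimately show ?thesis using r by blast
qed

section \<open>The cycle rates\<close>

text \<open>The logarithm series sums r^k / (2k) over all k \<ge> 1; the term r / 2 is taken away
  because cycles start at length 2.\<close>

lemma pois_total_tendsto:
  assumes c: "0 < c" and r: "c / fact (d - 2) < 1"
  defines "r \<equiv> c / fact (d - 2)"
  shows "(\<lambda>L. pois_total d c L) \<longlonglongrightarrow> - (ln (1 - r) + r) / 2"
proof -
  have r0: "0 < r" "r < 1" using c r unfolding r_def by auto
  have "(\<lambda>n. - ((- (- r)) ^ n) / real n) sums ln (1 + - r)" using ln_series'[of "- r"] r0 by simp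
  then have "(\<lambda>n. - (r ^ n) / real n) sums ln (1 - r)" by simp
  then have "(\<lambda>n. - (1 / 2) * (- (r ^ n) / real n)) sums (- (1 / 2) * ln (1 - r))" by (rule sums_mult)
  then have "(\<lambda>n. r ^ n / (2 * real n)) sums (- ln (1 - r) / 2)" by simp
  then have "(\<lambda>L. \<Sum>n\<le>L. r ^ n / (2 * real n)) \<longlonglongrightarrow> - ln (1 - r) / 2" unfolding sums_def_le .
  then have "(\<lambda>L. (\<Sum>n\<le>L. r ^ n / (2 * real n)) - r / 2) \<longlonglongrightarrow> - ln (1 - r) / 2 - r / 2" by (intro tendsto_intros)
  moreover have "\<forall>\<^sub>F L in sequentially. (\<Sum>n\<le>L. r ^ n / (2 * real n)) - r / 2 = pois_total d c L"
    using eventually_ge_at_top[of 1]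
  proof eventually_elim
    case (elim L)
    have "{..L} = insert 0 (insert 1 {2..L})" using elim by auto
    then show ?case unfolding pois_total_def cyc_rate_def r_def[symmetric] by simp
  qed
  ultimately have "(\<lambda>L. pois_total d c L) \<longlonglongrightarrow> - ln (1 - r) / 2 - r / 2" by (rule Lim_transform_eventually)
  then show ?thesis by (simp add: add_divide_distrib diff_divide_distrib)
qed

lemma pois_total_mono: "0 < c \<Longrightarrow> L \<le> M \<Longrightarrow> pois_total d c L \<le> pois_total d c M"
  unfolding pois_total_def using cyc_rate_nonneg by (intro sum_mono2) auto

text \<open>\<open>pois_total\<close> increases with \<open>L\<close>, so the probability at each
  finite \<open>L\<close> lies above the limit. This makes the gap uniform over all
  sentences.\<close>

lemma no_cycle_limit:
  assumes c: "0 < c" and r: "c / fact (d - 2) < 1"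
  defines "r \<equiv> c / fact (d - 2)"
  shows "(\<lambda>L. exp (- pois_total d c L)) \<longlonglongrightarrow> sqrt (exp r * (1 - r))"
    and "sqrt (exp r * (1 - r)) \<le> exp (- pois_total d c L)"
proof -
  have r0: "0 < r" "r < 1" using c r unfolding r_def by auto
  have e1: "exp ((ln (1 - r) + r) / 2) = sqrt (exp r * (1 - r))"
  proof -
    have "(exp ((ln (1 - r) + r) / 2))\<^sup>2 = exp (ln (1 - r) + r)" by (simp add: power2_eq_square flip: exp_add)
    also have "\<dots> = exp r * (1 - r)" using r0 by (simp add: exp_add)
    finally show ?thesis by (metis exp_ge_zero real_sqrt_unique)
  qed
  have lim0: "(\<lambda>L. exp (- pois_total d c L)) \<longlonglongrightarrow> exp (- (- (ln (1 - r) + r) / 2))"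
    unfolding r_def by (intro tendsto_intros pois_total_tendsto[OF c r])
  have e2: "- (- (ln (1 - r) + r) / 2) = (ln (1 - r) + r) / 2" by (simp add: field_simps)
  show lim: "(\<lambda>L. exp (- pois_total d c L)) \<longlonglongrightarrow> sqrt (exp r * (1 - r))"
    using lim0 unfolding e2 e1 .
  show "sqrt (exp r * (1 - r)) \<le> exp (- pois_total d c L)"
    by (rule tendsto_upperbound[OF lim])
      (use pois_total_mono[OF c] in \<open>auto intro!: eventually_sequentiallyI[of L]\<close>)
qed

lemma closure_gap:
  assumes d: "3 \<le> d" and c: "0 < c" "c < threshold d"
  shows "\<exists>a b. 0 \<le> a \<and> a < b \<and> b \<le> 1 \<and> closure (limit_set d c) \<inter> {a..b} = {}"
proof -
  obtain r0 where r0: "0 < r0" "r0 < 1" "exp r0 * (1 - r0) = 1 / 4" "threshold d = r0 * fact (d - 2)"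
    using threshold_char by blast
  define r where "r = c / fact (d - 2)"
  have rr: "0 < r" "r < r0" using c r0(4) unfolding r_def by (auto simp: field_simps)
  define q where "q = sqrt (exp r * (1 - r))"
  have "1 / 4 < exp r * (1 - r)" using thr_fun_decreasing[of r r0] rr r0(3) by simp
  then have "sqrt (1 / 4) < q" unfolding q_def by (simp add: real_sqrt_less_iff del: real_sqrt_divide)
  then have q2: "1 / 2 < q" by (simp add: real_sqrt_divide)
  have r1: "c / fact (d - 2) < 1" using rr r0(2) unfolding r_def by linarith
  have qL: "q \<le> exp (- pois_total d c L)" for L
    using no_cycle_limit(2)[OF c(1) r1, of L] unfolding q_def r_def .
  have q1: "q \<le> 1" using qL[of 0] by (simp add: pois_total_def)
  have "limit_set d c \<subseteq> {..1 - q} \<union> {q..}"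
  proof
    fix x assume "x \<in> limit_set d c"
    then obtain \<phi> where \<phi>: "sentence d \<phi>" "x = limit_prob d c \<phi>" unfolding limit_set_def by blast
    obtain L where "exp (- pois_total d c L) \<le> x \<or> x \<le> 1 - exp (- pois_total d c L)"
      using limit_prob_dichotomy[OF d c(1) \<phi>(1)] \<phi>(2) by blast
    then show "x \<in> {..1 - q} \<union> {q..}" using qL[of L] by auto
  qed
  then have "closure (limit_set d c) \<subseteq> {..1 - q} \<union> {q..}" by (rule closure_minimal) (intro closed_Un closed_atMost closed_atLeast)
  \<comment> \<open>A third of the distance from 1 - q to q, so that a closed interval of positive
    length remains strictly between them.\<close>
  moreover define h where "h = (2 * q - 1) / 3"
  have h: "0 < h" "3 * h = 2 * q - 1" using q2 unfolding h_def by auto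
  then have "{1 - q + h..q - h} \<inter> ({..1 - q} \<union> {q..}) = {}" by auto
  ultimately have "closure (limit_set d c) \<inter> {1 - q + h..q - h} = {}" by blast
  moreover have "0 \<le> 1 - q + h" "1 - q + h < q - h" "q - h \<le> 1" using h q1 by linarith+
  ultimately show ?thesis by blast
qed

section \<open>Above the threshold\<close>

lemma box_mass:
  "0 < r \<Longrightarrow> \<exists>M\<ge>1. 1 - r < (\<Sum>x\<in>PiE {2..L} (\<lambda>_. {..M}). cyc_atom d c L x)"
proof -
  assume r: "0 < r"
  have "(\<lambda>M. exp (- pois_total d c L) * box_weight d c L M) \<longlonglongrightarrow> exp (- pois_total d c L) * exp (pois_total d c L)"
    by (intro tendsto_intros box_weight_tendsto)
  then have "(\<lambda>M. exp (- pois_total d c L) * box_weight d c L M) \<longlonglongrightarrow> 1" by (simp flip: exp_add)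
  then have "\<forall>\<^sub>F M in sequentially. 1 - r < exp (- pois_total d c L) * box_weight d c L M"
    by (rule order_tendstoD) (use r in simp)
  then have "\<forall>\<^sub>F M in sequentially. 1 \<le> M \<and> 1 - r < exp (- pois_total d c L) * box_weight d c L M"
    using eventually_ge_at_top[of 1] by eventually_elim simp
  then obtain M where "1 \<le> M" "1 - r < exp (- pois_total d c L) * box_weight d c L M"
    by (metis (mono_tags, lifting) eventually_sequentially order_refl)
  then show ?thesis unfolding box_weight_sum cyc_atom_def sum_distrib_left[symmetric] by blast
qed

text \<open>Starting from the value 0 forces \<open>a = 0\<close> in \<open>limit_set_fill\<close>,
  so the subset sums themselves come close to every point of the unit interval.\<close>

lemma closure_full:
  assumes d: "3 \<le> d" and c: "0 < c"
    and ex: "\<And>r. 0 < r \<Longrightarrow> \<exists>L M f. 1 - r < (\<Sum>x\<in>PiE {2..L} (\<lambda>_. {..M}). cyc_atom d c L x) \<and>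
      (\<forall>x\<in>PiE {2..L} (\<lambda>_. {..M}). cyc_atom d c L x \<le>
         (\<Sum>y\<in>{y\<in>PiE {2..L} (\<lambda>_. {..M}). f x < (f y :: nat)}. cyc_atom d c L y) + r)"
  shows "closure (limit_set d c) = {0..1}"
proof
  show "closure (limit_set d c) \<subseteq> {0..1}"
    by (rule closure_minimal) (use limit_set_bounds[OF d c] in auto)
  show "{0..1} \<subseteq> closure (limit_set d c)"
  proof
    fix t :: real assume t: "t \<in> {0..1}"
    show "t \<in> closure (limit_set d c)"
    proof (rule closure_approachable[THEN iffD2], intro allI impI)
      fix e :: real assume e: "0 < e"
      define r where "r = e / 3"
      have r: "0 < r" using e unfolding r_def by simp
      obtain L M f where M: "1 - r < (\<Sum>x\<in>PiE {2..L} (\<lambda>_. {..M}). cyc_atom d c L x)"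
        and f: "\<And>x. x \<in> PiE {2..L} (\<lambda>_. {..M}) \<Longrightarrow> cyc_atom d c L x \<le>
         (\<Sum>y\<in>{y\<in>PiE {2..L} (\<lambda>_. {..M}). f x < (f y :: nat)}. cyc_atom d c L y) + r" using ex[OF r] by blast
      let ?X = "PiE {2..L} (\<lambda>_. {..M})" and ?s = "\<Sum>x\<in>PiE {2..L} (\<lambda>_. {..M}). cyc_atom d c L x"
      have "finite ?X" by (intro finite_PiE) auto
      moreover have "?X \<subseteq> PiE {2..L} (\<lambda>_. UNIV)" by (intro PiE_mono) auto
      ultimately obtain a where a: "0 \<le> a" "a \<le> 0" "\<forall>t. a \<le> t \<longrightarrow> t \<le> a + ?s \<longrightarrow> (\<exists>z\<in>limit_set d c. \<bar>z - t\<bar> \<le> r)"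
        using limit_set_fill[OF d c limit_set_0[OF d c], of ?X L r f] r f by auto
      have a0: "a = 0" using a by simp
      have s0: "0 \<le> ?s" using cyc_atom_nonneg[OF c] by (intro sum_nonneg) auto
      obtain z where z: "z \<in> limit_set d c" "\<bar>z - min t ?s\<bar> \<le> r" using a(3)[rule_format, of "min t ?s"] a0 t s0 by auto
      have "\<bar>min t ?s - t\<bar> \<le> r" using M t r by (auto simp: min_def)
      then have "dist z t < e" using z(2) e unfolding dist_real_def r_def by linarith
      then show "\<exists>y\<in>limit_set d c. dist y t < e" using z(1) by blast
    qed
  qed
qed

text \<open>For m \<ge> 1 the mass at m is largest when l = m, and there the masses at m - 1 and m
  agree, so neither exceeds 1/2.\<close>

lemma poisson_mass_le:
  fixes l :: real assumes l: "0 < l" shows "exp (- l) * l ^ m / fact m \<le> max (1 / 2) (exp (- l))"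
proof (cases "m = 0")
  case False
  then have m: "0 < real m" by simp
  have "l / real m \<le> exp (l / real m - 1)" using exp_ge_add_one_self[of "l / real m - 1"] by simp
  then have "(l / real m) ^ m \<le> exp (l / real m - 1) ^ m" using l m by (intro power_mono) auto
  also have "\<dots> = exp (l - real m)" using m by (simp add: exp_of_nat_mult[symmetric] algebra_simps)
  finally have "l ^ m \<le> real m ^ m * exp (l - real m)" using m by (simp add: power_divide field_simps)
  then have "exp (- l) * l ^ m \<le> exp (- l) * (real m ^ m * exp (l - real m))" by (intro mult_left_mono) auto
  also have "\<dots> = real m ^ m * exp (- real m)" by (simp add: exp_diff exp_minus field_simps)
  finally have 1: "exp (- l) * l ^ m \<le> real m ^ m * exp (- real m)" .
  have "(\<Sum>i\<in>{m - 1, m}. real m ^ i / fact i) \<le> exp (real m)"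
  proof -
    have "(\<Sum>i\<in>{m - 1, m}. inverse (fact i) * real m ^ i) \<le> (\<Sum>i. inverse (fact i) * real m ^ i)"
      by (rule sum_le_suminf[OF summable_exp]) auto
    also have "\<dots> = exp (real m)" unfolding exp_def by (simp add: scaleR_conv_of_real)
    finally show ?thesis by (simp add: divide_inverse mult.commute)
  qed
  moreover have "real m ^ (m - 1) / fact (m - 1) = real m ^ m / fact m"
  proof -
    obtain j where j: "m = Suc j" using False by (cases m) auto
    have "fact m = real m * fact j" unfolding j by (simp add: fact_Suc)
    then show ?thesis unfolding j using m by (simp add: j)
  qed
  moreover have "m - 1 \<noteq> m" using False by simp
  ultimately have "2 * (real m ^ m / fact m) \<le> exp (real m)" by simp
  then have "real m ^ m * exp (- real m) / fact m \<le> 1 / 2" by (simp add: exp_minus field_simps)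
  moreover have "exp (- l) * l ^ m / fact m \<le> real m ^ m * exp (- real m) / fact m"
    using 1 by (intro divide_right_mono) auto
  ultimately show ?thesis by linarith
qed simp

lemma poisson_mass_le_1: "0 \<le> l \<Longrightarrow> exp (- l) * l ^ m / fact m \<le> (1 :: real)"
proof (cases "l = 0")
  case False
  assume "0 \<le> l"
  then have "exp (- l) * l ^ m / fact m \<le> max (1 / 2) (exp (- l))" using poisson_mass_le[of l m] False by simp
  also have "\<dots> \<le> 1" using \<open>0 \<le> l\<close> by simp
  finally show ?thesis .
qed (simp add: power_0_left)

text \<open>For r \<ge> 1 the rates are at least 1/(2k) and their sum diverges, so all atoms become
  small as \<open>L\<close> grows. The criterion then holds by its error term alone, with a constant
  order \<open>f\<close>.\<close>

lemma closure_full_supercritical: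
  assumes d: "3 \<le> d" and c: "0 < c" and r1: "1 \<le> c / fact (d - 2)"
  shows "closure (limit_set d c) = {0..1}"
proof (rule closure_full[OF d c])
  fix r :: real assume r: "0 < r"
  \<comment> \<open>Solves \<open>exp (- ((B - 1) / 2)) = r\<close>; the harmonic sum loses its
    first term 1 because lengths start at 2.\<close>
  define B where "B = 2 * ln (1 / r) + 1"
  have "\<forall>\<^sub>F L in sequentially. B \<le> harm L" using harm_at_top unfolding filterlim_at_top by blast
  then have "\<forall>\<^sub>F L in sequentially. 1 \<le> L \<and> B \<le> harm L" using eventually_ge_at_top[of 1] by eventually_elim simp
  then obtain L :: nat where L: "1 \<le> L" "B \<le> harm L" by (metis (mono_tags, lifting) eventually_sequentially order_refl)
  obtain M where M: "1 - r < (\<Sum>x\<in>PiE {2..L} (\<lambda>_. {..M}). cyc_atom d c L x)" using box_mass[OF r] by blast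
  have rate: "1 / (2 * real k) \<le> cyc_rate d c k" for k
    unfolding cyc_rate_def using r1 by (intro divide_right_mono) (auto simp: one_le_power)
  have "cyc_atom d c L x \<le> r" for x
  proof -
    have "cyc_atom d c L x \<le> (\<Prod>k=2..L. exp (- (1 / (2 * real k))))"
      unfolding cyc_atom_prod
    proof (rule prod_mono, intro conjI)
      fix k assume k: "k \<in> {2..L}"
      show "0 \<le> exp (- cyc_rate d c k) * cyc_rate d c k ^ x k / fact (x k)" by (simp add: cyc_rate_nonneg[OF c])
      have k0: "0 < 1 / (2 * real k)" using k by simp
      then have "exp (- cyc_rate d c k) * cyc_rate d c k ^ x k / fact (x k) \<le> max (1 / 2) (exp (- cyc_rate d c k))"
        using rate[of k] by (intro poisson_mass_le) linarith
      moreover have "exp (- cyc_rate d c k) \<le> exp (- (1 / (2 * real k)))" using rate[of k] by simp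
      moreover have "1 / 2 \<le> exp (- (1 / (2 * real k)))"
      proof -
        have "1 / (2 * real k) \<le> 1 / 4" using k by (simp add: field_simps)
        then have "1 / 2 \<le> 1 + - (1 / (2 * real k))" by linarith
        also have "\<dots> \<le> exp (- (1 / (2 * real k)))" by (rule exp_ge_add_one_self)
        finally show ?thesis .
      qed
      ultimately show "exp (- cyc_rate d c k) * cyc_rate d c k ^ x k / fact (x k) \<le> exp (- (1 / (2 * real k)))" by linarith
    qed
    also have "\<dots> = exp (- ((harm L - 1) / 2))"
    proof -
      have "{1..L} = insert 1 {2..L}" using L(1) by auto
      then have h: "harm L - 1 = (\<Sum>k=2..L. 1 / real k)" unfolding harm_def by (simp add: inverse_eq_divide)
      have "(\<Prod>k=2..L. exp (- (1 / (2 * real k)))) = exp (\<Sum>k=2..L. - (1 / (2 * real k)))" by (simp add: exp_sum)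
      also have "(\<Sum>k=2..L. - (1 / (2 * real k))) = - ((\<Sum>k=2..L. 1 / real k) / 2)"
        by (simp add: sum_negf sum_divide_distrib mult.commute)
      finally show ?thesis unfolding h .
    qed
    also have "\<dots> \<le> exp (- ((B - 1) / 2))" using L(2) by simp
    also have "\<dots> = r" unfolding B_def using r by (simp add: ln_div)
    finally show ?thesis .
  qed
  then have "\<forall>x\<in>PiE {2..L} (\<lambda>_. {..M}). cyc_atom d c L x \<le>
         (\<Sum>y\<in>{y\<in>PiE {2..L} (\<lambda>_. {..M}). (0::nat) < 0}. cyc_atom d c L y) + r" by simp
  then show "\<exists>L M f. 1 - r < (\<Sum>x\<in>PiE {2..L} (\<lambda>_. {..M}). cyc_atom d c L x) \<and>
      (\<forall>x\<in>PiE {2..L} (\<lambda>_. {..M}). cyc_atom d c L x \<le>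
         (\<Sum>y\<in>{y\<in>PiE {2..L} (\<lambda>_. {..M}). f x < (f y :: nat)}. cyc_atom d c L y) + r)"
    using M by (intro exI[of _ L] exI[of _ M] exI[of _ "\<lambda>_. 0"]) simp
qed

text \<open>Divided by the rate at \<open>k\<close>, the right side is least for k = 2 and r = 4/5,
  where the three terms are about 0.533 + 0.320 + 0.205 > 1. Two terms would fall short
  there.\<close>

lemma cyc_rate_three:
  assumes r: "4 / 5 \<le> c / fact (d - 2)" and k: "2 \<le> k"
  shows "cyc_rate d c k \<le> cyc_rate d c (k + 1) + cyc_rate d c (k + 2) + cyc_rate d c (k + 3)"
proof -
  define r where "r = c / fact (d - 2)"
  have r0: "4 / 5 \<le> r" using r unfolding r_def .
  have kk: "2 / (2 + j) \<le> real k / (real k + j)" if "0 \<le> j" for j :: real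
  proof -
    have "2 * (real k + j) \<le> real k * (2 + j)" using k that by (simp add: algebra_simps mult_left_mono)
    then show ?thesis using k that by (simp add: field_simps)
  qed
  have p: "(4 / 5) ^ j \<le> r ^ j" for j using r0 by (intro power_mono) auto
  have t: "(4 / 5) ^ j * (2 / (2 + real j)) \<le> r ^ j * (real k / (real k + real j))" for j
    using p[of j] kk[of "real j"] r0 by (intro mult_mono) auto
  have "1 \<le> r ^ 1 * (real k / (real k + real 1)) + r ^ 2 * (real k / (real k + real 2)) + r ^ 3 * (real k / (real k + real 3))"
    using t[of 1] t[of 2] t[of 3] by (simp add: power2_eq_square power3_eq_cube)
  then have "r ^ k / (2 * real k) * 1 \<le> r ^ k / (2 * real k) *
      (r ^ 1 * (real k / (real k + real 1)) + r ^ 2 * (real k / (real k + real 2)) + r ^ 3 * (real k / (real k + real 3)))"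
    using r0 by (intro mult_left_mono) auto
  also have "\<dots> = r ^ (k + 1) / (2 * real (k + 1)) + r ^ (k + 2) / (2 * real (k + 2)) + r ^ (k + 3) / (2 * real (k + 3))"
  proof -
    have "r ^ k / (2 * real k) * (r ^ j * (real k / (real k + real j))) = r ^ (k + j) / (2 * real (k + j))" for j
      using k by (simp add: power_add field_simps)
    then show ?thesis by (simp only: distrib_left)
  qed
  finally show ?thesis unfolding cyc_rate_def r_def[symmetric] by simp
qed

text \<open>Vectors are ordered by the longest cycle length k present. Replacing one such cycle by
  one of length k + 1, k + 2 or k + 3 yields later vectors whose atoms together outweigh the given
  one. The zero vector comes first, and its atom of about 1/2 or less is balanced by all the
  others.\<close>

lemma closure_full_critical:
  assumes d: "3 \<le> d" and c: "0 < c" and rl: "4 / 5 \<le> c / fact (d - 2)" "c / fact (d - 2) < 1"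
    and half: "sqrt (exp (c / fact (d - 2)) * (1 - c / fact (d - 2))) \<le> 1 / 2"
  shows "closure (limit_set d c) = {0..1}"
proof (rule closure_full[OF d c])
  fix e :: real assume e: "0 < e"
  define r where "r = c / fact (d - 2)"
  have r: "0 < r" "r < 1" "4 / 5 \<le> r" using rl unfolding r_def by linarith+
  \<comment> \<open>For the zero vector the excess e/4 here and the loss e/2 of the box, which
    counts once, fit into the error: 1/2 + e/4 equals (1 - e/2) - (1/2 + e/4) + e.\<close>
  have half': "\<forall>\<^sub>F L in sequentially. exp (- pois_total d c L) < 1 / 2 + e / 4"
    by (rule order_tendstoD(2)[OF no_cycle_limit(1)[OF c rl(2)]]) (use half e in linarith)
  have "\<forall>\<^sub>F n in sequentially. r ^ n < e"
    using order_tendstoD(2)[OF LIMSEQ_realpow_zero[of r], of e] r e by simp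
  with iffD2[OF eventually_sequentially_seg[of "\<lambda>L. exp (- pois_total d c L) < 1 / 2 + e / 4" 3] half']
  have "\<forall>\<^sub>F n in sequentially. exp (- pois_total d c (n + 3)) < 1 / 2 + e / 4 \<and> r ^ n < e"
    by (rule eventually_conj)
  then obtain n where n: "exp (- pois_total d c (n + 3)) < 1 / 2 + e / 4" "r ^ n < e"
    by (metis (mono_tags, lifting) eventually_sequentially order_refl)
  \<comment> \<open>A vector whose longest length k leaves no room for three larger ones has k > n,
    and its atom is at most r^k \<le> r^n < e.\<close>
  define L where "L = n + 3"
  obtain M where M: "1 \<le> M" "1 - e / 2 < (\<Sum>x\<in>PiE {2..L} (\<lambda>_. {..M}). cyc_atom d c L x)"
    using box_mass[where r = "e / 2" and L = L and d = d and c = c] e by auto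
  let ?X = "PiE {2..L} (\<lambda>_. {..M})" and ?p = "cyc_atom d c L"
  have finX: "finite ?X" by (intro finite_PiE) auto
  define f where "f x = Max (insert 0 {k \<in> {2..L}. 0 < x k})" for x :: "nat \<Rightarrow> nat"
  have "?p x \<le> (\<Sum>y\<in>{y\<in>?X. f x < f y}. ?p y) + e" if x: "x \<in> ?X" for x
  proof (cases "\<forall>k\<in>{2..L}. x k = 0")
    case True
    have px: "?p x = exp (- pois_total d c L)" unfolding cyc_atom_def pois_weight_def using True by simp
    have "{k \<in> {2..L}. 0 < x k} = {}" using True by auto
    then have fx: "f x = 0" unfolding f_def by (simp only: Max_singleton)
    have "?X - {x} \<subseteq> {y\<in>?X. f x < f y}"
    proof
      fix y assume y: "y \<in> ?X - {x}"
      have "\<exists>k\<in>{2..L}. y k \<noteq> 0"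
      proof (rule ccontr)
        assume "\<not> ?thesis"
        then have "y = x" using y x True by (intro PiE_ext[of y "{2..L}" "\<lambda>_. {..M}" x]) auto
        then show False using y by simp
      qed
      then obtain k where k: "k \<in> {2..L}" "y k \<noteq> 0" by blast
      then have "k \<le> f y" unfolding f_def by (intro Max_ge) auto
      then show "y \<in> {y\<in>?X. f x < f y}" using y k fx by auto
    qed
    then have "(\<Sum>y\<in>?X - {x}. ?p y) \<le> (\<Sum>y\<in>{y\<in>?X. f x < f y}. ?p y)"
      using finX cyc_atom_nonneg[OF c] by (intro sum_mono2) auto
    moreover have "(\<Sum>y\<in>?X. ?p y) = ?p x + (\<Sum>y\<in>?X - {x}. ?p y)" by (rule sum.remove[OF finX x])
    ultimately show ?thesis using M(2) n(1) px unfolding L_def by linarith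
  next
    case False
    define k where "k = f x"
    have "finite (insert 0 {k \<in> {2..L}. 0 < x k})" by simp
    have "k \<in> insert 0 {k \<in> {2..L}. 0 < x k}" unfolding k_def f_def by (rule Max_in) auto
    moreover have kmax: "j \<le> k" if "j \<in> {2..L}" "0 < x j" for j unfolding k_def f_def using that by (intro Max_ge) auto
    moreover obtain j where "j \<in> {2..L}" "0 < x j" using False by auto
    ultimately have k: "k \<in> {2..L}" "0 < x k" by fastforce+
    have xj0: "x j = 0" if "j \<in> {2..L}" "k < j" for j using kmax[of j] that by fastforce
    show ?thesis
    proof (cases "k + 3 \<le> L")
      case False
      let ?l = "cyc_rate d c k"
      have l0: "0 \<le> ?l" by (rule cyc_rate_nonneg[OF c])
      have rk: "?l \<le> r ^ k"
        unfolding cyc_rate_def r_def[symmetric] using r k by (simp add: divide_le_eq mult_le_cancel_left1)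
      have l1: "?l \<le> 1" using rk r power_le_one[of r k] by linarith
      have "?p x = (exp (- ?l) * ?l ^ x k / fact (x k)) * (\<Prod>j\<in>{2..L} - {k}. exp (- cyc_rate d c j) * cyc_rate d c j ^ x j / fact (x j))"
        unfolding cyc_atom_prod by (rule prod.remove) (use k in auto)
      also have "\<dots> \<le> (exp (- ?l) * ?l ^ x k / fact (x k)) * 1"
        using cyc_rate_nonneg[OF c] l0
        by (intro mult_left_mono prod_le_1 conjI poisson_mass_le_1) auto
      also have "\<dots> \<le> ?l"
      proof -
        have "?l ^ x k \<le> ?l ^ 1" using l0 l1 k(2) by (intro power_decreasing) auto
        then have a: "?l ^ x k \<le> ?l" by simp
        have b: "exp (- ?l) \<le> 1" using l0 by simp
        have "exp (- ?l) * ?l ^ x k \<le> 1 * ?l" using a b l0 by (intro mult_mono) auto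
        moreover have "exp (- ?l) * ?l ^ x k / fact (x k) \<le> exp (- ?l) * ?l ^ x k / 1"
          using l0 by (intro divide_left_mono) (auto simp: fact_ge_1)
        ultimately show ?thesis by simp
      qed
      also have "\<dots> \<le> r ^ k" by (rule rk)
      also have "\<dots> \<le> r ^ n" using False r unfolding L_def by (intro power_decreasing) auto
      finally have "?p x \<le> e" using n(2) by linarith
      moreover have "0 \<le> (\<Sum>y\<in>{y\<in>?X. f x < f y}. ?p y)" using cyc_atom_nonneg[OF c] by (intro sum_nonneg) auto
      ultimately show ?thesis by linarith
    next
      case True
      \<comment> \<open>One cycle of length \<open>k\<close> becomes a cycle of length
        \<open>j\<close>. The count at \<open>j\<close> was 0 because \<open>k\<close> was the
        longest length, and 1 is within the box since M \<ge> 1.\<close>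
      define y where "y j = x(k := x k - 1, j := 1)" for j
      have yX: "y j \<in> ?X" and fy: "f (y j) = j" and py: "?p (y j) = ?p x * (real (x k) * cyc_rate d c j / cyc_rate d c k)"
        if j: "j \<in> {2..L}" "k < j" for j
      proof -
        show "y j \<in> ?X"
        proof (rule PiE_I)
          fix i assume "i \<in> {2..L}"
          then show "y j i \<in> {..M}" unfolding y_def using PiE_mem[OF x, of i] PiE_mem[OF x k(1)] M(1) by auto
        next
          fix i assume "i \<notin> {2..L}"
          then show "y j i = undefined" unfolding y_def using PiE_arb[OF x, of i] k j by auto
        qed
        show "f (y j) = j" unfolding f_def
        proof (rule Max_eqI)
          show "j \<in> insert 0 {k \<in> {2..L}. 0 < y j k}" using j unfolding y_def by auto
          fix i assume "i \<in> insert 0 {k \<in> {2..L}. 0 < y j k}"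
          then show "i \<le> j" using kmax[of i] j k unfolding y_def by (auto split: if_splits)
        qed simp
        let ?F = "\<lambda>x i. exp (- cyc_rate d c i) * cyc_rate d c i ^ x i / fact (x i)"
        have fin: "finite ({2..L} - {k})" by simp
        have kj: "j \<in> {2..L} - {k}" using j by auto
        have split: "?p z = ?F z k * (?F z j * (\<Prod>i\<in>{2..L} - {k} - {j}. ?F z i))" for z
          unfolding cyc_atom_prod prod.remove[OF finite_atLeastAtMost k(1)] prod.remove[OF fin kj] ..
        have rest: "(\<Prod>i\<in>{2..L} - {k} - {j}. ?F (y j) i) = (\<Prod>i\<in>{2..L} - {k} - {j}. ?F x i)"
          unfolding y_def by (intro prod.cong) auto
        have lk: "cyc_rate d c k \<noteq> 0" unfolding cyc_rate_def using c k by simp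
        obtain m where m: "x k = Suc m" using k(2) by (cases "x k") auto
        have Fk: "?F (y j) k = ?F x k * (real (x k) / cyc_rate d c k)"
          unfolding y_def using j lk by (simp add: m)
        have Fj: "?F (y j) j = ?F x j * cyc_rate d c j" unfolding y_def using xj0[OF j] by simp
        show "?p (y j) = ?p x * (real (x k) * cyc_rate d c j / cyc_rate d c k)"
          unfolding split[of "y j"] split[of x] rest Fk Fj by (simp add: mult_ac)
      qed
      let ?J = "{k + 1, k + 2, k + 3}"
      have J: "j \<in> {2..L}" "k < j" if "j \<in> ?J" for j using that True k by auto
      have injy: "inj_on y ?J" by (rule inj_onI) (metis J fy)
      have lk: "0 < cyc_rate d c k" unfolding cyc_rate_def using c k by simp
      have "?p x * 1 \<le> ?p x * (real (x k) * (cyc_rate d c (k + 1) + cyc_rate d c (k + 2) + cyc_rate d c (k + 3)) / cyc_rate d c k)"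
      proof (rule mult_left_mono[OF _ cyc_atom_nonneg[OF c]])
        have "cyc_rate d c k \<le> 1 * (cyc_rate d c (k + 1) + cyc_rate d c (k + 2) + cyc_rate d c (k + 3))"
          using cyc_rate_three[OF rl(1), of k] k by simp
        also have "\<dots> \<le> real (x k) * (cyc_rate d c (k + 1) + cyc_rate d c (k + 2) + cyc_rate d c (k + 3))"
          using k(2) cyc_rate_nonneg[OF c] by (intro mult_right_mono) auto
        finally show "1 \<le> real (x k) * (cyc_rate d c (k + 1) + cyc_rate d c (k + 2) + cyc_rate d c (k + 3)) / cyc_rate d c k"
          using lk by (simp add: field_simps)
      qed
      also have "\<dots> = (\<Sum>j\<in>?J. ?p (y j))" using py[OF J] by (simp add: distrib_left add_divide_distrib add.assoc)
      also have "\<dots> = (\<Sum>z\<in>y ` ?J. ?p z)" using injy by (simp add: sum.reindex)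
      also have "\<dots> \<le> (\<Sum>z\<in>{z\<in>?X. f x < f z}. ?p z)"
      proof (rule sum_mono2)
        show "finite {z\<in>?X. f x < f z}" using finX by simp
        show "y ` ?J \<subseteq> {z\<in>?X. f x < f z}"
        proof
          fix z assume "z \<in> y ` ?J"
          then obtain j where j: "j \<in> ?J" "z = y j" by blast
          show "z \<in> {z\<in>?X. f x < f z}" using yX[OF J[OF j(1)]] fy[OF J[OF j(1)]] J[OF j(1)] j(2) k_def by simp
        qed
      qed (rule cyc_atom_nonneg[OF c])
      finally show ?thesis using e by linarith
    qed
  qed
  moreover have "1 - e < (\<Sum>x\<in>?X. ?p x)" using M(2) e by linarith
  ultimately show "\<exists>L M f. 1 - e < (\<Sum>x\<in>PiE {2..L} (\<lambda>_. {..M}). cyc_atom d c L x) \<and>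
      (\<forall>x\<in>PiE {2..L} (\<lambda>_. {..M}). cyc_atom d c L x \<le>
         (\<Sum>y\<in>{y\<in>PiE {2..L} (\<lambda>_. {..M}). f x < (f y :: nat)}. cyc_atom d c L y) + e)"
    by (intro exI[of _ L] exI[of _ M] exI[of _ f] conjI ballI)
qed

lemma closure_above_threshold:
  assumes d: "3 \<le> d" and c: "0 < c" "threshold d \<le> c"
  shows "closure (limit_set d c) = {0..1}"
proof -
  obtain r0 where r0: "0 < r0" "r0 < 1" "exp r0 * (1 - r0) = 1 / 4" "threshold d = r0 * fact (d - 2)"
    using threshold_char by blast
  define r where "r = c / fact (d - 2)"
  have rr: "r0 \<le> r" using c r0(4) unfolding r_def by (simp add: field_simps)
  \<comment> \<open>At 4/5 the decreasing function e^r (1 - r) is at least (9/5)(1/5) = 9/25, still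
    above 1/4.\<close>
  have r45: "4 / 5 < r0"
  proof (rule ccontr)
    assume "\<not> 4 / 5 < r0"
    then have le: "r0 \<le> 4 / 5" by simp
    have "exp (4 / 5) * (1 - 4 / 5) \<le> exp r0 * (1 - r0)"
    proof (cases "r0 = 4 / 5")
      case True
      show ?thesis unfolding True ..
    next
      case False
      then show ?thesis using thr_fun_decreasing[of r0 "4 / 5"] r0(1) le by simp
    qed
    moreover have "1 + 4 / 5 \<le> exp (4 / 5 :: real)" by (rule exp_ge_add_one_self)
    ultimately show False using r0(3) by simp
  qed
  show ?thesis
  proof (cases "1 \<le> r")
    case True then show ?thesis using closure_full_supercritical[OF d c(1)] unfolding r_def by blast
  next
    case False
    have "exp r * (1 - r) \<le> 1 / 4"
      using thr_fun_decreasing[of r0 r] r0 rr by (cases "r0 = r") auto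
    then have "sqrt (exp r * (1 - r)) \<le> sqrt (1 / 4)" by (rule real_sqrt_le_mono)
    then have "sqrt (exp r * (1 - r)) \<le> 1 / 2" by (simp add: real_sqrt_divide)
    moreover have "4 / 5 \<le> r" "r < 1" using False rr r45 by linarith+
    ultimately show ?thesis using closure_full_critical[OF d c(1)] unfolding r_def by blast
  qed
qed

section \<open>Below the threshold: finitely many intervals\<close>

text \<open>Two cycles of different lengths \<open>j < k\<close> have limiting probability proportional to \<open>r ^ (j + k) / (j * k)\<close>.
  The masses of the pairs with \<open>j + k = m + 1\<close> sum up to order \<open>r ^ m * ln m / m\<close> and so dominate every single
  pair with \<open>j + k = m\<close>, which has order at most \<open>r ^ m / m\<close>.\<close>

definition cyc_pairs :: "nat \<Rightarrow> (nat \<times> nat) set" where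
  "cyc_pairs m = {(j, k). 2 \<le> j \<and> j < k \<and> j + k = m}"

lemma finite_cyc_pairs: "finite (cyc_pairs m)"
  by (rule finite_subset[of _ "{..m} \<times> {..m}"]) (auto simp: cyc_pairs_def)

lemma pair_levels:
  fixes r :: real assumes r: "0 < r" "r < 1"
  shows "\<exists>m0\<ge>5. \<forall>m\<ge>m0. \<forall>(j, k)\<in>cyc_pairs m.
    r ^ m / (4 * real j * real k) \<le> (\<Sum>(i, l)\<in>cyc_pairs (m + 1). r ^ (m + 1) / (4 * real i * real l))"
proof -
  \<comment> \<open>The 1 makes up for the harmonic term at 1, since pairs begin with length 2; the
    remaining sum has to recover the factor r lost from one level to the next.\<close>
  have "\<forall>\<^sub>F J in sequentially. 1 / r + 1 \<le> harm J" using harm_at_top unfolding filterlim_at_top by blast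
  then have "\<forall>\<^sub>F J in sequentially. 1 \<le> J \<and> 1 / r + 1 \<le> harm J" using eventually_ge_at_top[of 1] by eventually_elim simp
  then obtain J :: nat where J: "1 \<le> J" "1 / r + 1 \<le> harm J" by (metis (mono_tags, lifting) eventually_sequentially order_refl)
  have "{1..J} = insert 1 {2..J}" using J(1) by auto
  then have h: "1 / r \<le> (\<Sum>i=2..J. 1 / real i)" using J(2) unfolding harm_def by (simp add: inverse_eq_divide)
  have main: "r ^ m / (4 * real j * real k) \<le> (\<Sum>(i, l)\<in>cyc_pairs (m + 1). r ^ (m + 1) / (4 * real i * real l))"
    if m: "5 + 2 * J \<le> m" and jk: "(j, k) \<in> cyc_pairs m" for m j k
  proof -
    have j: "2 \<le> j" "j < k" "j + k = m" using jk unfolding cyc_pairs_def by auto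
    have m5: "5 \<le> real m" using m by linarith
    \<comment> \<open>For lengths at least 2 with sum m the product is least when one of them is 2;
      from m = 5 on this is at least m + 1.\<close>
    have "2 * (real m - 2) \<le> real j * real k"
    proof -
      have "0 \<le> (real j - 2) * (real k - 2)" using j by (intro mult_nonneg_nonneg) auto
      moreover have "real m = real j + real k" using j by simp
      ultimately show ?thesis by (simp add: algebra_simps)
    qed
    moreover have "real m + 1 \<le> 2 * (real m - 2)" using m5 by (simp add: algebra_simps)
    ultimately have jkm: "real m + 1 \<le> real j * real k" by (rule order_trans[rotated])
    have "r ^ m / (4 * real j * real k) = r ^ m / 4 * (1 / (real j * real k))" by (simp add: mult.assoc)
    also have "\<dots> \<le> r ^ m / 4 * (1 / (real m + 1))"
      using jkm r m5 by (intro mult_left_mono divide_left_mono) (auto intro!: mult_pos_pos)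
    also have "\<dots> = r ^ (m + 1) / 4 * (1 / (real m + 1)) * (1 / r)" using r by simp
    also have "\<dots> \<le> r ^ (m + 1) / 4 * (1 / (real m + 1)) * (\<Sum>i=2..J. 1 / real i)"
      using h r by (intro mult_left_mono) auto
    also have "\<dots> = (\<Sum>i=2..J. r ^ (m + 1) / 4 * (1 / (real m + 1)) * (1 / real i))" by (rule sum_distrib_left)
    also have "\<dots> \<le> (\<Sum>i=2..J. r ^ (m + 1) / (4 * real i * real (m + 1 - i)))"
    proof (rule sum_mono)
      fix i assume i: "i \<in> {2..J}"
      have "real (m + 1 - i) \<le> real m + 1" "0 < real (m + 1 - i)" using i m by auto
      then have "1 / (real m + 1) \<le> 1 / real (m + 1 - i)" by (intro divide_left_mono) auto
      then have "r ^ (m + 1) / 4 * (1 / real i) * (1 / (real m + 1)) \<le> r ^ (m + 1) / 4 * (1 / real i) * (1 / real (m + 1 - i))"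
        using r by (intro mult_left_mono) auto
      then show "r ^ (m + 1) / 4 * (1 / (real m + 1)) * (1 / real i) \<le> r ^ (m + 1) / (4 * real i * real (m + 1 - i))"
        by (simp add: mult_ac)
    qed
    \<comment> \<open>The pairs (i, m + 1 - i) with i \<le> J suffice;
      \<open>5 + 2 * J \<le> m\<close> makes i the smaller entry.\<close>
    also have "\<dots> = (\<Sum>(i, l)\<in>(\<lambda>i. (i, m + 1 - i)) ` {2..J}. r ^ (m + 1) / (4 * real i * real l))"
      by (subst sum.reindex) (auto simp: inj_on_def)
    also have "\<dots> \<le> (\<Sum>(i, l)\<in>cyc_pairs (m + 1). r ^ (m + 1) / (4 * real i * real l))"
      by (rule sum_mono2[OF finite_cyc_pairs]) (use m r in \<open>auto simp: cyc_pairs_def\<close>)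
    finally show ?thesis .
  qed
  show ?thesis by (rule exI[of _ "5 + 2 * J"]) (use main in auto)
qed

text \<open>The count vector with one cycle of each of two lengths and no other cycle up to
  \<open>L\<close>. The restriction makes it a member of the \<open>PiE\<close> sets used by
  \<open>limit_set_swap\<close>.\<close>

definition pair_vec :: "nat \<Rightarrow> nat \<times> nat \<Rightarrow> nat \<Rightarrow> nat" where
  "pair_vec L p = restrict (\<lambda>i. of_bool (i = fst p \<or> i = snd p)) {2..L}"

lemma pair_vec_atom:
  assumes p: "2 \<le> j" "j < k" "k \<le> L"
  shows "cyc_atom d c L (pair_vec L (j, k)) = exp (- pois_total d c L) * ((c / fact (d - 2)) ^ (j + k) / (4 * real j * real k))"
proof -
  have "pois_weight d c L (pair_vec L (j, k)) = (\<Prod>i=2..L. if i \<in> {j, k} then cyc_rate d c i else 1)"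
    unfolding pois_weight_def pair_vec_def by (intro prod.cong) auto
  also have "\<dots> = (\<Prod>i\<in>{2..L} \<inter> {j, k}. cyc_rate d c i)" by (rule prod.inter_restrict[symmetric]) simp
  also have "{2..L} \<inter> {j, k} = {j, k}" using p by auto
  also have "(\<Prod>i\<in>{j, k}. cyc_rate d c i) = cyc_rate d c j * cyc_rate d c k" using p by simp
  also have "\<dots> = (c / fact (d - 2)) ^ (j + k) / (4 * real j * real k)" unfolding cyc_rate_def by (simp add: power_add)
  finally show ?thesis unfolding cyc_atom_def by simp
qed

lemma pair_vec_level:
  assumes p: "2 \<le> j" "j < k" "k \<le> L" shows "(\<Sum>i=2..L. i * pair_vec L (j, k) i) = j + k"
proof -
  have "(\<Sum>i=2..L. i * pair_vec L (j, k) i) = (\<Sum>i=2..L. if i \<in> {j, k} then i else 0)"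
    unfolding pair_vec_def by (intro sum.cong) auto
  also have "\<dots> = (\<Sum>i\<in>{2..L} \<inter> {j, k}. i)" by (rule sum.inter_restrict[symmetric]) simp
  also have "{2..L} \<inter> {j, k} = {j, k}" using p by auto
  finally show ?thesis using p by simp
qed

lemma pair_vec_inj:
  assumes "2 \<le> j" "j < k" "k \<le> L" "2 \<le> j'" "j' < k'" "k' \<le> L" "pair_vec L (j, k) = pair_vec L (j', k')"
  shows "j = j' \<and> k = k'"
proof -
  have "i = j \<or> i = k \<longleftrightarrow> i = j' \<or> i = k'" if "i \<in> {2..L}" for i
    using fun_cong[OF assms(7), of i] that unfolding pair_vec_def by (auto simp: of_bool_def split: if_splits)
  from this[of j] this[of k] this[of j'] this[of k'] show ?thesis using assms(1-6) by auto
qed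

text \<open>The length \<delta> must not depend on the precision \<open>e\<close>. It comes from the
  single pair of lengths 2 and m0 - 2, which lies in every family used, and from a lower bound for
  the probability of no short cycle that is uniform in the cut-off.\<close>

lemma limit_set_thick:
  assumes d: "3 \<le> d" and c: "0 < c" and r1: "c / fact (d - 2) < 1"
  shows "\<exists>\<delta>>0. \<forall>q\<in>limit_set d c. \<forall>e>0. \<exists>a W. \<delta> \<le> W \<and> a \<le> q \<and> q \<le> a + W \<and>
    (\<forall>t. a \<le> t \<longrightarrow> t \<le> a + W \<longrightarrow> (\<exists>z\<in>limit_set d c. \<bar>z - t\<bar> \<le> e))"
proof -
  define r where "r = c / fact (d - 2)"
  have r: "0 < r" "r < 1" using c r1 unfolding r_def by auto
  obtain m0 where m0: "5 \<le> m0" "\<And>m j k. m0 \<le> m \<Longrightarrow> (j, k) \<in> cyc_pairs m \<Longrightarrow>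
    r ^ m / (4 * real j * real k) \<le> (\<Sum>(i, l)\<in>cyc_pairs (m + 1). r ^ (m + 1) / (4 * real i * real l))"
    using pair_levels[OF r] by blast
  define q0 where "q0 = sqrt (exp r * (1 - r))"
  have q0: "0 < q0" "q0 \<le> exp (- pois_total d c L)" for L
    using r no_cycle_limit(2)[OF c r1, of L] unfolding q0_def r_def by auto
  define \<delta> where "\<delta> = q0 * (r ^ m0 / (4 * real 2 * real (m0 - 2)))"
  have \<delta>: "0 < \<delta>" unfolding \<delta>_def using q0(1) r m0(1) by (intro mult_pos_pos divide_pos_pos) auto
  have "\<exists>a W. \<delta> \<le> W \<and> a \<le> q \<and> q \<le> a + W \<and> (\<forall>t. a \<le> t \<longrightarrow> t \<le> a + W \<longrightarrow> (\<exists>z\<in>limit_set d c. \<bar>z - t\<bar> \<le> e))"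
    if q: "q \<in> limit_set d c" and e: "0 < e" for q e
  proof -
    have "\<forall>\<^sub>F n in sequentially. r ^ n < e" using order_tendstoD(2)[OF LIMSEQ_realpow_zero[of r], of e] r e by simp
    then have "\<forall>\<^sub>F n in sequentially. m0 \<le> n \<and> r ^ n < e" using eventually_ge_at_top[of m0] by eventually_elim simp
    then obtain M where M: "m0 \<le> M" "r ^ M < e" by (metis (mono_tags, lifting) eventually_sequentially order_refl)
    define A where "A = (\<Union>m\<in>{m0..M}. cyc_pairs m)"
    have finA: "finite A" unfolding A_def using finite_cyc_pairs by auto
    have A: "2 \<le> j \<and> j < k \<and> k \<le> M \<and> m0 \<le> j + k \<and> j + k \<le> M" if "(j, k) \<in> A" for j k
      using that unfolding A_def cyc_pairs_def by auto
    define w where "w = (\<lambda>(j :: nat, k :: nat). exp (- pois_total d c M) * (r ^ (j + k) / (4 * real j * real k)))"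
    have atom: "cyc_atom d c M (pair_vec M p) = w p" if "p \<in> A" for p
      using pair_vec_atom[of "fst p" "snd p" M d c] A[of "fst p" "snd p"] that unfolding w_def r_def
      by (cases p) auto
    have injV: "inj_on (pair_vec M) A"
    proof (rule inj_onI)
      fix p p' assume p: "p \<in> A" "p' \<in> A" "pair_vec M p = pair_vec M p'"
      obtain j k j' k' where pp: "p = (j, k)" "p' = (j', k')" by (cases p, cases p')
      have "2 \<le> j" "j < k" "k \<le> M" "2 \<le> j'" "j' < k'" "k' \<le> M" using A[of j k] A[of j' k'] p pp by auto
      then have "j = j' \<and> k = k'" using p(3) unfolding pp by (rule pair_vec_inj)
      then show "p = p'" using pp by simp
    qed
    let ?X = "pair_vec M ` A" and ?f = "\<lambda>x. \<Sum>i=2..M. i * x i"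
    have lev: "?f (pair_vec M p) = fst p + snd p" if "p \<in> A" for p
      using pair_vec_level[of "fst p" "snd p" M] A[of "fst p" "snd p"] that by (cases p) auto
    have w0: "0 \<le> w p" for p unfolding w_def using r by (auto split: prod.split)
    have sumX: "(\<Sum>x\<in>pair_vec M ` B. cyc_atom d c M x) = (\<Sum>p\<in>B. w p)" if "B \<subseteq> A" for B
      using that atom inj_on_subset[OF injV that] by (subst sum.reindex) (auto intro!: sum.cong)
    have cond: "cyc_atom d c M x \<le> (\<Sum>y\<in>{y\<in>?X. ?f x < ?f y}. cyc_atom d c M y) + e" if x: "x \<in> ?X" for x
    proof -
      obtain p where p: "p \<in> A" "x = pair_vec M p" using x by blast
      obtain j k where jk: "p = (j, k)" by (cases p)
      have jkA: "2 \<le> j" "j < k" "k \<le> M" "m0 \<le> j + k" "j + k \<le> M" using A[of j k] p jk by auto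
      have nn: "0 \<le> (\<Sum>y\<in>{y\<in>?X. ?f x < ?f y}. cyc_atom d c M y)" using cyc_atom_nonneg[OF c] by (intro sum_nonneg) auto
      show ?thesis
      proof (cases "j + k = M")
        case True
        \<comment> \<open>The top level has no later pairs, but there the atom itself is below r^M <
          e.\<close>
        have "w p \<le> r ^ M"
        proof -
          have "1 \<le> 4 * real j * real k"
          proof -
            have "1 \<le> real j" "1 \<le> real k" using jkA by auto
            then have "1 * 1 \<le> real j * real k" by (intro mult_mono) auto
            then show ?thesis by simp
          qed
          then have "r ^ (j + k) / (4 * real j * real k) \<le> r ^ (j + k) / 1" using r by (intro divide_left_mono) auto
          moreover have "exp (- pois_total d c M) \<le> 1" using pois_total_mono[OF c, of 0 M d] by (simp add: pois_total_def)
          ultimately have "w p \<le> 1 * (r ^ (j + k) / 1)" unfolding w_def jk prod.case using r by (intro mult_mono) auto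
          then show ?thesis using True by simp
        qed
        then show ?thesis using M(2) nn atom[OF p(1)] p(2) by simp
      next
        case False
        let ?m = "j + k"
        have lt: "?m + 1 \<le> M" using False jkA by simp
        have BA: "cyc_pairs (?m + 1) \<subseteq> A" unfolding A_def by (rule UN_upper) (use lt jkA in simp)
        have "(j, k) \<in> cyc_pairs ?m" unfolding cyc_pairs_def using jkA by simp
        then have "r ^ ?m / (4 * real j * real k) \<le> (\<Sum>(i, l)\<in>cyc_pairs (?m + 1). r ^ (?m + 1) / (4 * real i * real l))"
          by (rule m0(2)[OF jkA(4)])
        then have "w p \<le> exp (- pois_total d c M) * (\<Sum>(i, l)\<in>cyc_pairs (?m + 1). r ^ (?m + 1) / (4 * real i * real l))"
          unfolding w_def jk prod.case by (intro mult_left_mono) auto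
        also have "\<dots> = (\<Sum>p\<in>cyc_pairs (?m + 1). w p)"
          unfolding sum_distrib_left w_def by (intro sum.cong) (auto simp: cyc_pairs_def)
        also have "\<dots> = (\<Sum>y\<in>pair_vec M ` cyc_pairs (?m + 1). cyc_atom d c M y)" by (rule sumX[OF BA, symmetric])
        also have "\<dots> \<le> (\<Sum>y\<in>{y\<in>?X. ?f x < ?f y}. cyc_atom d c M y)"
        proof (rule sum_mono2)
          show "finite {y\<in>?X. ?f x < ?f y}" using finA by simp
          show "pair_vec M ` cyc_pairs (?m + 1) \<subseteq> {y\<in>?X. ?f x < ?f y}"
          proof
            fix y assume "y \<in> pair_vec M ` cyc_pairs (?m + 1)"
            then obtain p' where p': "p' \<in> cyc_pairs (?m + 1)" "y = pair_vec M p'" by blast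
            have "p' \<in> A" using BA p'(1) by blast
            moreover have "fst p' + snd p' = ?m + 1" using p'(1) unfolding cyc_pairs_def by auto
            ultimately have "?f y = ?m + 1" using lev[of p'] p'(2) by simp
            moreover have "?f x = ?m" using lev[OF p(1)] p(2) jk by simp
            ultimately show "y \<in> {y\<in>?X. ?f x < ?f y}" using BA p' by auto
          qed
        qed (rule cyc_atom_nonneg[OF c])
        finally show ?thesis using e atom[OF p(1)] p(2) by simp
      qed
    qed
    have XP: "?X \<subseteq> PiE {2..M} (\<lambda>_. UNIV)" unfolding pair_vec_def by auto
    obtain a where a: "a \<le> q" "q \<le> a + (\<Sum>x\<in>?X. cyc_atom d c M x)"
      "\<forall>t. a \<le> t \<longrightarrow> t \<le> a + (\<Sum>x\<in>?X. cyc_atom d c M x) \<longrightarrow> (\<exists>z\<in>limit_set d c. \<bar>z - t\<bar> \<le> e)"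
      using limit_set_fill[OF d c q finite_imageI[OF finA] XP less_imp_le[OF e] cond] by blast
    have mem: "(2, m0 - 2) \<in> A" unfolding A_def cyc_pairs_def using m0(1) M(1) by auto
    have "\<delta> \<le> w (2, m0 - 2)"
    proof -
      have "2 + (m0 - 2) = m0" using m0(1) by simp
      then show ?thesis unfolding \<delta>_def w_def prod.case using q0(2)[of M] r by (simp only:) (intro mult_right_mono, auto)
    qed
    also have "\<dots> \<le> (\<Sum>p\<in>A. w p)" by (rule member_le_sum[OF mem _ finA]) (rule w0)
    finally have "\<delta> \<le> (\<Sum>x\<in>?X. cyc_atom d c M x)" using sumX[OF order_refl] by simp
    then show ?thesis using a by blast
  qed
  then show ?thesis using \<delta> by blast
qed

section \<open>From thickness to finitely many intervals\<close>

text \<open>An interval of length 2\<eta> around a point near \<open>s\<close> extends by \<eta> to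
  at least one side, and S fills it to any precision. Points missing from the closure on both sides
  of \<open>s\<close> would therefore be approximated after all.\<close>

lemma closure_thick:
  fixes S :: "real set"
  assumes \<eta>: "0 < \<eta>" and thick: "\<forall>q\<in>S. \<forall>e>0. \<exists>a W. 2 * \<eta> \<le> W \<and> a \<le> q \<and> q \<le> a + W \<and>
      (\<forall>t. a \<le> t \<longrightarrow> t \<le> a + W \<longrightarrow> (\<exists>z\<in>S. \<bar>z - t\<bar> \<le> e))"
    and s: "s \<in> closure S"
  shows "{s..s + \<eta>} \<subseteq> closure S \<or> {s - \<eta>..s} \<subseteq> closure S"
proof (rule ccontr)
  assume "\<not> ?thesis"
  then have n: "\<not> {s..s + \<eta>} \<subseteq> closure S" "\<not> {s - \<eta>..s} \<subseteq> closure S" by blast+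
  obtain t1 where t1: "s \<le> t1" "t1 \<le> s + \<eta>" "t1 \<notin> closure S" using n(1) unfolding subset_iff atLeastAtMost_iff by blast
  obtain t2 where t2: "s - \<eta> \<le> t2" "t2 \<le> s" "t2 \<notin> closure S" using n(2) unfolding subset_iff atLeastAtMost_iff by blast
  note t = t1 t2
  obtain e1 where e1: "0 < e1" "\<forall>y\<in>S. \<not> dist y t1 < e1" using t(3) unfolding closure_approachable by blast
  obtain e2 where e2: "0 < e2" "\<forall>y\<in>S. \<not> dist y t2 < e2" using t(6) unfolding closure_approachable by blast
  define e where "e = min e1 e2 / 2"
  have e: "0 < e" "2 * e \<le> e1" "2 * e \<le> e2" using e1 e2 unfolding e_def by auto
  obtain q where q: "q \<in> S" "dist q s < e / 2" using s e(1) unfolding closure_approachable by (metis half_gt_zero)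
  obtain a W where a: "2 * \<eta> \<le> W" "a \<le> q" "q \<le> a + W" "\<And>t. a \<le> t \<Longrightarrow> t \<le> a + W \<Longrightarrow> \<exists>z\<in>S. \<bar>z - t\<bar> \<le> e"
    using thick q(1) e(1) by blast
  \<comment> \<open>The missing point is shifted by q - s, so that it falls into the interval around
    \<open>q\<close>; the shift is less than e/2.\<close>
  have far: False if t': "a \<le> t'" "t' \<le> a + W" "t' = q + (t - s)" "t = t1 \<or> t = t2" for t' t
  proof -
    obtain z where z: "z \<in> S" "\<bar>z - t'\<bar> \<le> e" using a(4)[OF t'(1,2)] by blast
    have "\<bar>z - t\<bar> < 2 * e" using z(2) q(2) t'(3) e(1) unfolding dist_real_def by linarith
    then show False using z(1) e1(2) e2(2) e(2,3) t'(4) unfolding dist_real_def by force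
  qed
  show False
  proof (cases "q + \<eta> \<le> a + W")
    case True
    then show False using far[of "q + (t1 - s)" t1] a(2) t by auto
  next
    case False
    then have "a \<le> q - \<eta>" using a(1,3) by linarith
    then show False using far[of "q + (t2 - s)" t2] a(3) t by auto
  qed
qed

text \<open>Every point lies in an interval of length \<eta> inside \<open>S\<close>, and such an
  interval contains a multiple of \<eta>. So each component of \<open>S\<close> passes through one
  of finitely many grid points, and none is a single point.\<close>

lemma finite_union_of_thick:
  fixes S :: "real set"
  assumes \<eta>: "0 < \<eta>" and S: "S \<subseteq> {0..1}" and thick: "\<And>s. s \<in> S \<Longrightarrow> {s..s + \<eta>} \<subseteq> S \<or> {s - \<eta>..s} \<subseteq> S"
  shows "finite_union_of_intervals S"
proof -
  define N where "N = nat \<lceil>1 / \<eta>\<rceil>"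
  define \<I> where "\<I> = (\<lambda>i. connected_component_set S (real i * \<eta>)) ` {i. i \<le> N \<and> real i * \<eta> \<in> S}"
  have comp: "T \<subseteq> connected_component_set S x" if "connected T" "T \<subseteq> S" "x \<in> T" for T x
    using connected_component_maximal[OF that(3,1,2)] .
  have nondeg: "\<exists>T. connected T \<and> T \<subseteq> S \<and> s \<in> T \<and> (\<exists>x\<in>T. \<exists>y\<in>T. x < y)" if "s \<in> S" for s
    using thick[OF that]
  proof
    assume a: "{s..s + \<eta>} \<subseteq> S"
    have "connected {s..s + \<eta>}" "s \<in> {s..s + \<eta>}" "s + \<eta> \<in> {s..s + \<eta>}" "s < s + \<eta>" using \<eta> by auto
    then show ?thesis using a by blast
  next
    assume a: "{s - \<eta>..s} \<subseteq> S"
    have "connected {s - \<eta>..s}" "s \<in> {s - \<eta>..s}" "s - \<eta> \<in> {s - \<eta>..s}" "s - \<eta> < s" using \<eta> by auto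
    then show ?thesis using a by blast
  qed
  have grid: "\<exists>i. i \<le> N \<and> u \<le> real i * \<eta> \<and> real i * \<eta> \<le> u + \<eta>" if u: "0 \<le> u" "u + \<eta> \<le> 1" for u
  proof -
    define i where "i = nat \<lceil>u / \<eta>\<rceil>"
    have u0: "0 \<le> u / \<eta>" using u \<eta> by simp
    have i: "u / \<eta> \<le> real i" "real i \<le> u / \<eta> + 1" unfolding i_def using u0 by linarith+
    have 1: "u \<le> real i * \<eta>" using i(1) \<eta> by (simp add: field_simps)
    have 2: "real i * \<eta> \<le> u + \<eta>"
    proof -
      have "real i * \<eta> \<le> (u / \<eta> + 1) * \<eta>" using i(2) \<eta> by (intro mult_right_mono) auto
      also have "\<dots> = u + \<eta>" using \<eta> by (simp add: field_simps)
      finally show ?thesis .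
    qed
    have "real i * \<eta> \<le> 1" using 2 u by simp
    then have "real i \<le> 1 / \<eta>" using \<eta> by (simp add: field_simps)
    then have "i \<le> N" unfolding N_def by linarith
    then show ?thesis using 1 2 by blast
  qed
  have cover: "\<exists>i. i \<le> N \<and> real i * \<eta> \<in> S \<and> s \<in> connected_component_set S (real i * \<eta>)" if s: "s \<in> S" for s
  proof -
    have "\<exists>u. {u..u + \<eta>} \<subseteq> S \<and> s \<in> {u..u + \<eta>}"
      using thick[OF s]
    proof
      assume "{s..s + \<eta>} \<subseteq> S" then show ?thesis using \<eta> by (intro exI[of _ s]) auto
    next
      assume "{s - \<eta>..s} \<subseteq> S" then show ?thesis using \<eta> by (intro exI[of _ "s - \<eta>"]) auto
    qed
    then obtain u where u: "{u..u + \<eta>} \<subseteq> S" "s \<in> {u..u + \<eta>}" by blast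
    have "u \<in> S" "u + \<eta> \<in> S" using u(1) \<eta> by auto
    then have "0 \<le> u" "u + \<eta> \<le> 1" using S by auto
    then obtain i where i: "i \<le> N" "real i * \<eta> \<in> {u..u + \<eta>}" using grid[of u] by auto
    have "{u..u + \<eta>} \<subseteq> connected_component_set S (real i * \<eta>)" by (rule comp) (use u(1) i(2) in auto)
    then show ?thesis using i u by blast
  qed
  have "finite \<I>" unfolding \<I>_def by simp
  moreover have "is_interval I \<and> (\<exists>x\<in>I. \<exists>y\<in>I. x < y)" if I: "I \<in> \<I>" for I
  proof -
    obtain i where i: "real i * \<eta> \<in> S" "I = connected_component_set S (real i * \<eta>)" using I unfolding \<I>_def by auto
    obtain T where T: "connected T" "T \<subseteq> S" "real i * \<eta> \<in> T" "\<exists>x\<in>T. \<exists>y\<in>T. x < y" using nondeg[OF i(1)] by blast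
    have "T \<subseteq> I" unfolding i(2) by (rule comp[OF T(1-3)])
    moreover have "is_interval I" unfolding i(2) is_interval_connected_1 by (rule connected_connected_component)
    ultimately show ?thesis using T(4) by blast
  qed
  moreover have "S = \<Union>\<I>"
  proof
    show "S \<subseteq> \<Union>\<I>"
    proof
      fix s assume "s \<in> S"
      then obtain i where "i \<le> N" "real i * \<eta> \<in> S" "s \<in> connected_component_set S (real i * \<eta>)" using cover by blast
      then show "s \<in> \<Union>\<I>" unfolding \<I>_def by (intro UnionI[of "connected_component_set S (real i * \<eta>)"] imageI) auto
    qed
    show "\<Union>\<I> \<subseteq> S"
    proof (rule Union_least)
      fix I assume "I \<in> \<I>"
      then obtain i where "I = connected_component_set S (real i * \<eta>)" unfolding \<I>_def by auto
      then show "I \<subseteq> S" using connected_component_subset[of S "real i * \<eta>"] by simp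
    qed
  qed
  ultimately show ?thesis unfolding finite_union_of_intervals_def by blast
qed

lemma closure_finite_union:
  assumes d: "3 \<le> d" and c: "0 < c" "c < threshold d"
  shows "finite_union_of_intervals (closure (limit_set d c))"
proof -
  obtain r0 where r0: "r0 < 1" "threshold d = r0 * fact (d - 2)" using threshold_char by blast
  have "r0 * fact (d - 2) < 1 * (fact (d - 2) :: real)" using r0(1) by (intro mult_strict_right_mono) auto
  then have "c < fact (d - 2)" using c(2) unfolding r0(2) by linarith
  then have r1: "c / fact (d - 2) < 1" by (simp add: field_simps)
  obtain \<delta> where \<delta>: "0 < \<delta>" "\<forall>q\<in>limit_set d c. \<forall>e>0. \<exists>a W. \<delta> \<le> W \<and> a \<le> q \<and> q \<le> a + W \<and>
    (\<forall>t. a \<le> t \<longrightarrow> t \<le> a + W \<longrightarrow> (\<exists>z\<in>limit_set d c. \<bar>z - t\<bar> \<le> e))" using limit_set_thick[OF d c(1) r1] by blast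
  show ?thesis
  proof (rule finite_union_of_thick[of "\<delta> / 2"])
    show "closure (limit_set d c) \<subseteq> {0..1}" by (rule closure_minimal) (use limit_set_bounds[OF d c(1)] in auto)
    fix s assume "s \<in> closure (limit_set d c)"
    then show "{s..s + \<delta> / 2} \<subseteq> closure (limit_set d c) \<or> {s - \<delta> / 2..s} \<subseteq> closure (limit_set d c)"
      using closure_thick[of "\<delta> / 2" "limit_set d c" s] \<delta> by simp
  qed (use \<delta>(1) in simp)
qed

lemma unit_interval_finite_union: "finite_union_of_intervals {0..1}"
proof -
  have "\<exists>x\<in>{0..1::real}. \<exists>y\<in>{0..1}. x < y" by (intro bexI[of _ 0] bexI[of _ 1]) auto
  then show ?thesis unfolding finite_union_of_intervals_def
    by (intro exI[of _ "{{0..1}}"]) (auto simp: is_interval_cc)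
qed

theorem theorem2:
  fixes d :: nat and c :: real
  assumes "d \<ge> 3" and "c > 0"
  shows "(\<forall>\<phi>. sentence d \<phi> \<longrightarrow> convergent (fo_prob d c \<phi>))
    \<and> (\<exists>!c\<^sub>0. 0 < c\<^sub>0 \<and> threshold_eq d c\<^sub>0)
    \<and> finite_union_of_intervals (closure (limit_set d c))
    \<and> (c \<ge> threshold d \<longrightarrow> closure (limit_set d c) = {0..1})
    \<and> (c < threshold d \<longrightarrow>
         (\<exists>a b. 0 \<le> a \<and> a < b \<and> b \<le> 1 \<and> closure (limit_set d c) \<inter> {a..b} = {}))"
proof (intro conjI)
  show "\<forall>\<phi>. sentence d \<phi> \<longrightarrow> convergent (fo_prob d c \<phi>)" using fo_prob_convergent[OF assms] by blast
  show "\<exists>!c\<^sub>0. 0 < c\<^sub>0 \<and> threshold_eq d c\<^sub>0" using threshold_char by blast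
  show "finite_union_of_intervals (closure (limit_set d c))"
  proof (cases "c < threshold d")
    case True then show ?thesis by (rule closure_finite_union[OF assms])
  next
    case False
    then show ?thesis using closure_above_threshold[OF assms] unit_interval_finite_union by simp
  qed
  show "c \<ge> threshold d \<longrightarrow> closure (limit_set d c) = {0..1}" using closure_above_threshold[OF assms] by blast
  show "c < threshold d \<longrightarrow> (\<exists>a b. 0 \<le> a \<and> a < b \<and> b \<le> 1 \<and> closure (limit_set d c) \<inter> {a..b} = {})"
    using closure_gap[OF assms] by blast
qed

end
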